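(* Let $([\nabla],[h])$ be a non-exact Riemannian signature Einstein AH structure on a compact oriented surface $M$. Let $h\in[h]$ be a Gauduchon metric with Levi-Civita connection $D$ and Faraday primitive $\gamma_i$. Then: (a) the integral curves of the vector field $\gamma^\sharp$ are magnetic geodesics for the exact magnetic flow on $T^*M$ determined by $(h,\tfrac12d\gamma)$; (b) the function $|\gamma|_h^2$ is constant along a non-trivial integral curve of $\gamma^\sharp$, and the geodesic curvature of such an integral curve is the restriction to the curve of $-\tfrac14|\gamma|_h^{-1}\mathsf F_h$, which is constant along the integral curve; (c) the integral curves of $\gamma^\sharp$ passing through the points where $|\gamma|_h^2$ attains its maximum value are $D$-geodesics; in particular, at least one integral curve of $\gamma^\sharp$ is a $D$-geodesic; (d) the non-trivial integral curves of $J(\gamma^\sharp)$ are projective geodesics of $D$ (that is, they are $D$-geodesics up to reparametrization).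
   Context: A projective structure $[\nabla]$ is a class of torsion-free affine connections with the same unparametrized geodesics. An AH structure on a surface is a pair $([\nabla],[h])$ of a projective structure and a conformal structure. Let $H_{ij}=|\det h|^{-1/2}h_{ij}$ (independent of $h\in[h]$), with inverse $H^{ij}$. The aligned representative is the unique torsion-free $\nabla\in[\nabla]$ with $\nabla_{[i}H_{j]k}=0$ (equivalently $2h^{pq}\nabla_ph_{qi}=h^{pq}\nabla_ih_{pq}$ for all $h\in[h]$); henceforth $\nabla$ denotes it. Curvature: $2\nabla_{[i}\nabla_{j]}X^k=R_{ijp}{}^kX^p$, $R_{ij}=R_{pij}{}^p$, $R=H^{ij}R_{ij}$ (a $1$-density), $F_{ij}=-R_{[ij]}$. The AH structure is Einstein if $R_{(ij)}=\tfrac12RH_{ij}$ and $\nabla_iR+2H^{pq}\nabla_qF_{ip}=0$; it is exact if some $h\in[h]$ satisfies $\nabla|\det h|=0$. The Faraday primitive of $h\in[h]$ is $\gamma_i=\tfrac14h^{pq}\nabla_ih_{pq}$ (so $d\gamma=-F$). A Gauduchon metric is an $h\in[h]$ whose Faraday primitive is $h$-co-closed (it exists and is unique up to a positive constant). $\gamma^\sharp$ is the vector field $h^{ip}\gamma_p$. $J$ is the complex structure determined by $[h]$ and the orientation, $\omega_{ij}=J_i{}^ph_{pj}$ is the Kähler (area) form, and $\mathsf F_h$ is defined by $2F_{ij}=\mathsf F_h\omega_{ij}$. The magnetic flow on $T^*M$ determined by a metric $g$ and a closed two-form $\mu$ is the Hamiltonian flow of $G(s)=\tfrac12g^{ij}s_is_j$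 with respect to the symplectic form $\Omega_M-\pi^*\mu$, with $\Omega_M$ the canonical symplectic form and $\pi:T^*M\to M$ the projection; it is exact if $\mu$ is exact. Magnetic geodesics are the images in $M$ of its integral curves, i.e. the solutions $\sigma(t)$ of $D_{\dot\sigma}\dot\sigma=A(\dot\sigma)$, where $A_i{}^pg_{pj}=\mu_{ij}$ and $D$ is the Levi-Civita connection of $g$. Geodesic curvature is signed using the orientation: if $D_{\dot\sigma}\dot\sigma=fJ\dot\sigma$ with $|\dot\sigma|=e^c$ constant, it is $e^{-c}f$. *)

theory Defs
  imports "HOL-Analysis.Analysis"
begin

section \<open>Smooth functions between normed spaces\<close>

fun Ck_on :: "nat \<Rightarrow> 'a::real_normed_vector set \<Rightarrow> ('a \<Rightarrow> 'b::real_normed_vector) \<Rightarrow> bool" where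
  "Ck_on 0 S f \<longleftrightarrow> continuous_on S f"
| "Ck_on (Suc k) S f \<longleftrightarrow>
     (\<forall>x\<in>S. f differentiable (at x)) \<and> (\<forall>v. Ck_on k S (\<lambda>x. frechet_derivative f (at x) v))"

definition smooth_on :: "'a::real_normed_vector set \<Rightarrow> ('a \<Rightarrow> 'b::real_normed_vector) \<Rightarrow> bool" where
  "smooth_on S f \<longleftrightarrow> (\<forall>k. Ck_on k S f)"


section \<open>Oriented surfaces\<close>

text \<open>The surface is a whole Hausdorff type \<open>'a\<close>, with a smooth structure and an orientation given
  by an atlas whose transition maps have positive Jacobian determinant. Second countability is not
  imposed, since it follows from compactness.\<close>

type_synonym 'a chart = "'a set \<times> ('a \<Rightarrow> real^2)"

abbreviation cdom :: "'a chart \<Rightarrow> 'a set" where "cdom \<equiv> fst"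
abbreviation coord :: "'a chart \<Rightarrow> 'a \<Rightarrow> real^2" where "coord \<equiv> snd"

definition cinv :: "'a chart \<Rightarrow> real^2 \<Rightarrow> 'a" where
  "cinv c = inv_into (cdom c) (coord c)"

definition is_chart :: "'a::t2_space chart \<Rightarrow> bool" where
  "is_chart c \<longleftrightarrow> open (cdom c) \<and> open (coord c ` cdom c) \<and>
     homeomorphism (cdom c) (coord c ` cdom c) (coord c) (cinv c)"

text \<open>\<open>jac c d p $ m $ i\<close> is the derivative of the \<open>m\<close>-th coordinate of \<open>d\<close>
  in the direction of the \<open>i\<close>-th coordinate of \<open>c\<close>.\<close>

definition jac :: "'a chart \<Rightarrow> 'a chart \<Rightarrow> 'a \<Rightarrow> real^2^2" where
  "jac c d p = matrix (frechet_derivative (coord d \<circ> cinv c) (at (coord c p)))"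

definition oriented_surface :: "'a::t2_space chart set \<Rightarrow> bool" where
  "oriented_surface A \<longleftrightarrow> (\<forall>c\<in>A. is_chart c) \<and> (\<Union>c\<in>A. cdom c) = UNIV \<and>
     (\<forall>c\<in>A. \<forall>d\<in>A. smooth_on (coord c ` (cdom c \<inter> cdom d)) (coord d \<circ> cinv c) \<and>
        (\<forall>p\<in>cdom c \<inter> cdom d. det (jac c d p) > 0))"

text \<open>Partial derivative at a point of the surface with respect to a coordinate of the chart.\<close>

definition pd :: "'a chart \<Rightarrow> 2 \<Rightarrow> ('a \<Rightarrow> real) \<Rightarrow> 'a \<Rightarrow> real" where
  "pd c i f p = frechet_derivative (f \<circ> cinv c) (at (coord c p)) (axis i 1)"


section \<open>Tensor fields and affine connections\<close>

text \<open>A field is given by its components in every chart of the atlas, as a function on the domain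
  of the chart, subject to the usual transformation law. Values off the chart domain, or for
  charts not in the atlas, are irrelevant.\<close>

type_synonym ('a, 'v) comps = "'a chart \<Rightarrow> 'a \<Rightarrow> 'v"

definition smooth_comps :: "'a chart set \<Rightarrow> ('a, 'v::real_normed_vector) comps \<Rightarrow> bool" where
  "smooth_comps A T \<longleftrightarrow> (\<forall>c\<in>A. smooth_on (coord c ` cdom c) (T c \<circ> cinv c))"

definition one_form :: "'a chart set \<Rightarrow> ('a, real^2) comps \<Rightarrow> bool" where
  "one_form A \<alpha> \<longleftrightarrow> smooth_comps A \<alpha> \<and>
     (\<forall>c\<in>A. \<forall>d\<in>A. \<forall>p\<in>cdom c \<inter> cdom d. \<alpha> c p = transpose (jac c d p) *v \<alpha> d p)"

definition cov_tensor2 :: "'a chart set \<Rightarrow> ('a, real^2^2) comps \<Rightarrow> bool" where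
  "cov_tensor2 A T \<longleftrightarrow> smooth_comps A T \<and>
     (\<forall>c\<in>A. \<forall>d\<in>A. \<forall>p\<in>cdom c \<inter> cdom d.
        T c p = transpose (jac c d p) ** T d p ** jac c d p)"

text \<open>\<open>J c p $ k $ i\<close> stands for the component \<open>J_i^k\<close>, so that \<open>J\<close> acts on vectors by \<open>*v\<close>.\<close>

definition endo_field :: "'a chart set \<Rightarrow> ('a, real^2^2) comps \<Rightarrow> bool" where
  "endo_field A J \<longleftrightarrow> smooth_comps A J \<and>
     (\<forall>c\<in>A. \<forall>d\<in>A. \<forall>p\<in>cdom c \<inter> cdom d. J d p ** jac c d p = jac c d p ** J c p)"

text \<open>\<open>\<Gamma> c p $ k $ i $ j\<close> is the \<open>k\<close>-th component of the derivative, in direction \<open>i\<close>, of the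
  \<open>j\<close>-th coordinate vector field.\<close>

definition affine_connection :: "'a chart set \<Rightarrow> ('a, real^2^2^2) comps \<Rightarrow> bool" where
  "affine_connection A \<Gamma> \<longleftrightarrow> smooth_comps A \<Gamma> \<and>
     (\<forall>c\<in>A. \<forall>d\<in>A. \<forall>p\<in>cdom c \<inter> cdom d. \<forall>m i j.
        (\<Sum>k\<in>UNIV. jac c d p $ m $ k * \<Gamma> c p $ k $ i $ j) =
        (\<Sum>a\<in>UNIV. \<Sum>b\<in>UNIV. \<Gamma> d p $ m $ a $ b * jac c d p $ a $ i * jac c d p $ b $ j)
          + pd c i (\<lambda>q. jac c d q $ m $ j) p)"

definition torsion_free :: "'a chart set \<Rightarrow> ('a, real^2^2^2) comps \<Rightarrow> bool" where
  "torsion_free A \<Gamma> \<longleftrightarrow> (\<forall>c\<in>A. \<forall>p\<in>cdom c. \<forall>k i j. \<Gamma> c p $ k $ i $ j = \<Gamma> c p $ k $ j $ i)"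

text \<open>Covariant derivatives, with the derivative index first. The real \<open>w\<close> is a density weight:
  the component of a \<open>w\<close>-density is multiplied by \<open>\<bar>det (jac c d p)\<bar> powr w\<close> on passing from
  \<open>d\<close> to \<open>c\<close>, so that \<open>\<bar>det h\<bar>\<close> is a 2-density.\<close>

definition cov_density ::
  "('a, real^2^2^2) comps \<Rightarrow> real \<Rightarrow> ('a, real) comps \<Rightarrow> ('a, real^2) comps" where
  "cov_density \<Gamma> w s c p = (\<chi> i. pd c i (s c) p - w * (\<Sum>m\<in>UNIV. \<Gamma> c p $ m $ i $ m) * s c p)"

definition cov_one ::
  "('a, real^2^2^2) comps \<Rightarrow> ('a, real^2) comps \<Rightarrow> ('a, real^2^2) comps" where
  "cov_one \<Gamma> \<alpha> c p = (\<chi> i j. pd c i (\<lambda>q. \<alpha> c q $ j) p - (\<Sum>m\<in>UNIV. \<Gamma> c p $ m $ i $ j * \<alpha> c p $ m))"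

definition cov_two ::
  "('a, real^2^2^2) comps \<Rightarrow> real \<Rightarrow> ('a, real^2^2) comps \<Rightarrow> ('a, real^2^2^2) comps" where
  "cov_two \<Gamma> w T c p = (\<chi> i j k. pd c i (\<lambda>q. T c q $ j $ k) p
      - (\<Sum>m\<in>UNIV. \<Gamma> c p $ m $ i $ j * T c p $ m $ k)
      - (\<Sum>m\<in>UNIV. \<Gamma> c p $ m $ i $ k * T c p $ j $ m)
      - w * (\<Sum>m\<in>UNIV. \<Gamma> c p $ m $ i $ m) * T c p $ j $ k)"

definition ext_d :: "('a, real^2) comps \<Rightarrow> ('a, real^2^2) comps" where
  "ext_d \<alpha> c p = (\<chi> i j. pd c i (\<lambda>q. \<alpha> c q $ j) p - pd c j (\<lambda>q. \<alpha> c q $ i) p)"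

text \<open>\<open>curv \<Gamma> c p i j l k\<close> is \<open>R_{ijl}^k\<close>, where
  \<open>(\<nabla>_i \<nabla>_j - \<nabla>_j \<nabla>_i) X^k = R_{ijl}^k X^l\<close> for torsion-free \<open>\<Gamma>\<close>.\<close>

definition curv :: "('a, real^2^2^2) comps \<Rightarrow> 'a chart \<Rightarrow> 'a \<Rightarrow> 2 \<Rightarrow> 2 \<Rightarrow> 2 \<Rightarrow> 2 \<Rightarrow> real" where
  "curv \<Gamma> c p i j l k =
     pd c i (\<lambda>q. \<Gamma> c q $ k $ j $ l) p - pd c j (\<lambda>q. \<Gamma> c q $ k $ i $ l) p
     + (\<Sum>m\<in>UNIV. \<Gamma> c p $ k $ i $ m * \<Gamma> c p $ m $ j $ l)
     - (\<Sum>m\<in>UNIV. \<Gamma> c p $ k $ j $ m * \<Gamma> c p $ m $ i $ l)"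

definition ricci :: "('a, real^2^2^2) comps \<Rightarrow> ('a, real^2^2) comps" where
  "ricci \<Gamma> c p = (\<chi> i j. \<Sum>m\<in>UNIV. curv \<Gamma> c p m i j m)"

definition faraday_form :: "('a, real^2^2^2) comps \<Rightarrow> ('a, real^2^2) comps" where
  "faraday_form \<Gamma> c p = (\<chi> i j. - (ricci \<Gamma> c p $ i $ j - ricci \<Gamma> c p $ j $ i) / 2)"


section \<open>Metrics\<close>

definition pseudo_metric :: "'a chart set \<Rightarrow> ('a, real^2^2) comps \<Rightarrow> bool" where
  "pseudo_metric A h \<longleftrightarrow> cov_tensor2 A h \<and>
     (\<forall>c\<in>A. \<forall>p\<in>cdom c. transpose (h c p) = h c p \<and> det (h c p) \<noteq> 0)"

definition pos_def_on :: "'a chart set \<Rightarrow> ('a, real^2^2) comps \<Rightarrow> bool" where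
  "pos_def_on A h \<longleftrightarrow> (\<forall>c\<in>A. \<forall>p\<in>cdom c. \<forall>X. X \<noteq> 0 \<longrightarrow> X \<bullet> (h c p *v X) > 0)"

definition levi_civita :: "'a chart set \<Rightarrow> ('a, real^2^2) comps \<Rightarrow> ('a, real^2^2^2) comps \<Rightarrow> bool" where
  "levi_civita A h D \<longleftrightarrow> affine_connection A D \<and> torsion_free A D \<and>
     (\<forall>c\<in>A. \<forall>p\<in>cdom c. cov_two D 0 h c p = 0)"

definition co_closed :: "'a chart set \<Rightarrow> ('a, real^2^2) comps \<Rightarrow> ('a, real^2) comps \<Rightarrow> bool" where
  "co_closed A h \<alpha> \<longleftrightarrow> (\<exists>D. levi_civita A h D \<and>
     (\<forall>c\<in>A. \<forall>p\<in>cdom c.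
        (\<Sum>i\<in>UNIV. \<Sum>j\<in>UNIV. matrix_inv (h c p) $ i $ j * cov_one D \<alpha> c p $ i $ j) = 0))"

definition sharp :: "('a, real^2^2) comps \<Rightarrow> ('a, real^2) comps \<Rightarrow> ('a, real^2) comps" where
  "sharp h \<alpha> c p = matrix_inv (h c p) *v \<alpha> c p"

definition sq_norm :: "'a chart set \<Rightarrow> ('a, real^2^2) comps \<Rightarrow> ('a, real^2) comps \<Rightarrow> 'a \<Rightarrow> real" where
  "sq_norm A h \<alpha> p =
     (THE r. \<forall>c\<in>A. p \<in> cdom c \<longrightarrow> r = \<alpha> c p \<bullet> (matrix_inv (h c p) *v \<alpha> c p))"

text \<open>The rotation by a positive right angle. It depends only on the conformal class of \<open>h\<close> and the
  orientation. The last clause says that \<open>X, JX\<close> is a positively oriented frame.\<close>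

definition complex_structure :: "'a chart set \<Rightarrow> ('a, real^2^2) comps \<Rightarrow> ('a, real^2^2) comps \<Rightarrow> bool" where
  "complex_structure A h J \<longleftrightarrow> endo_field A J \<and>
     (\<forall>c\<in>A. \<forall>p\<in>cdom c.
        J c p ** J c p = - mat 1 \<and>
        (\<forall>X Y. (J c p *v X) \<bullet> (h c p *v (J c p *v Y)) = X \<bullet> (h c p *v Y)) \<and>
        (\<forall>X. X \<noteq> 0 \<longrightarrow> X $ 1 * (J c p *v X) $ 2 - X $ 2 * (J c p *v X) $ 1 > 0))"

definition kahler_form ::
  "('a, real^2^2) comps \<Rightarrow> ('a, real^2^2) comps \<Rightarrow> ('a, real^2^2) comps" where
  "kahler_form h J c p = transpose (J c p) ** h c p"


section \<open>Curves and geodesics\<close>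

definition open_interval :: "real set \<Rightarrow> bool" where
  "open_interval I \<longleftrightarrow> open I \<and> is_interval I \<and> I \<noteq> {}"

definition velocity :: "'a chart \<Rightarrow> (real \<Rightarrow> 'a) \<Rightarrow> real \<Rightarrow> real^2" where
  "velocity c \<sigma> t = vector_derivative (coord c \<circ> \<sigma>) (at t)"

definition twice_diff_curve :: "'a::t2_space chart set \<Rightarrow> real set \<Rightarrow> (real \<Rightarrow> 'a) \<Rightarrow> bool" where
  "twice_diff_curve A I \<sigma> \<longleftrightarrow> open_interval I \<and> continuous_on I \<sigma> \<and>
     (\<forall>c\<in>A. \<forall>t\<in>I. \<sigma> t \<in> cdom c \<longrightarrow>
        (coord c \<circ> \<sigma>) differentiable (at t) \<and> velocity c \<sigma> differentiable (at t))"

definition acceleration ::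
  "('a, real^2^2^2) comps \<Rightarrow> 'a chart \<Rightarrow> (real \<Rightarrow> 'a) \<Rightarrow> real \<Rightarrow> real^2" where
  "acceleration \<Gamma> c \<sigma> t = (\<chi> k. vector_derivative (velocity c \<sigma>) (at t) $ k
     + (\<Sum>i\<in>UNIV. \<Sum>j\<in>UNIV. \<Gamma> c (\<sigma> t) $ k $ i $ j * velocity c \<sigma> t $ i * velocity c \<sigma> t $ j))"

definition geodesic ::
  "'a::t2_space chart set \<Rightarrow> ('a, real^2^2^2) comps \<Rightarrow> real set \<Rightarrow> (real \<Rightarrow> 'a) \<Rightarrow> bool" where
  "geodesic A \<Gamma> I \<sigma> \<longleftrightarrow> twice_diff_curve A I \<sigma> \<and>
     (\<forall>c\<in>A. \<forall>t\<in>I. \<sigma> t \<in> cdom c \<longrightarrow> acceleration \<Gamma> c \<sigma> t = 0)"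

text \<open>Geodesics up to reparametrization. The derivative of \<open>\<phi>\<close> has no zero, so \<open>\<phi>\<close> is a
  bijection between the intervals, possibly reversing the direction.\<close>

definition projective_geodesic ::
  "'a::t2_space chart set \<Rightarrow> ('a, real^2^2^2) comps \<Rightarrow> real set \<Rightarrow> (real \<Rightarrow> 'a) \<Rightarrow> bool" where
  "projective_geodesic A \<Gamma> I \<sigma> \<longleftrightarrow> open_interval I \<and>
     (\<exists>I' \<phi>. open_interval I' \<and> Ck_on 2 I' \<phi> \<and> (\<forall>u\<in>I'. deriv \<phi> u \<noteq> 0) \<and> \<phi> ` I' = I \<and>
        geodesic A \<Gamma> I' (\<sigma> \<circ> \<phi>))"

definition integral_curve ::
  "'a::t2_space chart set \<Rightarrow> ('a, real^2) comps \<Rightarrow> real set \<Rightarrow> (real \<Rightarrow> 'a) \<Rightarrow> bool" where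
  "integral_curve A X I \<sigma> \<longleftrightarrow> open_interval I \<and> continuous_on I \<sigma> \<and>
     (\<forall>c\<in>A. \<forall>t\<in>I. \<sigma> t \<in> cdom c \<longrightarrow> ((coord c \<circ> \<sigma>) has_vector_derivative X c (\<sigma> t)) (at t))"

definition nontrivial_curve :: "real set \<Rightarrow> (real \<Rightarrow> 'a) \<Rightarrow> bool" where
  "nontrivial_curve I \<sigma> \<longleftrightarrow> \<not> \<sigma> constant_on I"

text \<open>Signed geodesic curvature of a curve of constant speed \<open>exp b\<close>.\<close>

definition has_geodesic_curvature ::
  "'a::t2_space chart set \<Rightarrow> ('a, real^2^2) comps \<Rightarrow> ('a, real^2^2^2) comps \<Rightarrow> ('a, real^2^2) comps \<Rightarrow>
   real set \<Rightarrow> (real \<Rightarrow> 'a) \<Rightarrow> (real \<Rightarrow> real) \<Rightarrow> bool" where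
  "has_geodesic_curvature A h D J I \<sigma> \<kappa> \<longleftrightarrow> twice_diff_curve A I \<sigma> \<and>
     (\<exists>b f. \<forall>t\<in>I.
        (\<forall>c\<in>A. \<sigma> t \<in> cdom c \<longrightarrow>
           sqrt (velocity c \<sigma> t \<bullet> (h c (\<sigma> t) *v velocity c \<sigma> t)) = exp b \<and>
           acceleration D c \<sigma> t = f t *\<^sub>R (J c (\<sigma> t) *v velocity c \<sigma> t)) \<and>
        \<kappa> t = exp (- b) * f t)"


section \<open>Magnetic flows\<close>

definition exact_two_form :: "'a chart set \<Rightarrow> ('a, real^2^2) comps \<Rightarrow> bool" where
  "exact_two_form A \<mu> \<longleftrightarrow> (\<exists>\<alpha>. one_form A \<alpha> \<and> (\<forall>c\<in>A. \<forall>p\<in>cdom c. \<mu> c p = ext_d \<alpha> c p))"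

text \<open>On the cotangent bundle we use the canonical coordinates \<open>(x, s)\<close> induced by a chart. The
  canonical symplectic form is the exterior derivative \<open>ds_i \<and> dx^i\<close> of the tautological one-form
  \<open>s_i dx^i\<close>, and the Hamiltonian vector field \<open>Z\<close> of \<open>G\<close> is given by \<open>\<Omega>(Z, W) = - dG(W)\<close> for
  all \<open>W\<close>. These are the signs for which the projected curves solve
  \<open>D_{\<sigma>'} \<sigma>' = A(\<sigma>')\<close> with \<open>A_i^k g_{kj} = \<mu>_{ij}\<close>.\<close>

definition kinetic_energy :: "('a, real^2^2) comps \<Rightarrow> 'a chart \<Rightarrow> (real^2) \<times> (real^2) \<Rightarrow> real" where
  "kinetic_energy g c z = (snd z \<bullet> (matrix_inv (g c (cinv c (fst z))) *v snd z)) / 2"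

definition magnetic_symplectic_form ::
  "('a, real^2^2) comps \<Rightarrow> 'a chart \<Rightarrow> (real^2) \<times> (real^2) \<Rightarrow>
   (real^2) \<times> (real^2) \<Rightarrow> (real^2) \<times> (real^2) \<Rightarrow> real" where
  "magnetic_symplectic_form \<mu> c z Z W =
     (snd Z \<bullet> fst W - snd W \<bullet> fst Z) - fst Z \<bullet> (\<mu> c (cinv c (fst z)) *v fst W)"

text \<open>The pair \<open>(\<sigma>, s)\<close> is a curve in the cotangent bundle, \<open>s c t\<close> being the components
  in the chart \<open>c\<close> of a covector at \<open>\<sigma> t\<close>.\<close>

definition magnetic_flow_curve ::
  "'a::t2_space chart set \<Rightarrow> ('a, real^2^2) comps \<Rightarrow> ('a, real^2^2) comps \<Rightarrow> real set \<Rightarrow>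
   (real \<Rightarrow> 'a) \<Rightarrow> ('a chart \<Rightarrow> real \<Rightarrow> real^2) \<Rightarrow> bool" where
  "magnetic_flow_curve A g \<mu> I \<sigma> s \<longleftrightarrow> open_interval I \<and> continuous_on I \<sigma> \<and>
     (\<forall>c\<in>A. \<forall>d\<in>A. \<forall>t\<in>I. \<sigma> t \<in> cdom c \<inter> cdom d \<longrightarrow>
        s c t = transpose (jac c d (\<sigma> t)) *v s d t) \<and>
     (\<forall>c\<in>A. \<forall>t\<in>I. \<sigma> t \<in> cdom c \<longrightarrow>
        (\<exists>Z. ((\<lambda>u. (coord c (\<sigma> u), s c u)) has_vector_derivative Z) (at t) \<and>
           (\<forall>W. magnetic_symplectic_form \<mu> c (coord c (\<sigma> t), s c t) Z W =
              - frechet_derivative (kinetic_energy g c) (at (coord c (\<sigma> t), s c t)) W)))"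

definition magnetic_geodesic ::
  "'a::t2_space chart set \<Rightarrow> ('a, real^2^2) comps \<Rightarrow> ('a, real^2^2) comps \<Rightarrow> real set \<Rightarrow>
   (real \<Rightarrow> 'a) \<Rightarrow> bool" where
  "magnetic_geodesic A g \<mu> I \<sigma> \<longleftrightarrow> (\<exists>s. magnetic_flow_curve A g \<mu> I \<sigma> s)"


section \<open>AH structures\<close>

definition projective_structure :: "'a::t2_space chart set \<Rightarrow> ('a, real^2^2^2) comps set \<Rightarrow> bool" where
  "projective_structure A P \<longleftrightarrow> (\<exists>\<Gamma>. affine_connection A \<Gamma> \<and> torsion_free A \<Gamma> \<and>
     P = {\<Gamma>'. affine_connection A \<Gamma>' \<and> torsion_free A \<Gamma>' \<and>
            (\<forall>I \<sigma>. projective_geodesic A \<Gamma>' I \<sigma> \<longleftrightarrow> projective_geodesic A \<Gamma> I \<sigma>)})"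

definition conformal_structure :: "'a chart set \<Rightarrow> ('a, real^2^2) comps set \<Rightarrow> bool" where
  "conformal_structure A C \<longleftrightarrow> (\<exists>h. pseudo_metric A h \<and>
     C = {h'. pseudo_metric A h' \<and>
            (\<exists>f. smooth_comps A (\<lambda>c. f) \<and> (\<forall>p. f p > 0) \<and>
               (\<forall>c\<in>A. \<forall>p\<in>cdom c. h' c p = f p *\<^sub>R h c p))})"

definition AH_structure ::
  "'a::t2_space chart set \<Rightarrow> ('a, real^2^2^2) comps set \<Rightarrow> ('a, real^2^2) comps set \<Rightarrow> bool" where
  "AH_structure A P C \<longleftrightarrow> projective_structure A P \<and> conformal_structure A C"

definition riemannian_signature :: "'a chart set \<Rightarrow> ('a, real^2^2) comps set \<Rightarrow> bool" where
  "riemannian_signature A C \<longleftrightarrow> (\<forall>h\<in>C. pos_def_on A h)"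

text \<open>\<open>H_{ij} = \<bar>det h\<bar>^{-1/2} h_{ij}\<close>, a tensor of density weight \<open>-1\<close>, depends only on the
  conformal class of \<open>h\<close>.\<close>

definition unimod :: "('a, real^2^2) comps \<Rightarrow> ('a, real^2^2) comps" where
  "unimod h c p = (\<bar>det (h c p)\<bar> powr (- 1/2)) *\<^sub>R h c p"

definition aligned ::
  "'a chart set \<Rightarrow> ('a, real^2^2^2) comps set \<Rightarrow> ('a, real^2^2) comps set \<Rightarrow>
   ('a, real^2^2^2) comps \<Rightarrow> bool" where
  "aligned A P C \<Gamma> \<longleftrightarrow> \<Gamma> \<in> P \<and> (\<forall>h\<in>C. \<forall>c\<in>A. \<forall>p\<in>cdom c. \<forall>i j k.
     cov_two \<Gamma> (-1) (unimod h) c p $ i $ j $ k = cov_two \<Gamma> (-1) (unimod h) c p $ j $ i $ k)"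

definition weighted_scalar ::
  "('a, real^2^2^2) comps \<Rightarrow> ('a, real^2^2) comps \<Rightarrow> ('a, real) comps" where
  "weighted_scalar \<Gamma> h c p =
     (\<Sum>i\<in>UNIV. \<Sum>j\<in>UNIV. matrix_inv (unimod h c p) $ i $ j * ricci \<Gamma> c p $ i $ j)"

text \<open>In the following definitions \<open>\<Gamma>\<close> is the aligned representative.\<close>

definition einstein_AH ::
  "'a chart set \<Rightarrow> ('a, real^2^2) comps set \<Rightarrow> ('a, real^2^2^2) comps \<Rightarrow> bool" where
  "einstein_AH A C \<Gamma> \<longleftrightarrow> (\<forall>h\<in>C. \<forall>c\<in>A. \<forall>p\<in>cdom c.
     (\<forall>i j. (ricci \<Gamma> c p $ i $ j + ricci \<Gamma> c p $ j $ i) / 2 =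
            weighted_scalar \<Gamma> h c p * unimod h c p $ i $ j / 2) \<and>
     (\<forall>i. cov_density \<Gamma> 1 (weighted_scalar \<Gamma> h) c p $ i +
          2 * (\<Sum>k\<in>UNIV. \<Sum>l\<in>UNIV. matrix_inv (unimod h c p) $ k $ l *
                 cov_two \<Gamma> 0 (faraday_form \<Gamma>) c p $ l $ i $ k) = 0))"

definition exact_AH ::
  "'a chart set \<Rightarrow> ('a, real^2^2) comps set \<Rightarrow> ('a, real^2^2^2) comps \<Rightarrow> bool" where
  "exact_AH A C \<Gamma> \<longleftrightarrow> (\<exists>h\<in>C. \<forall>c\<in>A. \<forall>p\<in>cdom c.
     cov_density \<Gamma> 2 (\<lambda>c p. \<bar>det (h c p)\<bar>) c p = 0)"

definition faraday_primitive ::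
  "('a, real^2^2^2) comps \<Rightarrow> ('a, real^2^2) comps \<Rightarrow> ('a, real^2) comps" where
  "faraday_primitive \<Gamma> h c p = (\<chi> i. (\<Sum>k\<in>UNIV. \<Sum>l\<in>UNIV.
     matrix_inv (h c p) $ k $ l * cov_two \<Gamma> 0 h c p $ i $ k $ l) / 4)"

definition gauduchon ::
  "'a chart set \<Rightarrow> ('a, real^2^2) comps set \<Rightarrow> ('a, real^2^2^2) comps \<Rightarrow> ('a, real^2^2) comps \<Rightarrow> bool" where
  "gauduchon A C \<Gamma> h \<longleftrightarrow> h \<in> C \<and> co_closed A h (faraday_primitive \<Gamma> h)"

text \<open>The function \<open>f\<close> with \<open>2 F_{ij} = f \<omega>_{ij}\<close>.\<close>

definition faraday_scalar ::
  "'a chart set \<Rightarrow> ('a, real^2^2^2) comps \<Rightarrow> ('a, real^2^2) comps \<Rightarrow> ('a, real^2^2) comps \<Rightarrow> 'a \<Rightarrow> real" where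
  "faraday_scalar A \<Gamma> h J p =
     (THE r. \<forall>c\<in>A. p \<in> cdom c \<longrightarrow> 2 *\<^sub>R faraday_form \<Gamma> c p = r *\<^sub>R kahler_form h J c p)"

end

theory Submission
  imports Defs
begin

text \<open>In the gauge of the Gauduchon metric \<open>h\<close>, let \<open>R\<close> be the \<open>h\<close>-trace of the Ricci tensor
  of the aligned connection and let \<open>L\<close> be its cubic torsion. The Einstein equations together with
  the Bochner formula give
  \<open>\<Delta>(4 |\<gamma>|\<^sup>2 - R) = 8 |sym D \<gamma>|\<^sup>2 + |L|\<^sup>2 |\<gamma>|\<^sup>2 \<ge> 0\<close> up to positive constants, so by the strong
  maximum principle the right-hand side vanishes on the compact surface. Hence the dual vector field
  of \<open>\<gamma>\<close> is Killing and \<open>D\<^sub>i \<gamma>\<^sub>j\<close> is a multiple of \<open>F\<^sub>h \<omega>\<^sub>i\<^sub>j\<close>; the accelerations of its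
  integral curves and of those of its rotation by \<open>J\<close> can then be read off. At a maximum of
  \<open>|\<gamma>|\<^sup>2\<close>, where \<open>\<gamma>\<close> is non-zero by non-exactness, the derivative \<open>d |\<gamma>|\<^sup>2\<close>, and
  therefore \<open>F\<^sub>h\<close>, vanishes.\<close>

section \<open>Calculus of smooth functions\<close>

text \<open>The weight 4 is forced. Write u = |\<gamma>|^2, X for the dual field and
  \<open>K\<close> for the Gauss curvature of \<open>h\<close>. Bochner's formula puts 2 K u and a
  multiple of dF \<and> \<gamma> into \<Delta> u; the divergence of the Einstein equation puts X(R)
  and dF \<and> \<gamma> into \<Delta> R; the same equation contracted with X ties dF \<and>
  \<gamma> to X(R) + 2 u R. Only in 4 u - R do the derivatives of R and F cancel. The curvature left
  over, 2 K - R, is a squared norm, so the sign is definite whatever the signs of \<open>K\<close>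
  and R, and the F^2 terms complete tr (DX)^2 to the norm of the symmetric part. The obstacle is
  that fields are families of components, one per chart. The identities are proved for scalar
  functions in a single chart, and |\<gamma>|^2, F_h and R are then shown to be chart independent;
  for R this takes the transformation law of curvature. The surface may be disconnected, so the
  maximum principle runs on a component. Part (c) is proved with a geodesic defined for all times,
  hence the flow on a compact surface is constructed as well.\<close>

lemma has_derivative_cong_open:
  assumes "open S" "x \<in> S" "\<And>y. y \<in> S \<Longrightarrow> f y = g y"
  shows "(f has_derivative f') (at x) \<longleftrightarrow> (g has_derivative f') (at x)"
  using assms by (metis has_derivative_transform_within_open)

lemma frechet_derivative_cong_open:
  assumes "open S" "x \<in> S" "\<And>y. y \<in> S \<Longrightarrow> f y = g y"
  shows "frechet_derivative f (at x) = frechet_derivative g (at x)"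
  unfolding frechet_derivative_def using has_derivative_cong_open[OF assms] by simp

lemma differentiable_cong_open:
  assumes "open S" "x \<in> S" "\<And>y. y \<in> S \<Longrightarrow> f y = g y"
  shows "f differentiable (at x) \<longleftrightarrow> g differentiable (at x)"
  unfolding differentiable_def using has_derivative_cong_open[OF assms] by simp

lemma Ck_on_cong:
  assumes "open S" "\<And>x. x \<in> S \<Longrightarrow> f x = g x"
  shows "Ck_on k S f \<longleftrightarrow> Ck_on k S g"
  using assms(2)
proof (induction k arbitrary: f g)
  case 0
  then show ?case by (auto intro: continuous_on_cong)
next
  case (Suc k)
  have "Ck_on k S (\<lambda>x. frechet_derivative f (at x) v) \<longleftrightarrow> Ck_on k S (\<lambda>x. frechet_derivative g (at x) v)" for v
    by (rule Suc.IH) (use Suc.prems frechet_derivative_cong_open[OF assms(1)] in metis)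
  moreover have "(\<forall>x\<in>S. f differentiable (at x)) \<longleftrightarrow> (\<forall>x\<in>S. g differentiable (at x))"
    using differentiable_cong_open[OF assms(1)] Suc.prems by metis
  ultimately show ?case by simp
qed

lemma smooth_on_cong:
  "open S \<Longrightarrow> (\<And>x. x \<in> S \<Longrightarrow> f x = g x) \<Longrightarrow> smooth_on S f \<longleftrightarrow> smooth_on S g"
  unfolding smooth_on_def using Ck_on_cong by metis

lemma Ck_on_SucD: "Ck_on (Suc k) S f \<Longrightarrow> Ck_on k S f"
proof (induction k arbitrary: f)
  case 0
  then show ?case
    using continuous_at_imp_continuous_on differentiable_imp_continuous_within
    by (metis Ck_on.simps)
next
  case (Suc k)
  have "\<forall>x\<in>S. f differentiable (at x)" "\<forall>v. Ck_on (Suc k) S (\<lambda>x. frechet_derivative f (at x) v)"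
    using Suc.prems unfolding Ck_on.simps(2)[of "Suc k"] by blast+
  then show ?case using Suc.IH unfolding Ck_on.simps(2)[of k] by blast
qed

lemma Ck_on_subset: "Ck_on k S f \<Longrightarrow> T \<subseteq> S \<Longrightarrow> Ck_on k T f"
  by (induction k arbitrary: f) (auto intro: continuous_on_subset)

lemma smooth_on_subset: "smooth_on S f \<Longrightarrow> T \<subseteq> S \<Longrightarrow> smooth_on T f"
  unfolding smooth_on_def using Ck_on_subset by blast

lemma smooth_on_differentiable: "smooth_on S f \<Longrightarrow> x \<in> S \<Longrightarrow> f differentiable (at x)"
  unfolding smooth_on_def using Ck_on.simps(2)[of 0 S f] by blast

lemma smooth_on_deriv: "smooth_on S f \<Longrightarrow> smooth_on S (\<lambda>x. frechet_derivative f (at x) v)"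
  unfolding smooth_on_def using Ck_on.simps(2)[of _ S f] by blast

lemma smooth_on_continuous: "smooth_on S f \<Longrightarrow> continuous_on S f"
  unfolding smooth_on_def using Ck_on.simps(1)[of S f] by blast

lemma Ck_on_const: "Ck_on k S (\<lambda>x. a)"
  by (induction k arbitrary: a) auto

lemma Ck_on_SucI:
  assumes "open S" "\<And>x. x \<in> S \<Longrightarrow> (f has_derivative f' x) (at x)" "\<And>v. Ck_on k S (\<lambda>x. f' x v)"
  shows "Ck_on (Suc k) S f"
proof -
  have "frechet_derivative f (at x) = f' x" if "x \<in> S" for x
    using frechet_derivative_at[OF assms(2)[OF that]] by simp
  then have "Ck_on k S (\<lambda>x. frechet_derivative f (at x) v) \<longleftrightarrow> Ck_on k S (\<lambda>x. f' x v)" for v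
    by (intro Ck_on_cong[OF assms(1)]) simp
  then show ?thesis using assms unfolding Ck_on.simps(2) differentiable_def by blast
qed

lemma Ck_on_SucE:
  assumes "Ck_on (Suc k) S f"
  obtains f' where "\<And>x. x \<in> S \<Longrightarrow> (f has_derivative f' x) (at x)" "\<And>v. Ck_on k S (\<lambda>x. f' x v)"
proof (rule that)
  show "(f has_derivative frechet_derivative f (at x)) (at x)" if "x \<in> S" for x
    using assms that unfolding Ck_on.simps(2) frechet_derivative_works by blast
  show "Ck_on k S (\<lambda>x. frechet_derivative f (at x) v)" for v
    using assms unfolding Ck_on.simps(2) by blast
qed

lemma Ck_on_bounded_linear_comp:
  assumes "open S" "bounded_linear L"
  shows "Ck_on k S f \<Longrightarrow> Ck_on k S (\<lambda>x. L (f x))"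
proof (induction k arbitrary: f)
  case 0
  then show ?case by (auto intro: bounded_linear.continuous_on[OF assms(2)])
next
  case (Suc k)
  obtain f' where f': "\<And>x. x \<in> S \<Longrightarrow> (f has_derivative f' x) (at x)" "\<And>v. Ck_on k S (\<lambda>x. f' x v)"
    using Suc.prems by (rule Ck_on_SucE) blast
  show ?case
    by (rule Ck_on_SucI[OF assms(1) bounded_linear.has_derivative[OF assms(2) f'(1)] Suc.IH[OF f'(2)]])
qed

lemma Ck_on_add:
  assumes "open S"
  shows "Ck_on k S f \<Longrightarrow> Ck_on k S g \<Longrightarrow> Ck_on k S (\<lambda>x. f x + g x)"
proof (induction k arbitrary: f g)
  case 0
  then show ?case by (auto intro: continuous_intros)
next
  case (Suc k)
  obtain f' where f': "\<And>x. x \<in> S \<Longrightarrow> (f has_derivative f' x) (at x)" "\<And>v. Ck_on k S (\<lambda>x. f' x v)"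
    using Suc.prems(1) by (rule Ck_on_SucE) blast
  obtain g' where g': "\<And>x. x \<in> S \<Longrightarrow> (g has_derivative g' x) (at x)" "\<And>v. Ck_on k S (\<lambda>x. g' x v)"
    using Suc.prems(2) by (rule Ck_on_SucE) blast
  show ?case
    by (rule Ck_on_SucI[OF assms has_derivative_add[OF f'(1) g'(1)] Suc.IH[OF f'(2) g'(2)]])
qed

lemma Ck_on_mult:
  fixes f g :: "'a::real_normed_vector \<Rightarrow> real"
  assumes "open S"
  shows "Ck_on k S f \<Longrightarrow> Ck_on k S g \<Longrightarrow> Ck_on k S (\<lambda>x. f x * g x)"
proof (induction k arbitrary: f g)
  case 0
  then show ?case by (auto intro: continuous_intros)
next
  case (Suc k)
  obtain f' where f': "\<And>x. x \<in> S \<Longrightarrow> (f has_derivative f' x) (at x)" "\<And>v. Ck_on k S (\<lambda>x. f' x v)"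
    using Suc.prems(1) by (rule Ck_on_SucE) blast
  obtain g' where g': "\<And>x. x \<in> S \<Longrightarrow> (g has_derivative g' x) (at x)" "\<And>v. Ck_on k S (\<lambda>x. g' x v)"
    using Suc.prems(2) by (rule Ck_on_SucE) blast
  show ?case
    by (rule Ck_on_SucI[OF assms has_derivative_mult[OF f'(1) g'(1)]])
      (assumption | rule Ck_on_add[OF assms Suc.IH[OF Ck_on_SucD[OF Suc.prems(1)] g'(2)]
          Suc.IH[OF f'(2) Ck_on_SucD[OF Suc.prems(2)]]])+
qed

text \<open>The chain rule trades one order of smoothness of the composite for smoothness of
  \<open>\<phi>'\<close> along \<open>f\<close>. For the inverse and the square root,
  \<open>\<phi>'\<close> is again an expression in the composite itself, so an induction on
  \<open>k\<close> closes.\<close>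

lemma Ck_on_field_comp_Suc:
  fixes f :: "'a::real_normed_vector \<Rightarrow> real"
  assumes "open S" "Ck_on (Suc k) S f" "\<And>x. x \<in> S \<Longrightarrow> (\<phi> has_field_derivative \<phi>' (f x)) (at (f x))"
    "Ck_on k S (\<lambda>x. \<phi>' (f x))"
  shows "Ck_on (Suc k) S (\<lambda>x. \<phi> (f x))"
proof -
  obtain f' where f': "\<And>x. x \<in> S \<Longrightarrow> (f has_derivative f' x) (at x)" "\<And>v. Ck_on k S (\<lambda>x. f' x v)"
    using assms(2) by (rule Ck_on_SucE) blast
  have "((\<lambda>y. \<phi> (f y)) has_derivative (\<lambda>v. \<phi>' (f x) * f' x v)) (at x)" if "x \<in> S" for x
    using diff_chain_at[OF f'(1)[OF that] assms(3)[OF that, unfolded has_field_derivative_def]]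
    by (simp add: o_def)
  then show ?thesis
    by (rule Ck_on_SucI[OF assms(1)]) (assumption | intro Ck_on_mult[OF assms(1)] assms(4) f'(2))+
qed

lemma frechet_derivative_field_comp:
  fixes f :: "'a::real_normed_vector \<Rightarrow> real"
  assumes "f differentiable (at x)" "(\<phi> has_field_derivative d) (at (f x))"
  shows "frechet_derivative (\<lambda>y. \<phi> (f y)) (at x) = (\<lambda>v. d * frechet_derivative f (at x) v)"
  using frechet_derivative_at[OF diff_chain_at[OF assms(1)[unfolded frechet_derivative_works]
      assms(2)[unfolded has_field_derivative_def]]]
  by (simp add: o_def)

lemma Ck_on_inverse:
  fixes f :: "'a::real_normed_vector \<Rightarrow> real"
  assumes "open S" "\<And>x. x \<in> S \<Longrightarrow> f x \<noteq> 0"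
  shows "Ck_on k S f \<Longrightarrow> Ck_on k S (\<lambda>x. inverse (f x))"
proof (induction k)
  case 0
  then show ?case using assms by (auto intro: continuous_intros)
next
  case (Suc k)
  have i: "Ck_on k S (\<lambda>x. inverse (f x))" using Suc Ck_on_SucD by auto
  show ?case
  proof (rule Ck_on_field_comp_Suc[OF assms(1) Suc.prems])
    show "(inverse has_field_derivative (-1) * (inverse (f x) * inverse (f x))) (at (f x))" if "x \<in> S" for x
      using DERIV_inverse[of "f x" UNIV] assms(2)[OF that] by (simp add: power2_eq_square numeral_2_eq_2)
    show "Ck_on k S (\<lambda>x. (-1) * (inverse (f x) * inverse (f x)))"
      by (intro Ck_on_mult[OF assms(1)] Ck_on_const i)
  qed
qed

lemma Ck_on_sqrt:
  fixes f :: "'a::real_normed_vector \<Rightarrow> real"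
  assumes "open S" "\<And>x. x \<in> S \<Longrightarrow> f x > 0"
  shows "Ck_on k S f \<Longrightarrow> Ck_on k S (\<lambda>x. sqrt (f x))"
proof (induction k)
  case 0
  then show ?case using assms by (auto intro: continuous_intros)
next
  case (Suc k)
  have i: "Ck_on k S (\<lambda>x. sqrt (f x))" using Suc Ck_on_SucD by auto
  have i2: "Ck_on k S (\<lambda>x. inverse (sqrt (f x)))"
    by (rule Ck_on_inverse[OF assms(1) _ i]) (use assms(2) in force)
  show ?case
  proof (rule Ck_on_field_comp_Suc[OF assms(1) Suc.prems])
    show "(sqrt has_field_derivative inverse (sqrt (f x)) * (1/2)) (at (f x))" if "x \<in> S" for x
      using DERIV_real_sqrt[OF assms(2)[OF that]] by simp
    show "Ck_on k S (\<lambda>x. inverse (sqrt (f x)) * (1/2))"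
      by (intro Ck_on_mult[OF assms(1)] Ck_on_const i2)
  qed
qed

text \<open>Schwarz's theorem. It is the source of the symmetries of the curvature, of its
  transformation law, and of the vanishing derivative of F along the Killing field.\<close>

lemma frechet_derivative_commute:
  fixes f :: "'a::real_normed_vector \<Rightarrow> real"
  assumes S: "open S" "x \<in> S" and f: "Ck_on 2 S f"
  shows "frechet_derivative (\<lambda>y. frechet_derivative f (at y) v) (at x) w =
         frechet_derivative (\<lambda>y. frechet_derivative f (at y) w) (at x) v"
proof -
  define f1 where "f1 = (\<lambda>v y. frechet_derivative f (at y) v)"
  define f2 where "f2 = (\<lambda>v w y. frechet_derivative (f1 v) (at y) w)"
  have d0: "f differentiable (at y)" if "y \<in> S" for y
    using f that by (auto simp: numeral_2_eq_2)
  have d1: "f1 v differentiable (at y)" if "y \<in> S" for y v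
    using f that unfolding f1_def by (auto simp: numeral_2_eq_2)
  have c2: "continuous_on S (f2 v w)" for v w
    using f unfolding f2_def f1_def by (auto simp: numeral_2_eq_2)
  have line0: "((\<lambda>s. f (y + s *\<^sub>R u)) has_real_derivative f1 u (y + s *\<^sub>R u)) (at s)"
    if "y + s *\<^sub>R u \<in> S" for y u s
  proof -
    have "((\<lambda>s. y + s *\<^sub>R u) has_derivative (\<lambda>r. r *\<^sub>R u)) (at s)"
      by (auto intro!: derivative_eq_intros)
    from diff_chain_at[OF this d0[OF that, unfolded frechet_derivative_works]]
    have "((\<lambda>s. f (y + s *\<^sub>R u)) has_derivative (\<lambda>r. frechet_derivative f (at (y + s *\<^sub>R u)) (r *\<^sub>R u))) (at s)"
      by (simp add: o_def)
    moreover have "frechet_derivative f (at (y + s *\<^sub>R u)) (r *\<^sub>R u) = f1 u (y + s *\<^sub>R u) * r" for r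
      using linear_frechet_derivative[OF d0[OF that]] unfolding f1_def by (simp add: linear_scale)
    ultimately show ?thesis unfolding has_field_derivative_def by (simp add: mult_commute_abs)
  qed
  have line1: "((\<lambda>s. f1 z (y + s *\<^sub>R u)) has_real_derivative f2 z u (y + s *\<^sub>R u)) (at s)"
    if "y + s *\<^sub>R u \<in> S" for y u s z
  proof -
    have "((\<lambda>s. y + s *\<^sub>R u) has_derivative (\<lambda>r. r *\<^sub>R u)) (at s)"
      by (auto intro!: derivative_eq_intros)
    from diff_chain_at[OF this d1[OF that, unfolded frechet_derivative_works]]
    have "((\<lambda>s. f1 z (y + s *\<^sub>R u)) has_derivative (\<lambda>r. frechet_derivative (f1 z) (at (y + s *\<^sub>R u)) (r *\<^sub>R u))) (at s)"
      by (simp add: o_def)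
    moreover have "frechet_derivative (f1 z) (at (y + s *\<^sub>R u)) (r *\<^sub>R u) = f2 z u (y + s *\<^sub>R u) * r" for r
      using linear_frechet_derivative[OF d1[OF that]] unfolding f2_def by (simp add: linear_scale)
    ultimately show ?thesis unfolding has_field_derivative_def by (simp add: mult_commute_abs)
  qed
  obtain \<rho> where \<rho>: "\<rho> > 0" "ball x \<rho> \<subseteq> S" using S open_contains_ball by blast
  \<comment> \<open>Points of the parallelogram with sides t v and t w lie within t * b of x. The
    summand 1 keeps \<open>b\<close> positive when v = w = 0.\<close>
  define b where "b = norm v + norm w + 1"
  have b: "b > 0" unfolding b_def by (simp add: add_nonneg_pos)
  have near: "norm (s *\<^sub>R v + r *\<^sub>R w) \<le> t * b" if "0 \<le> s" "s \<le> t" "0 \<le> r" "r \<le> t" for s r t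
  proof -
    have "norm (s *\<^sub>R v + r *\<^sub>R w) \<le> s * norm v + r * norm w"
      using norm_triangle_ineq[of "s *\<^sub>R v" "r *\<^sub>R w"] that by simp
    also have "\<dots> \<le> t * norm v + t * norm w" using that by (intro add_mono mult_right_mono) auto
    also have "\<dots> \<le> t * b" unfolding b_def using that by (simp add: distrib_left)
    finally show ?thesis .
  qed
  have inS: "x + s *\<^sub>R v + r *\<^sub>R w \<in> S" if "0 \<le> s" "s \<le> t" "0 \<le> r" "r \<le> t" "t * b < \<rho>" for s r t
  proof -
    have "dist x (x + y) = norm y" for y by (simp add: dist_norm)
    then have "x + (s *\<^sub>R v + r *\<^sub>R w) \<in> ball x \<rho>"
      using near[OF that(1-4)] that(5) by (simp del: dist_add_cancel)
    then show ?thesis using \<rho>(2) by (auto simp: add.assoc)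
  qed
  text \<open>Both mixed derivatives are limits of the same second difference quotient.\<close>
  have ex: "\<exists>s1 r1 s2 r2. 0 \<le> s1 \<and> s1 \<le> t \<and> 0 \<le> r1 \<and> r1 \<le> t \<and> 0 \<le> s2 \<and> s2 \<le> t \<and> 0 \<le> r2 \<and> r2 \<le> t \<and>
      f2 v w (x + s1 *\<^sub>R v + r1 *\<^sub>R w) = f2 w v (x + s2 *\<^sub>R v + r2 *\<^sub>R w)"
    if t: "0 < t" "t * b < \<rho>" for t
  proof -
    define \<Delta> where "\<Delta> = f (x + t *\<^sub>R v + t *\<^sub>R w) - f (x + t *\<^sub>R v) - f (x + t *\<^sub>R w) + f x"
    have in0: "x + s *\<^sub>R v \<in> S" "x + s *\<^sub>R w \<in> S"
      "x + t *\<^sub>R w + s *\<^sub>R v \<in> S" "x + t *\<^sub>R v + s *\<^sub>R w \<in> S" if "0 \<le> s" "s \<le> t" for s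
      using inS[of s t 0] inS[of 0 t s] inS[of s t t] inS[of t t s] that t by (simp_all add: add_ac)
    \<comment> \<open>The mean value theorem along v and then along w turns \<open>\<Delta>\<close>
      into t^2 times one mixed derivative. The second half of the block exchanges v and w and
      evaluates the same \<open>\<Delta>\<close> by the other mixed derivative.\<close>
    have "\<exists>s. 0 < s \<and> s < t \<and> ((\<lambda>s. f (x + t *\<^sub>R w + s *\<^sub>R v) - f (x + s *\<^sub>R v)) t
        - (\<lambda>s. f (x + t *\<^sub>R w + s *\<^sub>R v) - f (x + s *\<^sub>R v)) 0) = (t - 0) *
          (f1 v (x + t *\<^sub>R w + s *\<^sub>R v) - f1 v (x + s *\<^sub>R v))"
      by (intro MVT2[OF t(1)] DERIV_diff line0 in0)
    then obtain s where s: "0 < s" "s < t"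
      "\<Delta> = t * (f1 v (x + s *\<^sub>R v + t *\<^sub>R w) - f1 v (x + s *\<^sub>R v))"
      unfolding \<Delta>_def by (auto simp: add_ac)
    have "\<exists>r. 0 < r \<and> r < t \<and> (\<lambda>r. f1 v (x + s *\<^sub>R v + r *\<^sub>R w)) t - (\<lambda>r. f1 v (x + s *\<^sub>R v + r *\<^sub>R w)) 0
        = (t - 0) * f2 v w (x + s *\<^sub>R v + r *\<^sub>R w)"
      using s t by (intro MVT2[OF t(1)] line1 inS[of s t]) auto
    then obtain r where r: "0 < r" "r < t" "\<Delta> = t * (t * f2 v w (x + s *\<^sub>R v + r *\<^sub>R w))"
      using s(3) by auto
    have "\<exists>s. 0 < s \<and> s < t \<and> ((\<lambda>s. f (x + t *\<^sub>R v + s *\<^sub>R w) - f (x + s *\<^sub>R w)) t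
        - (\<lambda>s. f (x + t *\<^sub>R v + s *\<^sub>R w) - f (x + s *\<^sub>R w)) 0) = (t - 0) *
          (f1 w (x + t *\<^sub>R v + s *\<^sub>R w) - f1 w (x + s *\<^sub>R w))"
      by (intro MVT2[OF t(1)] DERIV_diff line0 in0)
    then obtain s' where s': "0 < s'" "s' < t"
      "\<Delta> = t * (f1 w (x + s' *\<^sub>R w + t *\<^sub>R v) - f1 w (x + s' *\<^sub>R w))"
      unfolding \<Delta>_def by (auto simp: add_ac)
    have "\<exists>r. 0 < r \<and> r < t \<and> (\<lambda>r. f1 w (x + s' *\<^sub>R w + r *\<^sub>R v)) t - (\<lambda>r. f1 w (x + s' *\<^sub>R w + r *\<^sub>R v)) 0
        = (t - 0) * f2 w v (x + s' *\<^sub>R w + r *\<^sub>R v)"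
    proof (intro MVT2[OF t(1)] line1)
      show "x + s' *\<^sub>R w + r *\<^sub>R v \<in> S" if "0 \<le> r" "r \<le> t" for r
        using inS[of r t s'] that s' t by (simp add: add_ac)
    qed
    then obtain r' where r': "0 < r'" "r' < t" "\<Delta> = t * (t * f2 w v (x + r' *\<^sub>R v + s' *\<^sub>R w))"
      using s'(3) by (auto simp: add_ac)
    have "f2 v w (x + s *\<^sub>R v + r *\<^sub>R w) = f2 w v (x + r' *\<^sub>R v + s' *\<^sub>R w)"
      using r(3) r'(3) t by simp
    then show ?thesis using s(1,2) r(1,2) s'(1,2) r'(1,2) by (meson less_imp_le)
  qed
  have "\<bar>f2 v w x - f2 w v x\<bar> < 2 * e" if e: "e > 0" for e
  proof -
    have "\<exists>d>0. \<forall>y\<in>S. dist y x < d \<longrightarrow> dist (f2 v w y) (f2 v w x) < e"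
      "\<exists>d>0. \<forall>y\<in>S. dist y x < d \<longrightarrow> dist (f2 w v y) (f2 w v x) < e"
      using c2 S(2) e unfolding continuous_on_iff by metis+
    then obtain d1 d2 where d: "d1 > 0" "d2 > 0"
      "\<And>y. y\<in>S \<Longrightarrow> dist y x < d1 \<Longrightarrow> dist (f2 v w y) (f2 v w x) < e"
      "\<And>y. y\<in>S \<Longrightarrow> dist y x < d2 \<Longrightarrow> dist (f2 w v y) (f2 w v x) < e" by metis
    define m where "m = min \<rho> (min d1 d2)"
    have m: "m > 0" "m \<le> \<rho>" "m \<le> d1" "m \<le> d2" unfolding m_def using d \<rho> by auto
    define t where "t = m / (2 * b)"
    have t: "0 < t" "t * b < m" unfolding t_def using m b by auto
    obtain s1 r1 s2 r2 where sr: "0 \<le> s1" "s1 \<le> t" "0 \<le> r1" "r1 \<le> t" "0 \<le> s2" "s2 \<le> t" "0 \<le> r2" "r2 \<le> t"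
      "f2 v w (x + s1 *\<^sub>R v + r1 *\<^sub>R w) = f2 w v (x + s2 *\<^sub>R v + r2 *\<^sub>R w)"
      using ex[of t] t m by auto
    have "dist (x + s1 *\<^sub>R v + r1 *\<^sub>R w) x < m" "dist (x + s2 *\<^sub>R v + r2 *\<^sub>R w) x < m"
      using near[of s1 t r1] near[of s2 t r2] sr t by (auto simp: dist_norm add.assoc)
    then have "dist (f2 v w (x + s1 *\<^sub>R v + r1 *\<^sub>R w)) (f2 v w x) < e"
      "dist (f2 w v (x + s2 *\<^sub>R v + r2 *\<^sub>R w)) (f2 w v x) < e"
      using d(3)[OF inS[of s1 t r1]] d(4)[OF inS[of s2 t r2]] sr(1-8) t m by linarith+
    then show ?thesis using sr(9) by (auto simp: dist_real_def)
  qed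
  \<comment> \<open>With e half of the gap, a positive gap would be smaller than itself.\<close>
  from this[of "\<bar>f2 v w x - f2 w v x\<bar> / 2"] have "f2 v w x = f2 w v x" by auto
  then show ?thesis unfolding f2_def f1_def .
qed

subsection \<open>Partial derivatives in a chart\<close>

text \<open>The scalar counterpart of \<open>smooth_comps\<close>. Component functions are treated
  one at a time, so tensor calculus in a chart becomes algebra with the commuting derivations
  \<open>pd c i\<close>.\<close>

definition chart_smooth :: "'a chart \<Rightarrow> ('a \<Rightarrow> real) \<Rightarrow> bool" where
  "chart_smooth c f \<longleftrightarrow> smooth_on (coord c ` cdom c) (f \<circ> cinv c)"

lemma is_chartD:
  assumes "is_chart c"
  shows "open (cdom c)" "open (coord c ` cdom c)"
    "p \<in> cdom c \<Longrightarrow> cinv c (coord c p) = p"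
    "x \<in> coord c ` cdom c \<Longrightarrow> coord c (cinv c x) = x"
    "x \<in> coord c ` cdom c \<Longrightarrow> cinv c x \<in> cdom c"
    "continuous_on (cdom c) (coord c)" "continuous_on (coord c ` cdom c) (cinv c)"
  using assms unfolding is_chart_def homeomorphism_def by auto

lemma pd_cong:
  assumes "is_chart c" "p \<in> cdom c" "\<And>q. q \<in> cdom c \<Longrightarrow> f q = g q"
  shows "pd c i f p = pd c i g p"
  unfolding pd_def
  by (subst frechet_derivative_cong_open[OF is_chartD(2)[OF assms(1)], of _ _ "g \<circ> cinv c"])
     (use assms is_chartD(5)[OF assms(1)] in auto)

lemma chart_smooth_cong:
  assumes "is_chart c" "\<And>q. q \<in> cdom c \<Longrightarrow> f q = g q"
  shows "chart_smooth c f \<longleftrightarrow> chart_smooth c g"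
  unfolding chart_smooth_def
  by (rule smooth_on_cong[OF is_chartD(2)[OF assms(1)]])
     (use assms is_chartD(5)[OF assms(1)] in auto)

lemma chart_smooth_const [simp]: "chart_smooth c (\<lambda>q. a)"
  unfolding chart_smooth_def smooth_on_def o_def using Ck_on_const by blast

lemma chart_smooth_add:
  "is_chart c \<Longrightarrow> chart_smooth c f \<Longrightarrow> chart_smooth c g \<Longrightarrow> chart_smooth c (\<lambda>q. f q + g q)"
  unfolding chart_smooth_def smooth_on_def 
  by (simp add: Ck_on_add[OF is_chartD(2)] o_def)

lemma chart_smooth_mult:
  "is_chart c \<Longrightarrow> chart_smooth c f \<Longrightarrow> chart_smooth c g \<Longrightarrow> chart_smooth c (\<lambda>q. f q * g q)"
  unfolding chart_smooth_def smooth_on_def 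
  by (simp add: Ck_on_mult[OF is_chartD(2)] o_def)

lemma chart_smooth_cmult: "is_chart c \<Longrightarrow> chart_smooth c f \<Longrightarrow> chart_smooth c (\<lambda>q. a * f q)"
  using chart_smooth_mult[OF _ chart_smooth_const] by blast

lemma chart_smooth_minus: "is_chart c \<Longrightarrow> chart_smooth c f \<Longrightarrow> chart_smooth c (\<lambda>q. - f q)"
  using chart_smooth_cmult[of c f "-1"] by simp

lemma chart_smooth_diff:
  "is_chart c \<Longrightarrow> chart_smooth c f \<Longrightarrow> chart_smooth c g \<Longrightarrow> chart_smooth c (\<lambda>q. f q - g q)"
  using chart_smooth_add[OF _ _ chart_smooth_minus, of c f g] by simp

lemma chart_smooth_inverse:
  assumes "is_chart c" "chart_smooth c f" "\<And>q. q \<in> cdom c \<Longrightarrow> f q \<noteq> 0"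
  shows "chart_smooth c (\<lambda>q. inverse (f q))"
  using assms Ck_on_inverse[OF is_chartD(2)[OF assms(1)], of "f \<circ> cinv c"] is_chartD(5)[OF assms(1)]
  unfolding chart_smooth_def smooth_on_def by (auto simp: o_def)

lemma chart_smooth_divide:
  assumes "is_chart c" "chart_smooth c f" "chart_smooth c g" "\<And>q. q \<in> cdom c \<Longrightarrow> g q \<noteq> 0"
  shows "chart_smooth c (\<lambda>q. f q / g q)"
  unfolding divide_inverse using assms by (intro chart_smooth_mult chart_smooth_inverse) auto

lemma chart_smooth_sqrt:
  assumes "is_chart c" "chart_smooth c f" "\<And>q. q \<in> cdom c \<Longrightarrow> f q > 0"
  shows "chart_smooth c (\<lambda>q. sqrt (f q))"
  using assms Ck_on_sqrt[OF is_chartD(2)[OF assms(1)], of "f \<circ> cinv c"] is_chartD(5)[OF assms(1)]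
  unfolding chart_smooth_def smooth_on_def by (auto simp: o_def)

lemma chart_smooth_pd:
  assumes "is_chart c" "chart_smooth c f"
  shows "chart_smooth c (pd c i f)"
proof -
  have "smooth_on (coord c ` cdom c) (\<lambda>x. frechet_derivative (f \<circ> cinv c) (at x) (axis i 1))"
    using smooth_on_deriv assms(2) unfolding chart_smooth_def by blast
  then show ?thesis
    unfolding chart_smooth_def
    by (rule smooth_on_cong[OF is_chartD(2)[OF assms(1)], THEN iffD1, rotated])
       (auto simp: pd_def is_chartD[OF assms(1)])
qed

lemma pd_const [simp]: "pd c i (\<lambda>q. a) p = 0"
  unfolding pd_def by (simp add: o_def)

lemma chart_smooth_differentiable:
  assumes "chart_smooth c f" "p \<in> cdom c"
  shows "(f \<circ> cinv c) differentiable (at (coord c p))"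
  using assms unfolding chart_smooth_def by (auto intro: smooth_on_differentiable)

lemma pd_add:
  assumes "chart_smooth c f" "chart_smooth c g" "p \<in> cdom c"
  shows "pd c i (\<lambda>q. f q + g q) p = pd c i f p + pd c i g p"
proof -
  note d = chart_smooth_differentiable[unfolded frechet_derivative_works, OF _ assms(3)]
  show ?thesis
    using has_derivative_add[OF d[OF assms(1)] d[OF assms(2)], THEN frechet_derivative_at, symmetric]
    unfolding pd_def by (simp add: o_def)
qed

lemma pd_mult:
  assumes "is_chart c" "chart_smooth c f" "chart_smooth c g" "p \<in> cdom c"
  shows "pd c i (\<lambda>q. f q * g q) p = f p * pd c i g p + pd c i f p * g p"
proof -
  note d = chart_smooth_differentiable[unfolded frechet_derivative_works, OF _ assms(4)]
  have "((\<lambda>q. f q * g q) \<circ> cinv c) = (\<lambda>x. (f \<circ> cinv c) x * (g \<circ> cinv c) x)" by auto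
  then show ?thesis
    using has_derivative_mult[OF d[OF assms(2)] d[OF assms(3)], THEN frechet_derivative_at, symmetric]
    unfolding pd_def by (simp add: is_chartD(3)[OF assms(1,4)])
qed

lemma pd_cmult:
  assumes "is_chart c" "chart_smooth c f" "p \<in> cdom c"
  shows "pd c i (\<lambda>q. a * f q) p = a * pd c i f p"
  using pd_mult[OF assms(1) chart_smooth_const assms(2,3)] by simp

lemma pd_minus:
  assumes "is_chart c" "chart_smooth c f" "p \<in> cdom c"
  shows "pd c i (\<lambda>q. - f q) p = - pd c i f p"
  using pd_cmult[OF assms, of i "-1"] by simp

lemma pd_diff:
  assumes "is_chart c" "chart_smooth c f" "chart_smooth c g" "p \<in> cdom c"
  shows "pd c i (\<lambda>q. f q - g q) p = pd c i f p - pd c i g p"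
  using pd_add[OF assms(2) chart_smooth_minus[OF assms(1,3)] assms(4)] pd_minus[OF assms(1,3,4)] by simp

lemma pd_field_comp:
  assumes "is_chart c" "chart_smooth c f" "p \<in> cdom c" "(\<phi> has_field_derivative d) (at (f p))"
  shows "pd c i (\<lambda>q. \<phi> (f q)) p = d * pd c i f p"
proof -
  have "(\<phi> has_field_derivative d) (at ((f \<circ> cinv c) (coord c p)))"
    using assms(4) is_chartD(3)[OF assms(1,3)] by simp
  from frechet_derivative_field_comp[OF chart_smooth_differentiable[OF assms(2,3)] this]
  show ?thesis unfolding pd_def by (simp add: o_def)
qed

lemma pd_inverse:
  assumes "is_chart c" "chart_smooth c f" "p \<in> cdom c" "f p \<noteq> 0"
  shows "pd c i (\<lambda>q. inverse (f q)) p = - pd c i f p / (f p)\<^sup>2"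
  using pd_field_comp[OF assms(1-3) DERIV_inverse[OF assms(4)], of i]
  by (simp add: divide_inverse power2_eq_square numeral_2_eq_2)

lemma pd_divide:
  assumes "is_chart c" "chart_smooth c f" "chart_smooth c g" "p \<in> cdom c" "\<And>q. q \<in> cdom c \<Longrightarrow> g q \<noteq> 0"
  shows "pd c i (\<lambda>q. f q / g q) p = (pd c i f p * g p - f p * pd c i g p) / (g p)\<^sup>2"
proof -
  have "pd c i (\<lambda>q. f q / g q) p = f p * (- pd c i g p / (g p)\<^sup>2) + pd c i f p * inverse (g p)"
    unfolding divide_inverse[of "f _"]
    using pd_mult[OF assms(1,2) chart_smooth_inverse[OF assms(1,3,5)] assms(4)]
      pd_inverse[OF assms(1,3,4) assms(5)[OF assms(4)]] by simp
  then show ?thesis using assms(5)[OF assms(4)] by (simp add: field_simps power2_eq_square)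
qed

lemma pd_sqrt:
  assumes "is_chart c" "chart_smooth c f" "p \<in> cdom c" "f p > 0"
  shows "pd c i (\<lambda>q. sqrt (f q)) p = pd c i f p / (2 * sqrt (f p))"
  using pd_field_comp[OF assms(1-3) DERIV_real_sqrt[OF assms(4)], of i] by (simp add: field_simps)

lemma pd_commute:
  assumes "is_chart c" "chart_smooth c f" "p \<in> cdom c"
  shows "pd c i (pd c j f) p = pd c j (pd c i f) p"
proof -
  note ch = is_chartD[OF assms(1)]
  have *: "pd c i (pd c j f) p = frechet_derivative (\<lambda>x. frechet_derivative (f \<circ> cinv c) (at x) (axis j 1))
     (at (coord c p)) (axis i 1)" for i j
    unfolding pd_def[of c i]
    by (subst frechet_derivative_cong_open[OF ch(2)]) (use assms(3) ch in \<open>auto simp: pd_def\<close>)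
  show ?thesis unfolding *
    using assms by (intro frechet_derivative_commute[OF ch(2)]) (auto simp: chart_smooth_def smooth_on_def)
qed

lemma chart_smooth_bounded_linear:
  assumes "is_chart c" "smooth_on (coord c ` cdom c) (T \<circ> cinv c)" "bounded_linear L"
  shows "chart_smooth c (\<lambda>q. L (T q))"
  using assms Ck_on_bounded_linear_comp[OF is_chartD(2)[OF assms(1)] assms(3), of _ "T \<circ> cinv c"]
  unfolding chart_smooth_def smooth_on_def by (auto simp: o_def)

lemma frechet_derivative_chart:
  assumes "chart_smooth c f" "p \<in> cdom c"
  shows "frechet_derivative (f \<circ> cinv c) (at (coord c p)) w = (\<Sum>i\<in>UNIV. w $ i * pd c i f p)"
proof -
  have l: "linear (frechet_derivative (f \<circ> cinv c) (at (coord c p)))"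
    using chart_smooth_differentiable[OF assms] by (rule linear_frechet_derivative)
  have "frechet_derivative (f \<circ> cinv c) (at (coord c p)) w =
     frechet_derivative (f \<circ> cinv c) (at (coord c p)) (\<Sum>i\<in>UNIV. (w $ i) *\<^sub>R axis i 1)"
    by (simp add: basis_expansion flip: scalar_mult_eq_scaleR)
  also have "\<dots> = (\<Sum>i\<in>UNIV. w $ i * pd c i f p)"
    unfolding pd_def by (simp add: linear_sum[OF l] linear_scale[OF l])
  finally show ?thesis .
qed

lemma chart_has_derivative:
  assumes "chart_smooth c f" "p \<in> cdom c"
  shows "((f \<circ> cinv c) has_derivative (\<lambda>w. \<Sum>i\<in>UNIV. w $ i * pd c i f p)) (at (coord c p))"
  using chart_smooth_differentiable[OF assms, unfolded frechet_derivative_works]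
  by (simp add: frechet_derivative_chart[OF assms, symmetric])

section \<open>Local identities\<close>

text \<open>The components \<open>R_{12l}^k\<close> of the curvature of the torsion-free connection with
  \<open>\<Gamma>^m_{11} = A_m\<close>, \<open>\<Gamma>^m_{12} = B_m\<close>, \<open>\<Gamma>^m_{22} = C_m\<close>.\<close>

definition curv11 where
  "curv11 c A1 A2 B1 B2 C1 C2 p = pd c 1 B1 p - pd c 2 A1 p + B1 p * B2 p - C1 p * A2 p"
definition curv12 where
  "curv12 c A1 A2 B1 B2 C1 C2 p = pd c 1 B2 p - pd c 2 A2 p
     + A2 p * B1 p + B2 p * B2 p - B2 p * A1 p - C2 p * A2 p"
definition curv21 where
  "curv21 c A1 A2 B1 B2 C1 C2 p = pd c 1 C1 p - pd c 2 B1 p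
     + A1 p * C1 p + B1 p * C2 p - B1 p * B1 p - C1 p * B2 p"
definition curv22 where
  "curv22 c A1 A2 B1 B2 C1 C2 p = pd c 1 C2 p - pd c 2 B2 p + A2 p * C1 p - B2 p * B1 p"

lemmas curv_defs = curv11_def curv12_def curv21_def curv22_def

text \<open>The metric has components \<open>e, f, g\<close> and Levi-Civita coefficients \<open>A, B, C\<close>; the
  vector field \<open>X\<close> is divergence free.\<close>

locale metric_jet =
  fixes c :: "'a::t2_space chart" and e f g W A1 A2 B1 B2 C1 C2 X1 X2 F :: "'a \<Rightarrow> real"
  assumes chart: "is_chart c"
    and smooth [simp]: "chart_smooth c e" "chart_smooth c f" "chart_smooth c g" "chart_smooth c W"
      "chart_smooth c A1" "chart_smooth c A2" "chart_smooth c B1" "chart_smooth c B2"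
      "chart_smooth c C1" "chart_smooth c C2" "chart_smooth c X1" "chart_smooth c X2" "chart_smooth c F"
    and e_pos: "p \<in> cdom c \<Longrightarrow> e p > 0"
    and W_pos: "p \<in> cdom c \<Longrightarrow> W p > 0"
    and W_sq: "p \<in> cdom c \<Longrightarrow> W p * W p = e p * g p - f p * f p"
    and pd_e: "p \<in> cdom c \<Longrightarrow> pd c 1 e p = 2 * (A1 p * e p + A2 p * f p)"
      "p \<in> cdom c \<Longrightarrow> pd c 2 e p = 2 * (B1 p * e p + B2 p * f p)"
    and pd_f: "p \<in> cdom c \<Longrightarrow> pd c 1 f p = A1 p * f p + A2 p * g p + B1 p * e p + B2 p * f p"
      "p \<in> cdom c \<Longrightarrow> pd c 2 f p = B1 p * f p + B2 p * g p + C1 p * e p + C2 p * f p"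
    and pd_g: "p \<in> cdom c \<Longrightarrow> pd c 1 g p = 2 * (B1 p * f p + B2 p * g p)"
      "p \<in> cdom c \<Longrightarrow> pd c 2 g p = 2 * (C1 p * f p + C2 p * g p)"
    and pd_W: "p \<in> cdom c \<Longrightarrow> pd c 1 W p = W p * (A1 p + B2 p)"
      "p \<in> cdom c \<Longrightarrow> pd c 2 W p = W p * (B1 p + C2 p)"
    and div_X: "p \<in> cdom c \<Longrightarrow> pd c 1 X1 p + pd c 2 X2 p + (A1 p + B2 p) * X1 p + (B1 p + C2 p) * X2 p = 0"
    and F: "p \<in> cdom c \<Longrightarrow> pd c 1 (\<lambda>q. f q * X1 q + g q * X2 q) p - pd c 2 (\<lambda>q. e q * X1 q + f q * X2 q) p
       = - F p * W p / 2"
begin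

lemmas [simp] = pd_add pd_mult[OF chart] pd_minus[OF chart] pd_diff[OF chart]
lemmas smooth_intros [simp] = chart_smooth_const chart_smooth_add[OF chart] chart_smooth_mult[OF chart]
  chart_smooth_minus[OF chart] chart_smooth_diff[OF chart] chart_smooth_pd[OF chart]

text \<open>The components of known objects: \<open>x1\<close>, \<open>x2\<close> are \<gamma>, that
  is X with its index lowered; \<open>u\<close> is |\<gamma>|^2; \<open>N11\<close> to
  \<open>N22\<close> are D_i X^k with the derivative index first; \<open>Y1\<close>,
  \<open>Y2\<close> are D_X X. The flux of \<phi> is W h^{ij} d_j \<phi>, so \<open>lap\<close> is W
  times the Laplace-Beltrami operator. With the weight \<open>W\<close> a divergence is a plain sum
  of partial derivatives.\<close>

definition "x1 q = e q * X1 q + f q * X2 q"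
definition "x2 q = f q * X1 q + g q * X2 q"
definition "u q = x1 q * X1 q + x2 q * X2 q"
definition "N11 q = pd c 1 X1 q + A1 q * X1 q + B1 q * X2 q"
definition "N12 q = pd c 1 X2 q + A2 q * X1 q + B2 q * X2 q"
definition "N21 q = pd c 2 X1 q + B1 q * X1 q + C1 q * X2 q"
definition "N22 q = pd c 2 X2 q + B2 q * X1 q + C2 q * X2 q"
definition "Y1 q = X1 q * N11 q + X2 q * N21 q"
definition "Y2 q = X1 q * N12 q + X2 q * N22 q"
definition "flux1 \<phi> q = (g q * pd c 1 \<phi> q - f q * pd c 2 \<phi> q) / W q"
definition "flux2 \<phi> q = (e q * pd c 2 \<phi> q - f q * pd c 1 \<phi> q) / W q"
definition "lap \<phi> p = pd c 1 (flux1 \<phi>) p + pd c 2 (flux2 \<phi>) p"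

lemma smooth_x [simp]: "chart_smooth c x1" "chart_smooth c x2"
  unfolding x1_def[abs_def] x2_def[abs_def] by simp_all

lemma smooth_N [simp]: "chart_smooth c N11" "chart_smooth c N12" "chart_smooth c N21" "chart_smooth c N22"
  unfolding N11_def[abs_def] N12_def[abs_def] N21_def[abs_def] N22_def[abs_def] by simp_all

lemma smooth_Y [simp]: "chart_smooth c Y1" "chart_smooth c Y2"
  unfolding Y1_def[abs_def] Y2_def[abs_def] by simp_all

lemma smooth_u [simp]: "chart_smooth c u"
  unfolding u_def[abs_def] by simp

lemma smooth_flux [simp]: "chart_smooth c \<phi> \<Longrightarrow> chart_smooth c (flux1 \<phi>)"
    "chart_smooth c \<phi> \<Longrightarrow> chart_smooth c (flux2 \<phi>)"
  unfolding flux1_def[abs_def] flux2_def[abs_def]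
  by (rule chart_smooth_divide[OF chart], simp, simp, use W_pos in fastforce)+

lemma trace_N: "p \<in> cdom c \<Longrightarrow> N11 p + N22 p = 0"
  using div_X unfolding N11_def N22_def by (simp add: algebra_simps)

lemma pd_x:
  assumes "p \<in> cdom c"
  shows "pd c 1 x1 p = e p * N11 p + f p * N12 p + A1 p * x1 p + A2 p * x2 p"
    "pd c 1 x2 p = f p * N11 p + g p * N12 p + B1 p * x1 p + B2 p * x2 p"
    "pd c 2 x1 p = e p * N21 p + f p * N22 p + B1 p * x1 p + B2 p * x2 p"
    "pd c 2 x2 p = f p * N21 p + g p * N22 p + C1 p * x1 p + C2 p * x2 p"
  using assms pd_e pd_f pd_g unfolding x1_def[abs_def] x2_def[abs_def] N11_def N12_def N21_def N22_def
  by (simp_all add: algebra_simps)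

lemma F_eq: "p \<in> cdom c \<Longrightarrow> pd c 1 x2 p - pd c 2 x1 p = - F p * W p / 2"
  using F unfolding x1_def[abs_def] x2_def[abs_def] .

lemma F_N: "p \<in> cdom c \<Longrightarrow> (f p * N11 p + g p * N12 p) - (e p * N21 p + f p * N22 p) = - F p * W p / 2"
  using F_eq pd_x by simp

lemma pd_u:
  assumes "p \<in> cdom c"
  shows "pd c 1 u p = 2 * (x1 p * N11 p + x2 p * N12 p)"
    "pd c 2 u p = 2 * (x1 p * N21 p + x2 p * N22 p)"
proof -
  have "pd c 1 u p = x1 p * pd c 1 X1 p + pd c 1 x1 p * X1 p + (x2 p * pd c 1 X2 p + pd c 1 x2 p * X2 p)"
    "pd c 2 u p = x1 p * pd c 2 X1 p + pd c 2 x1 p * X1 p + (x2 p * pd c 2 X2 p + pd c 2 x2 p * X2 p)"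
    using assms unfolding u_def[abs_def] by simp_all
  then show "pd c 1 u p = 2 * (x1 p * N11 p + x2 p * N12 p)"
    "pd c 2 u p = 2 * (x1 p * N21 p + x2 p * N22 p)"
    unfolding pd_x[OF assms] unfolding N11_def N12_def N21_def N22_def x1_def x2_def
    by (simp_all add: algebra_simps)
qed

text \<open>Half of du is D \<gamma> with X in the second slot. Moving X to the first slot costs the
  antisymmetric part of D \<gamma>, a multiple of F; hence grad u = 2 D_X X + F J X, stated here
  with the factor \<open>W\<close>.\<close>

lemma flux_u:
  assumes "p \<in> cdom c"
  shows "flux1 u p = 2 * W p * Y1 p - F p * x2 p" "flux2 u p = 2 * W p * Y2 p + F p * x1 p"
proof -
  have W0: "W p \<noteq> 0" using W_pos[OF assms] by simp
  have *: "F p * W p = 2 * (e p * N21 p + f p * N22 p - f p * N11 p - g p * N12 p)"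
    using F_N[OF assms] by simp
  have "W p * (2 * W p * Y1 p - F p * x2 p) = 2 * (W p * W p) * Y1 p - (F p * W p) * x2 p"
    "W p * (2 * W p * Y2 p + F p * x1 p) = 2 * (W p * W p) * Y2 p + (F p * W p) * x1 p"
    by (simp_all add: algebra_simps)
  moreover have "2 * (e p * g p - f p * f p) * Y1 p - (F p * W p) * x2 p = g p * pd c 1 u p - f p * pd c 2 u p"
    "2 * (e p * g p - f p * f p) * Y2 p + (F p * W p) * x1 p = e p * pd c 2 u p - f p * pd c 1 u p"
    unfolding * pd_u[OF assms] Y1_def Y2_def x1_def x2_def by (simp_all add: algebra_simps)
  ultimately show "flux1 u p = 2 * W p * Y1 p - F p * x2 p" "flux2 u p = 2 * W p * Y2 p + F p * x1 p"
    unfolding flux1_def flux2_def W_sq[OF assms] using W0 by (simp_all add: field_simps)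
qed

abbreviation "cv11 \<equiv> curv11 c A1 A2 B1 B2 C1 C2"
abbreviation "cv12 \<equiv> curv12 c A1 A2 B1 B2 C1 C2"
abbreviation "cv21 \<equiv> curv21 c A1 A2 B1 B2 C1 C2"
abbreviation "cv22 \<equiv> curv22 c A1 A2 B1 B2 C1 C2"

lemma div_WX:
  assumes "p \<in> cdom c"
  shows "pd c 1 (\<lambda>q. W q * X1 q) p + pd c 2 (\<lambda>q. W q * X2 q) p = 0"
proof -
  have "pd c 1 (\<lambda>q. W q * X1 q) p + pd c 2 (\<lambda>q. W q * X2 q) p =
     W p * (pd c 1 X1 p + pd c 2 X2 p + (A1 p + B2 p) * X1 p + (B1 p + C2 p) * X2 p)"
    using assms pd_W by (simp add: algebra_simps)
  then show ?thesis using div_X[OF assms] by simp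
qed

text \<open>For a divergence-free field, div (D_X X) = tr (DX)^2 + Ric(X, X): commuting the second
  derivatives of X produces the curvature, and the derivative of div X along X drops out. The last
  three terms are Ric(X, X).\<close>

lemma div_Y:
  assumes "p \<in> cdom c"
  shows "pd c 1 (\<lambda>q. W q * Y1 q) p + pd c 2 (\<lambda>q. W q * Y2 q) p =
     W p * (N11 p * N11 p + 2 * N12 p * N21 p + N22 p * N22 p
       - cv12 p * X1 p * X1 p + (cv11 p - cv22 p) * X1 p * X2 p + cv21 p * X2 p * X2 p)"
proof -
  \<comment> \<open>Differentiating div X = 0 eliminates one diagonal derivative of N in each
    direction.\<close>
  have t: "pd c i N11 p + pd c i N22 p = 0" for i
  proof -
    have "pd c i (\<lambda>q. N11 q + N22 q) p = pd c i (\<lambda>q. 0) p"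
      by (rule pd_cong[OF chart assms]) (simp add: trace_N)
    then show ?thesis using assms by simp
  qed
  have c: "pd c 2 (pd c 1 X1) p = pd c 1 (pd c 2 X1) p" "pd c 2 (pd c 1 X2) p = pd c 1 (pd c 2 X2) p"
    using pd_commute[OF chart _ assms] by simp_all
  have exN: "pd c 2 N11 p = pd c 2 (pd c 1 X1) p + (A1 p * pd c 2 X1 p + pd c 2 A1 p * X1 p) + (B1 p * pd c 2 X2 p + pd c 2 B1 p * X2 p)"
    "pd c 2 N12 p = pd c 2 (pd c 1 X2) p + (A2 p * pd c 2 X1 p + pd c 2 A2 p * X1 p) + (B2 p * pd c 2 X2 p + pd c 2 B2 p * X2 p)"
    "pd c 1 N21 p = pd c 1 (pd c 2 X1) p + (B1 p * pd c 1 X1 p + pd c 1 B1 p * X1 p) + (C1 p * pd c 1 X2 p + pd c 1 C1 p * X2 p)"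
    "pd c 1 N22 p = pd c 1 (pd c 2 X2) p + (B2 p * pd c 1 X1 p + pd c 1 B2 p * X1 p) + (C2 p * pd c 1 X2 p + pd c 1 C2 p * X2 p)"
    using assms unfolding N11_def[abs_def] N12_def[abs_def] N21_def[abs_def] N22_def[abs_def] by simp_all
  have n1: "pd c 1 N11 p = - pd c 1 N22 p" and n2: "pd c 2 N22 p = - pd c 2 N11 p" using t[of 1] t[of 2] by simp_all
  have n3: "pd c 1 X1 p = N11 p - A1 p * X1 p - B1 p * X2 p" "pd c 1 X2 p = N12 p - A2 p * X1 p - B2 p * X2 p"
     "pd c 2 X1 p = N21 p - B1 p * X1 p - C1 p * X2 p" "pd c 2 X2 p = N22 p - B2 p * X1 p - C2 p * X2 p"
    unfolding N11_def N12_def N21_def N22_def by simp_all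
  have "pd c 1 (\<lambda>q. W q * Y1 q) p + pd c 2 (\<lambda>q. W q * Y2 q) p =
     W p * ((A1 p + B2 p) * Y1 p + (B1 p + C2 p) * Y2 p
      + (X1 p * pd c 1 N11 p + pd c 1 X1 p * N11 p + X2 p * pd c 1 N21 p + pd c 1 X2 p * N21 p)
      + (X1 p * pd c 2 N12 p + pd c 2 X1 p * N12 p + X2 p * pd c 2 N22 p + pd c 2 X2 p * N22 p))"
    using assms pd_W unfolding Y1_def[abs_def] Y2_def[abs_def] by (simp add: algebra_simps)
  also have "\<dots> = W p * (N11 p * N11 p + 2 * N12 p * N21 p + N22 p * N22 p
       - cv12 p * X1 p * X1 p + (cv11 p - cv22 p) * X1 p * X2 p + cv21 p * X2 p * X2 p)"
    unfolding n1 n2 exN c curv_defs Y1_def Y2_def unfolding n3 by (simp add: algebra_simps)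
  finally show ?thesis .
qed

text \<open>The Gauss curvature, read off from R_{121}^2 = - K h_11.\<close>

definition "K p = - cv12 p / e p"

text \<open>The curvature endomorphism in the plane 12 is skew for the metric, and such
  endomorphisms of a plane form a line, so one function determines all four components. Skewness is
  the equality of the mixed second derivatives of \<open>e\<close>, \<open>g\<close> and
  \<open>f\<close>, which gives \<open>k1\<close>, \<open>k2\<close> and \<open>k3\<close> in
  turn.\<close>

lemma curvature:
  assumes "p \<in> cdom c"
  shows "cv12 p = - K p * e p" "cv11 p = K p * f p" "cv22 p = - K p * f p" "cv21 p = K p * g p"
proof -
  have sy: "pd c 2 (pd c 1 h) p = pd c 1 (pd c 2 h) p" if "chart_smooth c h" for h
    using pd_commute[OF chart that assms] .
  have e1: "pd c 2 (pd c 1 e) p = pd c 2 (\<lambda>q. 2 * (A1 q * e q + A2 q * f q)) p"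
    "pd c 1 (pd c 2 e) p = pd c 1 (\<lambda>q. 2 * (B1 q * e q + B2 q * f q)) p"
    "pd c 2 (pd c 1 f) p = pd c 2 (\<lambda>q. A1 q * f q + A2 q * g q + B1 q * e q + B2 q * f q) p"
    "pd c 1 (pd c 2 f) p = pd c 1 (\<lambda>q. B1 q * f q + B2 q * g q + C1 q * e q + C2 q * f q) p"
    "pd c 2 (pd c 1 g) p = pd c 2 (\<lambda>q. 2 * (B1 q * f q + B2 q * g q)) p"
    "pd c 1 (pd c 2 g) p = pd c 1 (\<lambda>q. 2 * (C1 q * f q + C2 q * g q)) p"
    by (intro pd_cong[OF chart assms]; simp add: pd_e pd_f pd_g)+
  have k1: "cv11 p * e p + cv12 p * f p = 0"
    using sy[of e] assms pd_e pd_f pd_g unfolding e1 curv_defs by (simp add: algebra_simps)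
  have k2: "cv21 p * f p + cv22 p * g p = 0"
    using sy[of g] assms pd_e pd_f pd_g unfolding e1 curv_defs by (simp add: algebra_simps)
  have k3: "cv11 p * f p + cv12 p * g p + cv21 p * e p + cv22 p * f p = 0"
    using sy[of f] assms pd_e pd_f pd_g unfolding e1 curv_defs by (simp add: algebra_simps)
  have e0: "e p \<noteq> 0" and w0: "e p * g p - f p * f p \<noteq> 0"
    using e_pos[OF assms] W_pos[OF assms] W_sq[OF assms] by auto
  show 12: "cv12 p = - K p * e p" unfolding K_def using e0 by simp
  show 11: "cv11 p = K p * f p" using k1 unfolding 12 using e0 by (simp add: algebra_simps)
  have "(e p * g p - f p * f p) * (cv22 p + K p * f p) = 0"
    using k2 k3 unfolding 11 12 by algebra
  then show 22: "cv22 p = - K p * f p" using w0 by simp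
  show "cv21 p = K p * g p" using k3 unfolding 11 12 22 using e0 by (simp add: algebra_simps)
qed

definition "trNN p = N11 p * N11 p + 2 * N12 p * N21 p + N22 p * N22 p"

text \<open>Bochner's formula for a co-closed form that need not be closed. The terms with F and its
  derivatives are the divergence of F J X from \<open>flux_u\<close>.\<close>

lemma lap_u:
  assumes "p \<in> cdom c"
  shows "lap u p = 2 * W p * (trNN p + K p * u p) - (pd c 1 F p * x2 p - pd c 2 F p * x1 p) + F p * F p * W p / 2"
proof -
  have "pd c 1 (flux1 u) p = pd c 1 (\<lambda>q. 2 * (W q * Y1 q) - F q * x2 q) p"
    "pd c 2 (flux2 u) p = pd c 2 (\<lambda>q. 2 * (W q * Y2 q) + F q * x1 q) p"
    by (rule pd_cong[OF chart assms]; simp add: flux_u)+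
  moreover have "pd c 1 (\<lambda>q. 2 * (W q * Y1 q) - F q * x2 q) p =
      2 * pd c 1 (\<lambda>q. W q * Y1 q) p - (F p * pd c 1 x2 p + pd c 1 F p * x2 p)"
    "pd c 2 (\<lambda>q. 2 * (W q * Y2 q) + F q * x1 q) p =
      2 * pd c 2 (\<lambda>q. W q * Y2 q) p + (F p * pd c 2 x1 p + pd c 2 F p * x1 p)"
    using assms by (simp_all add: algebra_simps)
  ultimately have "lap u p = 2 * (pd c 1 (\<lambda>q. W q * Y1 q) p + pd c 2 (\<lambda>q. W q * Y2 q) p)
     - (pd c 1 F p * x2 p - pd c 2 F p * x1 p) - F p * (pd c 1 x2 p - pd c 2 x1 p)"
    unfolding lap_def by (simp add: algebra_simps)
  also have "\<dots> = 2 * W p * (trNN p + K p * u p) - (pd c 1 F p * x2 p - pd c 2 F p * x1 p) + F p * F p * W p / 2"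
    unfolding div_Y[OF assms] F_eq[OF assms] curvature[OF assms] trNN_def u_def x1_def x2_def
    by (simp add: algebra_simps)
  finally show ?thesis .
qed

text \<open>\<open>S\<close> denotes the symmetric part of \<open>D \<gamma>\<close>; it is trace free, so its determinant is
  non-positive.\<close>

lemma sym_part:
  assumes "p \<in> cdom c"
  defines "S11 \<equiv> e p * N11 p + f p * N12 p" and "S22 \<equiv> f p * N21 p + g p * N22 p"
    and "S12 \<equiv> (f p * N11 p + g p * N12 p + e p * N21 p + f p * N22 p) / 2"
  shows "trNN p + F p * F p / 8 \<ge> 0"
    "trNN p + F p * F p / 8 = 0 \<Longrightarrow> S11 = 0 \<and> S12 = 0 \<and> S22 = 0"
proof -
  have W: "W p > 0" "W p * W p = e p * g p - f p * f p" and e: "e p > 0"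
    using W_pos W_sq e_pos assms by auto
  have t: "N22 p = - N11 p" using trace_N[OF assms(1)] by simp
  have tr: "g p * S11 - 2 * f p * S12 + e p * S22 = 0"
    unfolding S11_def S12_def S22_def t by (simp add: algebra_simps)
  have FW: "F p * W p = 2 * (e p * N21 p + f p * N22 p - f p * N11 p - g p * N12 p)"
    using F_N[OF assms(1)] by simp
  \<comment> \<open>D \<gamma> splits into S and an antisymmetric part with entry - F W / 4, whose
    squared norm is F^2 / 8. The left side is therefore W^2 |S|^2, and for a trace-free S this
    equals - 2 det S.\<close>
  have "(W p * W p) * (trNN p + F p * F p / 8) = (W p * W p) * trNN p + (F p * W p) * (F p * W p) / 8"
    by (simp add: algebra_simps)
  also have "\<dots> = 2 * (S12 * S12 - S11 * S22)"
    unfolding FW W(2) trNN_def S11_def S12_def S22_def t by (simp add: field_simps)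
  finally have 1: "(W p * W p) * (trNN p + F p * F p / 8) = 2 * (S12 * S12 - S11 * S22)" .
  \<comment> \<open>The trace condition eliminates \<open>S22\<close>, after which - det S is
    completed to a sum of two squares; these also decide the case of equality.\<close>
  have "e p * e p * (S12 * S12 - S11 * S22) = (e p * S12 - f p * S11)^2 + (W p * W p) * S11^2"
    using tr unfolding W(2) power2_eq_square by algebra
  then have 2: "(e p * e p) * ((W p * W p) * (trNN p + F p * F p / 8)) =
      2 * ((e p * S12 - f p * S11)^2 + (W p * S11)^2)"
    unfolding 1 by (simp add: power_mult_distrib power2_eq_square algebra_simps)
  then have "0 \<le> ((e p * e p) * (W p * W p)) * (trNN p + F p * F p / 8)" by (simp add: mult.assoc)
  moreover have pos: "(e p * e p) * (W p * W p) > 0" using W(1) e by (intro mult_pos_pos)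
  ultimately show "trNN p + F p * F p / 8 \<ge> 0" by (simp add: zero_le_mult_iff)
  assume "trNN p + F p * F p / 8 = 0"
  then have "2 * ((e p * S12 - f p * S11)^2 + (W p * S11)^2) = 0" using 2 by (simp only: mult_zero_right)
  then have "(e p * S12 - f p * S11)^2 + (W p * S11)^2 = 0"
    by (rule mult_left_cancel[THEN iffD1, of 2, rotated, OF trans[OF _ mult_zero_right[symmetric]]]) simp
  then have "e p * S12 - f p * S11 = 0" "W p * S11 = 0" using sum_power2_eq_zero_iff by blast+
  then have "S11 = 0" "S12 = 0" using W e by auto
  then show "S11 = 0 \<and> S12 = 0 \<and> S22 = 0" using tr e by auto
qed

lemma u_nonneg:
  assumes "p \<in> cdom c"
  shows "u p \<ge> 0" "u p = 0 \<Longrightarrow> X1 p = 0 \<and> X2 p = 0"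
proof -
  have *: "e p * u p = (x1 p)^2 + (W p * X2 p)^2"
    using W_sq[OF assms] unfolding u_def x1_def x2_def power2_eq_square by algebra
  then show "u p \<ge> 0" using e_pos[OF assms] by (metis sum_power2_ge_zero zero_le_mult_iff not_le)
  assume "u p = 0"
  then have "x1 p = 0 \<and> W p * X2 p = 0" using * by (simp add: sum_power2_eq_zero_iff)
  then show "X1 p = 0 \<and> X2 p = 0" using W_pos[OF assms] e_pos[OF assms] unfolding x1_def by auto
qed

text \<open>Without symmetric part, D \<gamma> is - F / 4 times the area form. Hence du is F / 2
  times the form dual to J X, and the last equation is d(du) = 0 combined with div X = 0.\<close>

lemma killing_consequences:
  assumes "p \<in> cdom c"
    and "\<forall>q\<in>cdom c. trNN q + F q * F q / 8 = 0"
  shows "pd c 1 x1 p = A1 p * x1 p + A2 p * x2 p"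
    "pd c 1 x2 p = B1 p * x1 p + B2 p * x2 p - F p * W p / 4"
    "pd c 2 x1 p = B1 p * x1 p + B2 p * x2 p + F p * W p / 4"
    "pd c 2 x2 p = C1 p * x1 p + C2 p * x2 p"
    "pd c 1 u p = - F p * W p * X2 p / 2" "pd c 2 u p = F p * W p * X1 p / 2"
    "X1 p * pd c 1 F p + X2 p * pd c 2 F p = 0"
proof -
  have n: "e q * N11 q + f q * N12 q = 0" "f q * N21 q + g q * N22 q = 0"
      "f q * N11 q + g q * N12 q = - F q * W q / 4" "e q * N21 q + f q * N22 q = F q * W q / 4"
    if "q \<in> cdom c" for q
    using sym_part(2)[OF that bspec[OF assms(2) that]] F_N[OF that] by auto
  show "pd c 1 x1 p = A1 p * x1 p + A2 p * x2 p"
    "pd c 1 x2 p = B1 p * x1 p + B2 p * x2 p - F p * W p / 4"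
    "pd c 2 x1 p = B1 p * x1 p + B2 p * x2 p + F p * W p / 4"
    "pd c 2 x2 p = C1 p * x1 p + C2 p * x2 p"
    using n[OF assms(1)] pd_x[OF assms(1)] by auto
  have du: "pd c 1 u q = (- 1/2) * (F q * (W q * X2 q))" "pd c 2 u q = 1/2 * (F q * (W q * X1 q))" if "q \<in> cdom c" for q
  proof -
    have "pd c 1 u q = 2 * (X1 q * (e q * N11 q + f q * N12 q) + X2 q * (f q * N11 q + g q * N12 q))"
      "pd c 2 u q = 2 * (X1 q * (e q * N21 q + f q * N22 q) + X2 q * (f q * N21 q + g q * N22 q))"
      unfolding pd_u[OF that] x1_def x2_def by (simp_all add: algebra_simps)
    then show "pd c 1 u q = (- 1/2) * (F q * (W q * X2 q))" "pd c 2 u q = 1/2 * (F q * (W q * X1 q))"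
      unfolding n[OF that] by simp_all
  qed
  then show "pd c 1 u p = - F p * W p * X2 p / 2" "pd c 2 u p = F p * W p * X1 p / 2" using assms(1) by simp_all
  have "pd c 2 (pd c 1 u) p = pd c 2 (\<lambda>q. (- 1/2) * (F q * (W q * X2 q))) p"
    "pd c 1 (pd c 2 u) p = pd c 1 (\<lambda>q. 1/2 * (F q * (W q * X1 q))) p"
    by (rule pd_cong[OF chart assms(1)], simp add: du)+
  then have "pd c 2 (\<lambda>q. (- 1/2) * (F q * (W q * X2 q))) p = pd c 1 (\<lambda>q. 1/2 * (F q * (W q * X1 q))) p"
    using pd_commute[OF chart smooth_u assms(1), of 1 2] by simp
  moreover have "pd c 2 (\<lambda>q. (- 1/2) * (F q * (W q * X2 q))) p = (- 1/2) * pd c 2 (\<lambda>q. F q * (W q * X2 q)) p"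
    "pd c 1 (\<lambda>q. 1/2 * (F q * (W q * X1 q))) p = 1/2 * pd c 1 (\<lambda>q. F q * (W q * X1 q)) p"
    by (intro pd_cmult[OF chart _ assms(1)]; simp)+
  moreover have "pd c 2 (\<lambda>q. F q * (W q * X2 q)) p = F p * pd c 2 (\<lambda>q. W q * X2 q) p + pd c 2 F p * (W p * X2 p)"
    "pd c 1 (\<lambda>q. F q * (W q * X1 q)) p = F p * pd c 1 (\<lambda>q. W q * X1 q) p + pd c 1 F p * (W p * X1 p)"
    by (intro pd_mult[OF chart _ _ assms(1)]; simp)+
  ultimately have "F p * (pd c 1 (\<lambda>q. W q * X1 q) p + pd c 2 (\<lambda>q. W q * X2 q) p)
     + W p * (X1 p * pd c 1 F p + X2 p * pd c 2 F p) = 0" by algebra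
  then show "X1 p * pd c 1 F p + X2 p * pd c 2 F p = 0" using div_WX[OF assms(1)] W_pos[OF assms(1)] by simp
qed

end

text \<open>\<open>P1\<close>, \<open>P2\<close>, then \<open>Q1\<close>, \<open>Q2\<close>, then
  \<open>R1\<close>, \<open>R2\<close> are the components of the difference tensor nabla - D at the
  lower index pairs 11, 12 and 22. Its contraction is - 2 \<gamma> by the two \<open>trace\<close>
  assumptions, and its metric trace is zero by alignment. \<open>R\<close> is the h-trace of the
  Ricci tensor of nabla, and \<open>einstein\<close> is the equation for dR in components.\<close>

locale einstein_jet = metric_jet +
  fixes P1 P2 Q1 Q2 R1 R2 R :: "'a \<Rightarrow> real"
  assumes smooth_P [simp]: "chart_smooth c P1" "chart_smooth c P2" "chart_smooth c Q1" "chart_smooth c Q2"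
      "chart_smooth c R1" "chart_smooth c R2" "chart_smooth c R"
    and trace1: "p \<in> cdom c \<Longrightarrow> P1 p + Q2 p = - 2 * (e p * X1 p + f p * X2 p)"
    and trace2: "p \<in> cdom c \<Longrightarrow> Q1 p + R2 p = - 2 * (f p * X1 p + g p * X2 p)"
    and aligned1: "p \<in> cdom c \<Longrightarrow> g p * P1 p - 2 * f p * Q1 p + e p * R1 p = 0"
    and aligned2: "p \<in> cdom c \<Longrightarrow> g p * P2 p - 2 * f p * Q2 p + e p * R2 p = 0"
    and R: "p \<in> cdom c \<Longrightarrow> W p * W p * R p =
      - g p * curv12 c (\<lambda>q. A1 q + P1 q) (\<lambda>q. A2 q + P2 q) (\<lambda>q. B1 q + Q1 q) (\<lambda>q. B2 q + Q2 q)
            (\<lambda>q. C1 q + R1 q) (\<lambda>q. C2 q + R2 q) p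
      + f p * curv22 c (\<lambda>q. A1 q + P1 q) (\<lambda>q. A2 q + P2 q) (\<lambda>q. B1 q + Q1 q) (\<lambda>q. B2 q + Q2 q)
            (\<lambda>q. C1 q + R1 q) (\<lambda>q. C2 q + R2 q) p
      - f p * curv11 c (\<lambda>q. A1 q + P1 q) (\<lambda>q. A2 q + P2 q) (\<lambda>q. B1 q + Q1 q) (\<lambda>q. B2 q + Q2 q)
            (\<lambda>q. C1 q + R1 q) (\<lambda>q. C2 q + R2 q) p
      + e p * curv21 c (\<lambda>q. A1 q + P1 q) (\<lambda>q. A2 q + P2 q) (\<lambda>q. B1 q + Q1 q) (\<lambda>q. B2 q + Q2 q)
            (\<lambda>q. C1 q + R1 q) (\<lambda>q. C2 q + R2 q) p"
    and einstein: "p \<in> cdom c \<Longrightarrow> W p * (pd c 1 R p + 2 * (e p * X1 p + f p * X2 p) * R p)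
        - f p * (pd c 1 F p + 2 * (e p * X1 p + f p * X2 p) * F p)
        + e p * (pd c 2 F p + 2 * (f p * X1 p + g p * X2 p) * F p) = 0"
      "p \<in> cdom c \<Longrightarrow> W p * (pd c 2 R p + 2 * (f p * X1 p + g p * X2 p) * R p)
        - g p * (pd c 1 F p + 2 * (e p * X1 p + f p * X2 p) * F p)
        + f p * (pd c 2 F p + 2 * (f p * X1 p + g p * X2 p) * F p) = 0"
begin

text \<open>Raising the index in the Einstein equation solves it for grad R in terms of X, dF and F.
  The determinant e g - f^2 that appears is W^2 and cancels.\<close>

lemma flux_R:
  assumes "p \<in> cdom c"
  shows "flux1 R p = - 2 * W p * X1 p * R p - (pd c 2 F p + 2 * x2 p * F p)"
    "flux2 R p = - 2 * W p * X2 p * R p + (pd c 1 F p + 2 * x1 p * F p)"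
proof -
  have W: "W p \<noteq> 0" "W p * W p = e p * g p - f p * f p" using W_pos[OF assms] W_sq[OF assms] by auto
  note E = einstein[OF assms, folded x1_def x2_def]
  have "W p * (g p * pd c 1 R p - f p * pd c 2 R p) =
     - 2 * (W p * W p * W p) * X1 p * R p - W p * W p * (pd c 2 F p + 2 * x2 p * F p)"
    "W p * (e p * pd c 2 R p - f p * pd c 1 R p) =
     - 2 * (W p * W p * W p) * X2 p * R p + W p * W p * (pd c 1 F p + 2 * x1 p * F p)"
    using E W(2) x1_def[of p] x2_def[of p] by algebra+
  then have "W p * (g p * pd c 1 R p - f p * pd c 2 R p) =
     W p * (W p * (- 2 * W p * X1 p * R p - (pd c 2 F p + 2 * x2 p * F p)))"
    "W p * (e p * pd c 2 R p - f p * pd c 1 R p) =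
     W p * (W p * (- 2 * W p * X2 p * R p + (pd c 1 F p + 2 * x1 p * F p)))"
    by (simp_all add: algebra_simps)
  then have "g p * pd c 1 R p - f p * pd c 2 R p =
     W p * (- 2 * W p * X1 p * R p - (pd c 2 F p + 2 * x2 p * F p))"
    "e p * pd c 2 R p - f p * pd c 1 R p =
     W p * (- 2 * W p * X2 p * R p + (pd c 1 F p + 2 * x1 p * F p))"
    using W(1) mult_left_cancel by blast+
  then show "flux1 R p = - 2 * W p * X1 p * R p - (pd c 2 F p + 2 * x2 p * F p)"
    "flux2 R p = - 2 * W p * X2 p * R p + (pd c 1 F p + 2 * x1 p * F p)"
    unfolding flux1_def flux2_def using W(1) by simp_all
qed

text \<open>In the divergence of the previous expressions the second derivatives of F cancel by
  symmetry, and undifferentiated R disappears because X is divergence free.\<close>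

lemma lap_R:
  assumes "p \<in> cdom c"
  shows "lap R p = - 2 * W p * (X1 p * pd c 1 R p + X2 p * pd c 2 R p)
    - 2 * (pd c 1 F p * x2 p - pd c 2 F p * x1 p) + F p * F p * W p"
proof -
  have a: "pd c 1 (flux1 R) p = pd c 1 (\<lambda>q. (-2) * ((W q * X1 q) * R q) - (pd c 2 F q + 2 * (x2 q * F q))) p"
    "pd c 2 (flux2 R) p = pd c 2 (\<lambda>q. (-2) * ((W q * X2 q) * R q) + (pd c 1 F q + 2 * (x1 q * F q))) p"
    by (rule pd_cong[OF chart assms]; simp add: flux_R)+
  have b: "pd c 1 (\<lambda>q. (-2) * ((W q * X1 q) * R q) - (pd c 2 F q + 2 * (x2 q * F q))) p =
     (-2) * ((W p * X1 p) * pd c 1 R p + pd c 1 (\<lambda>q. W q * X1 q) p * R p)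
      - (pd c 1 (pd c 2 F) p + 2 * (x2 p * pd c 1 F p + pd c 1 x2 p * F p))"
     "pd c 2 (\<lambda>q. (-2) * ((W q * X2 q) * R q) + (pd c 1 F q + 2 * (x1 q * F q))) p =
     (-2) * ((W p * X2 p) * pd c 2 R p + pd c 2 (\<lambda>q. W q * X2 q) p * R p)
      + (pd c 1 (pd c 2 F) p + 2 * (x1 p * pd c 2 F p + pd c 2 x1 p * F p))"
    using assms pd_commute[OF chart smooth(13) assms, of 1 2] by (simp_all add: algebra_simps)
  have "(-2) * ((w * y1) * r1 + a * r) - (h + 2 * (z2 * f1 + z12 * k))
      + ((-2) * ((w * y2) * r2 + b * r) + (h + 2 * (z1 * f2 + z21 * k)))
      = - 2 * w * (y1 * r1 + y2 * r2) - 2 * r * (a + b) - 2 * (f1 * z2 - f2 * z1) - 2 * k * (z12 - z21)"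
    for w y1 y2 r1 r2 r a b f1 f2 z1 z2 k z12 z21 h :: real
    by (simp add: algebra_simps)
  then have "lap R p = - 2 * W p * (X1 p * pd c 1 R p + X2 p * pd c 2 R p)
     - 2 * R p * (pd c 1 (\<lambda>q. W q * X1 q) p + pd c 2 (\<lambda>q. W q * X2 q) p)
     - 2 * (pd c 1 F p * x2 p - pd c 2 F p * x1 p) - 2 * F p * (pd c 1 x2 p - pd c 2 x1 p)"
    unfolding lap_def a b .
  then show ?thesis unfolding div_WX[OF assms] F_eq[OF assms] by (simp add: algebra_simps)
qed

text \<open>Up to a positive factor, the squared norm of the cubic torsion.\<close>

definition "Z1 p = P1 p + 2 * x1 p - e p * X1 p"
definition "Z2 p = P2 p - e p * X2 p"
definition "Q p = 4 * (e p * (Z1 p)\<^sup>2 + 2 * f p * Z1 p * Z2 p + g p * (Z2 p)\<^sup>2) / (e p)\<^sup>2"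

lemma Q_nonneg:
  assumes "p \<in> cdom c"
  shows "Q p \<ge> 0"
proof -
  have "e p * (e p * (Z1 p)\<^sup>2 + 2 * f p * Z1 p * Z2 p + g p * (Z2 p)\<^sup>2) = (e p * Z1 p + f p * Z2 p)\<^sup>2 + (W p * Z2 p)\<^sup>2"
    using W_sq[OF assms] unfolding power2_eq_square by algebra
  then have "e p * (e p * (Z1 p)\<^sup>2 + 2 * f p * Z1 p * Z2 p + g p * (Z2 p)\<^sup>2) \<ge> 0" by simp
  then show ?thesis using e_pos[OF assms] unfolding Q_def by (simp add: zero_le_mult_iff)
qed

text \<open>The terms of the curvature linear in nabla - D are two divergences: of its metric trace,
  zero by alignment, and of its contraction - 2 \<gamma>, zero because \<gamma> is co-closed. In the
  quadratic terms \<gamma> cancels, as it does for a conformal change of metric in dimension two,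
  and minus the squared norm of the trace-free part is left.\<close>

lemma scalar_curvature:
  assumes "p \<in> cdom c"
  shows "R p = 2 * K p - Q p"
proof -
  have tr: "P1 q + Q2 q = - 2 * x1 q" "Q1 q + R2 q = - 2 * x2 q" if "q \<in> cdom c" for q
    using trace1[OF that] trace2[OF that] unfolding x1_def x2_def by simp_all
  have "pd c 1 (\<lambda>q. P1 q + Q2 q) p = pd c 1 (\<lambda>q. - 2 * x1 q) p"
    "pd c 2 (\<lambda>q. P1 q + Q2 q) p = pd c 2 (\<lambda>q. - 2 * x1 q) p"
    "pd c 1 (\<lambda>q. Q1 q + R2 q) p = pd c 1 (\<lambda>q. - 2 * x2 q) p"
    "pd c 2 (\<lambda>q. Q1 q + R2 q) p = pd c 2 (\<lambda>q. - 2 * x2 q) p"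
    by (intro pd_cong[OF chart assms]; simp add: tr)+
  then have dt: "pd c 1 Q2 p = - 2 * pd c 1 x1 p - pd c 1 P1 p" "pd c 2 P1 p = - 2 * pd c 2 x1 p - pd c 2 Q2 p"
    "pd c 1 R2 p = - 2 * pd c 1 x2 p - pd c 1 Q1 p" "pd c 2 Q1 p = - 2 * pd c 2 x2 p - pd c 2 R2 p"
    using assms by simp_all
  have "pd c 1 (\<lambda>q. g q * P1 q - 2 * (f q * Q1 q) + e q * R1 q) p = pd c 1 (\<lambda>q. 0) p"
    "pd c 2 (\<lambda>q. g q * P2 q - 2 * (f q * Q2 q) + e q * R2 q) p = pd c 2 (\<lambda>q. 0) p"
    using aligned1 aligned2 by (intro pd_cong[OF chart assms]; simp add: mult.assoc)+
  then have da: "e p * pd c 1 R1 p = 2 * (f p * pd c 1 Q1 p + pd c 1 f p * Q1 p) - g p * pd c 1 P1 p - pd c 1 g p * P1 p - pd c 1 e p * R1 p"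
    "g p * pd c 2 P2 p = 2 * (f p * pd c 2 Q2 p + pd c 2 f p * Q2 p) - e p * pd c 2 R2 p - pd c 2 g p * P2 p - pd c 2 e p * R2 p"
    using assms by (simp_all add: algebra_simps)
  note cu = curvature[OF assms, unfolded curv_defs]
  have W: "W p > 0" "W p * W p = e p * g p - f p * f p" and e: "e p > 0"
    using W_pos W_sq e_pos assms by auto
  have t: "N22 p = - N11 p" using trace_N[OF assms(1)] by simp
  have tr': "Q2 p = - 2 * x1 p - P1 p" "R2 p = - 2 * x2 p - Q1 p" using tr[OF assms] by simp_all
  define quad where "quad = - g p * (P2 p * Q1 p + Q2 p * Q2 p - Q2 p * P1 p - R2 p * P2 p)
     + f p * (P2 p * R1 p - Q2 p * Q1 p) - f p * (Q1 p * Q2 p - R1 p * P2 p)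
     + e p * (P1 p * R1 p + Q1 p * R2 p - Q1 p * Q1 p - R1 p * Q2 p)"
  have c12: "curv12 c (\<lambda>q. A1 q + P1 q) (\<lambda>q. A2 q + P2 q) (\<lambda>q. B1 q + Q1 q) (\<lambda>q. B2 q + Q2 q)
        (\<lambda>q. C1 q + R1 q) (\<lambda>q. C2 q + R2 q) p = cv12 p + (pd c 1 Q2 p - pd c 2 P2 p)
        + (A2 p * Q1 p + P2 p * B1 p + 2 * B2 p * Q2 p - B2 p * P1 p - Q2 p * A1 p - C2 p * P2 p - R2 p * A2 p)
        + (P2 p * Q1 p + Q2 p * Q2 p - Q2 p * P1 p - R2 p * P2 p)"
    unfolding curv_defs using assms by (simp add: algebra_simps)
  have c22: "curv22 c (\<lambda>q. A1 q + P1 q) (\<lambda>q. A2 q + P2 q) (\<lambda>q. B1 q + Q1 q) (\<lambda>q. B2 q + Q2 q)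
        (\<lambda>q. C1 q + R1 q) (\<lambda>q. C2 q + R2 q) p = cv22 p + (pd c 1 R2 p - pd c 2 Q2 p)
        + (A2 p * R1 p + P2 p * C1 p - B2 p * Q1 p - Q2 p * B1 p) + (P2 p * R1 p - Q2 p * Q1 p)"
    unfolding curv_defs using assms by (simp add: algebra_simps)
  have c11: "curv11 c (\<lambda>q. A1 q + P1 q) (\<lambda>q. A2 q + P2 q) (\<lambda>q. B1 q + Q1 q) (\<lambda>q. B2 q + Q2 q)
        (\<lambda>q. C1 q + R1 q) (\<lambda>q. C2 q + R2 q) p = cv11 p + (pd c 1 Q1 p - pd c 2 P1 p)
        + (B1 p * Q2 p + Q1 p * B2 p - C1 p * P2 p - R1 p * A2 p) + (Q1 p * Q2 p - R1 p * P2 p)"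
    unfolding curv_defs using assms by (simp add: algebra_simps)
  have c21: "curv21 c (\<lambda>q. A1 q + P1 q) (\<lambda>q. A2 q + P2 q) (\<lambda>q. B1 q + Q1 q) (\<lambda>q. B2 q + Q2 q)
        (\<lambda>q. C1 q + R1 q) (\<lambda>q. C2 q + R2 q) p = cv21 p + (pd c 1 R1 p - pd c 2 Q1 p)
        + (A1 p * R1 p + P1 p * C1 p + B1 p * R2 p + Q1 p * C2 p - 2 * B1 p * Q1 p - C1 p * Q2 p - R1 p * B2 p)
        + (P1 p * R1 p + Q1 p * R2 p - Q1 p * Q1 p - R1 p * Q2 p)"
    unfolding curv_defs using assms by (simp add: algebra_simps)
  have "W p * W p * R p = 2 * K p * (W p * W p) + quad
     + (- g p * pd c 1 Q2 p + g p * pd c 2 P2 p + f p * (pd c 1 R2 p - pd c 2 Q2 p)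
          - f p * (pd c 1 Q1 p - pd c 2 P1 p) + e p * pd c 1 R1 p - e p * pd c 2 Q1 p
     - g p * (A2 p * Q1 p + P2 p * B1 p + 2 * B2 p * Q2 p - B2 p * P1 p - Q2 p * A1 p - C2 p * P2 p - R2 p * A2 p)
     + f p * (A2 p * R1 p + P2 p * C1 p - B2 p * Q1 p - Q2 p * B1 p)
     - f p * (B1 p * Q2 p + Q1 p * B2 p - C1 p * P2 p - R1 p * A2 p)
     + e p * (A1 p * R1 p + P1 p * C1 p + B1 p * R2 p + Q1 p * C2 p - 2 * B1 p * Q1 p - C1 p * Q2 p - R1 p * B2 p))"
    unfolding R[OF assms] c11 c12 c21 c22 curvature[OF assms] quad_def
    by (simp add: W(2) algebra_simps)
  \<comment> \<open>The bracket is the linear part. After the differentiated trace and alignment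
    conditions are substituted, it is a combination of the alignment conditions themselves.\<close>
  also have "\<dots> = 2 * K p * (W p * W p) + quad"
  proof -
    have "- g p * pd c 1 Q2 p + g p * pd c 2 P2 p + f p * (pd c 1 R2 p - pd c 2 Q2 p)
          - f p * (pd c 1 Q1 p - pd c 2 P1 p) + e p * pd c 1 R1 p - e p * pd c 2 Q1 p
     - g p * (A2 p * Q1 p + P2 p * B1 p + 2 * B2 p * Q2 p - B2 p * P1 p - Q2 p * A1 p - C2 p * P2 p - R2 p * A2 p)
     + f p * (A2 p * R1 p + P2 p * C1 p - B2 p * Q1 p - Q2 p * B1 p)
     - f p * (B1 p * Q2 p + Q1 p * B2 p - C1 p * P2 p - R1 p * A2 p)
     + e p * (A1 p * R1 p + P1 p * C1 p + B1 p * R2 p + Q1 p * C2 p - 2 * B1 p * Q1 p - C1 p * Q2 p - R1 p * B2 p)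
     = - (A1 p + B2 p) * (g p * P1 p - 2 * f p * Q1 p + e p * R1 p)
       - (B1 p + C2 p) * (g p * P2 p - 2 * f p * Q2 p + e p * R2 p)"
      unfolding da dt pd_x[OF assms] pd_e[OF assms] pd_f[OF assms] pd_g[OF assms] t tr'
      by (simp add: algebra_simps)
    then show ?thesis unfolding aligned1[OF assms] aligned2[OF assms] by simp
  qed
  finally have 1: "W p * W p * R p = 2 * K p * (W p * W p) + quad" .
  \<comment> \<open>The traces and the alignment express all six components by \<open>P1\<close>,
    \<open>P2\<close> and \<gamma>. The factor e^2 avoids the divisions by \<open>e\<close> in
    \<open>Q1\<close> and \<open>R1\<close>.\<close>
  have 2: "e p * e p * quad = - (W p * W p) * (4 * (e p * (Z1 p)\<^sup>2 + 2 * f p * Z1 p * Z2 p + g p * (Z2 p)\<^sup>2))"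
  proof -
    have q: "e p * Q1 p = g p * P2 p + 2 * f p * (2 * x1 p + P1 p) - 2 * e p * x2 p"
      using aligned2[OF assms] unfolding tr' by (simp add: algebra_simps)
    have r: "e p * (e p * R1 p) = 2 * f p * (e p * Q1 p) - e p * g p * P1 p"
    proof -
      have *: "e p * R1 p = 2 * f p * Q1 p - g p * P1 p" using aligned1[OF assms] by simp
      show ?thesis unfolding * by (simp add: algebra_simps)
    qed
    have "e p * e p * quad = - g p * (e p * P2 p * (e p * Q1 p) + e p * e p * (Q2 p * Q2 p - Q2 p * P1 p)
          - e p * P2 p * (- 2 * e p * x2 p - e p * Q1 p))
       + 2 * f p * P2 p * (e p * (e p * R1 p)) - 2 * e p * f p * Q2 p * (e p * Q1 p)
       + e p * (P1 p * (e p * (e p * R1 p)) + (e p * Q1 p) * (- 2 * e p * x2 p - e p * Q1 p)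
          - (e p * Q1 p) * (e p * Q1 p) - Q2 p * (e p * (e p * R1 p)))"
      unfolding quad_def tr' by (simp add: algebra_simps)
    also have "\<dots> = - (W p * W p) * (4 * (e p * (Z1 p)\<^sup>2 + 2 * f p * Z1 p * Z2 p + g p * (Z2 p)\<^sup>2))"
      unfolding r q tr' W(2) Z1_def Z2_def x1_def x2_def by (simp add: algebra_simps power2_eq_square)
    finally show ?thesis .
  qed
  have "quad = - (W p * W p) * Q p" using 2 e unfolding Q_def by (simp add: field_simps power2_eq_square)
  then have "(W p * W p) * R p = (W p * W p) * (2 * K p - Q p)" unfolding 1 by (simp add: algebra_simps)
  then show ?thesis using W(1) by (metis mult_left_cancel mult_eq_0_iff less_irrefl)
qed

text \<open>In 4 \<Delta> u - \<Delta> R the coefficient 4 is the one for which X(R) cancels. The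
  terms left in \<open>K\<close> and R combine to 2 K - R = \<open>Q\<close>, and those in F^2 have
  just the size needed in \<open>sym_part\<close>.\<close>

lemma lap_potential:
  assumes "p \<in> cdom c"
  shows "lap (\<lambda>q. 4 * u q - R q) p = W p * (8 * (trNN p + F p * F p / 8) + 4 * u p * Q p)"
proof -
  have fl: "flux1 (\<lambda>q. 4 * u q - R q) q = 4 * flux1 u q - flux1 R q"
    "flux2 (\<lambda>q. 4 * u q - R q) q = 4 * flux2 u q - flux2 R q" if "q \<in> cdom c" for q
    using that W_pos[OF that] unfolding flux1_def flux2_def by (simp_all add: field_simps)
  have "pd c 1 (flux1 (\<lambda>q. 4 * u q - R q)) p = pd c 1 (\<lambda>q. 4 * flux1 u q - flux1 R q) p"
    "pd c 2 (flux2 (\<lambda>q. 4 * u q - R q)) p = pd c 2 (\<lambda>q. 4 * flux2 u q - flux2 R q) p"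
    by (rule pd_cong[OF chart assms]; simp add: fl)+
  then have "lap (\<lambda>q. 4 * u q - R q) p = 4 * lap u p - lap R p"
    unfolding lap_def using assms by simp
  \<comment> \<open>The Einstein equation contracted with X. Its terms F \<gamma> drop out since
    \<gamma> vanishes on J X.\<close>
  moreover have "pd c 1 F p * x2 p - pd c 2 F p * x1 p =
      W p * (X1 p * pd c 1 R p + X2 p * pd c 2 R p + 2 * u p * R p)"
    using einstein[OF assms] x1_def[of p] x2_def[of p] u_def[of p] by algebra
  moreover have "2 * K p = R p + Q p" using scalar_curvature[OF assms] by simp
  ultimately show ?thesis unfolding lap_u[OF assms] lap_R[OF assms] by algebra
qed

end

section \<open>Change of charts\<close>

lemma matrix_inv_2x2:
  fixes M :: "real^2^2"
  assumes "det M \<noteq> 0"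
  shows "matrix_inv M $ 1 $ 1 = M $ 2 $ 2 / det M" "matrix_inv M $ 1 $ 2 = - M $ 1 $ 2 / det M"
    "matrix_inv M $ 2 $ 1 = - M $ 2 $ 1 / det M" "matrix_inv M $ 2 $ 2 = M $ 1 $ 1 / det M"
proof -
  define \<delta> where "\<delta> = det M"
  have \<delta>: "\<delta> \<noteq> 0" "\<delta> = M $ 1 $ 1 * M $ 2 $ 2 - M $ 1 $ 2 * M $ 2 $ 1" using assms unfolding \<delta>_def det_2 by auto
  define B :: "real^2^2" where "B = (\<chi> i j. if i = 1 then (if j = 1 then M $ 2 $ 2 / \<delta> else - M $ 1 $ 2 / \<delta>)
     else (if j = 1 then - M $ 2 $ 1 / \<delta> else M $ 1 $ 1 / \<delta>))"
  have 1: "M ** B = mat 1" "B ** M = mat 1"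
    using \<delta>(1) unfolding B_def matrix_matrix_mult_def mat_def vec_eq_iff forall_2 sum_2
    by (simp_all add: field_simps, simp_all add: \<delta>(2) algebra_simps)
  have "matrix_inv M ** M = mat 1" using someI[of "\<lambda>M'. M ** M' = mat 1 \<and> M' ** M = mat 1" B] 1
    unfolding matrix_inv_def by blast
  then have "matrix_inv M = B" using 1 by (metis matrix_mul_assoc matrix_mul_lid matrix_mul_rid)
  then show "matrix_inv M $ 1 $ 1 = M $ 2 $ 2 / det M" "matrix_inv M $ 1 $ 2 = - M $ 1 $ 2 / det M"
    "matrix_inv M $ 2 $ 1 = - M $ 2 $ 1 / det M" "matrix_inv M $ 2 $ 2 = M $ 1 $ 1 / det M"
    unfolding B_def \<delta>_def by simp_all
qed

lemma is_chart_inj: "is_chart c \<Longrightarrow> inj_on (coord c) (cdom c)"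
  using is_chartD(3) by (metis inj_onI)

text \<open>Two charts of the atlas have different domains. After restriction to the overlap the
  transition map is defined on a full chart image, which is the situation of
  \<open>chart_change\<close>.\<close>

lemma is_chart_restrict:
  assumes "is_chart c" "open V"
  shows "is_chart (cdom c \<inter> V, coord c)"
    and "p \<in> cdom c \<inter> V \<Longrightarrow> cinv (cdom c \<inter> V, coord c) (coord c p) = p"
    and "open (coord c ` (cdom c \<inter> V))"
proof -
  note ch = is_chartD[OF assms(1)]
  have inv: "cinv (cdom c \<inter> V, coord c) (coord c p) = p" if "p \<in> cdom c \<inter> V" for p
    unfolding cinv_def using that inv_into_f_f[OF inj_on_subset[OF is_chart_inj[OF assms(1)]], of "cdom c \<inter> V" p] by simp
  then show "p \<in> cdom c \<inter> V \<Longrightarrow> cinv (cdom c \<inter> V, coord c) (coord c p) = p" .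
  have img: "coord c ` (cdom c \<inter> V) = coord c ` cdom c \<inter> cinv c -` V"
    using ch(3) by force
  then show op: "open (coord c ` (cdom c \<inter> V))"
    using continuous_open_preimage[OF ch(7,2) assms(2)] by simp
  have inv': "cinv (cdom c \<inter> V, coord c) x = cinv c x" if "x \<in> coord c ` (cdom c \<inter> V)" for x
    using that inv ch(3) by auto
  have "continuous_on (coord c ` (cdom c \<inter> V)) (cinv (cdom c \<inter> V, coord c))"
    by (rule continuous_on_eq[OF continuous_on_subset[OF ch(7)]]) (use inv' in auto)
  moreover have "cinv (cdom c \<inter> V, coord c) ` coord c ` (cdom c \<inter> V) = cdom c \<inter> V"
    using inv by force
  ultimately have "homeomorphism (cdom c \<inter> V) (coord c ` (cdom c \<inter> V)) (coord c) (cinv (cdom c \<inter> V, coord c))"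
    unfolding homeomorphism_def using continuous_on_subset[OF ch(6)] inv by auto
  then show "is_chart (cdom c \<inter> V, coord c)"
    unfolding is_chart_def using op ch(1) assms(2) by auto
qed

lemma cinv_restrict:
  assumes "is_chart c" "open V" "x \<in> coord c ` (cdom c \<inter> V)"
  shows "cinv (cdom c \<inter> V, coord c) x = cinv c x"
  using assms(3) is_chart_restrict(2)[OF assms(1,2)] is_chartD(3)[OF assms(1)] by auto

lemma pd_restrict:
  assumes "is_chart c" "open V" "p \<in> cdom c \<inter> V"
  shows "pd (cdom c \<inter> V, coord c) i f p = pd c i f p"
  unfolding pd_def snd_conv
  by (subst frechet_derivative_cong_open[OF is_chart_restrict(3)[OF assms(1,2)], of _ _ "f \<circ> cinv c"])
     (use assms(3) cinv_restrict[OF assms(1,2)] in auto)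

lemma chart_smooth_restrict:
  assumes "is_chart c" "open V" "chart_smooth c f"
  shows "chart_smooth (cdom c \<inter> V, coord c) f"
proof -
  have "smooth_on (coord c ` (cdom c \<inter> V)) (f \<circ> cinv c)"
    using assms(3) unfolding chart_smooth_def by (rule smooth_on_subset) auto
  then show ?thesis unfolding chart_smooth_def fst_conv snd_conv
    by (rule smooth_on_cong[THEN iffD1, OF is_chart_restrict(3)[OF assms(1,2)], rotated])
      (use cinv_restrict[OF assms(1,2)] in auto)
qed

lemma linear_2: "linear L \<Longrightarrow> L v = v $ 1 *\<^sub>R L (axis 1 1) + v $ 2 *\<^sub>R L (axis 2 (1::real))" for v :: "real^2"
  by (subst basis_expansion[symmetric, of v])
    (simp add: sum_2 linear_add linear_scale scalar_mult_eq_scaleR)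

text \<open>\<open>Ck_on\<close> controls derivatives only in fixed directions, whereas the chain
  rule evaluates f' in the moving direction \<tau>'(x) v. Expanding that vector in the two basis
  vectors restores fixed directions.\<close>

lemma Ck_on_compose:
  fixes f :: "real^2 \<Rightarrow> real" and \<tau> :: "real^2 \<Rightarrow> real^2"
  assumes "open U" "\<tau> ` U \<subseteq> V" "smooth_on U \<tau>"
  shows "Ck_on k V f \<Longrightarrow> Ck_on k U (\<lambda>x. f (\<tau> x))"
proof (induction k arbitrary: f)
  case 0
  then show ?case using smooth_on_continuous[OF assms(3)] assms(2)
    by (auto intro: continuous_on_compose2)
next
  case (Suc k)
  obtain f' where f': "\<And>x. x \<in> V \<Longrightarrow> (f has_derivative f' x) (at x)" "\<And>v. Ck_on k V (\<lambda>x. f' x v)"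
    using Suc.prems by (rule Ck_on_SucE) blast
  have "Ck_on (Suc k) U \<tau>" using assms(3) unfolding smooth_on_def by blast
  then obtain t' where t': "\<And>x. x \<in> U \<Longrightarrow> (\<tau> has_derivative t' x) (at x)" "\<And>v. Ck_on k U (\<lambda>x. t' x v)"
    by (rule Ck_on_SucE) blast
  have "((\<lambda>x. f (\<tau> x)) has_derivative (\<lambda>v. t' x v $ 1 * f' (\<tau> x) (axis 1 1) + t' x v $ 2 * f' (\<tau> x) (axis 2 1))) (at x)"
    if "x \<in> U" for x
  proof -
    have V: "\<tau> x \<in> V" using that assms(2) by auto
    have "f' (\<tau> x) w = w $ 1 * f' (\<tau> x) (axis 1 1) + w $ 2 * f' (\<tau> x) (axis 2 1)" for w
      using linear_2[OF has_derivative_linear[OF f'(1)[OF V]], of w] by simp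
    then have "f' (\<tau> x) \<circ> t' x = (\<lambda>v. t' x v $ 1 * f' (\<tau> x) (axis 1 1) + t' x v $ 2 * f' (\<tau> x) (axis 2 1))"
      unfolding o_def by (rule ext)
    with diff_chain_at[OF t'(1)[OF that] f'(1)[OF V]] show ?thesis by (simp only: o_def)
  qed
  then show ?case
  proof (rule Ck_on_SucI[OF assms(1)])
    fix v
    have "Ck_on k U (\<lambda>x. t' x v $ a)" for a
      using Ck_on_bounded_linear_comp[OF assms(1) bounded_linear_vec_nth t'(2)] .
    then show "Ck_on k U (\<lambda>x. t' x v $ 1 * f' (\<tau> x) (axis 1 1) + t' x v $ 2 * f' (\<tau> x) (axis 2 1))"
      by (intro Ck_on_add[OF assms(1)] Ck_on_mult[OF assms(1)] Suc.IH f'(2))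
  qed
qed

locale chart_change =
  fixes c d :: "'a::t2_space chart"
  assumes charts: "is_chart c" "is_chart d" and same_dom: "cdom d = cdom c"
    and smooth_transition: "smooth_on (coord c ` cdom c) (coord d \<circ> cinv c)"
    and det_jac: "p \<in> cdom c \<Longrightarrow> det (jac c d p) > 0"
begin

definition "M a i q = pd c i (\<lambda>q. coord d q $ a) q"

lemma smooth_coord: "chart_smooth c (\<lambda>q. coord d q $ a)"
  using chart_smooth_bounded_linear[OF charts(1) smooth_transition bounded_linear_vec_nth] .

lemma smooth_M: "chart_smooth c (M a i)"
  using chart_smooth_pd[OF charts(1) smooth_coord] unfolding M_def[abs_def] .

lemma jac_eq:
  assumes "p \<in> cdom c"
  shows "jac c d p $ a $ i = M a i p"
proof -
  have "((coord d \<circ> cinv c) has_derivative frechet_derivative (coord d \<circ> cinv c) (at (coord c p))) (at (coord c p))"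
    using smooth_on_differentiable[OF smooth_transition] assms frechet_derivative_works by blast
  from bounded_linear.has_derivative[OF bounded_linear_vec_nth this, THEN frechet_derivative_at]
  show ?thesis unfolding jac_def matrix_def M_def pd_def by (simp add: o_def) metis
qed

lemma det_M: "p \<in> cdom c \<Longrightarrow> M 1 1 p * M 2 2 p - M 1 2 p * M 2 1 p > 0"
  using det_jac unfolding det_2 by (simp add: jac_eq)

lemma M_sym: "p \<in> cdom c \<Longrightarrow> pd c i (M a j) p = pd c j (M a i) p"
  unfolding M_def[abs_def] using pd_commute[OF charts(1) smooth_coord] .

lemma chart_smooth_transfer:
  assumes "chart_smooth d f"
  shows "chart_smooth c f"
proof -
  have "Ck_on k (coord c ` cdom c) (\<lambda>x. (f \<circ> cinv d) ((coord d \<circ> cinv c) x))" for k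
    by (rule Ck_on_compose[OF is_chartD(2)[OF charts(1)] _ smooth_transition, of "coord d ` cdom d"])
      (use assms is_chartD(5)[OF charts(1)] same_dom in \<open>auto simp: chart_smooth_def smooth_on_def o_def\<close>)
  moreover have "(f \<circ> cinv d) ((coord d \<circ> cinv c) x) = (f \<circ> cinv c) x" if "x \<in> coord c ` cdom c" for x
    using is_chartD(5)[OF charts(1) that] is_chartD(3)[OF charts(2)] same_dom by simp
  ultimately have "Ck_on k (coord c ` cdom c) (f \<circ> cinv c)" for k
    using Ck_on_cong[OF is_chartD(2)[OF charts(1)]] by metis
  then show ?thesis unfolding chart_smooth_def smooth_on_def by blast
qed

lemma pd_chain:
  assumes "chart_smooth d f" "p \<in> cdom c"
  shows "pd c i f p = M 1 i p * pd d 1 f p + M 2 i p * pd d 2 f p"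
proof -
  have p: "cinv c (coord c p) = p" using is_chartD(3)[OF charts(1) assms(2)] .
  have "((coord d \<circ> cinv c) has_derivative frechet_derivative (coord d \<circ> cinv c) (at (coord c p))) (at (coord c p))"
    using smooth_on_differentiable[OF smooth_transition] assms(2) frechet_derivative_works by blast
  moreover have "((f \<circ> cinv d) has_derivative (\<lambda>w. \<Sum>i\<in>UNIV. w $ i * pd d i f p)) (at ((coord d \<circ> cinv c) (coord c p)))"
    using chart_has_derivative[OF assms(1), of p] assms(2) same_dom p by simp
  ultimately have "((f \<circ> cinv d) \<circ> (coord d \<circ> cinv c) has_derivative
     (\<lambda>w. \<Sum>i\<in>UNIV. w $ i * pd d i f p) \<circ> frechet_derivative (coord d \<circ> cinv c) (at (coord c p))) (at (coord c p))"
    by (rule diff_chain_at)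
  then have "((f \<circ> cinv c) has_derivative
     (\<lambda>w. \<Sum>i\<in>UNIV. w $ i * pd d i f p) \<circ> frechet_derivative (coord d \<circ> cinv c) (at (coord c p))) (at (coord c p))"
    by (rule has_derivative_transform_within_open[OF _ is_chartD(2)[OF charts(1)]])
      (use assms(2) is_chartD(3)[OF charts(1)] is_chartD(3)[OF charts(2)] same_dom in auto)
  from frechet_derivative_at[OF this, symmetric]
  show ?thesis unfolding pd_def[of c i f] using jac_eq[OF assms(2)]
    unfolding jac_def matrix_def by (simp add: sum_2)
qed

lemmas [simp] = pd_add pd_mult[OF charts(1)] pd_minus[OF charts(1)] pd_diff[OF charts(1)] smooth_M
  chart_smooth_transfer chart_smooth_add[OF charts(1)] chart_smooth_mult[OF charts(1)]
  chart_smooth_minus[OF charts(1)] chart_smooth_diff[OF charts(1)] chart_smooth_pd[OF charts(1)]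

text \<open>\<open>\<Gamma>\<close> and \<open>\<Gamma>'\<close> are the coefficients of one connection in the two charts. The transformation
  law says that \<open>\<Gamma>\<close> is the gauge transform by \<open>M\<close> of the pull-back \<open>G\<close> of \<open>\<Gamma>'\<close>, and the
  integrability condition of this equation relates the curvatures.\<close>

lemma curvature_transform:
  fixes \<Gamma> \<Gamma>' :: "2 \<Rightarrow> 2 \<Rightarrow> 2 \<Rightarrow> 'a \<Rightarrow> real"
  assumes sm: "\<And>k i j. chart_smooth c (\<Gamma> k i j)" "\<And>k i j. chart_smooth d (\<Gamma>' k i j)"
    and law: "\<And>p m i j. p \<in> cdom c \<Longrightarrow> M m 1 p * \<Gamma> 1 i j p + M m 2 p * \<Gamma> 2 i j p =
      (\<Gamma>' m 1 1 p * M 1 i p * M 1 j p + \<Gamma>' m 1 2 p * M 1 i p * M 2 j p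
       + \<Gamma>' m 2 1 p * M 2 i p * M 1 j p + \<Gamma>' m 2 2 p * M 2 i p * M 2 j p) + pd c i (M m j) p"
    and p: "p \<in> cdom c"
  defines "\<rho> \<equiv> \<lambda>l k. pd c 1 (\<Gamma> k 2 l) p - pd c 2 (\<Gamma> k 1 l) p
      + (\<Gamma> k 1 1 p * \<Gamma> 1 2 l p + \<Gamma> k 1 2 p * \<Gamma> 2 2 l p) - (\<Gamma> k 2 1 p * \<Gamma> 1 1 l p + \<Gamma> k 2 2 p * \<Gamma> 2 1 l p)"
    and "\<rho>' \<equiv> \<lambda>l k. pd d 1 (\<Gamma>' k 2 l) p - pd d 2 (\<Gamma>' k 1 l) p
      + (\<Gamma>' k 1 1 p * \<Gamma>' 1 2 l p + \<Gamma>' k 1 2 p * \<Gamma>' 2 2 l p) - (\<Gamma>' k 2 1 p * \<Gamma>' 1 1 l p + \<Gamma>' k 2 2 p * \<Gamma>' 2 1 l p)"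
  shows "M m 1 p * \<rho> l 1 + M m 2 p * \<rho> l 2 =
    (M 1 1 p * M 2 2 p - M 1 2 p * M 2 1 p) * (\<rho>' 1 m * M 1 l p + \<rho>' 2 m * M 2 l p)"
proof -
  define G where "G = (\<lambda>m i b q. M 1 i q * \<Gamma>' m 1 b q + M 2 i q * \<Gamma>' m 2 b q)"
  note sm1 = sm(1) chart_smooth_transfer[OF sm(2)]
  have smG: "chart_smooth c (G m i b)" for m i b unfolding G_def using sm by simp
  have dM: "pd c i (M m j) q = (M m 1 q * \<Gamma> 1 i j q + M m 2 q * \<Gamma> 2 i j q)
       - (G m i 1 q * M 1 j q + G m i 2 q * M 2 j q)" if "q \<in> cdom c" for q m i j
    using law[OF that, of m i j] unfolding G_def by (simp add: algebra_simps)
  have dd: "pd c k (pd c i (M m j)) p = pd c k (\<lambda>q. (M m 1 q * \<Gamma> 1 i j q + M m 2 q * \<Gamma> 2 i j q)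
       - (G m i 1 q * M 1 j q + G m i 2 q * M 2 j q)) p" for k m i j
    by (rule pd_cong[OF charts(1) p]) (rule dM)
  \<comment> \<open>The second derivatives of the transition map enter symmetrically and cancel.
    Antisymmetry in the two form indices leaves the Jacobian determinant.\<close>
  have dG: "pd c 2 (G m 1 b) p - pd c 1 (G m 2 b) p =
      (M 1 1 p * M 2 2 p - M 1 2 p * M 2 1 p) * (pd d 2 (\<Gamma>' m 1 b) p - pd d 1 (\<Gamma>' m 2 b) p)" for m b
  proof -
    have "pd c i (G m j b) p = M 1 j p * (M 1 i p * pd d 1 (\<Gamma>' m 1 b) p + M 2 i p * pd d 2 (\<Gamma>' m 1 b) p)
       + pd c i (M 1 j) p * \<Gamma>' m 1 b p
       + (M 2 j p * (M 1 i p * pd d 1 (\<Gamma>' m 2 b) p + M 2 i p * pd d 2 (\<Gamma>' m 2 b) p)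
       + pd c i (M 2 j) p * \<Gamma>' m 2 b p)" for i j
      unfolding G_def using sm p by (simp add: pd_chain)
    then show ?thesis using M_sym[OF p, of 2 1 1] M_sym[OF p, of 2 2 1] by (simp add: algebra_simps)
  qed
  have GG: "G m 1 1 p * G 1 2 b p + G m 1 2 p * G 2 2 b p - (G m 2 1 p * G 1 1 b p + G m 2 2 p * G 2 1 b p) =
      (M 1 1 p * M 2 2 p - M 1 2 p * M 2 1 p) *
      ((\<Gamma>' m 1 1 p * \<Gamma>' 1 2 b p + \<Gamma>' m 1 2 p * \<Gamma>' 2 2 b p) - (\<Gamma>' m 2 1 p * \<Gamma>' 1 1 b p + \<Gamma>' m 2 2 p * \<Gamma>' 2 1 b p))" for m b
    unfolding G_def by (simp add: algebra_simps)
  have ex: "pd c k (pd c i (M m j)) p =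
      (M m 1 p * pd c k (\<Gamma> 1 i j) p + pd c k (M m 1) p * \<Gamma> 1 i j p + (M m 2 p * pd c k (\<Gamma> 2 i j) p + pd c k (M m 2) p * \<Gamma> 2 i j p))
      - (G m i 1 p * pd c k (M 1 j) p + pd c k (G m i 1) p * M 1 j p + (G m i 2 p * pd c k (M 2 j) p + pd c k (G m i 2) p * M 2 j p))"
    for k i m j unfolding dd using sm1 smG p by simp
  have "pd c 2 (pd c 1 (M m l)) p = pd c 1 (pd c 2 (M m l)) p"
    using pd_commute[OF charts(1) smooth_M p] .
  then have "M m 1 p * \<rho> l 1 + M m 2 p * \<rho> l 2 =
     - ((pd c 2 (G m 1 1) p - pd c 1 (G m 2 1) p) * M 1 l p + (pd c 2 (G m 1 2) p - pd c 1 (G m 2 2) p) * M 2 l p)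
     + ((G m 1 1 p * G 1 2 1 p + G m 1 2 p * G 2 2 1 p - (G m 2 1 p * G 1 1 1 p + G m 2 2 p * G 2 1 1 p)) * M 1 l p
      + (G m 1 1 p * G 1 2 2 p + G m 1 2 p * G 2 2 2 p - (G m 2 1 p * G 1 1 2 p + G m 2 2 p * G 2 1 2 p)) * M 2 l p)"
    unfolding ex dM[OF p] \<rho>_def by (simp add: algebra_simps)
  then show ?thesis unfolding dG GG \<rho>'_def by (simp add: algebra_simps)
qed

end

section \<open>The aligned representative of an Einstein AH structure\<close>

lemma smooth_comps_1:
  fixes T :: "('a::t2_space, real^2) comps"
  assumes "smooth_comps A T" "c \<in> A" "is_chart c"
  shows "chart_smooth c (\<lambda>q. T c q $ i)"
  using assms chart_smooth_bounded_linear[OF assms(3) _ bounded_linear_vec_nth] unfolding smooth_comps_def by blast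

lemma smooth_comps_2:
  fixes T :: "('a::t2_space, real^2^2) comps"
  assumes "smooth_comps A T" "c \<in> A" "is_chart c"
  shows "chart_smooth c (\<lambda>q. T c q $ i $ j)"
  using assms chart_smooth_bounded_linear[OF assms(3) _ bounded_linear_compose[OF bounded_linear_vec_nth bounded_linear_vec_nth]]
  unfolding smooth_comps_def by blast

lemma smooth_comps_3:
  fixes T :: "('a::t2_space, real^2^2^2) comps"
  assumes "smooth_comps A T" "c \<in> A" "is_chart c"
  shows "chart_smooth c (\<lambda>q. T c q $ i $ j $ k)"
  using assms chart_smooth_bounded_linear[OF assms(3) _ bounded_linear_compose[OF bounded_linear_vec_nth
      bounded_linear_compose[OF bounded_linear_vec_nth bounded_linear_vec_nth]]]
  unfolding smooth_comps_def by blast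

locale gauduchon_setting =
  fixes A :: "'a::t2_space chart set" and nabla D :: "('a, real^2^2^2) comps"
    and h J :: "('a, real^2^2) comps" and \<gamma> :: "('a, real^2) comps"
  assumes surface: "oriented_surface A"
    and nabla: "affine_connection A nabla" "torsion_free A nabla"
    and D: "levi_civita A h D"
    and h: "pseudo_metric A h" "pos_def_on A h"
    and aligned: "c \<in> A \<Longrightarrow> p \<in> cdom c \<Longrightarrow>
      cov_two nabla (-1) (unimod h) c p $ i $ j $ k = cov_two nabla (-1) (unimod h) c p $ j $ i $ k"
    and einstein_eq: "c \<in> A \<Longrightarrow> p \<in> cdom c \<Longrightarrow> cov_density nabla 1 (weighted_scalar nabla h) c p $ i +
          2 * (\<Sum>k\<in>UNIV. \<Sum>l\<in>UNIV. matrix_inv (unimod h c p) $ k $ l *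
                 cov_two nabla 0 (faraday_form nabla) c p $ l $ i $ k) = 0"
    and co_closed: "c \<in> A \<Longrightarrow> p \<in> cdom c \<Longrightarrow>
      (\<Sum>i\<in>UNIV. \<Sum>j\<in>UNIV. matrix_inv (h c p) $ i $ j * cov_one D \<gamma> c p $ i $ j) = 0"
    and J: "complex_structure A h J"
    and gamma: "\<gamma> = faraday_primitive nabla h"
begin

lemma chart: "c \<in> A \<Longrightarrow> is_chart c"
  using surface unfolding oriented_surface_def by blast

text \<open>Chart by chart versions of the area density, of F_h, and of the h-trace of the Ricci
  tensor, the last being a 1-density divided by \<open>W\<close>. \<open>Fc\<close> is defined from
  d \<gamma>; that it is also given by the Ricci curvature is \<open>faraday_eq\<close>, and the
  independence of the chart comes later.\<close>

definition "W c q = sqrt (det (h c q))"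
definition "Fc c q = -2 * (pd c 1 (\<lambda>q. \<gamma> c q $ 2) q - pd c 2 (\<lambda>q. \<gamma> c q $ 1) q) / W c q"
definition "Rc c q = weighted_scalar nabla h c q / W c q"

abbreviation "X \<equiv> sharp h \<gamma>"
abbreviation "\<pi> c q k i j \<equiv> nabla c q $ k $ i $ j - D c q $ k $ i $ j"

lemma smooth_h: "c \<in> A \<Longrightarrow> chart_smooth c (\<lambda>q. h c q $ i $ j)"
  using h smooth_comps_2[OF _ _ chart] unfolding pseudo_metric_def cov_tensor2_def by blast

lemma smooth_D: "c \<in> A \<Longrightarrow> chart_smooth c (\<lambda>q. D c q $ i $ j $ k)"
  using D smooth_comps_3[OF _ _ chart] unfolding levi_civita_def affine_connection_def by blast

lemma smooth_nabla: "c \<in> A \<Longrightarrow> chart_smooth c (\<lambda>q. nabla c q $ i $ j $ k)"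
  using nabla smooth_comps_3[OF _ _ chart] unfolding affine_connection_def by blast

context
  fixes c assumes c: "c \<in> A"
begin

lemmas chart_c = chart[OF c]

lemmas pd_rules = pd_add pd_mult[OF chart_c] pd_minus[OF chart_c] pd_diff[OF chart_c]
lemmas smooth_rules = chart_smooth_add[OF chart_c] chart_smooth_mult[OF chart_c]
  chart_smooth_minus[OF chart_c] chart_smooth_diff[OF chart_c] chart_smooth_pd[OF chart_c]
  smooth_h[OF c] smooth_D[OF c] smooth_nabla[OF c]

lemma h_sym: "p \<in> cdom c \<Longrightarrow> h c p $ 2 $ 1 = h c p $ 1 $ 2"
proof -
  assume "p \<in> cdom c"
  then have "transpose (h c p) $ 1 $ 2 = h c p $ 1 $ 2" using h c unfolding pseudo_metric_def by simp
  then show ?thesis by (simp add: transpose_def)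
qed

lemma D_sym: "p \<in> cdom c \<Longrightarrow> D c p $ k $ 2 $ 1 = D c p $ k $ 1 $ 2"
  using D c unfolding levi_civita_def torsion_free_def by blast

lemma nabla_sym: "p \<in> cdom c \<Longrightarrow> nabla c p $ k $ 2 $ 1 = nabla c p $ k $ 1 $ 2"
  using nabla c unfolding torsion_free_def by blast

lemma h_pos:
  assumes "p \<in> cdom c"
  shows "h c p $ 1 $ 1 > 0" "det (h c p) > 0" "det (h c p) = h c p $ 1 $ 1 * h c p $ 2 $ 2 - h c p $ 1 $ 2 * h c p $ 1 $ 2"
proof -
  have pos: "Y \<bullet> (h c p *v Y) > 0" if "Y \<noteq> 0" for Y
    using h(2) c assms that unfolding pos_def_on_def by blast
  show e: "h c p $ 1 $ 1 > 0"
    using pos[of "axis 1 1"] by (simp add: matrix_vector_mult_def inner_vec_def sum_2 axis_def vec_eq_iff forall_2)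
  show d: "det (h c p) = h c p $ 1 $ 1 * h c p $ 2 $ 2 - h c p $ 1 $ 2 * h c p $ 1 $ 2"
    unfolding det_2 h_sym[OF assms] ..
  \<comment> \<open>This vector is h-orthogonal to the first coordinate direction, and its squared
    length is h_11 det h.\<close>
  have "vector [- h c p $ 1 $ 2, h c p $ 1 $ 1] \<noteq> (0 :: real^2)"
    using e by (simp add: vec_eq_iff forall_2)
  from pos[OF this] have "h c p $ 1 $ 1 * det (h c p) > 0"
    unfolding d by (simp add: matrix_vector_mult_def inner_vec_def sum_2 h_sym[OF assms] algebra_simps)
  then show "det (h c p) > 0" using e by (simp add: zero_less_mult_iff)
qed

lemma W: "p \<in> cdom c \<Longrightarrow> W c p > 0" "p \<in> cdom c \<Longrightarrow> W c p * W c p = det (h c p)"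
  "p \<in> cdom c \<Longrightarrow> W c p * W c p = h c p $ 1 $ 1 * h c p $ 2 $ 2 - h c p $ 1 $ 2 * h c p $ 1 $ 2"
  unfolding W_def using h_pos by (simp_all add: less_imp_le)

lemma h_inv:
  assumes "p \<in> cdom c"
  shows "matrix_inv (h c p) $ 1 $ 1 = h c p $ 2 $ 2 / (W c p * W c p)"
   "matrix_inv (h c p) $ 1 $ 2 = - h c p $ 1 $ 2 / (W c p * W c p)"
   "matrix_inv (h c p) $ 2 $ 1 = - h c p $ 1 $ 2 / (W c p * W c p)"
   "matrix_inv (h c p) $ 2 $ 2 = h c p $ 1 $ 1 / (W c p * W c p)"
  using matrix_inv_2x2[of "h c p"] h_pos[OF assms] W[OF assms] h_sym[OF assms] by simp_all

lemma metric_compat: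
  assumes "p \<in> cdom c"
  shows "pd c i (\<lambda>q. h c q $ j $ k) p = (\<Sum>m\<in>UNIV. D c p $ m $ i $ j * h c p $ m $ k) + (\<Sum>m\<in>UNIV. D c p $ m $ i $ k * h c p $ j $ m)"
proof -
  have "cov_two D 0 h c p $ i $ j $ k = 0" using D c assms unfolding levi_civita_def by simp
  then show ?thesis unfolding cov_two_def by simp
qed

lemma pd_det:
  assumes "p \<in> cdom c"
  shows "pd c i (\<lambda>q. det (h c q)) p = 2 * (D c p $ 1 $ i $ 1 + D c p $ 2 $ i $ 2) * det (h c p)"
proof -
  have "pd c i (\<lambda>q. det (h c q)) p = pd c i (\<lambda>q. h c q $ 1 $ 1 * h c q $ 2 $ 2 - h c q $ 1 $ 2 * h c q $ 1 $ 2) p"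
    by (rule pd_cong[OF chart_c assms]) (rule h_pos(3))
  also have "\<dots> = 2 * (D c p $ 1 $ i $ 1 + D c p $ 2 $ i $ 2) * det (h c p)"
    using assms unfolding h_pos(3)[OF assms]
    by (simp add: pd_rules smooth_rules metric_compat sum_2 h_sym algebra_simps)
  finally show ?thesis .
qed

lemma smooth_det: "chart_smooth c (\<lambda>q. det (h c q))"
proof -
  have "chart_smooth c (\<lambda>q. h c q $ 1 $ 1 * h c q $ 2 $ 2 - h c q $ 1 $ 2 * h c q $ 1 $ 2)"
    by (intro smooth_rules)
  then show ?thesis by (rule chart_smooth_cong[OF chart_c, THEN iffD1, rotated]) (simp add: h_pos(3))
qed

lemma smooth_W: "chart_smooth c (W c)"
  unfolding W_def[abs_def] by (rule chart_smooth_sqrt[OF chart_c smooth_det]) (rule h_pos(2))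

lemma pd_W:
  assumes "p \<in> cdom c"
  shows "pd c i (W c) p = W c p * (D c p $ 1 $ i $ 1 + D c p $ 2 $ i $ 2)"
proof -
  have "pd c i (W c) p = pd c i (\<lambda>q. det (h c q)) p / (2 * W c p)"
    unfolding W_def[abs_def] by (rule pd_sqrt[OF chart_c smooth_det assms h_pos(2)[OF assms]])
  also have "\<dots> = W c p * (D c p $ 1 $ i $ 1 + D c p $ 2 $ i $ 2)"
    unfolding pd_det[OF assms] W(2)[OF assms, symmetric] using W(1)[OF assms] by (simp add: field_simps)
  finally show ?thesis .
qed

text \<open>Since D h = 0, nabla h is minus the action of nabla - D on the two slots of
  \<open>h\<close>. Its metric trace is thus - 2 times the contraction of nabla - D, and the
  normalising factor 1/4 turns - 2 into - 1/2.\<close>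

lemma gamma_eq:
  assumes "p \<in> cdom c"
  shows "\<gamma> c p $ i = - (\<pi> c p 1 i 1 + \<pi> c p 2 i 2) / 2"
proof -
  have "4 * \<gamma> c p $ i * (W c p * W c p) = h c p $ 2 $ 2 * cov_two nabla 0 h c p $ i $ 1 $ 1
     - h c p $ 1 $ 2 * (cov_two nabla 0 h c p $ i $ 1 $ 2 + cov_two nabla 0 h c p $ i $ 2 $ 1)
     + h c p $ 1 $ 1 * cov_two nabla 0 h c p $ i $ 2 $ 2"
    using W(1)[OF assms] unfolding gamma faraday_primitive_def by (simp add: sum_2 h_inv[OF assms] field_simps)
  also have "\<dots> = - 2 * (\<pi> c p 1 i 1 + \<pi> c p 2 i 2) * (W c p * W c p)"
    unfolding cov_two_def W(3)[OF assms] by (simp add: metric_compat[OF assms] sum_2 h_sym[OF assms] algebra_simps)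
  finally show ?thesis using W(1)[OF assms] by simp
qed

lemma smooth_gamma: "chart_smooth c (\<lambda>q. \<gamma> c q $ i)"
proof -
  have "chart_smooth c (\<lambda>q. (- 1/2) * ((nabla c q $ 1 $ i $ 1 - D c q $ 1 $ i $ 1) + (nabla c q $ 2 $ i $ 2 - D c q $ 2 $ i $ 2)))"
    by (intro smooth_rules chart_smooth_const)
  then show ?thesis by (rule chart_smooth_cong[OF chart_c, THEN iffD1, rotated]) (simp add: gamma_eq field_simps)
qed

lemma X_eq:
  assumes "p \<in> cdom c"
  shows "X c p $ 1 = (h c p $ 2 $ 2 * \<gamma> c p $ 1 - h c p $ 1 $ 2 * \<gamma> c p $ 2) / (W c p * W c p)"
    "X c p $ 2 = (h c p $ 1 $ 1 * \<gamma> c p $ 2 - h c p $ 1 $ 2 * \<gamma> c p $ 1) / (W c p * W c p)"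
    "\<gamma> c p $ 1 = h c p $ 1 $ 1 * X c p $ 1 + h c p $ 1 $ 2 * X c p $ 2"
    "\<gamma> c p $ 2 = h c p $ 1 $ 2 * X c p $ 1 + h c p $ 2 $ 2 * X c p $ 2"
proof -
  have w: "W c p * W c p \<noteq> 0" using W(1)[OF assms] by simp
  show x: "X c p $ 1 = (h c p $ 2 $ 2 * \<gamma> c p $ 1 - h c p $ 1 $ 2 * \<gamma> c p $ 2) / (W c p * W c p)"
    "X c p $ 2 = (h c p $ 1 $ 1 * \<gamma> c p $ 2 - h c p $ 1 $ 2 * \<gamma> c p $ 1) / (W c p * W c p)"
    unfolding sharp_def by (simp_all add: matrix_vector_mult_def sum_2 h_inv[OF assms] diff_divide_distrib)
  define w where "w = W c p * W c p"
  have xw: "X c p $ 1 * w = h c p $ 2 $ 2 * \<gamma> c p $ 1 - h c p $ 1 $ 2 * \<gamma> c p $ 2"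
    "X c p $ 2 * w = h c p $ 1 $ 1 * \<gamma> c p $ 2 - h c p $ 1 $ 2 * \<gamma> c p $ 1"
    unfolding x w_def using w by simp_all
  have "(h c p $ 1 $ 1 * X c p $ 1 + h c p $ 1 $ 2 * X c p $ 2) * w = \<gamma> c p $ 1 * w"
    "(h c p $ 1 $ 2 * X c p $ 1 + h c p $ 2 $ 2 * X c p $ 2) * w = \<gamma> c p $ 2 * w"
    unfolding distrib_right mult.assoc xw unfolding w_def W(3)[OF assms] by (simp_all add: algebra_simps)
  then show "\<gamma> c p $ 1 = h c p $ 1 $ 1 * X c p $ 1 + h c p $ 1 $ 2 * X c p $ 2"
    "\<gamma> c p $ 2 = h c p $ 1 $ 2 * X c p $ 1 + h c p $ 2 $ 2 * X c p $ 2" using w unfolding w_def by simp_all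
qed

lemma smooth_X: "chart_smooth c (\<lambda>q. X c q $ i)"
proof -
  have "chart_smooth c (\<lambda>q. X c q $ 1)"
  proof -
    have "chart_smooth c (\<lambda>q. (h c q $ 2 $ 2 * \<gamma> c q $ 1 - h c q $ 1 $ 2 * \<gamma> c q $ 2) / (W c q * W c q))"
      by (intro chart_smooth_divide[OF chart_c] smooth_rules smooth_gamma smooth_W) (use W(1) in force)
    then show ?thesis by (rule chart_smooth_cong[OF chart_c, THEN iffD1, rotated]) (simp add: X_eq(1))
  qed
  moreover have "chart_smooth c (\<lambda>q. X c q $ 2)"
  proof -
    have "chart_smooth c (\<lambda>q. (h c q $ 1 $ 1 * \<gamma> c q $ 2 - h c q $ 1 $ 2 * \<gamma> c q $ 1) / (W c q * W c q))"
      by (intro chart_smooth_divide[OF chart_c] smooth_rules smooth_gamma smooth_W) (use W(1) in force)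
    then show ?thesis by (rule chart_smooth_cong[OF chart_c, THEN iffD1, rotated]) (simp add: X_eq(2))
  qed
  ultimately show ?thesis using exhaust_2[of i] by auto
qed

lemma smooth_Fc: "chart_smooth c (Fc c)"
  unfolding Fc_def[abs_def]
  by (intro chart_smooth_divide[OF chart_c] smooth_rules smooth_gamma smooth_W chart_smooth_const) (use W(1) in force)

lemma pd_gamma:
  assumes "p \<in> cdom c"
  shows "pd c i (\<lambda>q. h c q $ 1 $ 1 * X c q $ 1 + h c q $ 1 $ 2 * X c q $ 2) p = pd c i (\<lambda>q. \<gamma> c q $ 1) p"
    "pd c i (\<lambda>q. h c q $ 1 $ 2 * X c q $ 1 + h c q $ 2 $ 2 * X c q $ 2) p = pd c i (\<lambda>q. \<gamma> c q $ 2) p"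
  by (rule pd_cong[OF chart_c assms], simp add: X_eq(3,4))+

text \<open>Co-closedness of \<gamma>, which is the Gauduchon condition, in terms of X: the metric
  is parallel, so raising the index commutes with D.\<close>

lemma div_X:
  assumes p: "p \<in> cdom c"
  shows "pd c 1 (\<lambda>q. X c q $ 1) p + pd c 2 (\<lambda>q. X c q $ 2) p +
           (D c p $ 1 $ 1 $ 1 + D c p $ 2 $ 1 $ 2) * X c p $ 1 +
           (D c p $ 1 $ 1 $ 2 + D c p $ 2 $ 2 $ 2) * X c p $ 2 = 0"
proof -
  have w: "W c p * W c p \<noteq> 0" using W(1)[OF p] by simp
  have pg: "pd c i (\<lambda>q. \<gamma> c q $ 1) p = h c p $ 1 $ 1 * pd c i (\<lambda>q. X c q $ 1) p + pd c i (\<lambda>q. h c q $ 1 $ 1) p * X c p $ 1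
      + (h c p $ 1 $ 2 * pd c i (\<lambda>q. X c q $ 2) p + pd c i (\<lambda>q. h c q $ 1 $ 2) p * X c p $ 2)"
    "pd c i (\<lambda>q. \<gamma> c q $ 2) p = h c p $ 1 $ 2 * pd c i (\<lambda>q. X c q $ 1) p + pd c i (\<lambda>q. h c q $ 1 $ 2) p * X c p $ 1
      + (h c p $ 2 $ 2 * pd c i (\<lambda>q. X c q $ 2) p + pd c i (\<lambda>q. h c q $ 2 $ 2) p * X c p $ 2)" for i
    unfolding pd_gamma[OF p, symmetric] using p by (simp_all add: pd_rules smooth_rules smooth_X)
  have "h c p $ 2 $ 2 * cov_one D \<gamma> c p $ 1 $ 1 - h c p $ 1 $ 2 * (cov_one D \<gamma> c p $ 1 $ 2 + cov_one D \<gamma> c p $ 2 $ 1)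
      + h c p $ 1 $ 1 * cov_one D \<gamma> c p $ 2 $ 2 = (W c p * W c p) *
     (\<Sum>i\<in>UNIV. \<Sum>j\<in>UNIV. matrix_inv (h c p) $ i $ j * cov_one D \<gamma> c p $ i $ j)"
    using w by (simp add: sum_2 h_inv[OF p] distrib_left right_diff_distrib)
  then have "h c p $ 2 $ 2 * cov_one D \<gamma> c p $ 1 $ 1 - h c p $ 1 $ 2 * (cov_one D \<gamma> c p $ 1 $ 2 + cov_one D \<gamma> c p $ 2 $ 1)
      + h c p $ 1 $ 1 * cov_one D \<gamma> c p $ 2 $ 2 = 0"
    using co_closed[OF c p] by simp
  moreover have "h c p $ 2 $ 2 * cov_one D \<gamma> c p $ 1 $ 1 - h c p $ 1 $ 2 * (cov_one D \<gamma> c p $ 1 $ 2 + cov_one D \<gamma> c p $ 2 $ 1)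
      + h c p $ 1 $ 1 * cov_one D \<gamma> c p $ 2 $ 2 = (W c p * W c p) *
     (pd c 1 (\<lambda>q. X c q $ 1) p + pd c 2 (\<lambda>q. X c q $ 2) p +
           (D c p $ 1 $ 1 $ 1 + D c p $ 2 $ 1 $ 2) * X c p $ 1 +
           (D c p $ 1 $ 1 $ 2 + D c p $ 2 $ 2 $ 2) * X c p $ 2)"
    unfolding cov_one_def W(3)[OF p] vec_lambda_beta pg sum_2 metric_compat[OF p] X_eq(3,4)[OF p] h_sym[OF p] D_sym[OF p]
    by (simp add: algebra_simps)
  ultimately show ?thesis using w by simp
qed

lemma metric_jet_c: "metric_jet c (\<lambda>q. h c q $ 1 $ 1) (\<lambda>q. h c q $ 1 $ 2) (\<lambda>q. h c q $ 2 $ 2) (W c)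
  (\<lambda>q. D c q $ 1 $ 1 $ 1) (\<lambda>q. D c q $ 2 $ 1 $ 1) (\<lambda>q. D c q $ 1 $ 1 $ 2) (\<lambda>q. D c q $ 2 $ 1 $ 2)
  (\<lambda>q. D c q $ 1 $ 2 $ 2) (\<lambda>q. D c q $ 2 $ 2 $ 2) (\<lambda>q. X c q $ 1) (\<lambda>q. X c q $ 2) (Fc c)"
proof (rule metric_jet.intro, goal_cases)
  \<comment> \<open>Cases 27 and 26 are the exterior derivative and the divergence; the other
    assumptions of \<open>metric_jet\<close> follow from compatibility and symmetry of
    \<open>D\<close> by simplification.\<close>
  case (27 p)
  then show ?case using W(1)[OF 27] unfolding pd_gamma[OF 27] Fc_def by simp
next
  case (26 p)
  then show ?case by (rule div_X)
qed (simp_all only: chart_c smooth_h[OF c] smooth_D[OF c] smooth_X smooth_W smooth_Fc h_pos W(1) W(3) metric_compat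
  sum_2 h_sym D_sym pd_W, simp_all add: h_sym D_sym algebra_simps)

lemma unimod_eq:
  assumes "p \<in> cdom c"
  shows "unimod h c p $ i $ j = h c p $ i $ j / W c p"
proof -
  have "\<bar>det (h c p)\<bar> powr (- 1/2) = inverse (det (h c p) powr (1/2))"
    using h_pos(2)[OF assms] powr_minus[of "det (h c p)" "1/2"] by simp
  also have "\<dots> = inverse (W c p)"
    using powr_half_sqrt[of "det (h c p)"] h_pos(2)[OF assms] unfolding W_def by simp
  finally have *: "\<bar>det (h c p)\<bar> powr (- 1/2) = inverse (W c p)" .
  show ?thesis unfolding unimod_def * vector_scaleR_component real_scaleR_def by (rule divide_inverse_commute[symmetric])
qed

lemma unimod_inv:
  assumes "p \<in> cdom c"
  shows "matrix_inv (unimod h c p) $ 1 $ 1 = h c p $ 2 $ 2 / W c p"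
   "matrix_inv (unimod h c p) $ 1 $ 2 = - h c p $ 1 $ 2 / W c p"
   "matrix_inv (unimod h c p) $ 2 $ 1 = - h c p $ 1 $ 2 / W c p"
   "matrix_inv (unimod h c p) $ 2 $ 2 = h c p $ 1 $ 1 / W c p"
proof -
  have "det (unimod h c p) = (h c p $ 1 $ 1 * h c p $ 2 $ 2 - h c p $ 1 $ 2 * h c p $ 1 $ 2) / (W c p * W c p)"
    unfolding det_2 unimod_eq[OF assms] h_sym[OF assms] by (simp add: diff_divide_distrib)
  then have "det (unimod h c p) = 1" unfolding W(3)[OF assms, symmetric] using W(1)[OF assms] by simp
  then show "matrix_inv (unimod h c p) $ 1 $ 1 = h c p $ 2 $ 2 / W c p"
   "matrix_inv (unimod h c p) $ 1 $ 2 = - h c p $ 1 $ 2 / W c p"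
   "matrix_inv (unimod h c p) $ 2 $ 1 = - h c p $ 1 $ 2 / W c p"
   "matrix_inv (unimod h c p) $ 2 $ 2 = h c p $ 1 $ 1 / W c p"
    using matrix_inv_2x2[of "unimod h c p"] unimod_eq[OF assms] h_sym[OF assms] by simp_all
qed

text \<open>Equivalently nabla W = 2 \<gamma> W. Every later summand with 2 \<gamma> comes from
  differentiating a density in this way.\<close>

lemma nabla_trace:
  assumes "p \<in> cdom c"
  shows "nabla c p $ 1 $ i $ 1 + nabla c p $ 2 $ i $ 2 = D c p $ 1 $ i $ 1 + D c p $ 2 $ i $ 2 - 2 * \<gamma> c p $ i"
  unfolding gamma_eq[OF assms] by (simp add: field_simps)

lemma cov_unimod:
  assumes "p \<in> cdom c"
  shows "W c p * cov_two nabla (-1) (unimod h) c p $ i $ j $ k =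
     - (\<pi> c p 1 i j * h c p $ 1 $ k + \<pi> c p 2 i j * h c p $ 2 $ k)
     - (\<pi> c p 1 i k * h c p $ j $ 1 + \<pi> c p 2 i k * h c p $ j $ 2) + (\<pi> c p 1 i 1 + \<pi> c p 2 i 2) * h c p $ j $ k"
proof -
  have w: "W c p \<noteq> 0" using W(1)[OF assms] by simp
  have W0: "q \<in> cdom c \<Longrightarrow> W c q \<noteq> 0" for q using W(1)[of q] by simp
  have "pd c i (\<lambda>q. unimod h c q $ j $ k) p = pd c i (\<lambda>q. h c q $ j $ k / W c q) p"
    by (rule pd_cong[OF chart_c assms]) (rule unimod_eq)
  also have "\<dots> = (pd c i (\<lambda>q. h c q $ j $ k) p * W c p - h c p $ j $ k * pd c i (W c) p) / (W c p)\<^sup>2"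
    by (rule pd_divide[OF chart_c smooth_h[OF c] smooth_W assms W0])
  finally have 1: "pd c i (\<lambda>q. unimod h c q $ j $ k) p =
      (pd c i (\<lambda>q. h c q $ j $ k) p * W c p - h c p $ j $ k * pd c i (W c) p) / (W c p)\<^sup>2" .
  have "b * ((z * b - x * (b * t)) / b\<^sup>2) = z - x * t" if "b \<noteq> 0" for b z x t :: real
    using that by (simp add: field_simps power2_eq_square)
  then have u: "W c p * pd c i (\<lambda>q. unimod h c q $ j $ k) p =
      pd c i (\<lambda>q. h c q $ j $ k) p - h c p $ j $ k * (D c p $ 1 $ i $ 1 + D c p $ 2 $ i $ 2)"
    unfolding 1 pd_W[OF assms] using w by blast
  have "W c p * cov_two nabla (-1) (unimod h) c p $ i $ j $ k = W c p * pd c i (\<lambda>q. unimod h c q $ j $ k) p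
      - (nabla c p $ 1 $ i $ j * h c p $ 1 $ k + nabla c p $ 2 $ i $ j * h c p $ 2 $ k)
      - (nabla c p $ 1 $ i $ k * h c p $ j $ 1 + nabla c p $ 2 $ i $ k * h c p $ j $ 2)
      + (nabla c p $ 1 $ i $ 1 + nabla c p $ 2 $ i $ 2) * h c p $ j $ k"
    unfolding cov_two_def vec_lambda_beta sum_2 unimod_eq[OF assms] using w by (simp add: field_simps)
  then show ?thesis unfolding u metric_compat[OF assms] sum_2 by (simp add: algebra_simps)
qed

text \<open>On a surface the antisymmetrised derivative of \<open>unimod\<close> has only the
  component pair 12. Its third index 2 gives the first and 1 the second component of the metric
  trace of nabla - D.\<close>

lemma aligned_eq:
  assumes p: "p \<in> cdom c"
  shows "h c p $ 2 $ 2 * \<pi> c p 1 1 1 - 2 * h c p $ 1 $ 2 * \<pi> c p 1 1 2 + h c p $ 1 $ 1 * \<pi> c p 1 2 2 = 0"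
    "h c p $ 2 $ 2 * \<pi> c p 2 1 1 - 2 * h c p $ 1 $ 2 * \<pi> c p 2 1 2 + h c p $ 1 $ 1 * \<pi> c p 2 2 2 = 0"
proof -
  have "W c p * cov_two nabla (-1) (unimod h) c p $ 1 $ 2 $ k = W c p * cov_two nabla (-1) (unimod h) c p $ 2 $ 1 $ k" for k
    using aligned[OF c p, of 1 2] by simp
  note a = this[unfolded cov_unimod[OF p] h_sym[OF p] D_sym[OF p] nabla_sym[OF p]]
  show "h c p $ 2 $ 2 * \<pi> c p 1 1 1 - 2 * h c p $ 1 $ 2 * \<pi> c p 1 1 2 + h c p $ 1 $ 1 * \<pi> c p 1 2 2 = 0"
    using a[of 2] by (simp add: algebra_simps h_sym[OF p] D_sym[OF p] nabla_sym[OF p])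
  show "h c p $ 2 $ 2 * \<pi> c p 2 1 1 - 2 * h c p $ 1 $ 2 * \<pi> c p 2 1 2 + h c p $ 1 $ 1 * \<pi> c p 2 2 2 = 0"
    using a[of 1] by (simp add: algebra_simps h_sym[OF p] D_sym[OF p] nabla_sym[OF p])
qed

abbreviation "ncv \<phi> \<equiv> \<phi> c (\<lambda>q. nabla c q $ 1 $ 1 $ 1) (\<lambda>q. nabla c q $ 2 $ 1 $ 1) (\<lambda>q. nabla c q $ 1 $ 1 $ 2)
  (\<lambda>q. nabla c q $ 2 $ 1 $ 2) (\<lambda>q. nabla c q $ 1 $ 2 $ 2) (\<lambda>q. nabla c q $ 2 $ 2 $ 2)"

lemma curv_nabla:
  assumes p: "p \<in> cdom c"
  shows "curv nabla c p 1 2 1 1 = ncv curv11 p" "curv nabla c p 1 2 1 2 = ncv curv12 p"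
    "curv nabla c p 1 2 2 1 = ncv curv21 p" "curv nabla c p 1 2 2 2 = ncv curv22 p"
    "curv nabla c p 2 1 l k = - curv nabla c p 1 2 l k" "curv nabla c p i i l k = 0"
proof -
  have s: "pd c i (\<lambda>q. nabla c q $ k $ 2 $ 1) p = pd c i (\<lambda>q. nabla c q $ k $ 1 $ 2) p" for i k
    by (rule pd_cong[OF chart_c p]) (rule nabla_sym)
  show "curv nabla c p 1 2 1 1 = ncv curv11 p" "curv nabla c p 1 2 1 2 = ncv curv12 p"
    "curv nabla c p 1 2 2 1 = ncv curv21 p" "curv nabla c p 1 2 2 2 = ncv curv22 p"
    unfolding curv_def curv_defs sum_2 s nabla_sym[OF p] by (simp_all add: algebra_simps)
  show "curv nabla c p 2 1 l k = - curv nabla c p 1 2 l k" "curv nabla c p i i l k = 0"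
    unfolding curv_def by simp_all
qed

lemma ricci_nabla:
  assumes "p \<in> cdom c"
  shows "ricci nabla c p $ 1 $ 1 = - ncv curv12 p" "ricci nabla c p $ 1 $ 2 = - ncv curv22 p"
    "ricci nabla c p $ 2 $ 1 = ncv curv11 p" "ricci nabla c p $ 2 $ 2 = ncv curv21 p"
  unfolding ricci_def vec_lambda_beta sum_2 curv_nabla[OF assms] by simp_all

text \<open>The antisymmetric Ricci tensor is governed by the trace of the curvature, which is the
  exterior derivative of the trace of the Christoffel symbols. For \<open>D\<close> this vanishes
  because its curvature is skew, and the traces of nabla and \<open>D\<close> differ by - 2
  \<gamma>.\<close>

lemma faraday_eq:
  assumes p: "p \<in> cdom c"
  shows "faraday_form nabla c p $ 1 $ 2 = Fc c p * W c p / 2" "faraday_form nabla c p $ 2 $ 1 = - (Fc c p * W c p / 2)"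
    "faraday_form nabla c p $ i $ i = 0"
proof -
  interpret metric_jet c "\<lambda>q. h c q $ 1 $ 1" "\<lambda>q. h c q $ 1 $ 2" "\<lambda>q. h c q $ 2 $ 2" "W c"
    "\<lambda>q. D c q $ 1 $ 1 $ 1" "\<lambda>q. D c q $ 2 $ 1 $ 1" "\<lambda>q. D c q $ 1 $ 1 $ 2" "\<lambda>q. D c q $ 2 $ 1 $ 2"
    "\<lambda>q. D c q $ 1 $ 2 $ 2" "\<lambda>q. D c q $ 2 $ 2 $ 2" "\<lambda>q. X c q $ 1" "\<lambda>q. X c q $ 2" "Fc c"
    by (rule metric_jet_c)
  have "pd c i (\<lambda>q. nabla c q $ 1 $ j $ 1 + nabla c q $ 2 $ j $ 2) p =
     pd c i (\<lambda>q. D c q $ 1 $ j $ 1 + D c q $ 2 $ j $ 2 - 2 * \<gamma> c q $ j) p" for i j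
    by (rule pd_cong[OF chart_c p]) (rule nabla_trace)
  then have t: "pd c i (\<lambda>q. nabla c q $ 1 $ j $ 1) p + pd c i (\<lambda>q. nabla c q $ 2 $ j $ 2) p =
     pd c i (\<lambda>q. D c q $ 1 $ j $ 1) p + pd c i (\<lambda>q. D c q $ 2 $ j $ 2) p - 2 * pd c i (\<lambda>q. \<gamma> c q $ j) p" for i j
    using p by (simp add: smooth_rules smooth_gamma)
  have s: "pd c i (\<lambda>q. nabla c q $ k $ 2 $ 1) p = pd c i (\<lambda>q. nabla c q $ k $ 1 $ 2) p"
    "pd c i (\<lambda>q. D c q $ k $ 2 $ 1) p = pd c i (\<lambda>q. D c q $ k $ 1 $ 2) p" for i k
    by (rule pd_cong[OF chart_c p], erule nabla_sym D_sym)+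
  have "cv11 p + cv22 p = 0" using curvature[OF p] by simp
  then have D0: "pd c 1 (\<lambda>q. D c q $ 1 $ 1 $ 2) p - pd c 2 (\<lambda>q. D c q $ 1 $ 1 $ 1) p
     + (pd c 1 (\<lambda>q. D c q $ 2 $ 2 $ 2) p - pd c 2 (\<lambda>q. D c q $ 2 $ 1 $ 2) p) = 0"
    unfolding curv_defs by (simp add: algebra_simps)
  have "ncv curv11 p + ncv curv22 p = pd c 1 (\<lambda>q. nabla c q $ 1 $ 1 $ 2) p - pd c 2 (\<lambda>q. nabla c q $ 1 $ 1 $ 1) p
     + (pd c 1 (\<lambda>q. nabla c q $ 2 $ 2 $ 2) p - pd c 2 (\<lambda>q. nabla c q $ 2 $ 1 $ 2) p)"
    unfolding curv_defs by (simp add: algebra_simps)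
  also have "\<dots> = - 2 * (pd c 1 (\<lambda>q. \<gamma> c q $ 2) p - pd c 2 (\<lambda>q. \<gamma> c q $ 1) p)"
  proof -
    have "n1 - m1 + (n2 - m2) = - 2 * (y - z)" if "n1 + n2 = a1 + a2 - 2 * y" "m1 + m2 = b1 + b2 - 2 * z"
      "a1 - b1 + (a2 - b2) = 0" for n1 n2 m1 m2 a1 a2 b1 b2 y z :: real
    proof -
      have "n1 - m1 + (n2 - m2) = (n1 + n2) - (m1 + m2)" by (simp only: algebra_simps)
      also have "\<dots> = (a1 - b1 + (a2 - b2)) - 2 * (y - z)" unfolding that(1,2) by (simp add: algebra_simps)
      finally show ?thesis unfolding that(3) by simp
    qed
    from this[OF t[of 1 2, unfolded s] t[of 2 1] D0] show ?thesis .
  qed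
  also have "\<dots> = Fc c p * W c p" unfolding Fc_def using W(1)[OF p] by simp
  finally have 1: "ncv curv11 p + ncv curv22 p = Fc c p * W c p" .
  show "faraday_form nabla c p $ 1 $ 2 = Fc c p * W c p / 2" "faraday_form nabla c p $ 2 $ 1 = - (Fc c p * W c p / 2)"
    "faraday_form nabla c p $ i $ i = 0"
    unfolding faraday_form_def vec_lambda_beta ricci_nabla[OF p] using 1 by simp_all
qed

lemma weighted_scalar_eq:
  assumes "p \<in> cdom c"
  shows "weighted_scalar nabla h c p = W c p * Rc c p"
    "W c p * W c p * Rc c p = - h c p $ 2 $ 2 * ncv curv12 p + h c p $ 1 $ 2 * ncv curv22 p
      - h c p $ 1 $ 2 * ncv curv11 p + h c p $ 1 $ 1 * ncv curv21 p"
proof -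
  have w: "W c p \<noteq> 0" using W(1)[OF assms] by simp
  then show *: "weighted_scalar nabla h c p = W c p * Rc c p" unfolding Rc_def by simp
  show "W c p * W c p * Rc c p = - h c p $ 2 $ 2 * ncv curv12 p + h c p $ 1 $ 2 * ncv curv22 p
      - h c p $ 1 $ 2 * ncv curv11 p + h c p $ 1 $ 1 * ncv curv21 p"
    unfolding mult.assoc *[symmetric] unfolding weighted_scalar_def sum_2 unimod_inv[OF assms] ricci_nabla[OF assms]
    using w by (simp add: field_simps)
qed

lemma smooth_Rc: "chart_smooth c (Rc c)"
proof -
  have "chart_smooth c (\<lambda>q. (- h c q $ 2 $ 2 * ncv curv12 q + h c q $ 1 $ 2 * ncv curv22 q
      - h c q $ 1 $ 2 * ncv curv11 q + h c q $ 1 $ 1 * ncv curv21 q) / (W c q * W c q))"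
    unfolding curv_defs
    by (intro chart_smooth_divide[OF chart_c] smooth_rules smooth_W) (use W(1) in force)
  moreover have "(- h c q $ 2 $ 2 * ncv curv12 q + h c q $ 1 $ 2 * ncv curv22 q
      - h c q $ 1 $ 2 * ncv curv11 q + h c q $ 1 $ 1 * ncv curv21 q) / (W c q * W c q) = Rc c q" if "q \<in> cdom c" for q
    unfolding weighted_scalar_eq(2)[OF that, symmetric] using W(1)[OF that] by simp
  ultimately show ?thesis
    by (rule chart_smooth_cong[OF chart_c, THEN iffD1, rotated])
qed

text \<open>A two-form on a surface is a function times the area form, and nabla acts on the area
  form through the trace of its coefficients, as on \<open>W\<close>.\<close>

lemma cov_faraday:
  assumes p: "p \<in> cdom c"
  shows "cov_two nabla 0 (faraday_form nabla) c p $ l $ 1 $ 2 = W c p * (pd c l (Fc c) p + 2 * \<gamma> c p $ l * Fc c p) / 2"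
    "cov_two nabla 0 (faraday_form nabla) c p $ l $ 2 $ 1 = - W c p * (pd c l (Fc c) p + 2 * \<gamma> c p $ l * Fc c p) / 2"
    "cov_two nabla 0 (faraday_form nabla) c p $ l $ i $ i = 0"
proof -
  have 12: "pd c l (\<lambda>q. faraday_form nabla c q $ 1 $ 2) p = pd c l (\<lambda>q. (1/2) * (Fc c q * W c q)) p"
    by (rule pd_cong[OF chart_c p]) (simp add: faraday_eq)
  have 21: "pd c l (\<lambda>q. faraday_form nabla c q $ 2 $ 1) p = pd c l (\<lambda>q. (-1/2) * (Fc c q * W c q)) p"
    by (rule pd_cong[OF chart_c p]) (simp add: faraday_eq)
  have ii: "pd c l (\<lambda>q. faraday_form nabla c q $ i $ i) p = pd c l (\<lambda>q. 0) p" for i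
    by (rule pd_cong[OF chart_c p]) (simp add: faraday_eq)
  have FW: "chart_smooth c (\<lambda>q. Fc c q * W c q)" by (intro smooth_rules smooth_Fc smooth_W)
  have d: "pd c l (\<lambda>q. Fc c q * W c q) p = Fc c p * (W c p * (nabla c p $ 1 $ l $ 1 + nabla c p $ 2 $ l $ 2 + 2 * \<gamma> c p $ l)) + pd c l (Fc c) p * W c p"
    unfolding pd_mult[OF chart_c smooth_Fc smooth_W p] pd_W[OF p] nabla_trace[OF p] by simp
  show "cov_two nabla 0 (faraday_form nabla) c p $ l $ 1 $ 2 = W c p * (pd c l (Fc c) p + 2 * \<gamma> c p $ l * Fc c p) / 2"
    "cov_two nabla 0 (faraday_form nabla) c p $ l $ 2 $ 1 = - W c p * (pd c l (Fc c) p + 2 * \<gamma> c p $ l * Fc c p) / 2"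
    unfolding cov_two_def vec_lambda_beta sum_2 faraday_eq[OF p] 12 21 pd_cmult[OF chart_c FW p] d
    by (simp_all add: algebra_simps add_divide_distrib diff_divide_distrib)
  show "cov_two nabla 0 (faraday_form nabla) c p $ l $ i $ i = 0"
    unfolding cov_two_def vec_lambda_beta sum_2 ii using exhaust_2[of i] by (auto simp: faraday_eq[OF p])
qed

lemma einstein_c:
  assumes p: "p \<in> cdom c"
  shows "W c p * (pd c 1 (Rc c) p + 2 * \<gamma> c p $ 1 * Rc c p) - h c p $ 1 $ 2 * (pd c 1 (Fc c) p + 2 * \<gamma> c p $ 1 * Fc c p)
        + h c p $ 1 $ 1 * (pd c 2 (Fc c) p + 2 * \<gamma> c p $ 2 * Fc c p) = 0"
    "W c p * (pd c 2 (Rc c) p + 2 * \<gamma> c p $ 2 * Rc c p) - h c p $ 2 $ 2 * (pd c 1 (Fc c) p + 2 * \<gamma> c p $ 1 * Fc c p)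
        + h c p $ 1 $ 2 * (pd c 2 (Fc c) p + 2 * \<gamma> c p $ 2 * Fc c p) = 0"
proof -
  have w: "W c p \<noteq> 0" using W(1)[OF p] by simp
  have "pd c i (weighted_scalar nabla h c) p = pd c i (\<lambda>q. W c q * Rc c q) p" for i
    by (rule pd_cong[OF chart_c p]) (rule weighted_scalar_eq)
  then have "cov_density nabla 1 (weighted_scalar nabla h) c p $ i = W c p * (pd c i (Rc c) p + 2 * \<gamma> c p $ i * Rc c p)" for i
    unfolding cov_density_def vec_lambda_beta sum_2 weighted_scalar_eq[OF p] nabla_trace[OF p]
    by (simp add: pd_mult[OF chart_c smooth_W smooth_Rc p] pd_W[OF p] algebra_simps)
  note E = einstein_eq[OF c p, unfolded this sum_2 unimod_inv[OF p]]
  have 1: "x + 2 * ((a / W c p * 0 + - b / W c p * 0) + (- b / W c p * (W c p * y / 2) + d / W c p * (W c p * z / 2)))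
      = x - b * y + d * z" for x a b d y z
    using w by (simp add: field_simps)
  have 2: "x + 2 * ((a / W c p * (- W c p * y / 2) + - b / W c p * (- W c p * z / 2)) + (- b / W c p * 0 + d / W c p * 0))
      = x - a * y + b * z" for x a b d y z
    using w by (simp add: field_simps)
  show "W c p * (pd c 1 (Rc c) p + 2 * \<gamma> c p $ 1 * Rc c p) - h c p $ 1 $ 2 * (pd c 1 (Fc c) p + 2 * \<gamma> c p $ 1 * Fc c p)
        + h c p $ 1 $ 1 * (pd c 2 (Fc c) p + 2 * \<gamma> c p $ 2 * Fc c p) = 0"
    using E[of 1] unfolding cov_faraday[OF p] 1 .
  show "W c p * (pd c 2 (Rc c) p + 2 * \<gamma> c p $ 2 * Rc c p) - h c p $ 2 $ 2 * (pd c 1 (Fc c) p + 2 * \<gamma> c p $ 1 * Fc c p)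
        + h c p $ 1 $ 2 * (pd c 2 (Fc c) p + 2 * \<gamma> c p $ 2 * Fc c p) = 0"
    using E[of 2] unfolding cov_faraday[OF p] 2 .
qed

lemma einstein_jet_c: "einstein_jet c (\<lambda>q. h c q $ 1 $ 1) (\<lambda>q. h c q $ 1 $ 2) (\<lambda>q. h c q $ 2 $ 2) (W c)
  (\<lambda>q. D c q $ 1 $ 1 $ 1) (\<lambda>q. D c q $ 2 $ 1 $ 1) (\<lambda>q. D c q $ 1 $ 1 $ 2) (\<lambda>q. D c q $ 2 $ 1 $ 2)
  (\<lambda>q. D c q $ 1 $ 2 $ 2) (\<lambda>q. D c q $ 2 $ 2 $ 2) (\<lambda>q. X c q $ 1) (\<lambda>q. X c q $ 2) (Fc c)
  (\<lambda>q. \<pi> c q 1 1 1) (\<lambda>q. \<pi> c q 2 1 1) (\<lambda>q. \<pi> c q 1 1 2) (\<lambda>q. \<pi> c q 2 1 2) (\<lambda>q. \<pi> c q 1 2 2) (\<lambda>q. \<pi> c q 2 2 2) (Rc c)"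
proof (rule einstein_jet.intro[OF metric_jet_c einstein_jet_axioms.intro])
  fix p assume p: "p \<in> cdom c"
  show "\<pi> c p 1 1 1 + \<pi> c p 2 1 2 = - 2 * (h c p $ 1 $ 1 * X c p $ 1 + h c p $ 1 $ 2 * X c p $ 2)"
    unfolding X_eq(3)[OF p, symmetric] gamma_eq[OF p] by simp
  show "\<pi> c p 1 1 2 + \<pi> c p 2 2 2 = - 2 * (h c p $ 1 $ 2 * X c p $ 1 + h c p $ 2 $ 2 * X c p $ 2)"
    unfolding X_eq(4)[OF p, symmetric] gamma_eq[OF p] D_sym[OF p] nabla_sym[OF p] by simp
next
  fix p assume p: "p \<in> cdom c"
  have *: "(\<lambda>q. D c q $ k $ i $ j + \<pi> c q k i j) = (\<lambda>q. nabla c q $ k $ i $ j)" for k i j by auto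
  show "W c p * W c p * Rc c p =
    - h c p $ 2 $ 2 * curv12 c (\<lambda>q. D c q $ 1 $ 1 $ 1 + \<pi> c q 1 1 1) (\<lambda>q. D c q $ 2 $ 1 $ 1 + \<pi> c q 2 1 1)
        (\<lambda>q. D c q $ 1 $ 1 $ 2 + \<pi> c q 1 1 2) (\<lambda>q. D c q $ 2 $ 1 $ 2 + \<pi> c q 2 1 2)
        (\<lambda>q. D c q $ 1 $ 2 $ 2 + \<pi> c q 1 2 2) (\<lambda>q. D c q $ 2 $ 2 $ 2 + \<pi> c q 2 2 2) p
    + h c p $ 1 $ 2 * curv22 c (\<lambda>q. D c q $ 1 $ 1 $ 1 + \<pi> c q 1 1 1) (\<lambda>q. D c q $ 2 $ 1 $ 1 + \<pi> c q 2 1 1)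
        (\<lambda>q. D c q $ 1 $ 1 $ 2 + \<pi> c q 1 1 2) (\<lambda>q. D c q $ 2 $ 1 $ 2 + \<pi> c q 2 1 2)
        (\<lambda>q. D c q $ 1 $ 2 $ 2 + \<pi> c q 1 2 2) (\<lambda>q. D c q $ 2 $ 2 $ 2 + \<pi> c q 2 2 2) p
    - h c p $ 1 $ 2 * curv11 c (\<lambda>q. D c q $ 1 $ 1 $ 1 + \<pi> c q 1 1 1) (\<lambda>q. D c q $ 2 $ 1 $ 1 + \<pi> c q 2 1 1)
        (\<lambda>q. D c q $ 1 $ 1 $ 2 + \<pi> c q 1 1 2) (\<lambda>q. D c q $ 2 $ 1 $ 2 + \<pi> c q 2 1 2)
        (\<lambda>q. D c q $ 1 $ 2 $ 2 + \<pi> c q 1 2 2) (\<lambda>q. D c q $ 2 $ 2 $ 2 + \<pi> c q 2 2 2) p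
    + h c p $ 1 $ 1 * curv21 c (\<lambda>q. D c q $ 1 $ 1 $ 1 + \<pi> c q 1 1 1) (\<lambda>q. D c q $ 2 $ 1 $ 1 + \<pi> c q 2 1 1)
        (\<lambda>q. D c q $ 1 $ 1 $ 2 + \<pi> c q 1 1 2) (\<lambda>q. D c q $ 2 $ 1 $ 2 + \<pi> c q 2 1 2)
        (\<lambda>q. D c q $ 1 $ 2 $ 2 + \<pi> c q 1 2 2) (\<lambda>q. D c q $ 2 $ 2 $ 2 + \<pi> c q 2 2 2) p"
    unfolding * by (rule weighted_scalar_eq(2)[OF p])
qed (use einstein_c in \<open>simp_all only: X_eq(3,4) aligned_eq\<close>, (intro smooth_rules smooth_Rc)+)

end

end

text \<open>The hypotheses say m p = q m with m invertible, so p and q are similar. It serves to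
  contract the transformation law of the difference tensor with one index held fixed.\<close>

lemma trace_similar_2x2:
  fixes m11 m12 m21 m22 :: real
  assumes "m11 * m22 - m12 * m21 \<noteq> 0"
    and "m11 * p11 + m12 * p21 = q11 * m11 + q12 * m21" "m11 * p12 + m12 * p22 = q11 * m12 + q12 * m22"
    and "m21 * p11 + m22 * p21 = q21 * m11 + q22 * m21" "m21 * p12 + m22 * p22 = q21 * m12 + q22 * m22"
  shows "p11 + p22 = q11 + q22"
proof -
  have "(m11 * m22 - m12 * m21) * (p11 + p22) = m22 * (m11 * p11 + m12 * p21) - m12 * (m21 * p11 + m22 * p21)
      - m21 * (m11 * p12 + m12 * p22) + m11 * (m21 * p12 + m22 * p22)"
    by (simp add: algebra_simps)
  also have "\<dots> = (m11 * m22 - m12 * m21) * (q11 + q22)"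
    unfolding assms(2-) by (simp add: algebra_simps)
  finally show ?thesis using assms(1) by simp
qed

lemma smooth_on_vec:
  fixes f :: "'a::real_normed_vector \<Rightarrow> real^2"
  assumes "open S" "\<And>i. smooth_on S (\<lambda>x. f x $ i)"
  shows "smooth_on S f"
proof -
  have "Ck_on k S (\<lambda>x. (f x $ 1) *\<^sub>R axis 1 1 + (f x $ 2) *\<^sub>R (axis 2 1 :: real^2))" for k
    using assms(2) unfolding smooth_on_def
    by (intro Ck_on_add[OF assms(1)] Ck_on_bounded_linear_comp[OF assms(1) bounded_linear_scaleR_left]) auto
  moreover have "(f x $ 1) *\<^sub>R axis 1 1 + (f x $ 2) *\<^sub>R (axis 2 1 :: real^2) = f x" for x
    by (simp add: vec_eq_iff forall_2 axis_def)
  ultimately show ?thesis unfolding smooth_on_def by simp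
qed

section \<open>Independence of the chart for \<gamma>, X, F_h and the scalar curvature\<close>

context gauduchon_setting
begin

lemma chart_change_restrict:
  assumes "c \<in> A" "d \<in> A"
  shows "chart_change (cdom c \<inter> cdom d, coord c) (cdom d \<inter> cdom c, coord d)"
    and "p \<in> cdom c \<inter> cdom d \<Longrightarrow>
      jac (cdom c \<inter> cdom d, coord c) (cdom d \<inter> cdom c, coord d) p = jac c d p"
proof -
  note cd = chart[OF assms(1)] chart[OF assms(2)]
  note op = is_chartD(1)[OF cd(1)] is_chartD(1)[OF cd(2)]
  have img: "open (coord c ` (cdom c \<inter> cdom d))" by (rule is_chart_restrict(3)[OF cd(1) op(2)])
  have eq: "(coord d \<circ> cinv c) x = (coord d \<circ> cinv (cdom c \<inter> cdom d, coord c)) x"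
    if "x \<in> coord c ` (cdom c \<inter> cdom d)" for x
    using cinv_restrict[OF cd(1) op(2) that] by simp
  show j: "jac (cdom c \<inter> cdom d, coord c) (cdom d \<inter> cdom c, coord d) p = jac c d p"
    if "p \<in> cdom c \<inter> cdom d" for p
  proof -
    have "frechet_derivative (coord d \<circ> cinv c) (at (coord c p)) =
        frechet_derivative (coord d \<circ> cinv (cdom c \<inter> cdom d, coord c)) (at (coord c p))"
      by (rule frechet_derivative_cong_open[OF img]) (use that eq in auto)
    then show ?thesis unfolding jac_def by simp
  qed
  have s: "smooth_on (coord c ` (cdom c \<inter> cdom d)) (coord d \<circ> cinv c)"
      "\<And>p. p \<in> cdom c \<inter> cdom d \<Longrightarrow> det (jac c d p) > 0"
    using surface assms unfolding oriented_surface_def by blast+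
  show "chart_change (cdom c \<inter> cdom d, coord c) (cdom d \<inter> cdom c, coord d)"
  proof
    show "is_chart (cdom c \<inter> cdom d, coord c)" "is_chart (cdom d \<inter> cdom c, coord d)"
      by (rule is_chart_restrict(1)[OF cd(1) op(2)], rule is_chart_restrict(1)[OF cd(2) op(1)])
    show "smooth_on (coord (cdom c \<inter> cdom d, coord c) ` cdom (cdom c \<inter> cdom d, coord c))
      (coord (cdom d \<inter> cdom c, coord d) \<circ> cinv (cdom c \<inter> cdom d, coord c))"
    proof -
      have "smooth_on (coord c ` (cdom c \<inter> cdom d)) (coord d \<circ> cinv (cdom c \<inter> cdom d, coord c))"
        by (rule smooth_on_cong[OF img, THEN iffD1, OF _ s(1)]) (rule eq)
      then show ?thesis by simp
    qed
  qed (use j s(2) in \<open>auto simp: Int_commute\<close>)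
qed

lemma det_jac: "c \<in> A \<Longrightarrow> d \<in> A \<Longrightarrow> p \<in> cdom c \<inter> cdom d \<Longrightarrow> det (jac c d p) > 0"
  using surface unfolding oriented_surface_def by blast

text \<open>The curvature law carries the Jacobian determinant on its form indices. Inverting the
  Jacobian on the remaining upper index by the adjugate brings in the same determinant, so it
  cancels and a polynomial law for the Ricci components remains.\<close>

lemma ricci_tensorial:
  assumes cA: "c \<in> A" "d \<in> A" and p: "p \<in> cdom c \<inter> cdom d"
  shows "ricci nabla c p = transpose (jac c d p) ** ricci nabla d p ** jac c d p"
proof -
  define c' where "c' = (cdom c \<inter> cdom d, coord c)"
  define d' where "d' = (cdom d \<inter> cdom c, coord d)"
  interpret chart_change c' d' unfolding c'_def d'_def by (rule chart_change_restrict(1)[OF cA])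
  note cd = chart[OF cA(1)] chart[OF cA(2)]
  note op = is_chartD(1)[OF cd(1)] is_chartD(1)[OF cd(2)]
  have dom: "cdom c' = cdom c \<inter> cdom d" "cdom d' = cdom d \<inter> cdom c" unfolding c'_def d'_def by simp_all
  have pdc: "pd c' i f q = pd c i f q" if "q \<in> cdom c \<inter> cdom d" for i f q
    unfolding c'_def by (rule pd_restrict[OF cd(1) op(2) that])
  have pdd: "pd d' i f q = pd d i f q" if "q \<in> cdom c \<inter> cdom d" for i f q
    unfolding d'_def by (rule pd_restrict[OF cd(2) op(1)]) (use that in auto)
  have jM: "jac c d q $ a $ i = M a i q" if "q \<in> cdom c \<inter> cdom d" for q a i
    using jac_eq[of q a i] that chart_change_restrict(2)[OF cA that] unfolding dom c'_def d'_def by simp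
  have sm: "chart_smooth c' (\<lambda>q. nabla c q $ k $ i $ j)" "chart_smooth d' (\<lambda>q. nabla d q $ k $ i $ j)" for k i j
    unfolding c'_def d'_def
    by (rule chart_smooth_restrict[OF cd(1) op(2) smooth_nabla[OF cA(1)]],
        rule chart_smooth_restrict[OF cd(2) op(1) smooth_nabla[OF cA(2)]])
  have law: "M m 1 q * nabla c q $ 1 $ i $ j + M m 2 q * nabla c q $ 2 $ i $ j =
      (nabla d q $ m $ 1 $ 1 * M 1 i q * M 1 j q + nabla d q $ m $ 1 $ 2 * M 1 i q * M 2 j q
       + nabla d q $ m $ 2 $ 1 * M 2 i q * M 1 j q + nabla d q $ m $ 2 $ 2 * M 2 i q * M 2 j q) + pd c' i (M m j) q"
    if "q \<in> cdom c'" for q m i j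
  proof -
    have q: "q \<in> cdom c \<inter> cdom d" using that dom by simp
    have "pd c i (\<lambda>q. jac c d q $ m $ j) q = pd c' i (M m j) q"
      unfolding pdc[OF q, symmetric] by (rule pd_cong[OF charts(1) that]) (use jM dom in auto)
    moreover have "(\<Sum>k\<in>UNIV. jac c d q $ m $ k * nabla c q $ k $ i $ j) =
        (\<Sum>a\<in>UNIV. \<Sum>b\<in>UNIV. nabla d q $ m $ a $ b * jac c d q $ a $ i * jac c d q $ b $ j)
          + pd c i (\<lambda>q. jac c d q $ m $ j) q"
      using nabla(1) cA q unfolding affine_connection_def by blast
    ultimately show ?thesis unfolding sum_2 jM[OF q] by simp
  qed
  have p': "p \<in> cdom c'" using p dom by simp
  have pc: "p \<in> cdom c" and pdm: "p \<in> cdom d" using p by auto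
  have cc: "pd c' 1 (\<lambda>q. nabla c q $ k $ 2 $ l) p - pd c' 2 (\<lambda>q. nabla c q $ k $ 1 $ l) p
      + (nabla c p $ k $ 1 $ 1 * nabla c p $ 1 $ 2 $ l + nabla c p $ k $ 1 $ 2 * nabla c p $ 2 $ 2 $ l)
      - (nabla c p $ k $ 2 $ 1 * nabla c p $ 1 $ 1 $ l + nabla c p $ k $ 2 $ 2 * nabla c p $ 2 $ 1 $ l)
      = curv nabla c p 1 2 l k" for k l
    unfolding curv_def pdc[OF p] sum_2 by simp
  have cdd: "pd d' 1 (\<lambda>q. nabla d q $ k $ 2 $ l) p - pd d' 2 (\<lambda>q. nabla d q $ k $ 1 $ l) p
      + (nabla d p $ k $ 1 $ 1 * nabla d p $ 1 $ 2 $ l + nabla d p $ k $ 1 $ 2 * nabla d p $ 2 $ 2 $ l)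
      - (nabla d p $ k $ 2 $ 1 * nabla d p $ 1 $ 1 $ l + nabla d p $ k $ 2 $ 2 * nabla d p $ 2 $ 1 $ l)
      = curv nabla d p 1 2 l k" for k l
    unfolding curv_def pdd[OF p] sum_2 by simp
  have T: "M m 1 p * curv nabla c p 1 2 l 1 + M m 2 p * curv nabla c p 1 2 l 2 =
      (M 1 1 p * M 2 2 p - M 1 2 p * M 2 1 p) * (curv nabla d p 1 2 1 m * M 1 l p + curv nabla d p 1 2 2 m * M 2 l p)" for m l
    by (rule curvature_transform[of "\<lambda>k i j q. nabla c q $ k $ i $ j" "\<lambda>k i j q. nabla d q $ k $ i $ j",
      OF sm law p', unfolded cc cdd])
  define \<Delta> where "\<Delta> = M 1 1 p * M 2 2 p - M 1 2 p * M 2 1 p"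
  have \<Delta>: "\<Delta> \<noteq> 0" using det_M[OF p'] unfolding \<Delta>_def by simp
  note T = T[folded \<Delta>_def]
  \<comment> \<open>Cramer's rule for the two equations \<open>T\<close> with m = 1, 2.\<close>
  have "\<Delta> * curv nabla c p 1 2 l 2 = \<Delta> * (- M 2 1 p * (curv nabla d p 1 2 1 1 * M 1 l p + curv nabla d p 1 2 2 1 * M 2 l p)
      + M 1 1 p * (curv nabla d p 1 2 1 2 * M 1 l p + curv nabla d p 1 2 2 2 * M 2 l p))" for l
  proof -
    have "\<Delta> * curv nabla c p 1 2 l 2 = - M 2 1 p * (M 1 1 p * curv nabla c p 1 2 l 1 + M 1 2 p * curv nabla c p 1 2 l 2)
      + M 1 1 p * (M 2 1 p * curv nabla c p 1 2 l 1 + M 2 2 p * curv nabla c p 1 2 l 2)"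
      unfolding \<Delta>_def by (simp add: algebra_simps)
    then show ?thesis unfolding T by (simp only: algebra_simps)
  qed
  moreover have "\<Delta> * curv nabla c p 1 2 l 1 = \<Delta> * (M 2 2 p * (curv nabla d p 1 2 1 1 * M 1 l p + curv nabla d p 1 2 2 1 * M 2 l p)
      - M 1 2 p * (curv nabla d p 1 2 1 2 * M 1 l p + curv nabla d p 1 2 2 2 * M 2 l p))" for l
  proof -
    have "\<Delta> * curv nabla c p 1 2 l 1 = M 2 2 p * (M 1 1 p * curv nabla c p 1 2 l 1 + M 1 2 p * curv nabla c p 1 2 l 2)
      - M 1 2 p * (M 2 1 p * curv nabla c p 1 2 l 1 + M 2 2 p * curv nabla c p 1 2 l 2)"
      unfolding \<Delta>_def by (simp add: algebra_simps)
    then show ?thesis unfolding T by (simp only: algebra_simps)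
  qed
  ultimately have K: "curv nabla c p 1 2 l 2 = - M 2 1 p * (curv nabla d p 1 2 1 1 * M 1 l p + curv nabla d p 1 2 2 1 * M 2 l p)
      + M 1 1 p * (curv nabla d p 1 2 1 2 * M 1 l p + curv nabla d p 1 2 2 2 * M 2 l p)"
    "curv nabla c p 1 2 l 1 = M 2 2 p * (curv nabla d p 1 2 1 1 * M 1 l p + curv nabla d p 1 2 2 1 * M 2 l p)
      - M 1 2 p * (curv nabla d p 1 2 1 2 * M 1 l p + curv nabla d p 1 2 2 2 * M 2 l p)" for l
    using \<Delta> mult_left_cancel by blast+
  have ric: "ricci nabla c p $ 1 $ l = - curv nabla c p 1 2 l 2" "ricci nabla c p $ 2 $ l = curv nabla c p 1 2 l 1"
     "ricci nabla d p $ 1 $ l = - curv nabla d p 1 2 l 2" "ricci nabla d p $ 2 $ l = curv nabla d p 1 2 l 1" for l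
    unfolding ricci_def vec_lambda_beta sum_2
    using curv_nabla(5,6)[OF cA(1) pc] curv_nabla(5,6)[OF cA(2) pdm] by simp_all
  show ?thesis
    unfolding vec_eq_iff forall_2 matrix_matrix_mult_def transpose_def vec_lambda_beta sum_2 ric K jM[OF p]
    by (simp add: algebra_simps)
qed

context
  fixes c d p assumes cA: "c \<in> A" "d \<in> A" and p: "p \<in> cdom c" "p \<in> cdom d"
begin

lemma h_change: "h c p = transpose (jac c d p) ** h d p ** jac c d p"
  using h(1) cA p unfolding pseudo_metric_def cov_tensor2_def by blast

text \<open>The orientation enters here: the Jacobian determinant is positive, so the square root of
  its square carries no sign.\<close>

lemma W_change: "W c p = det (jac c d p) * W d p"
proof -
  have "det (h c p) = (det (jac c d p))\<^sup>2 * det (h d p)"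
    unfolding h_change det_mul det_transpose by (simp add: power2_eq_square)
  moreover have "det (jac c d p) > 0" using det_jac[OF cA] p by blast
  ultimately show ?thesis unfolding W_def by (simp add: real_sqrt_mult)
qed

text \<open>The inhomogeneous term with second derivatives is the same for nabla and
  \<open>D\<close>, so their difference is a tensor, and \<gamma> is - 1/2 times its
  contraction.\<close>

lemma gamma_change: "\<gamma> c p = transpose (jac c d p) *v \<gamma> d p"
proof -
  define N where "N = (\<lambda>a i. jac c d p $ a $ i)"
  have n: "(\<Sum>k\<in>UNIV. jac c d p $ m $ k * nabla c p $ k $ i $ j) =
        (\<Sum>a\<in>UNIV. \<Sum>b\<in>UNIV. nabla d p $ m $ a $ b * jac c d p $ a $ i * jac c d p $ b $ j)
          + pd c i (\<lambda>q. jac c d q $ m $ j) p" for m i j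
    using nabla(1) cA p unfolding affine_connection_def by blast
  have D': "(\<Sum>k\<in>UNIV. jac c d p $ m $ k * D c p $ k $ i $ j) =
        (\<Sum>a\<in>UNIV. \<Sum>b\<in>UNIV. D d p $ m $ a $ b * jac c d p $ a $ i * jac c d p $ b $ j)
          + pd c i (\<lambda>q. jac c d q $ m $ j) p" for m i j
    using D cA p unfolding levi_civita_def affine_connection_def by blast
  have t: "N m 1 * \<pi> c p 1 i j + N m 2 * \<pi> c p 2 i j =
    (N 1 i * \<pi> d p m 1 1 + N 2 i * \<pi> d p m 2 1) * N 1 j + (N 1 i * \<pi> d p m 1 2 + N 2 i * \<pi> d p m 2 2) * N 2 j" for m i j
    using n[of m i j] D'[of m i j] unfolding sum_2 N_def by (simp add: algebra_simps)
  have "N 1 1 * N 2 2 - N 1 2 * N 2 1 \<noteq> 0" using det_jac[OF cA] p unfolding det_2 N_def by fastforce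
  from trace_similar_2x2[OF this t t t t]
  have "\<pi> c p 1 i 1 + \<pi> c p 2 i 2 = N 1 i * (\<pi> d p 1 1 1 + \<pi> d p 2 1 2) + N 2 i * (\<pi> d p 1 2 1 + \<pi> d p 2 2 2)" for i
    by (simp add: algebra_simps)
  note e = this
  have "\<gamma> c p $ i = N 1 i * \<gamma> d p $ 1 + N 2 i * \<gamma> d p $ 2" for i
    unfolding gamma_eq[OF cA(1) p(1)] gamma_eq[OF cA(2) p(2)] e by (simp add: field_simps)
  then show ?thesis unfolding vec_eq_iff matrix_vector_mult_def transpose_def N_def by (simp add: sum_2)
qed

lemma h_X: "h c p *v X c p = \<gamma> c p" "h d p *v X d p = \<gamma> d p"
  unfolding vec_eq_iff forall_2 matrix_vector_mult_def vec_lambda_beta sum_2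
  using X_eq(3,4)[OF cA(1) p(1)] X_eq(3,4)[OF cA(2) p(2)] h_sym[OF cA(1) p(1)] h_sym[OF cA(2) p(2)] by simp_all

text \<open>Both sides become \<gamma> after lowering the index and pulling back, and this combined
  map is invertible.\<close>

lemma X_change: "X d p = jac c d p *v X c p"
proof -
  have "transpose (jac c d p) *v (h d p *v (jac c d p *v X c p)) = h c p *v X c p"
    unfolding h_change by (simp add: matrix_vector_mul_assoc matrix_mul_assoc)
  then have "transpose (jac c d p) *v (h d p *v (jac c d p *v X c p)) = transpose (jac c d p) *v (h d p *v X d p)"
    unfolding h_X gamma_change .
  then have "(transpose (jac c d p) ** h d p) *v (jac c d p *v X c p) = (transpose (jac c d p) ** h d p) *v X d p"
    by (simp add: matrix_vector_mul_assoc matrix_mul_assoc)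
  moreover have "invertible (transpose (jac c d p) ** h d p)"
    using det_jac[OF cA] p h_pos(2)[OF cA(2) p(2)] unfolding invertible_det_nz det_mul det_transpose by fastforce
  ultimately show ?thesis by (metis inj_matrix_vector_mult inj_eq)
qed

lemma sq_norm_change: "\<gamma> c p \<bullet> X c p = \<gamma> d p \<bullet> X d p"
  unfolding X_change gamma_change by (simp add: dot_lmul_matrix[symmetric] vector_transpose_matrix)

text \<open>The single component of a two-form and the area density pick up the same
  determinant.\<close>

lemma faraday_change: "Fc c p = Fc d p"
proof -
  have "faraday_form nabla c p $ 1 $ 2 = det (jac c d p) * faraday_form nabla d p $ 1 $ 2"
    unfolding faraday_form_def vec_lambda_beta ricci_tensorial[OF cA IntI[OF p]] det_2
      matrix_matrix_mult_def transpose_def sum_2 by (simp add: field_simps)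
  then have "Fc c p * W c p = det (jac c d p) * (Fc d p * W d p)"
    unfolding faraday_eq[OF cA(1) p(1)] faraday_eq[OF cA(2) p(2)] by simp
  then have "Fc c p * W c p = Fc d p * W c p" unfolding W_change by simp
  then show ?thesis using W(1)[OF cA(1) p(1)] by simp
qed

text \<open>Multiplying by W^2 replaces the inverse metric by its adjugate, so the comparison is a
  polynomial identity in the components.\<close>

lemma scalar_change: "Rc c p = Rc d p"
proof -
  have r: "W b p * W b p * Rc b p = h b p $ 2 $ 2 * ricci nabla b p $ 1 $ 1
     - h b p $ 1 $ 2 * (ricci nabla b p $ 1 $ 2 + ricci nabla b p $ 2 $ 1) + h b p $ 1 $ 1 * ricci nabla b p $ 2 $ 2"
    if "b \<in> A" "p \<in> cdom b" for b
    unfolding weighted_scalar_eq(2)[OF that] ricci_nabla[OF that] by (simp add: algebra_simps)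
  have "W c p * W c p * Rc c p = (det (jac c d p))\<^sup>2 * (W d p * W d p * Rc d p)"
    unfolding r[OF cA(1) p(1)] r[OF cA(2) p(2)]
    unfolding h_change ricci_tensorial[OF cA IntI[OF p]] det_2 matrix_matrix_mult_def transpose_def
      vec_lambda_beta sum_2 power2_eq_square h_sym[OF cA(2) p(2)]
    by (simp add: algebra_simps)
  also have "\<dots> = W c p * W c p * Rc d p" unfolding W_change by (simp add: power2_eq_square)
  finally show ?thesis using W(1)[OF cA(1) p(1)] by simp
qed

end

lemma chart_at: obtains c where "c \<in> A" "p \<in> cdom c"
  using surface unfolding oriented_surface_def by blast

text \<open>The definite description in \<open>sq_norm\<close> denotes because the value is the same
  in all charts around the point.\<close>

lemma sq_norm_eq:
  assumes "c \<in> A" "p \<in> cdom c"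
  shows "sq_norm A h \<gamma> p = \<gamma> c p \<bullet> X c p"
  unfolding sq_norm_def sharp_def[symmetric]
  by (rule the_equality) (use assms sq_norm_change in blast)+

text \<open>An isometry with square - 1 sends the first coordinate vector to an orthogonal one of
  equal length. This leaves two choices, and the orientation, in the form k > 0, selects
  one.\<close>

lemma J_eq:
  assumes c: "c \<in> A" and p: "p \<in> cdom c"
  shows "J c p $ 1 $ 1 = - h c p $ 1 $ 2 / W c p" "J c p $ 1 $ 2 = - h c p $ 2 $ 2 / W c p"
    "J c p $ 2 $ 1 = h c p $ 1 $ 1 / W c p" "J c p $ 2 $ 2 = h c p $ 1 $ 2 / W c p"
proof -
  define a b k l where "a = J c p $ 1 $ 1" and "b = J c p $ 1 $ 2" and "k = J c p $ 2 $ 1" and "l = J c p $ 2 $ 2"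
  define e f g w where "e = h c p $ 1 $ 1" and "f = h c p $ 1 $ 2" and "g = h c p $ 2 $ 2" and "w = W c p"
  note abkl = a_def[symmetric] b_def[symmetric] k_def[symmetric] l_def[symmetric]
    e_def[symmetric] f_def[symmetric] g_def[symmetric] w_def[symmetric]
  have pos: "e > 0" "w > 0" "w * w = e * g - f * f"
    using h_pos(1)[OF c p] W[OF c p] unfolding e_def w_def f_def g_def by auto
  have JJ: "J c p ** J c p = - mat 1"
    and Jh: "\<And>X Y. (J c p *v X) \<bullet> (h c p *v (J c p *v Y)) = X \<bullet> (h c p *v Y)"
    and Jo: "\<And>X. X \<noteq> 0 \<Longrightarrow> X $ 1 * (J c p *v X) $ 2 - X $ 2 * (J c p *v X) $ 1 > 0"
    using J c p unfolding complex_structure_def by blast+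
  have k: "k > 0" using Jo[of "axis 1 1"]
    by (simp add: matrix_vector_mult_def sum_2 axis_def vec_eq_iff forall_2 abkl)
  have "(J c p ** J c p) $ i $ j = - mat 1 $ i $ j" for i j unfolding JJ by simp
  from this[of 1 1] this[of 2 1]
  have q: "a * a + b * k = -1" "k * a + l * k = 0"
    by (simp_all add: matrix_matrix_mult_def sum_2 mat_def abkl)
  have l: "l = - a" using q(2) k by (metis add.commute add_eq_0_iff distrib_left mult.commute mult_eq_0_iff less_irrefl)
  have h1: "e * a * a + 2 * f * a * k + g * k * k = e"
    using Jh[of "axis 1 1" "axis 1 1"]
    by (simp add: matrix_vector_mult_def inner_vec_def sum_2 axis_def h_sym[OF c p] abkl algebra_simps)
  have h2: "e * a * b + f * (a * l + b * k) + g * k * l = f"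
    using Jh[of "axis 1 1" "axis 2 1"]
    by (simp add: matrix_vector_mult_def inner_vec_def sum_2 axis_def h_sym[OF c p] abkl algebra_simps)
  \<comment> \<open>With v the first coordinate vector, h(Jv, JJv) is h(v, Jv) by isometry and -
    h(v, Jv) by J^2 = - 1.\<close>
  have "2 * (e * a + f * k) = 0"
  proof -
    have "a * (e * a * a + 2 * f * a * k + g * k * k) + k * (e * a * b + f * (a * l + b * k) + g * k * l)
       = (a * a + b * k) * (e * a + f * k)"
      unfolding l by (simp add: algebra_simps)
    then show ?thesis unfolding h1 h2 q(1) by (simp add: algebra_simps)
  qed
  then have s: "e * a + f * k = 0" by simp
  then have a: "e * a = - f * k" by simp
  have "(w * k)\<^sup>2 = e\<^sup>2"
  proof -
    have "(w * k)\<^sup>2 = (w * w) * (k * k)" by (simp add: power2_eq_square)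
    also have "\<dots> = e * (e * a * a + 2 * f * a * k + g * k * k) - (e * a + f * k)\<^sup>2"
      unfolding pos(3) by (simp add: power2_eq_square algebra_simps)
    also have "\<dots> = e\<^sup>2" unfolding h1 s by (simp add: power2_eq_square)
    finally show ?thesis .
  qed
  then have wk: "w * k = e" using pos k by (simp add: power2_eq_iff_nonneg)
  have "e * (w * a) = e * (- f)"
    using a wk by (metis mult.commute mult.left_commute mult_minus_left)
  then have wa: "w * a = - f" using pos(1) mult_left_cancel[of e "w * a" "- f"] by (metis less_irrefl)
  have "e * (w * b) = w * w * (b * k)" unfolding wk[symmetric] by (simp add: algebra_simps)
  also have "b * k = - 1 - a * a" using q(1) by simp
  also have "w * w * (- 1 - a * a) = - (w * w) - (w * a) * (w * a)" by (simp add: algebra_simps)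
  also have "\<dots> = e * (- g)" unfolding wa pos(3) by (simp add: algebra_simps)
  finally have wb: "w * b = - g" using pos(1) mult_left_cancel[of e "w * b" "- g"] by (metis less_irrefl)
  show "J c p $ 1 $ 1 = - h c p $ 1 $ 2 / W c p" "J c p $ 1 $ 2 = - h c p $ 2 $ 2 / W c p"
    "J c p $ 2 $ 1 = h c p $ 1 $ 1 / W c p" "J c p $ 2 $ 2 = h c p $ 1 $ 2 / W c p"
    unfolding abkl l using wa wb wk pos by (simp_all add: field_simps)
qed

lemma faraday_scalar_eq:
  assumes "c \<in> A" "p \<in> cdom c"
  shows "faraday_scalar A nabla h J p = Fc c p"
  unfolding faraday_scalar_def
proof (rule the_equality)
  have k: "kahler_form h J b p = (\<chi> i j. if i = j then 0 else if i = 1 then W b p else - W b p)" if "b \<in> A" "p \<in> cdom b" for b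
  proof -
    have w: "W b p \<noteq> 0" "W b p * W b p = h b p $ 1 $ 1 * h b p $ 2 $ 2 - h b p $ 1 $ 2 * h b p $ 1 $ 2"
      using W(1)[OF that] W(3)[OF that] by auto
    have "W b p * (kahler_form h J b p $ 1 $ 2) = W b p * W b p" "W b p * (kahler_form h J b p $ 2 $ 1) = - (W b p * W b p)"
      "W b p * (kahler_form h J b p $ 1 $ 1) = 0" "W b p * (kahler_form h J b p $ 2 $ 2) = 0"
      unfolding kahler_form_def matrix_matrix_mult_def transpose_def vec_lambda_beta sum_2 J_eq[OF that] h_sym[OF that]
      using w(1) unfolding w(2) by (simp_all add: field_simps)
    then have "W b p * (kahler_form h J b p $ 1 $ 2) = W b p * W b p" "W b p * (kahler_form h J b p $ 2 $ 1) = W b p * (- W b p)"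
      "W b p * (kahler_form h J b p $ 1 $ 1) = W b p * 0" "W b p * (kahler_form h J b p $ 2 $ 2) = W b p * 0"
      by simp_all
    then have "kahler_form h J b p $ 1 $ 2 = W b p" "kahler_form h J b p $ 2 $ 1 = - W b p"
      "kahler_form h J b p $ 1 $ 1 = 0" "kahler_form h J b p $ 2 $ 2 = 0"
      using w(1) mult_left_cancel by blast+
    then show ?thesis unfolding vec_eq_iff forall_2 by simp
  qed
  show "\<forall>b\<in>A. p \<in> cdom b \<longrightarrow> 2 *\<^sub>R faraday_form nabla b p = Fc c p *\<^sub>R kahler_form h J b p"
  proof (intro ballI impI)
    fix b assume b: "b \<in> A" "p \<in> cdom b"
    show "2 *\<^sub>R faraday_form nabla b p = Fc c p *\<^sub>R kahler_form h J b p"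
      unfolding k[OF b] faraday_change[OF assms(1) b(1) assms(2) b(2)] vec_eq_iff forall_2
      by (simp add: faraday_eq[OF b])
  qed
  fix r assume "\<forall>b\<in>A. p \<in> cdom b \<longrightarrow> 2 *\<^sub>R faraday_form nabla b p = r *\<^sub>R kahler_form h J b p"
  then have "(2 *\<^sub>R faraday_form nabla c p) $ 1 $ 2 = (r *\<^sub>R kahler_form h J c p) $ 1 $ 2" using assms by simp
  then have "Fc c p * W c p = r * W c p" unfolding k[OF assms] by (simp add: faraday_eq[OF assms])
  then show "r = Fc c p" using W(1)[OF assms] by simp
qed

end

section \<open>The strong maximum principle\<close>

definition partial :: "2 \<Rightarrow> (real^2 \<Rightarrow> real) \<Rightarrow> real^2 \<Rightarrow> real" where
  "partial i f x = frechet_derivative f (at x) (axis i 1)"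

lemma frechet_derivative_partial:
  assumes "f differentiable (at x)"
  shows "frechet_derivative f (at x) v = v $ 1 * partial 1 f x + v $ 2 * partial 2 f x"
  using linear_2[OF linear_frechet_derivative[OF assms], of v] unfolding partial_def by simp

lemma partialI: "(f has_derivative f') (at x) \<Longrightarrow> partial i f x = f' (axis i 1)"
  unfolding partial_def using frechet_derivative_at by metis

lemma partial_cong:
  "open S \<Longrightarrow> x \<in> S \<Longrightarrow> (\<And>y. y \<in> S \<Longrightarrow> f y = g y) \<Longrightarrow> partial i f x = partial i g x"
  unfolding partial_def using frechet_derivative_cong_open by metis

lemma Ck_on_2D:
  assumes "Ck_on 2 U f" "x \<in> U"
  shows "(f has_derivative (\<lambda>v. v $ 1 * partial 1 f x + v $ 2 * partial 2 f x)) (at x)"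
    "(partial i f has_derivative (\<lambda>v. v $ 1 * partial 1 (partial i f) x + v $ 2 * partial 2 (partial i f) x)) (at x)"
proof -
  have d: "f differentiable (at x)" "partial i f differentiable (at x)"
    using assms by (auto simp: numeral_2_eq_2 partial_def[abs_def])
  have e: "frechet_derivative f (at x) = (\<lambda>v. v $ 1 * partial 1 f x + v $ 2 * partial 2 f x)"
    "frechet_derivative (partial i f) (at x) = (\<lambda>v. v $ 1 * partial 1 (partial i f) x + v $ 2 * partial 2 (partial i f) x)"
    by (rule ext, rule frechet_derivative_partial, rule d)+
  show "(f has_derivative (\<lambda>v. v $ 1 * partial 1 f x + v $ 2 * partial 2 f x)) (at x)"
    "(partial i f has_derivative (\<lambda>v. v $ 1 * partial 1 (partial i f) x + v $ 2 * partial 2 (partial i f) x)) (at x)"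
    using d[unfolded frechet_derivative_works] unfolding e by simp_all
qed

lemma second_derivative_nonpos_at_max:
  fixes g g' :: "real \<Rightarrow> real"
  assumes "0 < \<delta>" "\<And>t. \<bar>t\<bar> < \<delta> \<Longrightarrow> (g has_real_derivative g' t) (at t)"
    and "(g' has_real_derivative l) (at 0)" and max: "\<And>t. \<bar>t\<bar> < \<delta> \<Longrightarrow> g t \<le> g 0"
  shows "l \<le> 0"
proof (rule ccontr)
  assume "\<not> l \<le> 0"
  then obtain d where d: "d > 0" "\<And>t. 0 < t \<Longrightarrow> t < d \<Longrightarrow> g' 0 < g' t"
    using DERIV_pos_inc_right[OF assms(3)] by auto
  have g0: "g' 0 = 0"
    by (rule DERIV_local_max[OF assms(2)[of 0] assms(1)]) (use assms(1) max in auto)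
  define t where "t = min d \<delta> / 2"
  have t: "0 < t" "t < d" "t < \<delta>" unfolding t_def using d assms(1) by auto
  obtain s where s: "0 < s" "s < t" "g t - g 0 = (t - 0) * g' s"
    using MVT2[OF t(1), of g g'] assms(2) t by fastforce
  have "g' s > 0" using d(2)[of s] s t g0 by simp
  then have "t * g' s > 0" using t by simp
  then show False using max[of t] t s(3) by simp
qed

text \<open>The one-dimensional test along every line through x makes the Hessian negative
  semidefinite, and an elliptic operator contracts it with a positive definite matrix.\<close>

lemma second_order_at_max:
  assumes U: "open U" "x \<in> U" and w: "Ck_on 2 U w" and max: "\<And>y. y \<in> U \<Longrightarrow> w y \<le> w x"
    and a: "a11 > 0" "a11 * a22 - a12 * a12 > (0::real)"
  shows "partial i w x = 0"
    "a11 * partial 1 (partial 1 w) x + a12 * (partial 1 (partial 2 w) x + partial 2 (partial 1 w) x)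
       + a22 * partial 2 (partial 2 w) x \<le> 0"
proof -
  have "(\<lambda>v :: real^2. v $ 1 * partial 1 w x + v $ 2 * partial 2 w x) = (\<lambda>v. 0)"
    by (rule differential_zero_maxmin[OF U(2,1) Ck_on_2D(1)[OF w U(2)]]) (use max in blast)
  from fun_cong[OF this, of "axis 1 1"] fun_cong[OF this, of "axis 2 1"]
  show "partial i w x = 0" using exhaust_2[of i] by (auto simp: axis_def)
  have H: "v1 * v1 * partial 1 (partial 1 w) x + v1 * v2 * (partial 1 (partial 2 w) x + partial 2 (partial 1 w) x)
     + v2 * v2 * partial 2 (partial 2 w) x \<le> 0" for v1 v2
  proof -
    define v :: "real^2" where "v = vector [v1, v2]"
    have v: "v $ 1 = v1" "v $ 2 = v2" unfolding v_def by simp_all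
    obtain \<rho> where \<rho>: "\<rho> > 0" "ball x \<rho> \<subseteq> U" using U open_contains_ball by blast
    define \<delta> where "\<delta> = \<rho> / (norm v + 1)"
    have n: "norm v + 1 > 0" by (simp add: add_nonneg_pos)
    have \<delta>: "\<delta> > 0" unfolding \<delta>_def using \<rho> n by simp
    have inU: "x + t *\<^sub>R v \<in> U" if "\<bar>t\<bar> < \<delta>" for t
    proof -
      have "\<bar>t\<bar> * norm v \<le> \<bar>t\<bar> * (norm v + 1)" by (simp add: mult_left_mono)
      also have "\<dots> < \<rho>" using that n unfolding \<delta>_def by (simp add: pos_less_divide_eq)
      finally show ?thesis using \<rho>(2) by (auto simp: dist_norm)
    qed
    have line: "((\<lambda>t. x + t *\<^sub>R v) has_derivative (\<lambda>t. t *\<^sub>R v)) (at t)" for t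
      by (auto intro!: derivative_eq_intros)
    have l: "((\<lambda>t. \<phi> (x + t *\<^sub>R v)) has_real_derivative (v1 * p1 + v2 * p2)) (at t)"
      if "(\<phi> has_derivative (\<lambda>u. u $ 1 * p1 + u $ 2 * p2)) (at (x + t *\<^sub>R v))" for \<phi> p1 p2 t
    proof -
      have "(\<lambda>u. u $ 1 * p1 + u $ 2 * p2) \<circ> (\<lambda>t. t *\<^sub>R v) = (*) (v1 * p1 + v2 * p2)"
        by (rule ext) (simp add: v algebra_simps)
      with diff_chain_at[OF line that] show ?thesis unfolding has_field_derivative_def by (simp add: o_def)
    qed
    have "v1 * (v1 * partial 1 (partial 1 w) x + v2 * partial 2 (partial 1 w) x)
        + v2 * (v1 * partial 1 (partial 2 w) x + v2 * partial 2 (partial 2 w) x) \<le> 0"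
    proof (rule second_derivative_nonpos_at_max[OF \<delta>])
      show "((\<lambda>t. w (x + t *\<^sub>R v)) has_real_derivative
          v1 * partial 1 w (x + t *\<^sub>R v) + v2 * partial 2 w (x + t *\<^sub>R v)) (at t)" if "\<bar>t\<bar> < \<delta>" for t
        by (rule l[OF Ck_on_2D(1)[OF w inU[OF that]]])
      show "((\<lambda>t. v1 * partial 1 w (x + t *\<^sub>R v) + v2 * partial 2 w (x + t *\<^sub>R v)) has_real_derivative
          v1 * (v1 * partial 1 (partial 1 w) x + v2 * partial 2 (partial 1 w) x)
        + v2 * (v1 * partial 1 (partial 2 w) x + v2 * partial 2 (partial 2 w) x)) (at 0)"
        using l[of "partial 1 w" _ _ 0] l[of "partial 2 w" _ _ 0] Ck_on_2D(2)[OF w U(2)]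
        by (intro DERIV_add DERIV_cmult) simp_all
      show "w (x + t *\<^sub>R v) \<le> w (x + 0 *\<^sub>R v)" if "\<bar>t\<bar> < \<delta>" for t
        using max[OF inU[OF that]] by simp
    qed
    then show ?thesis by (simp add: algebra_simps)
  qed
  \<comment> \<open>Completing the square: a11 times the operator is the second derivative in the
    direction (a11, a12) plus the determinant times the second derivative in the direction (0,
    1).\<close>
  have "a11 * (a11 * partial 1 (partial 1 w) x + a12 * (partial 1 (partial 2 w) x + partial 2 (partial 1 w) x)
       + a22 * partial 2 (partial 2 w) x) =
    (a11 * a11 * partial 1 (partial 1 w) x + a11 * a12 * (partial 1 (partial 2 w) x + partial 2 (partial 1 w) x)
       + a12 * a12 * partial 2 (partial 2 w) x) + (a11 * a22 - a12 * a12) * partial 2 (partial 2 w) x"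
    by (simp add: algebra_simps)
  also have "\<dots> \<le> 0"
    by (rule add_nonpos_nonpos[OF H[of a11 a12] mult_nonneg_nonpos]) (use H[of 0 1] a(2) in auto)
  finally show "a11 * partial 1 (partial 1 w) x + a12 * (partial 1 (partial 2 w) x + partial 2 (partial 1 w) x)
       + a22 * partial 2 (partial 2 w) x \<le> 0" using a(1) by (simp add: mult_le_0_iff)
qed

text \<open>Hopf's barrier. For positive \<open>\<alpha>\<close> it decreases with the distance from
  \<open>y\<close>, and for large \<open>\<alpha>\<close> an elliptic operator without zero-order
  term makes it strictly positive away from \<open>y\<close>.\<close>

definition barrier :: "real \<Rightarrow> real^2 \<Rightarrow> real^2 \<Rightarrow> real" where
  "barrier \<alpha> y x = exp (- \<alpha> * ((x - y) \<bullet> (x - y)))"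

lemma barrier_derivatives:
  shows "(barrier \<alpha> y has_derivative (\<lambda>v. (- 2 * \<alpha> * ((x - y) \<bullet> v)) * barrier \<alpha> y x)) (at x)"
    and "((\<lambda>x. (- 2 * \<alpha> * ((x - y) \<bullet> u)) * barrier \<alpha> y x) has_derivative
      (\<lambda>v. (4 * \<alpha> * \<alpha> * ((x - y) \<bullet> u) * ((x - y) \<bullet> v) - 2 * \<alpha> * (v \<bullet> u)) * barrier \<alpha> y x)) (at x)"
proof -
  show 1: "(barrier \<alpha> y has_derivative (\<lambda>v. (- 2 * \<alpha> * ((x - y) \<bullet> v)) * barrier \<alpha> y x)) (at x)" for x
    unfolding barrier_def[abs_def] by (auto intro!: derivative_eq_intros simp: inner_commute algebra_simps)
  show "((\<lambda>x. (- 2 * \<alpha> * ((x - y) \<bullet> u)) * barrier \<alpha> y x) has_derivative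
      (\<lambda>v. (4 * \<alpha> * \<alpha> * ((x - y) \<bullet> u) * ((x - y) \<bullet> v) - 2 * \<alpha> * (v \<bullet> u)) * barrier \<alpha> y x)) (at x)"
    by (auto intro!: derivative_eq_intros 1 simp: algebra_simps)
qed

lemma barrier_Ck: "open U \<Longrightarrow> Ck_on 2 U (barrier \<alpha> y)"
  unfolding numeral_2_eq_2
proof (rule Ck_on_SucI, assumption, rule barrier_derivatives(1), rule Ck_on_SucI, assumption, rule barrier_derivatives(2))
  show "Ck_on 0 U (\<lambda>x. (4 * \<alpha> * \<alpha> * ((x - y) \<bullet> u) * ((x - y) \<bullet> v) - 2 * \<alpha> * (v \<bullet> u)) * barrier \<alpha> y x)" for u v
    unfolding barrier_def[abs_def] by (auto intro!: continuous_intros)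
qed

text \<open>Hopf's argument. Where the set of maximum points is approached from outside by a
  touching ball, a small multiple of a barrier is added to \<open>f\<close>. The sum has an interior
  maximum at which the operator is strictly positive, which contradicts
  \<open>second_order_at_max\<close>.\<close>

lemma strong_maximum_local:
  fixes f a11 a12 a22 b1 b2 :: "real^2 \<Rightarrow> real"
  assumes U: "open U" and f: "Ck_on 2 U f"
    and cont: "continuous_on U a11" "continuous_on U a12" "continuous_on U a22" "continuous_on U b1" "continuous_on U b2"
    and pos: "\<And>x. x \<in> U \<Longrightarrow> a11 x > 0" "\<And>x. x \<in> U \<Longrightarrow> a11 x * a22 x - a12 x * a12 x > 0"
    and L: "\<And>x. x \<in> U \<Longrightarrow> a11 x * partial 1 (partial 1 f) x + a12 x * (partial 1 (partial 2 f) x + partial 2 (partial 1 f) x)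
       + a22 x * partial 2 (partial 2 f) x + b1 x * partial 1 f x + b2 x * partial 2 f x \<ge> 0"
    and x0: "x0 \<in> U" and max: "\<And>x. x \<in> U \<Longrightarrow> f x \<le> f x0"
  shows "\<exists>\<rho>>0. ball x0 \<rho> \<subseteq> U \<and> (\<forall>x\<in>ball x0 \<rho>. f x = f x0)"
proof -
  define m where "m = f x0"
  obtain \<rho> where \<rho>: "\<rho> > 0" "cball x0 \<rho> \<subseteq> U" using U x0 open_contains_cball by blast
  have cf: "continuous_on U f" using Ck_on_SucD[of 1 U f] Ck_on_SucD[of 0 U f] f by (simp add: numeral_2_eq_2)
  \<comment> \<open>Halving the radius keeps the construction inside the ball: the maximum point
    nearest to \<open>y0\<close> is at most as far from it as \<open>x0\<close>, hence closer than
    \<rho>/2.\<close>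
  have "f y0 = m" if y0: "y0 \<in> ball x0 (\<rho>/2)" for y0
  proof (rule ccontr)
    assume ne: "f y0 \<noteq> m"
    define Z where "Z = {x \<in> cball x0 \<rho>. f x = m}"
    have Zc: "closed Z" unfolding Z_def
      using continuous_closed_preimage_constant[OF continuous_on_subset[OF cf \<rho>(2)] closed_cball] by simp
    have "x0 \<in> Z" unfolding Z_def m_def using \<rho> by simp
    then obtain z where z: "z \<in> Z" "\<And>z'. z' \<in> Z \<Longrightarrow> dist y0 z \<le> dist y0 z'"
      using distance_attains_inf[OF Zc] by blast
    define r where "r = dist y0 z"
    have r: "r > 0" "r < \<rho>/2"
      using z(1) ne z(2)[OF \<open>x0 \<in> Z\<close>] y0 unfolding r_def Z_def by (auto simp: dist_commute)
    \<comment> \<open>The closed ball of radius r/2 about the midpoint lies in the closed ball of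
      radius r about \<open>y0\<close> and meets its sphere only at \<open>z\<close>. The
      parallelogram law makes this strict, so f < m on the smaller ball except at
      \<open>z\<close>.\<close>
    define y where "y = midpoint y0 z"
    have yz: "y - y0 = z - y" "norm (z - y) = r / 2"
    proof -
      have "z - y = (1/2) *\<^sub>R (z - y0)" by (simp add: vec_eq_iff y_def midpoint_def field_simps)
      then show "norm (z - y) = r / 2" unfolding r_def by (simp add: dist_norm norm_minus_commute)
      show "y - y0 = z - y" by (simp add: vec_eq_iff y_def midpoint_def field_simps)
    qed
    have less: "f x < m" if "dist y x \<le> r / 2" "x \<noteq> z" for x
    proof -
      have "(norm (x - y0))\<^sup>2 + (norm (x - z))\<^sup>2 = 2 * (norm (x - y))\<^sup>2 + 2 * (norm (z - y))\<^sup>2"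
      proof -
        have e: "x - y0 = (x - y) + (z - y)" "x - z = (x - y) - (z - y)" using yz(1) by (simp_all add: algebra_simps)
        have "(norm (a + b))\<^sup>2 + (norm (a - b))\<^sup>2 = 2 * (norm a)\<^sup>2 + 2 * (norm b)\<^sup>2" for a b :: "real^2"
          by (simp add: power2_norm_eq_inner inner_add inner_diff inner_commute)
        then show ?thesis unfolding e(1) unfolding e(2) .
      qed
      moreover have "(norm (x - y))\<^sup>2 \<le> (r/2)\<^sup>2"
        using that(1) by (intro power_mono) (auto simp: dist_norm norm_minus_commute)
      moreover have "(norm (x - z))\<^sup>2 > 0" using that(2) by simp
      moreover have "(r/2)\<^sup>2 = r\<^sup>2 / 4" by (simp add: power_divide)
      ultimately have "(norm (x - y0))\<^sup>2 < r\<^sup>2" unfolding yz(2) by linarith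
      then have "dist y0 x < r" using r(1) by (simp add: dist_norm norm_minus_commute power2_less_imp_less)
      moreover have "dist x0 x \<le> dist x0 y0 + dist y0 x" by (rule dist_triangle)
      ultimately have "x \<notin> Z" "x \<in> cball x0 \<rho>" using z(2)[of x] r y0 unfolding r_def by auto
      then show ?thesis using max[of x] \<rho>(2) unfolding Z_def m_def by fastforce
    qed
    have zx0: "dist x0 z < \<rho>" using dist_triangle[of x0 z y0] y0 r unfolding r_def by simp
    \<comment> \<open>The bound r/4 keeps the centre \<open>y\<close> of the barrier outside the
      small ball about \<open>z\<close>; the other bound keeps that ball in
      \<open>U\<close>.\<close>
    define s where "s = min (r/4) ((\<rho> - dist x0 z) / 2)"
    have s: "s > 0" "s \<le> r / 4" "s < \<rho> - dist x0 z" unfolding s_def using r zx0 by (auto simp: min_less_iff_disj)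
    have KU: "cball z s \<subseteq> U"
    proof
      fix x assume "x \<in> cball z s"
      then have "dist x0 x \<le> \<rho>" using dist_triangle[of x0 x z] s(3) by simp
      then show "x \<in> U" using \<rho>(2) by auto
    qed
    have far: "x \<noteq> y" if "x \<in> cball z s" for x
      using that s(2) r(1) yz(2) by (auto simp: dist_norm)
    \<comment> \<open>The operator applied to the barrier is (4 \<alpha>^2 q - 2 \<alpha> t) times
      the barrier, with \<open>q\<close> the principal symbol in the direction x - y and
      \<open>t\<close> below the remaining terms.\<close>
    define q where "q = (\<lambda>x. a11 x * ((x - y) $ 1 * (x - y) $ 1) + 2 * a12 x * ((x - y) $ 1 * (x - y) $ 2)
        + a22 x * ((x - y) $ 2 * (x - y) $ 2))"
    have q_pos: "q x > 0" if "x \<in> cball z s" for x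
    proof -
      have xU: "x \<in> U" using that KU by auto
      define k l where "k = (x - y) $ 1" and "l = (x - y) $ 2"
      have kl: "k \<noteq> 0 \<or> l \<noteq> 0" using far[OF that] unfolding k_def l_def vec_eq_iff forall_2 by simp
      have "a11 x * q x = (a11 x * k + a12 x * l)\<^sup>2 + (a11 x * a22 x - a12 x * a12 x) * l\<^sup>2"
        unfolding q_def k_def[symmetric] l_def[symmetric] by (simp add: power2_eq_square algebra_simps)
      also have "\<dots> > 0"
      proof (cases "l = 0")
        case True
        then show ?thesis using kl pos(1)[OF xU] by simp
      next
        case False
        then show ?thesis using pos(2)[OF xU] by (intro add_nonneg_pos mult_pos_pos) auto
      qed
      finally show ?thesis using pos(1)[OF xU] by (simp add: zero_less_mult_iff)
    qed
    have ck: "continuous_on (cball z s) a" if "continuous_on U a" for a :: "real^2 \<Rightarrow> real"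
      using continuous_on_subset[OF that KU] .
    have cq: "continuous_on (cball z s) q"
      unfolding q_def by (intro continuous_intros ck cont)
    obtain xq where xq: "xq \<in> cball z s" "\<And>x. x \<in> cball z s \<Longrightarrow> q xq \<le> q x"
      using continuous_attains_inf[OF compact_cball _ cq] s(1) by fastforce
    define t where "t = (\<lambda>x. a11 x + a22 x + b1 x * (x - y) $ 1 + b2 x * (x - y) $ 2)"
    have ct: "continuous_on (cball z s) t" unfolding t_def by (intro continuous_intros ck cont)
    obtain xt where xt: "xt \<in> cball z s" "\<And>x. x \<in> cball z s \<Longrightarrow> t x \<le> t xt"
      using continuous_attains_sup[OF compact_cball _ ct] s(1) by fastforce
    \<comment> \<open>Weighing the minimum of \<open>q\<close> against the maximum of
      \<open>t\<close> gives \<alpha> q \<ge> t + 1 on the whole small ball.\<close>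
    define \<alpha> where "\<alpha> = (\<bar>t xt\<bar> + 1) / q xq"
    have \<alpha>: "\<alpha> > 0" "\<alpha> * q xq = \<bar>t xt\<bar> + 1" unfolding \<alpha>_def using q_pos[OF xq(1)] by (simp_all add: add_nonneg_pos)
    define E where "E = barrier \<alpha> y"
    have LE: "(4 * \<alpha> * \<alpha> * q x - 2 * \<alpha> * t x) * E x > 0" if "x \<in> cball z s" for x
    proof -
      have "\<alpha> * q x \<ge> \<bar>t xt\<bar> + 1" using xq(2)[OF that] \<alpha> by (metis mult_left_mono less_imp_le)
      then have "2 * (\<alpha> * q x) - t x > 0" using xt(2)[OF that] by linarith
      then have "2 * \<alpha> * (2 * (\<alpha> * q x) - t x) > 0" using \<alpha>(1) by simp
      moreover have "E x > 0" unfolding E_def barrier_def by simp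
      ultimately have "(2 * \<alpha> * (2 * (\<alpha> * q x) - t x)) * E x > 0" by (rule mult_pos_pos)
      then show ?thesis by (simp add: algebra_simps)
    qed
    \<comment> \<open>The sphere about \<open>z\<close> is split. On \<open>C\<close>, compact and
      without \<open>z\<close>, \<open>f\<close> stays below m by a fixed \<delta>, which outweighs
      the perturbation since the barrier is at most 1; off \<open>C\<close> the barrier is smaller
      than at \<open>z\<close>.\<close>
    define C where "C = sphere z s \<inter> cball y (r/2)"
    have "\<exists>\<delta>>0. \<forall>x\<in>C. f x \<le> m - \<delta>"
    proof (cases "C = {}")
      case True
      then show ?thesis by (intro exI[of _ 1]) auto
    next
      case False
      have "compact C" unfolding C_def by (intro compact_Int_closed compact_sphere closed_cball)
      moreover have "C \<subseteq> U" using KU unfolding C_def by auto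
      ultimately obtain xc where xc: "xc \<in> C" "\<And>x. x \<in> C \<Longrightarrow> f x \<le> f xc"
        using continuous_attains_sup[of C f] continuous_on_subset[OF cf] False by blast
      have "f xc < m" using less[of xc] xc(1) s(1) unfolding C_def by auto
      then show ?thesis using xc(2) by (intro exI[of _ "m - f xc"]) auto
    qed
    then obtain \<delta> where \<delta>: "\<delta> > 0" "\<And>x. x \<in> C \<Longrightarrow> f x \<le> m - \<delta>" by blast
    define w where "w = (\<lambda>x. f x + (\<delta>/2) * E x)"
    have E1: "E x \<le> 1" for x unfolding E_def barrier_def using \<alpha>(1) by simp
    have Epos: "E x > 0" for x unfolding E_def barrier_def by simp
    have fz: "f z = m" using z(1) unfolding Z_def by simp
    have wC: "Ck_on 2 U w" unfolding w_def E_def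
      by (intro Ck_on_add[OF U] Ck_on_mult[OF U] Ck_on_const barrier_Ck f U)
    have w_sphere: "w x < w z" if "x \<in> sphere z s" for x
    proof (cases "x \<in> cball y (r/2)")
      case True
      then have "f x \<le> m - \<delta>" using \<delta>(2) that unfolding C_def by auto
      moreover have "(\<delta>/2) * E x \<le> (\<delta>/2) * 1" using E1[of x] \<delta>(1) by (intro mult_left_mono) auto
      moreover have "(\<delta>/2) * E z > 0" using Epos[of z] \<delta>(1) by simp
      ultimately show ?thesis unfolding w_def fz using \<delta>(1) by linarith
    next
      case False
      then have "(norm (z - y))\<^sup>2 < (norm (x - y))\<^sup>2"
        unfolding yz(2) using r(1) by (intro power_strict_mono) (auto simp: dist_norm norm_minus_commute)
      then have "E x < E z" unfolding E_def barrier_def using \<alpha>(1) by (simp add: power2_norm_eq_inner)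
      then have "(\<delta>/2) * E x < (\<delta>/2) * E z" using \<delta>(1) by simp
      moreover have "f x \<le> m" using max[of x] KU that unfolding m_def by auto
      ultimately show ?thesis unfolding w_def fz by linarith
    qed
    have "continuous_on (cball z s) w"
      using ck Ck_on_SucD[of 1 U w] Ck_on_SucD[of 0 U w] wC by (simp add: numeral_2_eq_2)
    then obtain x1 where x1: "x1 \<in> cball z s" "\<And>x. x \<in> cball z s \<Longrightarrow> w x \<le> w x1"
      using continuous_attains_sup[OF compact_cball, of z s w] s(1) by fastforce
    have x1b: "x1 \<in> ball z s" using x1(1) x1(2)[of z] w_sphere[of x1] s(1) by (force simp: less_le)
    have wb: "Ck_on 2 (ball z s) w" using wC by (rule Ck_on_subset) (use KU in auto)
    have x1U: "x1 \<in> U" using x1 KU by auto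
    note M = second_order_at_max[OF open_ball x1b wb _ pos(1)[OF x1U] pos(2)[OF x1U]]
    have g0: "partial i w x1 = 0" for i by (rule M(1)) (use x1(2) in auto)
    have "a11 x1 * partial 1 (partial 1 w) x1 + a12 x1 * (partial 1 (partial 2 w) x1 + partial 2 (partial 1 w) x1)
       + a22 x1 * partial 2 (partial 2 w) x1 \<le> 0" by (rule M(2)) (use x1(2) in auto)
    moreover have pw: "partial i w x = partial i f x + (\<delta>/2) * ((- 2 * \<alpha> * ((x - y) \<bullet> axis i 1)) * E x)" if "x \<in> U" for x i
    proof -
      have "(w has_derivative (\<lambda>v. (v $ 1 * partial 1 f x + v $ 2 * partial 2 f x)
         + (\<delta>/2) * ((- 2 * \<alpha> * ((x - y) \<bullet> v)) * E x))) (at x)"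
        unfolding w_def E_def by (intro has_derivative_add has_derivative_mult_right Ck_on_2D(1)[OF f that] barrier_derivatives(1))
      from partialI[OF this, of i] show ?thesis using exhaust_2[of i] by (auto simp: axis_def)
    qed
    have ppw: "partial j (partial i w) x1 = partial j (partial i f) x1
       + (\<delta>/2) * ((4 * \<alpha> * \<alpha> * ((x1 - y) \<bullet> axis i 1) * ((x1 - y) \<bullet> axis j 1) - 2 * \<alpha> * (axis j 1 \<bullet> axis i (1::real))) * E x1)" for i j
    proof -
      have "partial j (partial i w) x1 = partial j (\<lambda>x. partial i f x + (\<delta>/2) * ((- 2 * \<alpha> * ((x - y) \<bullet> axis i 1)) * E x)) x1"
        by (rule partial_cong[OF U x1U pw])
      moreover have "((\<lambda>x. partial i f x + (\<delta>/2) * ((- 2 * \<alpha> * ((x - y) \<bullet> axis i 1)) * E x)) has_derivative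
         (\<lambda>v. (v $ 1 * partial 1 (partial i f) x1 + v $ 2 * partial 2 (partial i f) x1)
          + (\<delta>/2) * ((4 * \<alpha> * \<alpha> * ((x1 - y) \<bullet> axis i 1) * ((x1 - y) \<bullet> v) - 2 * \<alpha> * (v \<bullet> axis i 1)) * E x1))) (at x1)"
        unfolding E_def by (intro has_derivative_add has_derivative_mult_right Ck_on_2D(2)[OF f x1U] barrier_derivatives(2))
      from partialI[OF this, of j] have "partial j (\<lambda>x. partial i f x + (\<delta>/2) * ((- 2 * \<alpha> * ((x - y) \<bullet> axis i 1)) * E x)) x1 =
        partial j (partial i f) x1 + (\<delta>/2) * ((4 * \<alpha> * \<alpha> * ((x1 - y) \<bullet> axis i 1) * ((x1 - y) \<bullet> axis j 1) - 2 * \<alpha> * (axis j 1 \<bullet> axis i (1::real))) * E x1)"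
        using exhaust_2[of j] by (auto simp: axis_def)
      ultimately show ?thesis by simp
    qed
    have "a11 x1 * partial 1 (partial 1 w) x1 + a12 x1 * (partial 1 (partial 2 w) x1 + partial 2 (partial 1 w) x1)
       + a22 x1 * partial 2 (partial 2 w) x1 + b1 x1 * partial 1 w x1 + b2 x1 * partial 2 w x1 =
      (a11 x1 * partial 1 (partial 1 f) x1 + a12 x1 * (partial 1 (partial 2 f) x1 + partial 2 (partial 1 f) x1)
       + a22 x1 * partial 2 (partial 2 f) x1 + b1 x1 * partial 1 f x1 + b2 x1 * partial 2 f x1)
      + (\<delta>/2) * ((4 * \<alpha> * \<alpha> * q x1 - 2 * \<alpha> * t x1) * E x1)"
    proof -
      have ax: "(x1 - y) \<bullet> axis i 1 = (x1 - y) $ i" "axis 1 1 \<bullet> (axis 1 1 :: real^2) = 1"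
        "axis 2 1 \<bullet> (axis 2 1 :: real^2) = 1" "axis 1 1 \<bullet> (axis 2 1 :: real^2) = 0"
        "axis 2 1 \<bullet> (axis 1 1 :: real^2) = 0" for i
        by (simp_all add: inner_axis inner_axis_axis) (simp_all add: axis_def)
      show ?thesis unfolding ppw pw[OF x1U] ax q_def t_def by (simp add: algebra_simps)
    qed
    moreover have "(\<delta>/2) * ((4 * \<alpha> * \<alpha> * q x1 - 2 * \<alpha> * t x1) * E x1) > 0"
      using LE[OF x1(1)] \<delta>(1) by simp
    ultimately show False using L[OF x1U] unfolding g0 by linarith
  qed
  note const = this
  show ?thesis
  proof (intro exI[of _ "\<rho>/2"] conjI ballI)
    have "ball x0 (\<rho>/2) \<subseteq> cball x0 \<rho>" using \<rho>(1) by (auto simp: subset_eq)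
    then show "ball x0 (\<rho>/2) \<subseteq> U" using \<rho>(2) by blast
    show "\<rho>/2 > 0" using \<rho>(1) by simp
    show "f x = f x0" if "x \<in> ball x0 (\<rho>/2)" for x using const[OF that] unfolding m_def .
  qed
qed

lemma pd_partial:
  assumes "is_chart c" "chart_smooth c f" "p \<in> cdom c"
  shows "partial i (f \<circ> cinv c) (coord c p) = pd c i f p"
    "partial i (partial j (f \<circ> cinv c)) (coord c p) = pd c i (pd c j f) p"
proof -
  show 1: "partial i (f \<circ> cinv c) (coord c p) = pd c i f p" for i f unfolding partial_def pd_def ..
  have "partial i (partial j (f \<circ> cinv c)) (coord c p) = partial i (pd c j f \<circ> cinv c) (coord c p)"
    by (rule partial_cong[OF is_chartD(2)[OF assms(1)]])
      (use assms(3) is_chartD(3)[OF assms(1)] in \<open>auto simp: partial_def pd_def\<close>)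
  then show "partial i (partial j (f \<circ> cinv c)) (coord c p) = pd c i (pd c j f) p" using 1 by simp
qed

lemma chart_smooth_continuous:
  assumes "chart_smooth c f"
  shows "continuous_on (coord c ` cdom c) (f \<circ> cinv c)"
  using assms smooth_on_continuous unfolding chart_smooth_def by blast

lemma continuous_on_chart:
  assumes "is_chart c" "chart_smooth c f"
  shows "continuous_on (cdom c) f"
proof -
  have "continuous_on (cdom c) (\<lambda>p. (f \<circ> cinv c) (coord c p))"
    using continuous_on_compose2[OF chart_smooth_continuous[OF assms(2)] is_chartD(6)[OF assms(1)]] by auto
  then show ?thesis by (rule continuous_on_eq) (simp add: is_chartD(3)[OF assms(1)])
qed

lemma chart_nbhd:
  assumes "is_chart c" "\<rho> > 0" "ball (coord c p) \<rho> \<subseteq> coord c ` cdom c" "p \<in> cdom c"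
  shows "open (cinv c ` ball (coord c p) \<rho>)" "connected (cinv c ` ball (coord c p) \<rho>)"
    "p \<in> cinv c ` ball (coord c p) \<rho>" "cinv c ` ball (coord c p) \<rho> \<subseteq> cdom c"
proof -
  note ch = is_chartD[OF assms(1)]
  have eq: "cinv c ` ball (coord c p) \<rho> = cdom c \<inter> coord c -` ball (coord c p) \<rho>"
    using ch(3,4,5) assms(3) by force
  show "open (cinv c ` ball (coord c p) \<rho>)" unfolding eq
    by (rule continuous_open_preimage[OF ch(6) ch(1) open_ball])
  show "connected (cinv c ` ball (coord c p) \<rho>)"
    by (rule connected_continuous_image[OF continuous_on_subset[OF ch(7) assms(3)]]) simp
  show "p \<in> cinv c ` ball (coord c p) \<rho>" unfolding eq using assms by simp
  show "cinv c ` ball (coord c p) \<rho> \<subseteq> cdom c" unfolding eq by simp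
qed

text \<open>Local constancy is the right conclusion on a possibly disconnected surface. The
  component of \<open>p\<close> is open because coordinate balls are connected, and compact; on it
  the set of maximum points is closed, and open by the local principle in any one chart.\<close>

lemma strong_maximum_surface:
  fixes A :: "'a::t2_space chart set"
  assumes A: "oriented_surface A" "compact (UNIV :: 'a set)"
    and sm: "\<And>c. c \<in> A \<Longrightarrow> chart_smooth c \<phi>"
    and L: "\<And>c. c \<in> A \<Longrightarrow> \<exists>a11 a12 a22 b1 b2. chart_smooth c a11 \<and> chart_smooth c a12 \<and> chart_smooth c a22
      \<and> chart_smooth c b1 \<and> chart_smooth c b2 \<and> (\<forall>p\<in>cdom c. a11 p > 0 \<and> a11 p * a22 p - a12 p * a12 p > 0 \<and>
        a11 p * pd c 1 (pd c 1 \<phi>) p + a12 p * (pd c 1 (pd c 2 \<phi>) p + pd c 2 (pd c 1 \<phi>) p)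
        + a22 p * pd c 2 (pd c 2 \<phi>) p + b1 p * pd c 1 \<phi> p + b2 p * pd c 2 \<phi> p \<ge> 0)"
    and c: "c \<in> A" "p \<in> cdom c"
  shows "pd c i \<phi> p = 0"
proof -
  have chart: "c \<in> A \<Longrightarrow> is_chart c" and cover: "\<exists>c\<in>A. p \<in> cdom c" for c p
    using A(1) unfolding oriented_surface_def by blast+
  define S where "S = connected_component_set UNIV p"
  have pS: "p \<in> S" unfolding S_def by simp
  have nb: "cinv c ` ball (coord c q) \<rho> \<subseteq> S"
    if "c \<in> A" "q \<in> cdom c" "q \<in> S" "\<rho> > 0" "ball (coord c q) \<rho> \<subseteq> coord c ` cdom c" for c q \<rho>
  proof -
    note N = chart_nbhd[OF chart[OF that(1)] that(4,5,2)]
    have "cinv c ` ball (coord c q) \<rho> \<subseteq> connected_component_set UNIV q"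
      by (rule connected_component_maximal[OF N(3,2)]) simp
    moreover have "connected_component_set UNIV q = S"
      using that(3) connected_component_eq unfolding S_def by blast
    ultimately show ?thesis by simp
  qed
  have rho: "\<exists>\<rho>>0. ball (coord c q) \<rho> \<subseteq> coord c ` cdom c" if "c \<in> A" "q \<in> cdom c" for c q
    using is_chartD(2)[OF chart[OF that(1)]] that(2) open_contains_ball by blast
  have opS: "open S"
  proof (rule open_subopen[THEN iffD2], rule ballI)
    fix q assume q: "q \<in> S"
    obtain c where cc: "c \<in> A" "q \<in> cdom c" using cover by blast
    obtain \<rho> where r: "\<rho> > 0" "ball (coord c q) \<rho> \<subseteq> coord c ` cdom c" using rho[OF cc] by blast
    show "\<exists>T. open T \<and> q \<in> T \<and> T \<subseteq> S"
      using chart_nbhd(1,3)[OF chart[OF cc(1)] r cc(2)] nb[OF cc q r] by blast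
  qed
  have "closed S" unfolding S_def by (rule closed_connected_component) simp
  then have "compact S" using compact_Int_closed[OF A(2)] by simp
  have cont: "continuous_on UNIV \<phi>"
  proof -
    have "continuous (at q) \<phi>" for q
    proof -
      obtain c where cc: "c \<in> A" "q \<in> cdom c" using cover by blast
      show ?thesis using continuous_on_chart[OF chart[OF cc(1)] sm[OF cc(1)]] is_chartD(1)[OF chart[OF cc(1)]] cc(2)
        by (simp add: continuous_on_eq_continuous_at)
    qed
    then show ?thesis by (simp add: continuous_at_imp_continuous_on)
  qed
  obtain q0 where q0: "q0 \<in> S" "\<And>q. q \<in> S \<Longrightarrow> \<phi> q \<le> \<phi> q0"
    using continuous_attains_sup[OF \<open>compact S\<close> _ continuous_on_subset[OF cont]] pS by blast
  define Z where "Z = {q \<in> S. \<phi> q = \<phi> q0}"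
  have "open Z"
  proof (rule open_subopen[THEN iffD2], rule ballI)
    fix q assume "q \<in> Z"
    then have q: "q \<in> S" "\<phi> q = \<phi> q0" unfolding Z_def by auto
    obtain c where cc: "c \<in> A" "q \<in> cdom c" using cover by blast
    note ch = is_chartD[OF chart[OF cc(1)]]
    obtain \<rho> where r: "\<rho> > 0" "ball (coord c q) \<rho> \<subseteq> coord c ` cdom c" using rho[OF cc] by blast
    obtain a11 a12 a22 b1 b2 where a: "chart_smooth c a11" "chart_smooth c a12" "chart_smooth c a22"
      "chart_smooth c b1" "chart_smooth c b2" "\<And>p. p\<in>cdom c \<Longrightarrow> a11 p > 0" "\<And>p. p\<in>cdom c \<Longrightarrow> a11 p * a22 p - a12 p * a12 p > 0"
      "\<And>p. p\<in>cdom c \<Longrightarrow> a11 p * pd c 1 (pd c 1 \<phi>) p + a12 p * (pd c 1 (pd c 2 \<phi>) p + pd c 2 (pd c 1 \<phi>) p)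
        + a22 p * pd c 2 (pd c 2 \<phi>) p + b1 p * pd c 1 \<phi> p + b2 p * pd c 2 \<phi> p \<ge> 0"
      using L[OF cc(1)] by (elim exE conjE) blast
    have sub: "x \<in> coord c ` cdom c" "cinv c x \<in> cdom c" "coord c (cinv c x) = x" "cinv c x \<in> S"
      if "x \<in> ball (coord c q) \<rho>" for x
      using that r(2) ch(4,5) nb[OF cc q(1) r] by blast+
    have co: "continuous_on (ball (coord c q) \<rho>) (f \<circ> cinv c)" if "chart_smooth c f" for f
      using continuous_on_subset[OF chart_smooth_continuous[OF that] r(2)] .
    have "\<exists>\<rho>'>0. ball (coord c q) \<rho>' \<subseteq> ball (coord c q) \<rho> \<and> (\<forall>x\<in>ball (coord c q) \<rho>'. (\<phi> \<circ> cinv c) x = (\<phi> \<circ> cinv c) (coord c q))"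
    proof (rule strong_maximum_local[OF open_ball _ co[OF a(1)] co[OF a(2)] co[OF a(3)] co[OF a(4)] co[OF a(5)]])
      show "Ck_on 2 (ball (coord c q) \<rho>) (\<phi> \<circ> cinv c)"
        using sm[OF cc(1)] Ck_on_subset[OF _ r(2)] unfolding chart_smooth_def smooth_on_def by blast
      fix x assume x: "x \<in> ball (coord c q) \<rho>"
      note s = sub[OF x]
      show "0 < (a11 \<circ> cinv c) x" "0 < (a11 \<circ> cinv c) x * (a22 \<circ> cinv c) x - (a12 \<circ> cinv c) x * (a12 \<circ> cinv c) x"
        using a(6,7)[OF s(2)] by simp_all
      show "(\<phi> \<circ> cinv c) x \<le> (\<phi> \<circ> cinv c) (coord c q)"
        using q0(2)[OF s(4)] q(2) ch(3)[OF cc(2)] by simp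
      note pp = pd_partial[OF chart[OF cc(1)] sm[OF cc(1)] s(2), unfolded s(3)]
      show "0 \<le> (a11 \<circ> cinv c) x * partial 1 (partial 1 (\<phi> \<circ> cinv c)) x +
           (a12 \<circ> cinv c) x * (partial 1 (partial 2 (\<phi> \<circ> cinv c)) x + partial 2 (partial 1 (\<phi> \<circ> cinv c)) x) +
           (a22 \<circ> cinv c) x * partial 2 (partial 2 (\<phi> \<circ> cinv c)) x +
           (b1 \<circ> cinv c) x * partial 1 (\<phi> \<circ> cinv c) x + (b2 \<circ> cinv c) x * partial 2 (\<phi> \<circ> cinv c) x"
        unfolding pp comp_def using a(8)[OF s(2)] by (simp add: pp[unfolded comp_def])
    qed (use r in simp)
    then obtain \<rho>' where r': "\<rho>' > 0" "ball (coord c q) \<rho>' \<subseteq> ball (coord c q) \<rho>"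
      "\<And>x. x\<in>ball (coord c q) \<rho>' \<Longrightarrow> \<phi> (cinv c x) = \<phi> q" using ch(3)[OF cc(2)] by auto
    have r'': "ball (coord c q) \<rho>' \<subseteq> coord c ` cdom c" using r'(2) r(2) by blast
    have "cinv c ` ball (coord c q) \<rho>' \<subseteq> Z"
      using r'(3) nb[OF cc q(1) r'(1) r''] q(2) unfolding Z_def by auto
    then show "\<exists>T. open T \<and> q \<in> T \<and> T \<subseteq> Z"
      using chart_nbhd(1,3)[OF chart[OF cc(1)] r'(1) r'' cc(2)] by blast
  qed
  moreover have "closed Z"
    unfolding Z_def using continuous_closed_preimage_constant[OF continuous_on_subset[OF cont subset_UNIV] \<open>closed S\<close>] .
  moreover have "connected S" unfolding S_def by simp
  moreover have "q0 \<in> Z" "Z \<subseteq> S" unfolding Z_def using q0 by auto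
  ultimately have "Z = S"
    using connectedD[of S Z "- Z"] by (auto simp: open_Compl)
  have const: "\<phi> q = \<phi> p" if "q \<in> S" for q 
  proof -
    have "q \<in> Z" "p \<in> Z" using that pS \<open>Z = S\<close> by auto
    then show ?thesis unfolding Z_def by simp
  qed
  have "pd (cdom c \<inter> S, coord c) i \<phi> p = pd (cdom c \<inter> S, coord c) i (\<lambda>q. \<phi> p) p"
    by (rule pd_cong[OF is_chart_restrict(1)[OF chart[OF c(1)] opS]]) 
      (use c(2) pS in simp, rule const, simp)
  then show ?thesis using pd_restrict[OF chart[OF c(1)] opS, of p i \<phi>] c(2) pS by simp
qed

section \<open>Complete integral curves on compact surfaces\<close>

text \<open>The difference is the oriented integral from 0 to s. Integrating from the fixed base -
  \<delta> gives one formula for both signs of s.\<close>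

lemma norm_integral_difference_le:
  fixes F :: "real \<Rightarrow> 'b::banach"
  assumes "continuous_on {-\<delta>..\<delta>} F" "\<And>t. t \<in> {-\<delta>..\<delta>} \<Longrightarrow> norm (F t) \<le> B" "s \<in> {-\<delta>..\<delta>}"
  shows "norm (integral {-\<delta>..s} F - integral {-\<delta>..0} F) \<le> B * \<bar>s\<bar>"
proof -
  have int: "F integrable_on {-\<delta>..u}" if "u \<in> {-\<delta>..\<delta>}" for u
    by (rule integrable_continuous_real[OF continuous_on_subset[OF assms(1)]]) (use that in auto)
  show ?thesis
  proof (cases "s \<ge> 0")
    case True
    have "integral {-\<delta>..0} F + integral {0..s} F = integral {-\<delta>..s} F"
      by (rule Henstock_Kurzweil_Integration.integral_combine) (use True assms(3) int[of s] in auto)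
    moreover have "norm (integral {0..s} F) \<le> B * (s - 0)"
      by (rule integral_bound[OF True]) (use assms True in \<open>auto intro: continuous_on_subset\<close>)
    ultimately show ?thesis using True by (metis abs_of_nonneg add_diff_cancel_left' diff_zero)
  next
    case False
    have "integral {-\<delta>..s} F + integral {s..0} F = integral {-\<delta>..0} F"
      by (rule Henstock_Kurzweil_Integration.integral_combine) (use False assms(3) int[of 0] in auto)
    moreover have "norm (integral {s..0} F) \<le> B * (0 - s)"
      by (rule integral_bound) (use assms False in \<open>auto intro: continuous_on_subset\<close>)
    ultimately show ?thesis using False
      by (metis abs_of_neg add_diff_cancel_left' diff_0 linorder_not_le norm_minus_commute)
  qed
qed

text \<open>One \<delta> serves all starting points in the half ball, which a uniform existence time
  on a compact surface requires. Composing V with the nearest-point map makes it bounded and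
  Lipschitz everywhere, and clamping the time puts the Picard operator on bounded continuous
  functions of the line, a complete space.\<close>

lemma picard_lindelof_local:
  fixes V :: "'b::euclidean_space \<Rightarrow> 'b"
  assumes R: "R > 0" and lip: "\<And>x y. x \<in> cball x0 R \<Longrightarrow> y \<in> cball x0 R \<Longrightarrow> norm (V x - V y) \<le> L * norm (x - y)"
  shows "\<exists>\<delta>>0. \<forall>y\<in>cball x0 (R/2). \<exists>g. g 0 = y \<and>
    (\<forall>t. \<bar>t\<bar> < \<delta> \<longrightarrow> g t \<in> cball x0 R \<and> (g has_vector_derivative V (g t)) (at t))"
proof -
  define L' where "L' = \<bar>L\<bar> + 1"
  have L': "L' > 0" "L \<le> L'" unfolding L'_def by auto
  define M where "M = norm (V x0) + L' * R + 1"
  have M: "M > 0" unfolding M_def using L' R by (simp add: add_nonneg_pos)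
  define V' where "V' = (\<lambda>x. V (closest_point (cball x0 R) x))"
  have cp: "closest_point (cball x0 R) x \<in> cball x0 R" for x
    by (rule closest_point_in_set) (use R in auto)
  have lip': "norm (V' x - V' y) \<le> L' * norm (x - y)" for x y
  proof -
    have "norm (V' x - V' y) \<le> L * norm (closest_point (cball x0 R) x - closest_point (cball x0 R) y)"
      unfolding V'_def by (rule lip[OF cp cp])
    also have "\<dots> \<le> L' * norm (closest_point (cball x0 R) x - closest_point (cball x0 R) y)"
      using L'(2) by (rule mult_right_mono) simp
    also have "\<dots> \<le> L' * norm (x - y)"
      using closest_point_lipschitz[of "cball x0 R" x y] R L'(1) by (simp add: dist_norm)
    finally show ?thesis .
  qed
  have bound: "norm (V' x) \<le> M" for x
  proof -
    have "norm (V' x) \<le> norm (V x0) + norm (V (closest_point (cball x0 R) x) - V x0)"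
      unfolding V'_def using norm_triangle_ineq[of "V x0" "V (closest_point (cball x0 R) x) - V x0"] by simp
    also have "\<dots> \<le> norm (V x0) + L * norm (closest_point (cball x0 R) x - x0)"
      using lip[OF cp, of x0 x] R by simp
    also have "L * norm (closest_point (cball x0 R) x - x0) \<le> L' * R"
      by (rule mult_mono) (use L' cp[of x] in \<open>auto simp: dist_norm norm_minus_commute\<close>)
    finally show ?thesis unfolding M_def by simp
  qed
  have contV: "continuous_on UNIV V'"
  proof (rule lipschitz_on_continuous_on[of L'])
    show "L'-lipschitz_on UNIV V'" using lip' L'(1) by (auto simp: lipschitz_on_def dist_norm)
  qed
  \<comment> \<open>The first bound keeps the solution within R/2 of its start, hence where
    \<open>V'\<close> agrees with \<open>V\<close>; the second makes the Picard operator contract by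
    1/2.\<close>
  define \<delta> where "\<delta> = min (R / (2 * M)) (1 / (2 * L'))"
  have \<delta>: "\<delta> > 0" "M * \<delta> \<le> R / 2" "L' * \<delta> \<le> 1 / 2"
  proof -
    show "\<delta> > 0" unfolding \<delta>_def using M L' R by simp
    have "M * \<delta> \<le> M * (R / (2 * M))" unfolding \<delta>_def using M by (intro mult_left_mono) auto
    then show "M * \<delta> \<le> R / 2" using M by simp
    have "L' * \<delta> \<le> L' * (1 / (2 * L'))" unfolding \<delta>_def using L' by (intro mult_left_mono) auto
    then show "L' * \<delta> \<le> 1 / 2" using L' by simp
  qed
  define cl where "cl = (\<lambda>t. max (-\<delta>) (min \<delta> t))"
  have cl: "cl t \<in> {-\<delta>..\<delta>}" "\<bar>cl t\<bar> \<le> \<delta>" "\<bar>t\<bar> < \<delta> \<Longrightarrow> cl t = t" for t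
    unfolding cl_def using \<delta>(1) by (auto simp: min_def max_def)
  have "\<exists>g. g 0 = y \<and> (\<forall>t. \<bar>t\<bar> < \<delta> \<longrightarrow> g t \<in> cball x0 R \<and> (g has_vector_derivative V (g t)) (at t))"
    if y: "y \<in> cball x0 (R/2)" for y
  proof -
    define I where "I = (\<lambda>(g :: real \<Rightarrow> 'b) s. integral {-\<delta>..s} (\<lambda>u. V' (g u)) - integral {-\<delta>..0} (\<lambda>u. V' (g u)))"
    define T where "T = (\<lambda>g :: real \<Rightarrow>\<^sub>C 'b. Bcontfun (\<lambda>t. y + I g (cl t)))"
    have cVg: "continuous_on S (\<lambda>u. V' (apply_bcontfun g u))" for g :: "real \<Rightarrow>\<^sub>C 'b" and S
      by (rule continuous_on_compose2[OF contV]) auto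
    have Ib: "norm (I g s) \<le> M * \<bar>s\<bar>" if "s \<in> {-\<delta>..\<delta>}" for s and g :: "real \<Rightarrow>\<^sub>C 'b"
      unfolding I_def by (rule norm_integral_difference_le[OF cVg _ that]) (rule bound)
    have "(\<lambda>t. y + I g (cl t)) \<in> bcontfun" for g :: "real \<Rightarrow>\<^sub>C 'b"
    proof -
      have "continuous_on {-\<delta>..\<delta>} (\<lambda>s. integral {-\<delta>..s} (\<lambda>u. V' (g u)))"
        by (rule indefinite_integral_continuous_1[OF integrable_continuous_real[OF cVg]])
      then have cI: "continuous_on {-\<delta>..\<delta>} (I g)" unfolding I_def by (intro continuous_intros)
      have "continuous_on UNIV cl" unfolding cl_def by (intro continuous_intros)
      then have "continuous_on UNIV (\<lambda>t. y + I g (cl t))"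
        by (intro continuous_intros continuous_on_compose2[OF cI]) (use cl(1) in auto)
      moreover have "norm (y + I g (cl t)) \<le> norm y + M * \<delta>" for t
      proof -
        have "norm (I g (cl t)) \<le> M * \<bar>cl t\<bar>" by (rule Ib[OF cl(1)])
        also have "\<dots> \<le> M * \<delta>" using cl(2) M by (intro mult_left_mono) auto
        finally show ?thesis using norm_triangle_ineq[of y "I g (cl t)"] by linarith
      qed
      then have "bounded (range (\<lambda>t. y + I g (cl t)))" by (intro boundedI) auto
      ultimately show ?thesis unfolding bcontfun_def by simp
    qed
    then have T: "apply_bcontfun (T g) t = y + I g (cl t)" for g t unfolding T_def by (simp add: Bcontfun_inverse)
    have "dist (T g) (T k) \<le> (1/2) * dist g k" for g k
    proof (rule dist_bound)
      fix t
      have "I g (cl t) - I k (cl t) = integral {-\<delta>..cl t} (\<lambda>u. V' (g u) - V' (k u)) - integral {-\<delta>..0} (\<lambda>u. V' (g u) - V' (k u))"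
        unfolding I_def by (simp add: Henstock_Kurzweil_Integration.integral_diff integrable_continuous_real[OF cVg])
      also have "norm \<dots> \<le> (L' * dist g k) * \<bar>cl t\<bar>"
      proof (rule norm_integral_difference_le[OF _ _ cl(1)])
        show "continuous_on {-\<delta>..\<delta>} (\<lambda>u. V' (g u) - V' (k u))" by (intro continuous_intros cVg)
        show "norm (V' (g u) - V' (k u)) \<le> L' * dist g k" for u
        proof -
          have "norm (V' (g u) - V' (k u)) \<le> L' * dist (g u) (k u)" unfolding dist_norm by (rule lip')
          also have "\<dots> \<le> L' * dist g k" using L'(1) by (intro mult_left_mono dist_bounded) auto
          finally show ?thesis .
        qed
      qed
      also have "\<dots> \<le> (L' * dist g k) * \<delta>" using cl(2) L'(1) by (intro mult_left_mono) auto
      also have "\<dots> = (L' * \<delta>) * dist g k" by simp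
      also have "\<dots> \<le> (1/2) * dist g k" using \<delta>(3) by (rule mult_right_mono) simp
      finally show "dist (T g t) (T k t) \<le> (1/2) * dist g k" unfolding T dist_norm by simp
    qed
    then obtain g where g: "T g = g" using banach_fix_type[of "1/2" T] by auto
    have gt: "g t = y + I g (cl t)" for t using T[of g t] unfolding g .
    have ball: "g t \<in> cball x0 R" for t
    proof -
      have "norm (I g (cl t)) \<le> M * \<bar>cl t\<bar>" by (rule Ib[OF cl(1)])
      also have "\<dots> \<le> M * \<delta>" using cl(2) M by (intro mult_left_mono) auto
      finally have "norm (g t - y) \<le> R / 2" using \<delta>(2) unfolding gt[of t] by simp
      then show ?thesis using y dist_triangle[of x0 "g t" y] by (simp add: dist_norm norm_minus_commute)
    qed
    have "(g has_vector_derivative V (g t)) (at t)" if t: "\<bar>t\<bar> < \<delta>" for t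
    proof -
      have tI: "t \<in> {-\<delta><..<\<delta>}" using t by auto
      have "((\<lambda>s. integral {-\<delta>..s} (\<lambda>u. V' (g u))) has_vector_derivative V' (g t)) (at t within {-\<delta>..\<delta>})"
        by (rule integral_has_vector_derivative[OF cVg]) (use tI in auto)
      then have "((\<lambda>s. integral {-\<delta>..s} (\<lambda>u. V' (g u))) has_vector_derivative V' (g t)) (at t)"
        using at_within_Icc_at[of "-\<delta>" t \<delta>] tI by simp
      then have "((\<lambda>s. y + I g s) has_vector_derivative V' (g t)) (at t)"
        unfolding I_def by (auto intro!: derivative_eq_intros)
      then have "(g has_vector_derivative V' (g t)) (at t)"
      proof (rule has_vector_derivative_transform_within_open)
        show "y + I g s = g s" if "s \<in> {-\<delta><..<\<delta>}" for s using cl(3)[of s] that unfolding gt[of s] by (simp add: abs_less_iff)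
      qed (use tI in auto)
      then show ?thesis unfolding V'_def using closest_point_self[OF ball] by simp
    qed
    moreover have "g 0 = y" using gt[of 0] cl(3)[of 0] \<delta>(1) unfolding I_def by simp
    ultimately show ?thesis using ball by blast
  qed
  then show ?thesis using \<delta>(1) by blast
qed

lemma smooth_on_lipschitz:
  fixes V :: "real^2 \<Rightarrow> real^2"
  assumes "smooth_on U V" "cball x0 R \<subseteq> U"
  shows "\<exists>L. \<forall>x\<in>cball x0 R. \<forall>y\<in>cball x0 R. norm (V x - V y) \<le> L * norm (x - y)"
proof -
  have "\<exists>B. \<forall>x\<in>cball x0 R. norm (frechet_derivative V (at x) (axis i 1)) \<le> B" for i
  proof -
    have "continuous_on (cball x0 R) (\<lambda>x. frechet_derivative V (at x) (axis i 1))"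
      using smooth_on_continuous[OF smooth_on_deriv[OF assms(1)]] continuous_on_subset assms(2) by blast
    then have "bounded ((\<lambda>x. frechet_derivative V (at x) (axis i 1)) ` cball x0 R)"
      by (intro compact_imp_bounded compact_continuous_image) auto
    then show ?thesis unfolding bounded_iff by auto
  qed
  then obtain B where B: "\<And>i x. x \<in> cball x0 R \<Longrightarrow> norm (frechet_derivative V (at x) (axis i 1)) \<le> B i" by metis
  have "norm (V x - V y) \<le> (B 1 + B 2) * norm (x - y)" if "x \<in> cball x0 R" "y \<in> cball x0 R" for x y
  proof (rule differentiable_bound[OF convex_cball _ _ that])
    fix x assume x: "x \<in> cball x0 R"
    have d: "V differentiable (at x)" using smooth_on_differentiable[OF assms(1)] assms(2) x by blast
    then show "(V has_derivative frechet_derivative V (at x)) (at x within cball x0 R)"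
      unfolding frechet_derivative_works by (rule has_derivative_at_withinI)
    show "onorm (frechet_derivative V (at x)) \<le> B 1 + B 2"
    proof (rule onorm_le)
      fix v :: "real^2"
      have "norm (frechet_derivative V (at x) v) \<le>
        norm (v $ 1 *\<^sub>R frechet_derivative V (at x) (axis 1 1)) + norm (v $ 2 *\<^sub>R frechet_derivative V (at x) (axis 2 1))"
        unfolding linear_2[OF linear_frechet_derivative[OF d], of v] by (rule norm_triangle_ineq)
      also have "\<dots> \<le> norm v * B 1 + norm v * B 2"
        unfolding norm_scaleR
        by (intro add_mono mult_mono B[OF x]) (auto intro: component_le_norm_cart)
      finally show "norm (frechet_derivative V (at x) v) \<le> (B 1 + B 2) * norm v" by (simp add: algebra_simps)
    qed
  qed
  then show ?thesis by blast
qed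

locale vector_field_on_surface =
  fixes A :: "'a::t2_space chart set" and X :: "('a, real^2) comps"
  assumes surface: "oriented_surface A" and smooth_X: "smooth_comps A X"
    and X_change: "\<And>c d p. c \<in> A \<Longrightarrow> d \<in> A \<Longrightarrow> p \<in> cdom c \<Longrightarrow> p \<in> cdom d \<Longrightarrow> X d p = jac c d p *v X c p"
begin

lemma is_chart: "c \<in> A \<Longrightarrow> is_chart c" and cover: "\<exists>c\<in>A. p \<in> cdom c"
  using surface unfolding oriented_surface_def by blast+

lemma velocity_change:
  assumes c: "c \<in> A" "d \<in> A" and I: "open I" "continuous_on I \<sigma>" "t \<in> I"
    and t: "\<sigma> t \<in> cdom c" "\<sigma> t \<in> cdom d"
    and der: "((coord c \<circ> \<sigma>) has_vector_derivative v) (at t)"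
  shows "((coord d \<circ> \<sigma>) has_vector_derivative jac c d (\<sigma> t) *v v) (at t)"
proof -
  have "smooth_on (coord c ` (cdom c \<inter> cdom d)) (coord d \<circ> cinv c)"
    using surface c unfolding oriented_surface_def by blast
  then have d: "(coord d \<circ> cinv c) differentiable (at (coord c (\<sigma> t)))"
    by (rule smooth_on_differentiable) (use t in auto)
  have "(coord d \<circ> cinv c has_derivative (*v) (jac c d (\<sigma> t))) (at ((coord c \<circ> \<sigma>) t))"
  proof -
    have "(*v) (jac c d (\<sigma> t)) = frechet_derivative (coord d \<circ> cinv c) (at (coord c (\<sigma> t)))"
      unfolding jac_def
      by (rule ext, rule matrix_works[OF linear_matrix_vector_mul_eq[THEN iffD2, OF linear_frechet_derivative[OF d]]])
    then show ?thesis using d unfolding frechet_derivative_works by simp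
  qed
  from diff_chain_at[OF der[unfolded has_vector_derivative_def] this]
  have "((coord d \<circ> cinv c) \<circ> (coord c \<circ> \<sigma>) has_vector_derivative jac c d (\<sigma> t) *v v) (at t)"
    unfolding has_vector_derivative_def by (simp add: o_def matrix_vector_mult_scaleR)
  then show ?thesis
  proof (rule has_vector_derivative_transform_within_open)
    show "open (I \<inter> \<sigma> -` cdom c)"
      by (rule continuous_open_preimage[OF I(2,1) is_chartD(1)[OF is_chart[OF c(1)]]])
  qed (use I t is_chartD(3)[OF is_chart[OF c(1)]] in auto)
qed

text \<open>The definition ranges over all charts at each time. Velocity and X obey the same
  transformation law, so a single chart suffices.\<close>

lemma integral_curveI:
  assumes "open_interval I" "continuous_on I \<sigma>"
    and "\<And>t. t \<in> I \<Longrightarrow> \<exists>c\<in>A. \<sigma> t \<in> cdom c \<and> ((coord c \<circ> \<sigma>) has_vector_derivative X c (\<sigma> t)) (at t)"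
  shows "integral_curve A X I \<sigma>"
  unfolding integral_curve_def
proof (intro conjI ballI impI)
  fix d t assume d: "d \<in> A" "t \<in> I" "\<sigma> t \<in> cdom d"
  obtain c where c: "c \<in> A" "\<sigma> t \<in> cdom c" "((coord c \<circ> \<sigma>) has_vector_derivative X c (\<sigma> t)) (at t)"
    using assms(3)[OF d(2)] by blast
  have "open I" using assms(1) unfolding open_interval_def by blast
  from velocity_change[OF c(1) d(1) this assms(2) d(2) c(2) d(3) c(3)]
  show "((coord d \<circ> \<sigma>) has_vector_derivative X d (\<sigma> t)) (at t)"
    using X_change[OF c(1) d(1) c(2) d(3)] by simp
qed (use assms in auto)

lemma local_integral_curves:
  "\<exists>N \<delta>. open N \<and> p \<in> N \<and> \<delta> > 0 \<and> (\<forall>q\<in>N. \<exists>\<sigma>. \<sigma> 0 = q \<and> integral_curve A X {-\<delta><..<\<delta>} \<sigma>)"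
proof -
  obtain c where c: "c \<in> A" "p \<in> cdom c" using cover by blast
  note ch = is_chartD[OF is_chart[OF c(1)]]
  define V where "V = X c \<circ> cinv c"
  have sV: "smooth_on (coord c ` cdom c) V" using smooth_X c unfolding smooth_comps_def V_def by blast
  obtain R where R: "R > 0" "cball (coord c p) R \<subseteq> coord c ` cdom c"
    using ch(2) c(2) open_contains_cball by blast
  obtain L where L: "\<And>x y. x \<in> cball (coord c p) R \<Longrightarrow> y \<in> cball (coord c p) R \<Longrightarrow> norm (V x - V y) \<le> L * norm (x - y)"
    using smooth_on_lipschitz[OF sV R(2)] by blast
  obtain \<delta> where \<delta>: "\<delta> > 0" "\<And>y. y\<in>cball (coord c p) (R/2) \<Longrightarrow> \<exists>g. g 0 = y \<and>
      (\<forall>t. \<bar>t\<bar> < \<delta> \<longrightarrow> g t \<in> cball (coord c p) R \<and> (g has_vector_derivative V (g t)) (at t))"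
    using picard_lindelof_local[OF R(1) L] by blast
  have R2: "ball (coord c p) (R/2) \<subseteq> coord c ` cdom c" using R by (auto simp: subset_eq)
  define N where "N = cinv c ` ball (coord c p) (R/2)"
  have "open N" "p \<in> N" "N \<subseteq> cdom c"
    unfolding N_def using chart_nbhd[OF is_chart[OF c(1)] _ R2 c(2)] R(1) by simp_all
  moreover have "\<exists>\<sigma>. \<sigma> 0 = q \<and> integral_curve A X {-\<delta><..<\<delta>} \<sigma>" if q: "q \<in> N" for q
  proof -
    have "coord c q \<in> ball (coord c p) (R/2)" using q R2 ch(4) unfolding N_def by auto
    then obtain g where g: "g 0 = coord c q"
      "\<And>t. \<bar>t\<bar> < \<delta> \<Longrightarrow> g t \<in> cball (coord c p) R \<and> (g has_vector_derivative V (g t)) (at t)"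
      using \<delta>(2)[of "coord c q"] by auto
    define \<sigma> where "\<sigma> = cinv c \<circ> g"
    have gU: "g t \<in> coord c ` cdom c" if "t \<in> {-\<delta><..<\<delta>}" for t using g(2)[of t] that R(2) by (auto simp: abs_less_iff)
    have cg: "continuous_on {-\<delta><..<\<delta>} g"
    proof (rule continuous_at_imp_continuous_on, rule ballI)
      fix t assume "t \<in> {-\<delta><..<\<delta>}"
      then have "\<bar>t\<bar> < \<delta>" by (simp add: abs_less_iff)
      then show "isCont g t" using g(2) has_vector_derivative_continuous by blast
    qed
    have "integral_curve A X {-\<delta><..<\<delta>} \<sigma>"
    proof (rule integral_curveI)
      show "open_interval {-\<delta><..<\<delta>}" unfolding open_interval_def using \<delta>(1) by (auto simp: is_interval_oo)
      show "continuous_on {-\<delta><..<\<delta>} \<sigma>" unfolding \<sigma>_def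
        by (rule continuous_on_compose[OF cg continuous_on_subset[OF ch(7)]]) (use gU in auto)
      fix t assume t: "t \<in> {-\<delta><..<\<delta>}"
      have "(g has_vector_derivative X c (\<sigma> t)) (at t)"
        using g(2)[of t] t unfolding \<sigma>_def V_def by (simp add: abs_less_iff)
      then have "((coord c \<circ> \<sigma>) has_vector_derivative X c (\<sigma> t)) (at t)"
        by (rule has_vector_derivative_transform_within_open[of _ _ _ "{-\<delta><..<\<delta>}"])
          (use t gU ch(4) in \<open>auto simp: \<sigma>_def\<close>)
      then show "\<exists>c\<in>A. \<sigma> t \<in> cdom c \<and> ((coord c \<circ> \<sigma>) has_vector_derivative X c (\<sigma> t)) (at t)"
        using c(1) gU[OF t] ch(5) unfolding \<sigma>_def by auto
    qed
    moreover have "\<sigma> 0 = q" unfolding \<sigma>_def using g(1) ch(3) q \<open>N \<subseteq> cdom c\<close> by auto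
    ultimately show ?thesis by blast
  qed
  ultimately show ?thesis using \<delta>(1) by blast
qed

lemma integral_curve_subset:
  assumes "integral_curve A X I \<sigma>" "open_interval K" "K \<subseteq> I"
  shows "integral_curve A X K \<sigma>"
  using assms unfolding integral_curve_def by (auto intro: continuous_on_subset)

lemma integral_curve_shift:
  assumes "integral_curve A X {a<..<b} \<sigma>"
  shows "integral_curve A X {a + s<..<b + s} (\<lambda>t. \<sigma> (t - s))"
  unfolding integral_curve_def
proof (intro conjI ballI impI)
  have i: "open_interval {a<..<b}" "continuous_on {a<..<b} \<sigma>" using assms unfolding integral_curve_def by auto
  then have "a < b" unfolding open_interval_def by auto
  then show "open_interval {a + s<..<b + s}" unfolding open_interval_def by (auto simp: is_interval_oo)
  show "continuous_on {a + s<..<b + s} (\<lambda>t. \<sigma> (t - s))"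
    by (rule continuous_on_compose2[OF i(2)]) (auto intro!: continuous_intros)
  fix c t assume "c \<in> A" "t \<in> {a + s<..<b + s}" "\<sigma> (t - s) \<in> cdom c"
  then have d: "((coord c \<circ> \<sigma>) has_vector_derivative X c (\<sigma> (t - s))) (at (t - s))"
    using assms unfolding integral_curve_def by auto
  have "((\<lambda>t. t - s) has_vector_derivative 1) (at t)" by (auto intro!: derivative_eq_intros)
  from vector_diff_chain_at[OF this d]
  show "((coord c \<circ> (\<lambda>t. \<sigma> (t - s))) has_vector_derivative X c (\<sigma> (t - s))) (at t)"
    by (simp add: o_def)
qed

text \<open>Compactness turns the locally uniform life spans into one, the minimum over a finite
  subcover.\<close>

lemma uniform_integral_curves:
  assumes "compact (UNIV :: 'a set)"
  shows "\<exists>\<delta>>0. \<forall>q. \<exists>\<sigma>. \<sigma> 0 = q \<and> integral_curve A X {-\<delta><..<\<delta>} \<sigma>"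
proof -
  obtain N \<delta> where N: "\<And>p. open (N p) \<and> p \<in> N p \<and> \<delta> p > 0 \<and>
      (\<forall>q\<in>N p. \<exists>\<sigma>. \<sigma> 0 = q \<and> integral_curve A X {-\<delta> p<..<\<delta> p} \<sigma>)"
    using local_integral_curves by metis
  have No: "open (N p)" "p \<in> N p" "\<delta> p > 0" for p using N[of p] by simp_all
  have N\<sigma>: "\<exists>\<sigma>. \<sigma> 0 = q \<and> integral_curve A X {-\<delta> p<..<\<delta> p} \<sigma>" if "q \<in> N p" for p q
    using N[of p] that by simp
  have "UNIV \<subseteq> (\<Union>p\<in>UNIV. N p)" using No(2) by auto
  then obtain F where F: "finite F" "UNIV \<subseteq> (\<Union>p\<in>F. N p)"
    using compactE_image[OF assms, of UNIV N] No(1) by metis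
  have ne: "F \<noteq> {}" using F(2) by auto
  define e where "e = Min (\<delta> ` F)"
  have e: "e > 0" "\<And>p. p \<in> F \<Longrightarrow> e \<le> \<delta> p" unfolding e_def using F(1) ne No(3) by auto
  have "\<exists>\<sigma>. \<sigma> 0 = q \<and> integral_curve A X {-e<..<e} \<sigma>" for q
  proof -
    obtain p where p: "p \<in> F" "q \<in> N p" using F(2) by blast
    then obtain \<sigma> where "\<sigma> 0 = q" "integral_curve A X {-\<delta> p<..<\<delta> p} \<sigma>" using N\<sigma> by blast
    moreover have "open_interval {-e<..<e}" unfolding open_interval_def using e(1) by (auto simp: is_interval_oo)
    ultimately show ?thesis using integral_curve_subset[of "{-\<delta> p<..<\<delta> p}" \<sigma> "{-e<..<e}"] e(2)[OF p(1)] by force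
  qed
  then show ?thesis using e(1) by blast
qed

lemma has_vector_derivative_split:
  fixes f :: "real \<Rightarrow> 'b::real_normed_vector"
  assumes "(f has_vector_derivative v) (at t within {..t})" "(f has_vector_derivative v) (at t within {t..})"
  shows "(f has_vector_derivative v) (at t)"
proof -
  have u: "{..t} \<union> {t..} = UNIV" by auto
  show ?thesis using assms unfolding has_vector_derivative_def has_derivative_within
    by (intro conjI; elim conjE) (assumption, rule Lim_Un_univ[OF _ _ u])
qed

text \<open>The two pieces have the same value at t and solve the same equation, so the one-sided
  derivatives of the joined curve agree.\<close>

lemma glue_curves:
  assumes \<sigma>1: "integral_curve A X {t-\<epsilon><..<t+\<epsilon>} \<sigma>1" and \<sigma>2: "integral_curve A X {t-\<epsilon><..<t+\<epsilon>} \<sigma>2"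
    and eq1: "\<And>s. s \<in> {t-\<epsilon><..t} \<Longrightarrow> \<sigma> s = \<sigma>1 s" and eq2: "\<And>s. s \<in> {t..<t+\<epsilon>} \<Longrightarrow> \<sigma> s = \<sigma>2 s"
  shows "isCont \<sigma> t" "\<exists>c\<in>A. \<sigma> t \<in> cdom c \<and> ((coord c \<circ> \<sigma>) has_vector_derivative X c (\<sigma> t)) (at t)"
proof -
  have e: "\<epsilon> > 0" using \<sigma>1 unfolding integral_curve_def open_interval_def by auto
  then have t: "\<sigma> t = \<sigma>1 t" "\<sigma> t = \<sigma>2 t" using eq1[of t] eq2[of t] by auto
  have c1: "isCont \<sigma>1 t" and c2: "isCont \<sigma>2 t"
    using \<sigma>1 \<sigma>2 e unfolding integral_curve_def by (auto simp: continuous_on_eq_continuous_at)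
  have "continuous (at t within {..t}) \<sigma>"
    by (rule continuous_transform_within[OF continuous_at_imp_continuous_at_within[OF c1] e])
      (use eq1 in \<open>auto simp: dist_real_def\<close>)
  moreover have "continuous (at t within {t..}) \<sigma>"
    by (rule continuous_transform_within[OF continuous_at_imp_continuous_at_within[OF c2] e])
      (use eq2 in \<open>auto simp: dist_real_def\<close>)
  moreover have u: "{..t} \<union> {t..} = UNIV" by auto
  ultimately show "isCont \<sigma> t" unfolding continuous_within by (intro Lim_Un_univ[OF _ _ u])
  obtain c where c: "c \<in> A" "\<sigma> t \<in> cdom c" using cover by blast
  have tI: "t \<in> {t-\<epsilon><..<t+\<epsilon>}" using e by simp
  have d1: "((coord c \<circ> \<sigma>1) has_vector_derivative X c (\<sigma> t)) (at t)"
    using \<sigma>1 c tI unfolding integral_curve_def t(1) by blast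
  have d2: "((coord c \<circ> \<sigma>2) has_vector_derivative X c (\<sigma> t)) (at t)"
    using \<sigma>2 c tI unfolding integral_curve_def t(2) by blast
  have "((coord c \<circ> \<sigma>) has_vector_derivative X c (\<sigma> t)) (at t within {..t})"
    by (rule has_vector_derivative_transform_within[OF has_vector_derivative_at_within[OF d1] e])
      (use eq1 in \<open>auto simp: dist_real_def\<close>)
  moreover have "((coord c \<circ> \<sigma>) has_vector_derivative X c (\<sigma> t)) (at t within {t..})"
    by (rule has_vector_derivative_transform_within[OF has_vector_derivative_at_within[OF d2] e])
      (use eq2 in \<open>auto simp: dist_real_def\<close>)
  ultimately show "\<exists>c\<in>A. \<sigma> t \<in> cdom c \<and> ((coord c \<circ> \<sigma>) has_vector_derivative X c (\<sigma> t)) (at t)"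
    using has_vector_derivative_split c by blast
qed

text \<open>Steps of a fixed length \<open>\<tau>\<close> are concatenated in both directions.
  \<open>P k\<close> is the position reached at time k \<tau>.\<close>

lemma complete_integral_curve:
  assumes "compact (UNIV :: 'a set)"
  shows "\<exists>\<sigma>. \<sigma> 0 = p \<and> integral_curve A X UNIV \<sigma>"
proof -
  obtain \<delta> \<Phi> where \<delta>: "\<delta> > 0" and \<Phi>: "\<And>q. \<Phi> q 0 = q" "\<And>q. integral_curve A X {-\<delta><..<\<delta>} (\<Phi> q)"
    using uniform_integral_curves[OF assms] by metis
  \<comment> \<open>Half of the life span, so that every piece extends past both ends of its step
    and is differentiable there.\<close>
  define \<tau> where "\<tau> = \<delta> / 2"
  have \<tau>: "\<tau> > 0" "\<delta> = 2 * \<tau>" unfolding \<tau>_def using \<delta> by auto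
  define P where "P = (\<lambda>k::int. if k \<ge> 0 then ((\<lambda>q. \<Phi> q \<tau>) ^^ nat k) p else ((\<lambda>q. \<Phi> q (- \<tau>)) ^^ nat (- k)) p)"
  \<comment> \<open>Each step is launched from its end nearer to time 0: the left end
    \<open>P k\<close> for k \<ge> 0, the right end \<open>P (k + 1)\<close> for k < 0.\<close>
  define piece where "piece = (\<lambda>(k::int) t. if k \<ge> 0 then \<Phi> (P k) (t - of_int k * \<tau>) else \<Phi> (P (k + 1)) (t - (of_int k + 1) * \<tau>))"
  have P_pos: "P (k + 1) = \<Phi> (P k) \<tau>" if "k \<ge> 0" for k
    using that unfolding P_def by (simp add: nat_add_distrib)
  have P_neg: "P k = \<Phi> (P (k + 1)) (- \<tau>)" if "k < 0" for k
  proof -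
    have n: "nat (- k) = Suc (nat (- (k + 1)))" using that by auto
    have "P (k + 1) = ((\<lambda>q. \<Phi> q (- \<tau>)) ^^ nat (- (k + 1))) p"
    proof (cases "k + 1 = 0")
      case True
      then show ?thesis unfolding P_def by simp
    next
      case False
      then show ?thesis using that unfolding P_def by simp
    qed
    moreover have "P k = ((\<lambda>q. \<Phi> q (- \<tau>)) ^^ nat (- k)) p" using that unfolding P_def by simp
    ultimately show ?thesis unfolding n by simp
  qed
  have ends: "piece k (of_int k * \<tau>) = P k" "piece k ((of_int k + 1) * \<tau>) = P (k + 1)" for k
    using \<Phi>(1) P_pos[of k] P_neg[of k] unfolding piece_def by (simp_all add: algebra_simps)
  have pc: "integral_curve A X {of_int k * \<tau> - \<tau><..<of_int k * \<tau> + 2 * \<tau>} (piece k)" for k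
  proof (cases "k \<ge> 0")
    case True
    have "integral_curve A X {-\<delta> + of_int k * \<tau><..<\<delta> + of_int k * \<tau>} (piece k)"
      using integral_curve_shift[OF \<Phi>(2), of "of_int k * \<tau>" "P k"] True unfolding piece_def by simp
    then show ?thesis
      by (rule integral_curve_subset) (use \<tau> in \<open>auto simp: open_interval_def is_interval_oo\<close>)
  next
    case False
    have "integral_curve A X {-\<delta> + (of_int k + 1) * \<tau><..<\<delta> + (of_int k + 1) * \<tau>} (piece k)"
      using integral_curve_shift[OF \<Phi>(2), of "(of_int k + 1) * \<tau>" "P (k + 1)"] False unfolding piece_def by simp
    then show ?thesis
      by (rule integral_curve_subset) (use \<tau> in \<open>auto simp: open_interval_def is_interval_oo algebra_simps\<close>)
  qed
  define \<sigma> where "\<sigma> = (\<lambda>t. piece \<lfloor>t / \<tau>\<rfloor> t)"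
  have \<sigma>_piece: "\<sigma> t = piece k t" if "of_int k * \<tau> \<le> t" "t \<le> (of_int k + 1) * \<tau>" for k t
  proof (cases "t = (of_int k + 1) * \<tau>")
    case True
    then have "\<lfloor>t / \<tau>\<rfloor> = k + 1" using \<tau>(1) by simp
    moreover have "t = of_int (k + 1) * \<tau>" using True by simp
    ultimately show ?thesis using ends(1)[of "k + 1"] ends(2)[of k] True unfolding \<sigma>_def by metis
  next
    case False
    then have "t / \<tau> < of_int k + 1" "of_int k \<le> t / \<tau>"
      using that \<tau>(1) by (simp_all add: pos_divide_less_eq pos_le_divide_eq)
    then have "\<lfloor>t / \<tau>\<rfloor> = k" by (simp add: floor_eq_iff)
    then show ?thesis unfolding \<sigma>_def by simp
  qed
  have loc: "isCont \<sigma> t \<and> (\<exists>c\<in>A. \<sigma> t \<in> cdom c \<and> ((coord c \<circ> \<sigma>) has_vector_derivative X c (\<sigma> t)) (at t))" for t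
  proof -
    define k where "k = \<lfloor>t / \<tau>\<rfloor>"
    have k: "of_int k * \<tau> \<le> t" "t < (of_int k + 1) * \<tau>"
    proof -
      have "of_int k \<le> t / \<tau>" "t / \<tau> < of_int k + 1" unfolding k_def by linarith+
      then show "of_int k * \<tau> \<le> t" "t < (of_int k + 1) * \<tau>"
        using pos_le_divide_eq[OF \<tau>(1)] pos_divide_less_eq[OF \<tau>(1)] by blast+
    qed
    define \<epsilon> where "\<epsilon> = (if t = of_int k * \<tau> then \<tau> else min (t - of_int k * \<tau>) ((of_int k + 1) * \<tau> - t))"
    have \<epsilon>: "\<epsilon> > 0" "\<epsilon> \<le> \<tau>" "t + \<epsilon> \<le> (of_int k + 1) * \<tau>"
      unfolding \<epsilon>_def using k \<tau>(1) by (auto simp: algebra_simps min_def)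
    \<comment> \<open>At a break point k \<tau> the piece on the left has index k - 1; elsewhere
      both sides belong to the same piece.\<close>
    define l where "l = (if t = of_int k * \<tau> then k - 1 else k)"
    have l1: "t - \<epsilon> \<ge> of_int l * \<tau>" "t \<le> (of_int l + 1) * \<tau>"
      unfolding \<epsilon>_def l_def using k by (auto simp: algebra_simps)
    have oi: "open_interval {t - \<epsilon><..<t + \<epsilon>}" using \<epsilon>(1) by (auto simp: open_interval_def is_interval_oo)
    have "integral_curve A X {t - \<epsilon><..<t + \<epsilon>} (piece k)"
      by (rule integral_curve_subset[OF pc oi]) (use k \<epsilon> in \<open>auto simp: algebra_simps\<close>)
    moreover have "integral_curve A X {t - \<epsilon><..<t + \<epsilon>} (piece l)"
      by (rule integral_curve_subset[OF pc oi]) (use l1 \<epsilon> in \<open>auto simp: algebra_simps\<close>)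
    moreover have "\<sigma> s = piece l s" if "s \<in> {t-\<epsilon><..t}" for s
      by (rule \<sigma>_piece) (use that l1 in auto)
    moreover have "\<sigma> s = piece k s" if "s \<in> {t..<t+\<epsilon>}" for s
      by (rule \<sigma>_piece) (use that k \<epsilon> in auto)
    ultimately show ?thesis using glue_curves[of t \<epsilon> "piece l" "piece k" \<sigma>] by blast
  qed
  have "integral_curve A X UNIV \<sigma>"
    by (rule integral_curveI) (use loc in \<open>auto simp: open_interval_def continuous_at_imp_continuous_on\<close>)
  moreover have "\<sigma> 0 = p"
  proof -
    have "\<sigma> 0 = P 0" using ends(1)[of 0] unfolding \<sigma>_def by simp
    then show ?thesis unfolding P_def by simp
  qed
  ultimately show ?thesis by blast
qed

end

section \<open>The dual of the Faraday primitive is a Killing field\<close>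

context metric_jet
begin

lemma g_pos: "p \<in> cdom c \<Longrightarrow> g p > 0"
proof -
  assume p: "p \<in> cdom c"
  have "e p * g p = W p * W p + f p * f p" using W_sq[OF p] by simp
  also have "\<dots> > 0" using W_pos[OF p] by (intro add_pos_nonneg mult_pos_pos) auto
  finally show "g p > 0" using e_pos[OF p] by (simp add: zero_less_mult_iff)
qed

lemma smooth_over_W [simp]: "chart_smooth c k \<Longrightarrow> chart_smooth c (\<lambda>q. k q / W q)"
  by (rule chart_smooth_divide[OF chart]) (use W_pos in force)+

text \<open>\<open>strong_maximum_surface\<close> speaks of operators in non-divergence form, while
  \<open>lap\<close> is defined as a divergence.\<close>

lemma lap_expand:
  assumes \<phi>: "chart_smooth c \<phi>" and p: "p \<in> cdom c"
  shows "lap \<phi> p = (g p / W p) * pd c 1 (pd c 1 \<phi>) p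
     + (- f p / W p) * (pd c 1 (pd c 2 \<phi>) p + pd c 2 (pd c 1 \<phi>) p) + (e p / W p) * pd c 2 (pd c 2 \<phi>) p
     + (pd c 1 (\<lambda>q. g q / W q) p - pd c 2 (\<lambda>q. f q / W q) p) * pd c 1 \<phi> p
     + (pd c 2 (\<lambda>q. e q / W q) p - pd c 1 (\<lambda>q. f q / W q) p) * pd c 2 \<phi> p"
proof -
  have fl: "flux1 \<phi> = (\<lambda>q. (g q / W q) * pd c 1 \<phi> q - (f q / W q) * pd c 2 \<phi> q)"
    "flux2 \<phi> = (\<lambda>q. (e q / W q) * pd c 2 \<phi> q - (f q / W q) * pd c 1 \<phi> q)"
    unfolding flux1_def[abs_def] flux2_def[abs_def] by (simp_all add: diff_divide_distrib)
  have s: "chart_smooth c (\<lambda>q. (k q / W q) * pd c i \<phi> q)" if "chart_smooth c k" for k i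
    using that \<phi> by (intro chart_smooth_mult[OF chart] smooth_over_W chart_smooth_pd[OF chart])
  have m: "pd c j (\<lambda>q. (k q / W q) * pd c i \<phi> q) p = (k p / W p) * pd c j (pd c i \<phi>) p + pd c j (\<lambda>q. k q / W q) p * pd c i \<phi> p"
    if "chart_smooth c k" for k i j
    by (rule pd_mult[OF chart smooth_over_W[OF that] chart_smooth_pd[OF chart \<phi>] p])
  show ?thesis unfolding lap_def fl
    unfolding pd_diff[OF chart s[OF smooth(3)] s[OF smooth(2)] p] pd_diff[OF chart s[OF smooth(1)] s[OF smooth(2)] p]
      m[OF smooth(1)] m[OF smooth(2)] m[OF smooth(3)]
    by (simp add: algebra_simps)
qed

text \<open>The components of J X, once \<open>J_eq\<close> has made J explicit.\<close>

definition "T1 q = - x2 q / W q"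
definition "T2 q = x1 q / W q"

text \<open>Here D_V X = - (F / 4) J V for every V. Taking V = X gives the first two equations. As J
  is parallel, D_{JX} (JX) = J (D_{JX} X) = (F / 4) J X, which gives the other two.\<close>

lemma killing_accelerations:
  assumes p: "p \<in> cdom c" and K: "\<forall>q\<in>cdom c. trNN q + F q * F q / 8 = 0"
  shows "Y1 p = - F p / 4 * T1 p" "Y2 p = - F p / 4 * T2 p"
    "T1 p * pd c 1 T1 p + T2 p * pd c 2 T1 p + (A1 p * T1 p * T1 p + 2 * B1 p * T1 p * T2 p + C1 p * T2 p * T2 p) = F p / 4 * T1 p"
    "T1 p * pd c 1 T2 p + T2 p * pd c 2 T2 p + (A2 p * T1 p * T1 p + 2 * B2 p * T1 p * T2 p + C2 p * T2 p * T2 p) = F p / 4 * T2 p"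
proof -
  have w: "W p \<noteq> 0" using W_pos[OF p] by simp
  then have ww: "W p * W p \<noteq> 0" by simp
  have W0: "q \<in> cdom c \<Longrightarrow> W q \<noteq> 0" for q using W_pos[of q] by simp
  note k = killing_consequences[OF p K]
  have B: "e p * N11 p + f p * N12 p = 0" "f p * N11 p + g p * N12 p = - F p * W p / 4"
    "e p * N21 p + f p * N22 p = F p * W p / 4" "f p * N21 p + g p * N22 p = 0"
    using k(1-4) pd_x[OF p] by linarith+
  have Zx: "x2 p = - W p * T1 p" "x1 p = W p * T2 p" unfolding T1_def T2_def using w by simp_all
  have "(W p * W p) * Y1 p = (W p * W p) * (- F p / 4 * T1 p)" "(W p * W p) * Y2 p = (W p * W p) * (- F p / 4 * T2 p)"
  proof -
    have "(W p * W p) * Y1 p = g p * (X1 p * (e p * N11 p + f p * N12 p) + X2 p * (e p * N21 p + f p * N22 p))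
       - f p * (X1 p * (f p * N11 p + g p * N12 p) + X2 p * (f p * N21 p + g p * N22 p))"
      unfolding W_sq[OF p] Y1_def by (simp add: algebra_simps)
    also have "\<dots> = F p * W p / 4 * x2 p" unfolding B x2_def by (simp add: algebra_simps)
    finally show "(W p * W p) * Y1 p = (W p * W p) * (- F p / 4 * T1 p)" unfolding Zx by simp
    have "(W p * W p) * Y2 p = e p * (X1 p * (f p * N11 p + g p * N12 p) + X2 p * (f p * N21 p + g p * N22 p))
       - f p * (X1 p * (e p * N11 p + f p * N12 p) + X2 p * (e p * N21 p + f p * N22 p))"
      unfolding W_sq[OF p] Y2_def by (simp add: algebra_simps)
    also have "\<dots> = - F p * W p / 4 * x1 p" unfolding B x1_def by (simp add: algebra_simps)
    finally show "(W p * W p) * Y2 p = (W p * W p) * (- F p / 4 * T2 p)" unfolding Zx by simp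
  qed
  then show "Y1 p = - F p / 4 * T1 p" "Y2 p = - F p / 4 * T2 p" using mult_left_cancel[OF ww] by blast+
  have dZ: "pd c i T1 p = - (pd c i x2 p * W p - x2 p * pd c i W p) / (W p * W p)"
    "pd c i T2 p = (pd c i x1 p * W p - x1 p * pd c i W p) / (W p * W p)" for i
  proof -
    have "pd c i T1 p = (pd c i (\<lambda>q. - x2 q) p * W p - (- x2 p) * pd c i W p) / (W p)\<^sup>2"
      unfolding T1_def[abs_def] by (rule pd_divide[OF chart chart_smooth_minus[OF chart smooth_x(2)] smooth(4) p W0])
    then show "pd c i T1 p = - (pd c i x2 p * W p - x2 p * pd c i W p) / (W p * W p)"
      unfolding pd_minus[OF chart smooth_x(2) p] power2_eq_square by simp
    have "pd c i T2 p = (pd c i x1 p * W p - x1 p * pd c i W p) / (W p)\<^sup>2"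
      unfolding T2_def[abs_def] by (rule pd_divide[OF chart smooth_x(1) smooth(4) p W0])
    then show "pd c i T2 p = (pd c i x1 p * W p - x1 p * pd c i W p) / (W p * W p)"
      unfolding power2_eq_square .
  qed
  have red: "(w * w * a) / (w * w) = a" if "w \<noteq> 0" for w a :: real using that by simp
  have "pd c 1 T1 p = (W p * W p * (F p / 4 - A1 p * T1 p - B1 p * T2 p)) / (W p * W p)"
    "pd c 2 T1 p = (W p * W p * (- B1 p * T1 p - C1 p * T2 p)) / (W p * W p)"
    "pd c 1 T2 p = (W p * W p * (- A2 p * T1 p - B2 p * T2 p)) / (W p * W p)"
    "pd c 2 T2 p = (W p * W p * (F p / 4 - B2 p * T1 p - C2 p * T2 p)) / (W p * W p)"
    unfolding dZ k(1-4) pd_W[OF p] unfolding Zx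
    by (intro arg_cong[where f = "\<lambda>x. x / (W p * W p)"]; simp add: algebra_simps)+
  note d = this[unfolded red[OF w]]
  show "T1 p * pd c 1 T1 p + T2 p * pd c 2 T1 p + (A1 p * T1 p * T1 p + 2 * B1 p * T1 p * T2 p + C1 p * T2 p * T2 p) = F p / 4 * T1 p"
    "T1 p * pd c 1 T2 p + T2 p * pd c 2 T2 p + (A2 p * T1 p * T1 p + 2 * B2 p * T1 p * T2 p + C2 p * T2 p * T2 p) = F p / 4 * T2 p"
    unfolding d by (simp_all add: algebra_simps)
qed

end

locale compact_gauduchon_setting = gauduchon_setting +
  assumes compact: "compact (UNIV :: 'a set)"
begin

abbreviation "JX \<equiv> \<lambda>c p. J c p *v X c p"
abbreviation "usq c q \<equiv> \<gamma> c q \<bullet> X c q"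

lemma smooth_J: "c \<in> A \<Longrightarrow> chart_smooth c (\<lambda>q. J c q $ i $ j)"
  using J smooth_comps_2[OF _ _ chart] unfolding complex_structure_def endo_field_def by blast

text \<open>The local inequality becomes rigidity here, and the list collects what the study of the
  curves uses: besides du and X(F) = 0, the accelerations of X and of J X, and the growth rate of
  |\<gamma>|^2 along J X.\<close>

lemma killing:
  assumes c: "c \<in> A" and p: "p \<in> cdom c"
  shows
    "pd c 1 (\<lambda>q. \<gamma> c q $ 2) p - pd c 2 (\<lambda>q. \<gamma> c q $ 1) p = - Fc c p * W c p / 2"
    "pd c 1 (usq c) p = - Fc c p * W c p * X c p $ 2 / 2" "pd c 2 (usq c) p = Fc c p * W c p * X c p $ 1 / 2"
    "X c p $ 1 * pd c 1 (Fc c) p + X c p $ 2 * pd c 2 (Fc c) p = 0"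
    "(\<Sum>i\<in>UNIV. X c p $ i * pd c i (\<lambda>q. X c q $ k) p) + (\<Sum>i\<in>UNIV. \<Sum>j\<in>UNIV. D c p $ k $ i $ j * X c p $ i * X c p $ j)
      = - Fc c p / 4 * JX c p $ k"
    "(\<Sum>i\<in>UNIV. JX c p $ i * pd c i (\<lambda>q. JX c q $ k) p) + (\<Sum>i\<in>UNIV. \<Sum>j\<in>UNIV. D c p $ k $ i $ j * JX c p $ i * JX c p $ j)
      = Fc c p / 4 * JX c p $ k"
    "JX c p $ 1 * pd c 1 (usq c) p + JX c p $ 2 * pd c 2 (usq c) p = Fc c p / 2 * usq c p"
    "usq c p \<ge> 0" "usq c p = 0 \<Longrightarrow> X c p = 0" "chart_smooth c (usq c)"
proof -
  have jet: "einstein_jet b (\<lambda>q. h b q $ 1 $ 1) (\<lambda>q. h b q $ 1 $ 2) (\<lambda>q. h b q $ 2 $ 2) (W b)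
    (\<lambda>q. D b q $ 1 $ 1 $ 1) (\<lambda>q. D b q $ 2 $ 1 $ 1) (\<lambda>q. D b q $ 1 $ 1 $ 2) (\<lambda>q. D b q $ 2 $ 1 $ 2)
    (\<lambda>q. D b q $ 1 $ 2 $ 2) (\<lambda>q. D b q $ 2 $ 2 $ 2) (\<lambda>q. X b q $ 1) (\<lambda>q. X b q $ 2) (Fc b)
    (\<lambda>q. \<pi> b q 1 1 1) (\<lambda>q. \<pi> b q 2 1 1) (\<lambda>q. \<pi> b q 1 1 2) (\<lambda>q. \<pi> b q 2 1 2) (\<lambda>q. \<pi> b q 1 2 2) (\<lambda>q. \<pi> b q 2 2 2) (Rc b)"
    if "b \<in> A" for b by (rule einstein_jet_c[OF that])
  \<comment> \<open>\<open>Rc\<close> is given chart by chart. A chart is chosen at each point to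
    obtain one function on the surface, and \<open>scalar_change\<close> shows that the choice has
    no influence.\<close>
  define \<phi> where "\<phi> = (\<lambda>q. 4 * sq_norm A h \<gamma> q - Rc (SOME b. b \<in> A \<and> q \<in> cdom b) q)"
  have \<phi>: "\<phi> q = 4 * usq b q - Rc b q" if b: "b \<in> A" "q \<in> cdom b" for b q
  proof -
    have "(SOME b. b \<in> A \<and> q \<in> cdom b) \<in> A \<and> q \<in> cdom (SOME b. b \<in> A \<and> q \<in> cdom b)"
      by (rule someI[of "\<lambda>b. b \<in> A \<and> q \<in> cdom b" b]) (use b in simp)
    then have "Rc (SOME b. b \<in> A \<and> q \<in> cdom b) q = Rc b q" using scalar_change b by blast
    then show ?thesis unfolding \<phi>_def sq_norm_eq[OF b] by simp
  qed
  have \<phi>0: "pd b i \<phi> q = 0" if b: "b \<in> A" "q \<in> cdom b" for b q i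
  proof (rule strong_maximum_surface[OF surface compact _ _ b])
    fix c assume c: "c \<in> A"
    interpret E: einstein_jet c "\<lambda>q. h c q $ 1 $ 1" "\<lambda>q. h c q $ 1 $ 2" "\<lambda>q. h c q $ 2 $ 2" "W c"
      "\<lambda>q. D c q $ 1 $ 1 $ 1" "\<lambda>q. D c q $ 2 $ 1 $ 1" "\<lambda>q. D c q $ 1 $ 1 $ 2" "\<lambda>q. D c q $ 2 $ 1 $ 2"
      "\<lambda>q. D c q $ 1 $ 2 $ 2" "\<lambda>q. D c q $ 2 $ 2 $ 2" "\<lambda>q. X c q $ 1" "\<lambda>q. X c q $ 2" "Fc c"
      "\<lambda>q. \<pi> c q 1 1 1" "\<lambda>q. \<pi> c q 2 1 1" "\<lambda>q. \<pi> c q 1 1 2" "\<lambda>q. \<pi> c q 2 1 2" "\<lambda>q. \<pi> c q 1 2 2" "\<lambda>q. \<pi> c q 2 2 2" "Rc c"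
      by (rule jet[OF c])
    have \<phi>E: "\<phi> q = 4 * E.u q - Rc c q" if q: "q \<in> cdom c" for q
      unfolding \<phi>[OF c q] E.u_def E.x1_def E.x2_def inner_vec_def sum_2 X_eq(3,4)[OF c q] by simp
    have sm: "chart_smooth c (\<lambda>q. 4 * E.u q - Rc c q)"
      by (intro chart_smooth_diff[OF chart[OF c]] chart_smooth_cmult[OF chart[OF c]] E.smooth_u smooth_Rc[OF c])
    show s\<phi>: "chart_smooth c \<phi>" by (rule chart_smooth_cong[OF chart[OF c], THEN iffD2, OF _ sm]) (rule \<phi>E)
    have lap: "E.lap \<phi> q \<ge> 0" if q: "q \<in> cdom c" for q
    proof -
      have p1: "pd c i \<phi> r = pd c i (\<lambda>q. 4 * E.u q - Rc c q) r" if "r \<in> cdom c" for i r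
        by (rule pd_cong[OF chart[OF c] that \<phi>E])
      have "E.lap \<phi> q = E.lap (\<lambda>q. 4 * E.u q - Rc c q) q"
        unfolding E.lap_def
        by (intro arg_cong2[where f = "(+)"]; rule pd_cong[OF chart[OF c] q]; simp only: E.flux1_def E.flux2_def p1)
      also have "\<dots> \<ge> 0"
        unfolding E.lap_potential[OF q]
        using W(1)[OF c q] E.sym_part(1)[OF q] E.u_nonneg(1)[OF q] E.Q_nonneg[OF q] by simp
      finally show ?thesis .
    qed
    note ov = E.smooth_over_W[OF E.smooth(1)] E.smooth_over_W[OF E.smooth(2)] E.smooth_over_W[OF E.smooth(3)]
    show "\<exists>a11 a12 a22 b1 b2. chart_smooth c a11 \<and> chart_smooth c a12 \<and> chart_smooth c a22
      \<and> chart_smooth c b1 \<and> chart_smooth c b2 \<and> (\<forall>p\<in>cdom c. a11 p > 0 \<and> a11 p * a22 p - a12 p * a12 p > 0 \<and>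
        a11 p * pd c 1 (pd c 1 \<phi>) p + a12 p * (pd c 1 (pd c 2 \<phi>) p + pd c 2 (pd c 1 \<phi>) p)
        + a22 p * pd c 2 (pd c 2 \<phi>) p + b1 p * pd c 1 \<phi> p + b2 p * pd c 2 \<phi> p \<ge> 0)"
    proof (rule exI[of _ "\<lambda>q. h c q $ 2 $ 2 / W c q"], rule exI[of _ "\<lambda>q. - h c q $ 1 $ 2 / W c q"],
        rule exI[of _ "\<lambda>q. h c q $ 1 $ 1 / W c q"],
        rule exI[of _ "\<lambda>q. pd c 1 (\<lambda>q. h c q $ 2 $ 2 / W c q) q - pd c 2 (\<lambda>q. h c q $ 1 $ 2 / W c q) q"],
        rule exI[of _ "\<lambda>q. pd c 2 (\<lambda>q. h c q $ 1 $ 1 / W c q) q - pd c 1 (\<lambda>q. h c q $ 1 $ 2 / W c q) q"],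
        intro conjI ballI)
      show "chart_smooth c (\<lambda>q. h c q $ 2 $ 2 / W c q)" "chart_smooth c (\<lambda>q. h c q $ 1 $ 1 / W c q)" by (rule ov)+
      show "chart_smooth c (\<lambda>q. - h c q $ 1 $ 2 / W c q)" using chart_smooth_minus[OF chart[OF c] ov(2)] by simp
      show "chart_smooth c (\<lambda>q. pd c 1 (\<lambda>q. h c q $ 2 $ 2 / W c q) q - pd c 2 (\<lambda>q. h c q $ 1 $ 2 / W c q) q)"
        "chart_smooth c (\<lambda>q. pd c 2 (\<lambda>q. h c q $ 1 $ 1 / W c q) q - pd c 1 (\<lambda>q. h c q $ 1 $ 2 / W c q) q)"
        by (intro chart_smooth_diff[OF chart[OF c]] chart_smooth_pd[OF chart[OF c]] ov)+
      fix q assume q: "q \<in> cdom c"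
      have w: "W c q > 0" by (rule W(1)[OF c q])
      show "h c q $ 2 $ 2 / W c q > 0" using E.g_pos[OF q] w by simp
      have "h c q $ 2 $ 2 / W c q * (h c q $ 1 $ 1 / W c q) - - h c q $ 1 $ 2 / W c q * (- h c q $ 1 $ 2 / W c q)
        = (h c q $ 1 $ 1 * h c q $ 2 $ 2 - h c q $ 1 $ 2 * h c q $ 1 $ 2) / (W c q * W c q)"
        by (simp add: diff_divide_distrib mult.commute)
      also have "\<dots> = 1" unfolding W(3)[OF c q, symmetric] using w by simp
      finally show "h c q $ 2 $ 2 / W c q * (h c q $ 1 $ 1 / W c q) - - h c q $ 1 $ 2 / W c q * (- h c q $ 1 $ 2 / W c q) > 0"
        by simp
      show "h c q $ 2 $ 2 / W c q * pd c 1 (pd c 1 \<phi>) q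
        + - h c q $ 1 $ 2 / W c q * (pd c 1 (pd c 2 \<phi>) q + pd c 2 (pd c 1 \<phi>) q)
        + h c q $ 1 $ 1 / W c q * pd c 2 (pd c 2 \<phi>) q
        + (pd c 1 (\<lambda>q. h c q $ 2 $ 2 / W c q) q - pd c 2 (\<lambda>q. h c q $ 1 $ 2 / W c q) q) * pd c 1 \<phi> q
        + (pd c 2 (\<lambda>q. h c q $ 1 $ 1 / W c q) q - pd c 1 (\<lambda>q. h c q $ 1 $ 2 / W c q) q) * pd c 2 \<phi> q \<ge> 0"
        using lap[OF q] unfolding E.lap_expand[OF s\<phi> q] .
    qed
  qed
  interpret E: einstein_jet c "\<lambda>q. h c q $ 1 $ 1" "\<lambda>q. h c q $ 1 $ 2" "\<lambda>q. h c q $ 2 $ 2" "W c"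
    "\<lambda>q. D c q $ 1 $ 1 $ 1" "\<lambda>q. D c q $ 2 $ 1 $ 1" "\<lambda>q. D c q $ 1 $ 1 $ 2" "\<lambda>q. D c q $ 2 $ 1 $ 2"
    "\<lambda>q. D c q $ 1 $ 2 $ 2" "\<lambda>q. D c q $ 2 $ 2 $ 2" "\<lambda>q. X c q $ 1" "\<lambda>q. X c q $ 2" "Fc c"
    "\<lambda>q. \<pi> c q 1 1 1" "\<lambda>q. \<pi> c q 2 1 1" "\<lambda>q. \<pi> c q 1 1 2" "\<lambda>q. \<pi> c q 2 1 2" "\<lambda>q. \<pi> c q 1 2 2" "\<lambda>q. \<pi> c q 2 2 2" "Rc c"
    by (rule jet[OF c])
  have uE: "usq c q = E.u q" if q: "q \<in> cdom c" for q
    unfolding E.u_def E.x1_def E.x2_def inner_vec_def sum_2 X_eq(3,4)[OF c q] by simp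
  have xE: "E.x1 q = \<gamma> c q $ 1" "E.x2 q = \<gamma> c q $ 2" if q: "q \<in> cdom c" for q
    unfolding E.x1_def E.x2_def X_eq(3,4)[OF c q] by simp_all
  have K: "E.trNN q + Fc c q * Fc c q / 8 = 0" if q: "q \<in> cdom c" for q
  proof -
    have p0: "pd c i (\<lambda>q. 4 * E.u q - Rc c q) r = 0" if r: "r \<in> cdom c" for i r
    proof -
      have "pd c i \<phi> r = pd c i (\<lambda>q. 4 * E.u q - Rc c q) r"
        by (rule pd_cong[OF chart[OF c] r]) (simp add: \<phi>[OF c] uE)
      then show ?thesis using \<phi>0[OF c r] by simp
    qed
    have "pd c i (E.flux1 (\<lambda>q. 4 * E.u q - Rc c q)) q = pd c i (\<lambda>q. 0) q"
      "pd c i (E.flux2 (\<lambda>q. 4 * E.u q - Rc c q)) q = pd c i (\<lambda>q. 0) q" for i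
      by (rule pd_cong[OF chart[OF c] q], simp only: E.flux1_def E.flux2_def p0 mult_zero_right diff_self div_0)+
    then have "E.lap (\<lambda>q. 4 * E.u q - Rc c q) q = 0" unfolding E.lap_def by simp
    \<comment> \<open>The potential is locally constant, so both non-negative terms of its Laplacian
      vanish; the first is the symmetric part of D \<gamma>.\<close>
    then have "8 * (E.trNN q + Fc c q * Fc c q / 8) + 4 * E.u q * E.Q q = 0"
      unfolding E.lap_potential[OF q] using W(1)[OF c q] by simp
    moreover have "4 * E.u q * E.Q q \<ge> 0" using E.u_nonneg(1)[OF q] E.Q_nonneg[OF q] by simp
    moreover have "8 * (E.trNN q + Fc c q * Fc c q / 8) \<ge> 0"
      by (rule mult_nonneg_nonneg[OF _ E.sym_part(1)[OF q]]) simp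
    ultimately have "8 * (E.trNN q + Fc c q * Fc c q / 8) = 0" using add_nonneg_eq_0_iff by blast
    then show ?thesis by (rule mult_eq_0_iff[THEN iffD1, THEN disjE]) simp_all
  qed
  have K: "\<forall>q\<in>cdom c. E.trNN q + Fc c q * Fc c q / 8 = 0" using K by blast
  note k = E.killing_consequences[OF p K] and a = E.killing_accelerations[OF p K]
  have pdu: "pd c i (usq c) p = pd c i E.u p" for i by (rule pd_cong[OF chart[OF c] p uE])
  have zE: "JX c q $ 1 = E.T1 q" "JX c q $ 2 = E.T2 q" if q: "q \<in> cdom c" for q
    unfolding E.T1_def E.T2_def E.x1_def E.x2_def matrix_vector_mult_def vec_lambda_beta sum_2 J_eq[OF c q]
    by (simp_all add: add_divide_distrib diff_divide_distrib)
  have pdz: "pd c i (\<lambda>q. JX c q $ 1) p = pd c i E.T1 p" "pd c i (\<lambda>q. JX c q $ 2) p = pd c i E.T2 p" for i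
    by (rule pd_cong[OF chart[OF c] p], erule zE)+
  show "pd c 1 (\<lambda>q. \<gamma> c q $ 2) p - pd c 2 (\<lambda>q. \<gamma> c q $ 1) p = - Fc c p * W c p / 2"
    unfolding Fc_def using W(1)[OF c p] by simp
  show u1: "pd c 1 (usq c) p = - Fc c p * W c p * X c p $ 2 / 2" and u2: "pd c 2 (usq c) p = Fc c p * W c p * X c p $ 1 / 2"
    unfolding pdu by (rule k)+
  show "X c p $ 1 * pd c 1 (Fc c) p + X c p $ 2 * pd c 2 (Fc c) p = 0" by (rule k)
  have Y: "X c p $ 1 * pd c 1 (\<lambda>q. X c q $ 1) p + X c p $ 2 * pd c 2 (\<lambda>q. X c q $ 1) p +
      (D c p $ 1 $ 1 $ 1 * X c p $ 1 * X c p $ 1 + D c p $ 1 $ 1 $ 2 * X c p $ 1 * X c p $ 2 +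
       (D c p $ 1 $ 1 $ 2 * X c p $ 2 * X c p $ 1 + D c p $ 1 $ 2 $ 2 * X c p $ 2 * X c p $ 2)) = E.Y1 p"
    "X c p $ 1 * pd c 1 (\<lambda>q. X c q $ 2) p + X c p $ 2 * pd c 2 (\<lambda>q. X c q $ 2) p +
      (D c p $ 2 $ 1 $ 1 * X c p $ 1 * X c p $ 1 + D c p $ 2 $ 1 $ 2 * X c p $ 1 * X c p $ 2 +
       (D c p $ 2 $ 1 $ 2 * X c p $ 2 * X c p $ 1 + D c p $ 2 $ 2 $ 2 * X c p $ 2 * X c p $ 2)) = E.Y2 p"
    unfolding E.Y1_def E.Y2_def E.N11_def E.N12_def E.N21_def E.N22_def by (simp_all add: algebra_simps)
  show "(\<Sum>i\<in>UNIV. X c p $ i * pd c i (\<lambda>q. X c q $ k) p) + (\<Sum>i\<in>UNIV. \<Sum>j\<in>UNIV. D c p $ k $ i $ j * X c p $ i * X c p $ j)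
      = - Fc c p / 4 * JX c p $ k"
  proof (cases "k = 1")
    case True
    show ?thesis unfolding True sum_2 D_sym[OF c p] Y zE[OF p] a(1) ..
  next
    case False
    then have k2: "k = 2" using exhaust_2[of k] by blast
    show ?thesis unfolding k2 sum_2 D_sym[OF c p] Y zE[OF p] a(2) ..
  qed
  have ZZ: "z1 * d1 + z2 * d2 + (x * z1 * z1 + y * z1 * z2 + (y * z2 * z1 + w * z2 * z2)) =
     z1 * d1 + z2 * d2 + (x * z1 * z1 + 2 * y * z1 * z2 + w * z2 * z2)" for z1 d1 z2 d2 x y w :: real
    by (simp add: algebra_simps)
  show "(\<Sum>i\<in>UNIV. JX c p $ i * pd c i (\<lambda>q. JX c q $ k) p) + (\<Sum>i\<in>UNIV. \<Sum>j\<in>UNIV. D c p $ k $ i $ j * JX c p $ i * JX c p $ j)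
      = Fc c p / 4 * JX c p $ k"
  proof (cases "k = 1")
    case True
    show ?thesis unfolding True sum_2 D_sym[OF c p] pdz zE[OF p] ZZ by (rule a(3))
  next
    case False
    then have k2: "k = 2" using exhaust_2[of k] by blast
    show ?thesis unfolding k2 sum_2 D_sym[OF c p] pdz zE[OF p] ZZ by (rule a(4))
  qed
  have "E.T1 p * (- Fc c p * W c p * X c p $ 2 / 2) + E.T2 p * (Fc c p * W c p * X c p $ 1 / 2) = Fc c p / 2 * E.u p"
    unfolding E.T1_def E.T2_def E.u_def using W(1)[OF c p] by (simp add: field_simps)
  then show "JX c p $ 1 * pd c 1 (usq c) p + JX c p $ 2 * pd c 2 (usq c) p = Fc c p / 2 * usq c p"
    unfolding u1 u2 zE[OF p] uE[OF p] .
  show "usq c p \<ge> 0" unfolding uE[OF p] by (rule E.u_nonneg(1)[OF p])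
  show "X c p = 0" if "usq c p = 0"
    using E.u_nonneg(2)[OF p] that unfolding uE[OF p] vec_eq_iff forall_2 by simp
  show "chart_smooth c (usq c)" by (rule chart_smooth_cong[OF chart[OF c], THEN iffD2, OF _ E.smooth_u]) (rule uE)
qed

end

section \<open>Curves and reparametrizations\<close>

lemma open_intervalD:
  assumes "open_interval I"
  shows "open I" "I \<noteq> {}" "convex I" "connected I" "a \<in> I \<Longrightarrow> b \<in> I \<Longrightarrow> {a..b} \<subseteq> I"
proof -
  have i: "is_interval I" using assms unfolding open_interval_def by blast
  show "open I" "I \<noteq> {}" using assms unfolding open_interval_def by blast+
  show "convex I" "connected I" using i by (rule is_interval_convex, rule is_interval_connected)
  show "{a..b} \<subseteq> I" if "a \<in> I" "b \<in> I"
    using mem_is_interval_1_I[OF i that] by auto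
qed

lemma has_vector_derivative_vec2:
  fixes f :: "real \<Rightarrow> real^2"
  assumes "\<And>i. ((\<lambda>u. f u $ i) has_real_derivative v $ i) (at t)"
  shows "(f has_vector_derivative v) (at t)"
proof -
  have e: "w = (w $ 1) *\<^sub>R axis 1 1 + (w $ 2) *\<^sub>R (axis 2 1 :: real^2)" for w :: "real^2"
    by (simp add: vec_eq_iff forall_2 axis_def)
  have "((\<lambda>u. (f u $ i) *\<^sub>R (axis i 1 :: real^2)) has_vector_derivative (v $ i) *\<^sub>R axis i 1) (at t)" for i
    using has_vector_derivative_scaleR[OF assms[of i] has_vector_derivative_const[of "axis i 1 :: real^2"]] by simp
  from has_vector_derivative_add[OF this[of 1] this[of 2]]
  have "((\<lambda>u. (f u $ 1) *\<^sub>R axis 1 1 + (f u $ 2) *\<^sub>R (axis 2 1 :: real^2)) has_vector_derivative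
     (v $ 1) *\<^sub>R axis 1 1 + (v $ 2) *\<^sub>R axis 2 1) (at t)" .
  then show ?thesis unfolding e[symmetric] .
qed

lemma constant_on_open_interval:
  fixes g :: "real \<Rightarrow> real"
  assumes "open_interval I" "\<And>t. t \<in> I \<Longrightarrow> (g has_real_derivative 0) (at t)"
  shows "g constant_on I"
  using has_field_derivative_zero_constant[OF open_intervalD(3)[OF assms(1)], of g] assms(2)
  unfolding constant_on_def by (meson has_field_derivative_at_within)

text \<open>Gronwall's argument. With |a| \<le> B on the compact interval between the two times, u
  exp(- B t) is non-increasing and u exp(B t) is non-decreasing, so zero propagates both forwards
  and backwards.\<close>

lemma linear_ode_zero:
  fixes u :: "real \<Rightarrow> real"
  assumes I: "open_interval I" and u: "\<And>t. t \<in> I \<Longrightarrow> u t \<ge> 0"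
    and der: "\<And>t. t \<in> I \<Longrightarrow> (u has_real_derivative a t * u t) (at t)"
    and a: "continuous_on I a" and t0: "t0 \<in> I" "u t0 = 0" and t1: "t1 \<in> I"
  shows "u t1 = 0"
proof -
  define l r where "l = min t0 t1" and "r = max t0 t1"
  have lr: "{l..r} \<subseteq> I" unfolding l_def r_def using open_intervalD(5)[OF I] t0 t1 by (auto simp: min_def max_def)
  have "bounded (a ` {l..r})"
    by (intro compact_imp_bounded compact_continuous_image continuous_on_subset[OF a lr]) simp
  then obtain B where "\<forall>x\<in>a ` {l..r}. norm x \<le> B" unfolding bounded_iff by blast
  then have B: "\<bar>a t\<bar> \<le> B" if "t \<in> {l..r}" for t using that by auto
  have d: "((\<lambda>t. u t * exp (k * t)) has_real_derivative (a t + k) * u t * exp (k * t)) (at t)" if "t \<in> I" for t k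
    by (auto intro!: derivative_eq_intros der[OF that] simp: algebra_simps)
  show ?thesis
  proof (cases "t0 \<le> t1")
    case True
    have "u t1 * exp (- B * t1) \<le> u t0 * exp (- B * t0)"
    proof (rule DERIV_nonpos_imp_nonincreasing[OF True], intro exI conjI)
      fix t assume t: "t0 \<le> t" "t \<le> t1"
      then have tI: "t \<in> {l..r}" unfolding l_def r_def by auto
      show "((\<lambda>t. u t * exp (- B * t)) has_real_derivative (a t + - B) * u t * exp (- B * t)) (at t)"
        by (rule d) (use tI lr in auto)
      have "a t + - B \<le> 0" using B[OF tI] by linarith
      then show "(a t + - B) * u t * exp (- B * t) \<le> 0"
        using u[of t] tI lr by (intro mult_nonpos_nonneg mult_nonneg_nonneg) auto
    qed
    then have "u t1 * exp (- B * t1) \<le> 0" using t0(2) by simp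
    then show ?thesis using u[OF t1] by (simp add: mult_le_0_iff)
  next
    case False
    then have le: "t1 \<le> t0" by simp
    have "u t1 * exp (B * t1) \<le> u t0 * exp (B * t0)"
    proof (rule DERIV_nonneg_imp_nondecreasing[OF le], intro exI conjI)
      fix t assume t: "t1 \<le> t" "t \<le> t0"
      then have tI: "t \<in> {l..r}" unfolding l_def r_def by auto
      show "((\<lambda>t. u t * exp (B * t)) has_real_derivative (a t + B) * u t * exp (B * t)) (at t)"
        by (rule d) (use tI lr in auto)
      have "a t + B \<ge> 0" using B[OF tI] by linarith
      then show "(a t + B) * u t * exp (B * t) \<ge> 0"
        using u[of t] tI lr by (intro mult_nonneg_nonneg) auto
    qed
    then have "u t1 * exp (B * t1) \<le> 0" using t0(2) by simp
    then show ?thesis using u[OF t1] by (simp add: mult_le_0_iff)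
  qed
qed

text \<open>An open interval offers no end point to integrate from. The base is an interior point,
  and of the two integrals in \<open>s\<close> the one over a reversed interval is zero, so the
  difference is the oriented integral.\<close>

lemma open_interval_antiderivative:
  fixes f :: "real \<Rightarrow> real"
  assumes I: "open_interval I" and f: "continuous_on I f"
  shows "\<exists>s. \<forall>t\<in>I. (s has_real_derivative f t) (at t)"
proof -
  note oi = open_intervalD[OF I]
  obtain t0 where t0: "t0 \<in> I" using oi(2) by blast
  define s where "s = (\<lambda>t. integral {t0..t} f - integral {t..t0} f)"
  have "(s has_real_derivative f t) (at t)" if t: "t \<in> I" for t
  proof -
    obtain \<epsilon> where \<epsilon>: "\<epsilon> > 0" "cball t \<epsilon> \<subseteq> I" using oi(1) t open_contains_cball by blast
    have te: "t - \<epsilon> \<in> I" "t + \<epsilon> \<in> I" using \<epsilon> by (auto simp: dist_real_def subset_eq)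
    define a b where "a = min t0 (t - \<epsilon>)" and "b = max t0 (t + \<epsilon>)"
    have abI: "{a..b} \<subseteq> I" unfolding a_def b_def by (rule oi(5)) (use t0 te in \<open>auto simp: min_def max_def\<close>)
    have c: "continuous_on {a..b} f" using continuous_on_subset[OF f abI] .
    have int: "f integrable_on {x..y}" if "a \<le> x" "y \<le> b" for x y
      by (rule integrable_continuous_real[OF continuous_on_subset[OF c]]) (use that in auto)
    have s: "s v = integral {a..v} f - integral {a..t0} f" if v: "a \<le> v" "v \<le> b" for v
    proof (cases "t0 \<le> v")
      case True
      have "integral {a..t0} f + integral {t0..v} f = integral {a..v} f"
        by (rule Henstock_Kurzweil_Integration.integral_combine) (use True int[of a v] v in \<open>auto simp: a_def\<close>)
      moreover have "integral {v..t0} f = 0" using True by (cases "v = t0") auto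
      ultimately show ?thesis unfolding s_def by simp
    next
      case False
      have "integral {a..v} f + integral {v..t0} f = integral {a..t0} f"
        by (rule Henstock_Kurzweil_Integration.integral_combine) (use False int[of a t0] v in \<open>auto simp: b_def\<close>)
      then show ?thesis unfolding s_def using False by simp
    qed
    have tab: "a < t" "t < b" unfolding a_def b_def using \<epsilon>(1) by auto
    have "((\<lambda>v. integral {a..v} f) has_vector_derivative f t) (at t within {a..b})"
      by (rule integral_has_vector_derivative[OF c]) (use tab in auto)
    then have "((\<lambda>v. integral {a..v} f) has_vector_derivative f t) (at t)"
      using at_within_Icc_at[OF tab] by simp
    then have "((\<lambda>v. integral {a..v} f - integral {a..t0} f) has_vector_derivative f t) (at t)"
      by (auto intro!: derivative_eq_intros)
    then have "(s has_vector_derivative f t) (at t)"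
      by (rule has_vector_derivative_transform_within_open[of _ _ _ "{a<..<b}"]) (use tab s in auto)
    then show ?thesis by (simp add: has_real_derivative_iff_has_vector_derivative)
  qed
  then show ?thesis by blast
qed

text \<open>The reparametrization is by arc length when \<open>f\<close> is the speed of the curve.\<close>

lemma unit_speed_reparametrization:
  fixes f a :: "real \<Rightarrow> real"
  assumes I: "open_interval I" and pos: "\<And>t. t \<in> I \<Longrightarrow> f t > 0"
    and der: "\<And>t. t \<in> I \<Longrightarrow> (f has_real_derivative a t * f t) (at t)" and a: "continuous_on I a"
  shows "\<exists>I' \<phi>. open_interval I' \<and> Ck_on 2 I' \<phi> \<and> \<phi> ` I' = I \<and>
    (\<forall>u\<in>I'. (\<phi> has_real_derivative inverse (f (\<phi> u))) (at u))"
proof -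
  note oi = open_intervalD[OF I]
  have cf: "continuous_on I f"
    using der by (intro continuous_at_imp_continuous_on ballI) (rule DERIV_isCont, blast)
  obtain s where s: "\<And>t. t \<in> I \<Longrightarrow> (s has_real_derivative f t) (at t)"
    using open_interval_antiderivative[OF I cf] by blast
  have mono: "s x < s y" if "x \<in> I" "y \<in> I" "x < y" for x y
  proof (rule DERIV_pos_imp_increasing[OF that(3)])
    fix t assume "x \<le> t" "t \<le> y"
    then have "t \<in> I" using oi(5)[OF that(1,2)] by auto
    then show "\<exists>d. (s has_real_derivative d) (at t) \<and> 0 < d" using s pos by blast
  qed
  have inj: "inj_on s I" using mono by (metis inj_onI less_irrefl linorder_neqE_linordered_idom)
  have cs: "continuous_on I s"
    using s by (intro continuous_at_imp_continuous_on ballI) (rule DERIV_isCont, blast)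
  define I' where "I' = s ` I"
  define \<phi> where "\<phi> = inv_into I s"
  have \<phi>s: "\<phi> (s t) = t" if "t \<in> I" for t unfolding \<phi>_def using inv_into_f_f[OF inj that] .
  have \<phi>I: "\<phi> u \<in> I" if "u \<in> I'" for u using that \<phi>s unfolding I'_def by auto
  have "open I'" unfolding I'_def by (rule invariance_of_domain[OF cs oi(1) inj])
  moreover have "connected I'" unfolding I'_def by (rule connected_continuous_image[OF cs oi(4)])
  ultimately have oI': "open_interval I'"
    unfolding open_interval_def using oi(2) by (auto simp: I'_def is_interval_connected_1)
  have d\<phi>: "(\<phi> has_real_derivative inverse (f (\<phi> u))) (at u)" if u: "u \<in> I'" for u
  proof -
    obtain t where t: "t \<in> I" "u = s t" using u unfolding I'_def by blast
    have "(\<phi> has_derivative (*) (inverse (f t))) (at (s t))"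
    proof (rule has_derivative_inverse_on[OF oi(1) _ _ _ t(1)])
      show "(s has_derivative (*) (f x)) (at x)" if "x \<in> I" for x
        using s[OF that] unfolding has_field_derivative_def .
      show "\<phi> (s x) = x" if "x \<in> I" for x by (rule \<phi>s[OF that])
      show "(*) (f t) \<circ> (*) (inverse (f t)) = id" using pos[OF t(1)] by (auto simp: fun_eq_iff)
    qed
    then show ?thesis unfolding has_field_derivative_def t(2) \<phi>s[OF t(1)] .
  qed
  have c\<phi>: "continuous_on I' \<phi>"
    using d\<phi> by (intro continuous_at_imp_continuous_on ballI) (rule DERIV_isCont, blast)
  have oI: "open I'" using open_intervalD(1)[OF oI'] .
  have d2: "((\<lambda>u. inverse (f (\<phi> u))) has_real_derivative - a (\<phi> u) * (inverse (f (\<phi> u)))\<^sup>2) (at u)" if u: "u \<in> I'" for u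
  proof -
    have "((\<lambda>u. f (\<phi> u)) has_real_derivative a (\<phi> u) * f (\<phi> u) * inverse (f (\<phi> u))) (at u)"
      using DERIV_chain2[OF der[OF \<phi>I[OF u]] d\<phi>[OF u]] .
    from DERIV_inverse'[OF this] pos[OF \<phi>I[OF u]]
    show ?thesis by (simp add: power2_eq_square field_simps)
  qed
  have "Ck_on (Suc (Suc 0)) I' \<phi>"
  proof (rule Ck_on_SucI[OF oI])
    show "(\<phi> has_derivative (\<lambda>v. inverse (f (\<phi> u)) * v)) (at u)" if "u \<in> I'" for u
      using d\<phi>[OF that] unfolding has_field_derivative_def .
    show "Ck_on (Suc 0) I' (\<lambda>u. inverse (f (\<phi> u)) * v)" for v
    proof (rule Ck_on_SucI[OF oI])
      show "((\<lambda>u. inverse (f (\<phi> u)) * v) has_derivative (\<lambda>w. (- a (\<phi> u) * (inverse (f (\<phi> u)))\<^sup>2) * w * v)) (at u)"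
        if "u \<in> I'" for u
        using has_derivative_mult_left[OF d2[OF that, unfolded has_field_derivative_def], of v] .
      have "continuous_on I' (\<lambda>u. a (\<phi> u))" by (rule continuous_on_compose2[OF a c\<phi>]) (use \<phi>I in auto)
      moreover have "continuous_on I' (\<lambda>u. f (\<phi> u))" by (rule continuous_on_compose2[OF cf c\<phi>]) (use \<phi>I in auto)
      moreover have "\<forall>u\<in>I'. f (\<phi> u) \<noteq> 0" using pos \<phi>I by (metis less_irrefl)
      ultimately show "Ck_on 0 I' (\<lambda>u. (- a (\<phi> u) * (inverse (f (\<phi> u)))\<^sup>2) * w * v)" for w
        unfolding Ck_on.simps by (intro continuous_intros) auto
    qed
  qed
  then have "Ck_on 2 I' \<phi>" by (simp add: numeral_2_eq_2)
  moreover have "\<phi> ` I' = I" unfolding I'_def image_image using \<phi>s by simp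
  ultimately show ?thesis using oI' d\<phi> by blast
qed

lemma curve_nbhd:
  assumes "is_chart c" "open I" "continuous_on I \<sigma>"
  shows "open (I \<inter> \<sigma> -` cdom c)"
  by (rule continuous_open_preimage[OF assms(3,2) is_chartD(1)[OF assms(1)]])

lemma curve_fun_derivative:
  assumes c: "is_chart c" and I: "open I" "continuous_on I \<sigma>" "t \<in> I" "\<sigma> t \<in> cdom c"
    and v: "((coord c \<circ> \<sigma>) has_vector_derivative v) (at t)" and f: "chart_smooth c f"
  shows "((\<lambda>u. f (\<sigma> u)) has_real_derivative (\<Sum>i\<in>UNIV. v $ i * pd c i f (\<sigma> t))) (at t)"
proof -
  have "((f \<circ> cinv c) has_derivative (\<lambda>w. \<Sum>i\<in>UNIV. w $ i * pd c i f (\<sigma> t))) (at ((coord c \<circ> \<sigma>) t))"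
    using chart_has_derivative[OF f I(4)] by simp
  from diff_chain_at[OF v[unfolded has_vector_derivative_def] this]
  have "((f \<circ> cinv c) \<circ> (coord c \<circ> \<sigma>) has_derivative (\<lambda>r. (\<Sum>i\<in>UNIV. v $ i * pd c i f (\<sigma> t)) * r)) (at t)"
    by (simp add: o_def sum_distrib_left sum_distrib_right mult_ac)
  then have "((\<lambda>u. f (\<sigma> u)) has_derivative (\<lambda>r. (\<Sum>i\<in>UNIV. v $ i * pd c i f (\<sigma> t)) * r)) (at t)"
    by (rule has_derivative_transform_within_open[OF _ curve_nbhd[OF c I(1,2)]])
      (use I is_chartD(3)[OF c] in auto)
  then show ?thesis unfolding has_field_derivative_def .
qed

section \<open>Velocity, acceleration and reparametrization of integral curves\<close>

context vector_field_on_surface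
begin

lemma integral_curveD:
  assumes "integral_curve A X I \<sigma>"
  shows "open_interval I" "open I" "continuous_on I \<sigma>"
    "c \<in> A \<Longrightarrow> t \<in> I \<Longrightarrow> \<sigma> t \<in> cdom c \<Longrightarrow> ((coord c \<circ> \<sigma>) has_vector_derivative X c (\<sigma> t)) (at t)"
  using assms unfolding integral_curve_def open_interval_def by auto

lemma integral_curve_fun_derivative:
  assumes "integral_curve A X I \<sigma>" "c \<in> A" "t \<in> I" "\<sigma> t \<in> cdom c" "chart_smooth c f"
  shows "((\<lambda>u. f (\<sigma> u)) has_real_derivative (\<Sum>i\<in>UNIV. X c (\<sigma> t) $ i * pd c i f (\<sigma> t))) (at t)"
  using curve_fun_derivative[OF is_chart[OF assms(2)] integral_curveD(2,3)[OF assms(1)] assms(3,4)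
      integral_curveD(4)[OF assms(1-4)] assms(5)] .

lemma velocity_eq:
  assumes "integral_curve A X I \<sigma>" "c \<in> A" "t \<in> I" "\<sigma> t \<in> cdom c"
  shows "velocity c \<sigma> t = X c (\<sigma> t)"
  unfolding velocity_def by (rule vector_derivative_at[OF integral_curveD(4)[OF assms]])

lemma field_derivative_along:
  assumes "integral_curve A X I \<sigma>" "c \<in> A" "t \<in> I" "\<sigma> t \<in> cdom c"
  shows "((\<lambda>u. X c (\<sigma> u)) has_vector_derivative (\<chi> k. \<Sum>i\<in>UNIV. X c (\<sigma> t) $ i * pd c i (\<lambda>q. X c q $ k) (\<sigma> t))) (at t)"
proof (rule has_vector_derivative_vec2)
  show "((\<lambda>u. X c (\<sigma> u) $ k) has_real_derivative (\<chi> k. \<Sum>i\<in>UNIV. X c (\<sigma> t) $ i * pd c i (\<lambda>q. X c q $ k) (\<sigma> t)) $ k) (at t)" for k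
    unfolding vec_lambda_beta
    by (rule integral_curve_fun_derivative[OF assms smooth_comps_1[OF smooth_X assms(2) is_chart[OF assms(2)]]])
qed

lemma velocity_derivative:
  assumes "integral_curve A X I \<sigma>" "c \<in> A" "t \<in> I" "\<sigma> t \<in> cdom c"
  shows "(velocity c \<sigma> has_vector_derivative (\<chi> k. \<Sum>i\<in>UNIV. X c (\<sigma> t) $ i * pd c i (\<lambda>q. X c q $ k) (\<sigma> t))) (at t)"
  by (rule has_vector_derivative_transform_within_open[OF field_derivative_along[OF assms]
        curve_nbhd[OF is_chart[OF assms(2)] integral_curveD(2,3)[OF assms(1)]]])
    (use assms velocity_eq[OF assms(1,2)] in auto)

lemma twice_diff_integral_curve:
  assumes "integral_curve A X I \<sigma>"
  shows "twice_diff_curve A I \<sigma>"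
  unfolding twice_diff_curve_def
  using integral_curveD[OF assms] velocity_derivative[OF assms] has_vector_derivative_def differentiable_def by blast

lemma acceleration_eq:
  assumes "integral_curve A X I \<sigma>" "c \<in> A" "t \<in> I" "\<sigma> t \<in> cdom c"
  shows "acceleration \<Gamma> c \<sigma> t $ k = (\<Sum>i\<in>UNIV. X c (\<sigma> t) $ i * pd c i (\<lambda>q. X c q $ k) (\<sigma> t)) +
    (\<Sum>i\<in>UNIV. \<Sum>j\<in>UNIV. \<Gamma> c (\<sigma> t) $ k $ i $ j * X c (\<sigma> t) $ i * X c (\<sigma> t) $ j)"
  unfolding acceleration_def velocity_eq[OF assms] vector_derivative_at[OF velocity_derivative[OF assms]] by simp

text \<open>Zero derivative gives constancy only while the curve stays in one chart. The times at
  which it has a given value, and those at which it has not, are both open, and the interval is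
  connected.\<close>

lemma zero_velocity_constant:
  assumes \<sigma>: "integral_curve A X I \<sigma>" and zero: "\<And>c t. c \<in> A \<Longrightarrow> t \<in> I \<Longrightarrow> \<sigma> t \<in> cdom c \<Longrightarrow> X c (\<sigma> t) = 0"
  shows "\<sigma> constant_on I"
proof -
  note ic = integral_curveD[OF \<sigma>]
  have loc: "\<exists>T. open T \<and> t \<in> T \<and> T \<subseteq> I \<and> (\<forall>u\<in>T. \<sigma> u = \<sigma> t)" if t: "t \<in> I" for t
  proof -
    obtain c where c: "c \<in> A" "\<sigma> t \<in> cdom c" using cover by blast
    have op: "open (I \<inter> \<sigma> -` cdom c)" by (rule curve_nbhd[OF is_chart[OF c(1)] ic(2,3)])
    then obtain \<epsilon> where \<epsilon>: "\<epsilon> > 0" "ball t \<epsilon> \<subseteq> I \<inter> \<sigma> -` cdom c"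
      using open_contains_ball t c(2) by blast
    have "\<exists>y. \<forall>u\<in>ball t \<epsilon>. (coord c \<circ> \<sigma>) u = y"
    proof (rule has_derivative_zero_constant[OF convex_ball])
      fix u assume u: "u \<in> ball t \<epsilon>"
      then have "u \<in> I" "\<sigma> u \<in> cdom c" using \<epsilon>(2) by blast+
      then have "((coord c \<circ> \<sigma>) has_vector_derivative 0) (at u)"
        using ic(4)[OF c(1), of u] zero[OF c(1), of u] by simp
      then show "((coord c \<circ> \<sigma>) has_derivative (\<lambda>h. 0)) (at u within ball t \<epsilon>)"
        unfolding has_vector_derivative_def by (auto intro: has_derivative_at_withinI)
    qed
    then obtain y where y: "\<And>u. u \<in> ball t \<epsilon> \<Longrightarrow> coord c (\<sigma> u) = y" by auto
    have "\<sigma> u = \<sigma> t" if u: "u \<in> ball t \<epsilon>" for u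
    proof -
      have "coord c (\<sigma> u) = coord c (\<sigma> t)" using y[OF u] y[of t] \<epsilon>(1) by simp
      moreover have "\<sigma> u \<in> cdom c" using \<epsilon>(2) u by auto
      ultimately show ?thesis using is_chart_inj[OF is_chart[OF c(1)]] c(2) by (meson inj_onD)
    qed
    note const = this
    have "ball t \<epsilon> \<subseteq> I" using \<epsilon>(2) by blast
    moreover have "t \<in> ball t \<epsilon>" using \<epsilon>(1) by simp
    ultimately show ?thesis using const open_ball by blast
  qed
  obtain t0 where t0: "t0 \<in> I" using open_intervalD(2)[OF ic(1)] by blast
  define U where "U = {t \<in> I. \<sigma> t = \<sigma> t0}"
  define V where "V = {t \<in> I. \<sigma> t \<noteq> \<sigma> t0}"
  have "open U"
  proof (rule open_subopen[THEN iffD2], rule ballI)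
    fix t assume "t \<in> U"
    then have t: "t \<in> I" "\<sigma> t = \<sigma> t0" unfolding U_def by auto
    obtain T where T: "open T" "t \<in> T" "T \<subseteq> I" "\<forall>u\<in>T. \<sigma> u = \<sigma> t" using loc[OF t(1)] by blast
    have "T \<subseteq> U"
    proof
      fix u assume u: "u \<in> T"
      have "\<sigma> u = \<sigma> t" using T(4) u by blast
      then have "\<sigma> u = \<sigma> t0" using t(2) by (simp only: not_False_eq_True)
      then show "u \<in> U" using T(3) u unfolding U_def by blast
    qed
    then show "\<exists>T. open T \<and> t \<in> T \<and> T \<subseteq> U" using T(1,2) by blast
  qed
  moreover have "open V"
  proof (rule open_subopen[THEN iffD2], rule ballI)
    fix t assume "t \<in> V"
    then have t: "t \<in> I" "\<sigma> t \<noteq> \<sigma> t0" unfolding V_def by auto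
    obtain T where T: "open T" "t \<in> T" "T \<subseteq> I" "\<forall>u\<in>T. \<sigma> u = \<sigma> t" using loc[OF t(1)] by blast
    have "T \<subseteq> V"
    proof
      fix u assume u: "u \<in> T"
      have "\<sigma> u = \<sigma> t" using T(4) u by blast
      then have "\<sigma> u \<noteq> \<sigma> t0" using t(2) by (simp only: not_False_eq_True)
      then show "u \<in> V" using T(3) u unfolding V_def by blast
    qed
    then show "\<exists>T. open T \<and> t \<in> T \<and> T \<subseteq> V" using T(1,2) by blast
  qed
  moreover have "U \<inter> V \<inter> I = {}" "I \<subseteq> U \<union> V" unfolding U_def V_def by auto
  moreover have "U \<inter> I \<noteq> {}" using t0 unfolding U_def by auto
  ultimately have "V \<inter> I = {}" using connectedD[OF open_intervalD(4)[OF ic(1)]] by blast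
  then show ?thesis unfolding constant_on_def V_def by blast
qed

text \<open>With b = 1/f the new velocity is b X. Its covariant derivative is b^2 times the old
  acceleration a X plus b' X, and the equation f' = a f means b' = - a b^2.\<close>

lemma reparametrized_geodesic:
  assumes \<sigma>: "integral_curve A X I \<sigma>" and I': "open_interval I'" and \<phi>I: "\<phi> ` I' = I"
    and \<phi>: "\<And>u. u \<in> I' \<Longrightarrow> (\<phi> has_real_derivative inverse (f (\<phi> u))) (at u)"
    and f: "\<And>t. t \<in> I \<Longrightarrow> (f has_real_derivative a t * f t) (at t)" "\<And>t. t \<in> I \<Longrightarrow> f t > 0"
    and acc: "\<And>c t. c \<in> A \<Longrightarrow> t \<in> I \<Longrightarrow> \<sigma> t \<in> cdom c \<Longrightarrow> acceleration \<Gamma> c \<sigma> t = a t *\<^sub>R X c (\<sigma> t)"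
  shows "geodesic A \<Gamma> I' (\<sigma> \<circ> \<phi>)"
proof -
  note ic = integral_curveD[OF \<sigma>]
  note oI' = open_intervalD(1)[OF I']
  have c\<phi>: "continuous_on I' \<phi>"
    using \<phi> by (intro continuous_at_imp_continuous_on ballI) (rule DERIV_isCont, blast)
  have cw: "continuous_on I' (\<sigma> \<circ> \<phi>)" by (rule continuous_on_compose[OF c\<phi>]) (use ic(3) \<phi>I in simp)
  have tI: "\<phi> u \<in> I" if "u \<in> I'" for u using that \<phi>I by blast
  define b where "b = (\<lambda>u. inverse (f (\<phi> u)))"
  have db: "(b has_real_derivative - a (\<phi> u) * (b u)\<^sup>2) (at u)" if u: "u \<in> I'" for u
  proof -
    have "((\<lambda>u. f (\<phi> u)) has_real_derivative a (\<phi> u) * f (\<phi> u) * inverse (f (\<phi> u))) (at u)"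
      using DERIV_chain2[OF f(1)[OF tI[OF u]] \<phi>[OF u]] .
    from DERIV_inverse'[OF this] f(2)[OF tI[OF u]]
    show ?thesis unfolding b_def by (simp add: power2_eq_square field_simps)
  qed
  have \<phi>v: "(\<phi> has_vector_derivative b u) (at u)" if "u \<in> I'" for u
    using \<phi>[OF that] unfolding has_real_derivative_iff_has_vector_derivative b_def .
  have d1: "((coord c \<circ> (\<sigma> \<circ> \<phi>)) has_vector_derivative b u *\<^sub>R X c (\<sigma> (\<phi> u))) (at u)"
    if "c \<in> A" "u \<in> I'" "\<sigma> (\<phi> u) \<in> cdom c" for c u
    using vector_diff_chain_at[OF \<phi>v[OF that(2)] ic(4)[OF that(1) tI[OF that(2)] that(3)]] by (simp only: comp_assoc)
  have vel: "velocity c (\<sigma> \<circ> \<phi>) u = b u *\<^sub>R X c (\<sigma> (\<phi> u))"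
    if "c \<in> A" "u \<in> I'" "\<sigma> (\<phi> u) \<in> cdom c" for c u
    unfolding velocity_def by (rule vector_derivative_at[OF d1[OF that]])
  have d2: "(velocity c (\<sigma> \<circ> \<phi>) has_vector_derivative
      b u *\<^sub>R (b u *\<^sub>R vector_derivative (velocity c \<sigma>) (at (\<phi> u))) + (- a (\<phi> u) * (b u)\<^sup>2) *\<^sub>R X c (\<sigma> (\<phi> u))) (at u)"
    if c: "c \<in> A" "u \<in> I'" "\<sigma> (\<phi> u) \<in> cdom c" for c u
  proof -
    note vd = velocity_derivative[OF \<sigma> c(1) tI[OF c(2)] c(3)]
    have X': "((\<lambda>t. X c (\<sigma> t)) has_vector_derivative vector_derivative (velocity c \<sigma>) (at (\<phi> u))) (at (\<phi> u))"
      using field_derivative_along[OF \<sigma> c(1) tI[OF c(2)] c(3)] unfolding vector_derivative_at[OF vd] .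
    have "((\<lambda>u. X c (\<sigma> (\<phi> u))) has_vector_derivative b u *\<^sub>R vector_derivative (velocity c \<sigma>) (at (\<phi> u))) (at u)"
      using vector_diff_chain_at[OF \<phi>v[OF c(2)] X'] by (simp add: o_def)
    from has_vector_derivative_scaleR[OF db[OF c(2)] this]
    have "((\<lambda>u. b u *\<^sub>R X c (\<sigma> (\<phi> u))) has_vector_derivative
      b u *\<^sub>R (b u *\<^sub>R vector_derivative (velocity c \<sigma>) (at (\<phi> u))) + (- a (\<phi> u) * (b u)\<^sup>2) *\<^sub>R X c (\<sigma> (\<phi> u))) (at u)" .
    then show ?thesis
      by (rule has_vector_derivative_transform_within_open[OF _ curve_nbhd[OF is_chart[OF c(1)] oI' cw]])
        (use c vel[OF c(1)] in auto)
  qed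
  show ?thesis
    unfolding geodesic_def twice_diff_curve_def
  proof (intro conjI ballI impI I' cw)
    fix c u assume c: "c \<in> A" "u \<in> I'" "(\<sigma> \<circ> \<phi>) u \<in> cdom c"
    then have c': "\<sigma> (\<phi> u) \<in> cdom c" by simp
    show "(coord c \<circ> (\<sigma> \<circ> \<phi>)) differentiable (at u)"
      using d1[OF c(1,2) c'] unfolding has_vector_derivative_def differentiable_def by blast
    show "velocity c (\<sigma> \<circ> \<phi>) differentiable (at u)"
      using d2[OF c(1,2) c'] unfolding has_vector_derivative_def differentiable_def by blast
    show "acceleration \<Gamma> c (\<sigma> \<circ> \<phi>) u = 0"
    proof (rule vec_eq_iff[THEN iffD2], rule allI)
      fix k
      define x where "x = X c (\<sigma> (\<phi> u))"
      have "acceleration \<Gamma> c (\<sigma> \<circ> \<phi>) u $ k = (b u)\<^sup>2 * acceleration \<Gamma> c \<sigma> (\<phi> u) $ k - a (\<phi> u) * (b u)\<^sup>2 * x $ k"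
        unfolding acceleration_def vec_lambda_beta vector_derivative_at[OF d2[OF c(1,2) c']] vel[OF c(1,2) c']
          velocity_eq[OF \<sigma> c(1) tI[OF c(2)] c'] x_def[symmetric] sum_2
        by (simp add: power2_eq_square algebra_simps x_def)
      also have "\<dots> = 0" unfolding acc[OF c(1) tI[OF c(2)] c'] x_def by simp
      finally show "acceleration \<Gamma> c (\<sigma> \<circ> \<phi>) u $ k = 0 $ k" by simp
    qed
  qed
qed

end

section \<open>The integral curves\<close>

context compact_gauduchon_setting
begin

lemma smooth_comps_vec:
  fixes Y :: "('a, real^2) comps"
  assumes "\<And>c k. c \<in> A \<Longrightarrow> chart_smooth c (\<lambda>q. Y c q $ k)"
  shows "smooth_comps A Y"
  unfolding smooth_comps_def
proof
  fix c assume c: "c \<in> A"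
  show "smooth_on (coord c ` cdom c) (Y c \<circ> cinv c)"
    using assms[OF c] unfolding chart_smooth_def
    by (intro smooth_on_vec is_chartD(2)[OF chart[OF c]]) (simp add: o_def)
qed

sublocale VX: vector_field_on_surface A X
proof
  show "smooth_comps A X" by (rule smooth_comps_vec) (rule smooth_X)
  show "X d p = jac c d p *v X c p" if "c \<in> A" "d \<in> A" "p \<in> cdom c" "p \<in> cdom d" for c d p
    by (rule X_change[OF that])
qed (rule surface)

sublocale VJ: vector_field_on_surface A JX
proof
  show "smooth_comps A JX"
  proof (rule smooth_comps_vec)
    fix c k assume c: "c \<in> A"
    have "chart_smooth c (\<lambda>q. J c q $ k $ 1 * X c q $ 1 + J c q $ k $ 2 * X c q $ 2)"
      by (intro chart_smooth_add[OF chart[OF c]] chart_smooth_mult[OF chart[OF c]] smooth_J[OF c] smooth_X[OF c])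
    then show "chart_smooth c (\<lambda>q. JX c q $ k)" by (simp add: matrix_vector_mult_def sum_2)
  qed
  fix c d p assume c: "c \<in> A" "d \<in> A" "p \<in> cdom c" "p \<in> cdom d"
  have "J d p ** jac c d p = jac c d p ** J c p"
    using J c unfolding complex_structure_def endo_field_def by blast
  then show "JX d p = jac c d p *v JX c p"
    unfolding X_change[OF c] by (simp add: matrix_vector_mul_assoc)
qed (rule surface)

abbreviation "nsq \<equiv> sq_norm A h \<gamma>"
abbreviation "Fh \<equiv> faraday_scalar A nabla h J"

lemma along_curve:
  assumes "open I" "continuous_on I \<sigma>" "t \<in> I" "c \<in> A" "\<sigma> t \<in> cdom c"
    and "((\<lambda>u. f (\<sigma> u)) has_real_derivative v) (at t)" "\<And>q. q \<in> cdom c \<Longrightarrow> g q = f q"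
  shows "((\<lambda>u. g (\<sigma> u)) has_real_derivative v) (at t)"
  by (rule has_field_derivative_transform_within_open[OF assms(6) curve_nbhd[OF chart[OF assms(4)] assms(1,2)]])
    (use assms in auto)

text \<open>grad |\<gamma>|^2 is a multiple of J X, which is orthogonal to X; for F_h the claim is
  the last of the Killing consequences.\<close>

lemma invariants_along_X:
  assumes \<sigma>: "integral_curve A X I \<sigma>" and t: "t \<in> I"
  shows "((\<lambda>u. nsq (\<sigma> u)) has_real_derivative 0) (at t)" "((\<lambda>u. Fh (\<sigma> u)) has_real_derivative 0) (at t)"
proof -
  obtain c where c: "c \<in> A" "\<sigma> t \<in> cdom c" using chart_at by blast
  note ic = VX.integral_curveD[OF \<sigma>]
  have "((\<lambda>u. usq c (\<sigma> u)) has_real_derivative 0) (at t)"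
    using VX.integral_curve_fun_derivative[OF \<sigma> c(1) t c(2) killing(10)[OF c]]
    unfolding sum_2 killing(2,3)[OF c] by (simp add: mult.commute)
  then show "((\<lambda>u. nsq (\<sigma> u)) has_real_derivative 0) (at t)"
    by (rule along_curve[OF ic(2,3) t c]) (rule sq_norm_eq[OF c(1)])
  have "((\<lambda>u. Fc c (\<sigma> u)) has_real_derivative 0) (at t)"
    using VX.integral_curve_fun_derivative[OF \<sigma> c(1) t c(2) smooth_Fc[OF c(1)]]
    unfolding sum_2 killing(4)[OF c] .
  then show "((\<lambda>u. Fh (\<sigma> u)) has_real_derivative 0) (at t)"
    by (rule along_curve[OF ic(2,3) t c]) (rule faraday_scalar_eq[OF c(1)])
qed

lemma nsq_constant: "integral_curve A X I \<sigma> \<Longrightarrow> (\<lambda>t. nsq (\<sigma> t)) constant_on I"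
  and Fh_constant: "integral_curve A X I \<sigma> \<Longrightarrow> (\<lambda>t. Fh (\<sigma> t)) constant_on I"
  using constant_on_open_interval[OF VX.integral_curveD(1)] invariants_along_X by blast+

lemma acceleration_X:
  assumes "integral_curve A X I \<sigma>" "c \<in> A" "t \<in> I" "\<sigma> t \<in> cdom c"
  shows "acceleration D c \<sigma> t = (- Fh (\<sigma> t) / 4) *\<^sub>R JX c (\<sigma> t)"
  unfolding vec_eq_iff VX.acceleration_eq[OF assms] killing(5)[OF assms(2,4)] faraday_scalar_eq[OF assms(2,4)]
  by simp

lemma acceleration_JX:
  assumes "integral_curve A JX I \<sigma>" "c \<in> A" "t \<in> I" "\<sigma> t \<in> cdom c"
  shows "acceleration D c \<sigma> t = (Fh (\<sigma> t) / 4) *\<^sub>R JX c (\<sigma> t)"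
  unfolding vec_eq_iff VJ.acceleration_eq[OF assms] killing(6)[OF assms(2,4)] faraday_scalar_eq[OF assms(2,4)]
  by simp

lemma nsq_nonneg: "nsq p \<ge> 0"
proof -
  obtain c where c: "c \<in> A" "p \<in> cdom c" using chart_at by blast
  show ?thesis unfolding sq_norm_eq[OF c] by (rule killing(8)[OF c])
qed

lemma X_zero: "nsq p = 0 \<Longrightarrow> c \<in> A \<Longrightarrow> p \<in> cdom c \<Longrightarrow> X c p = 0"
  using killing(9) sq_norm_eq by simp

text \<open>|\<gamma>|^2 is the squared speed and is constant along the curve, so a single zero
  would make the whole curve constant.\<close>

lemma nsq_pos_X:
  assumes \<sigma>: "integral_curve A X I \<sigma>" "nontrivial_curve I \<sigma>" and t: "t \<in> I"
  shows "nsq (\<sigma> t) > 0"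
proof (rule ccontr)
  assume "\<not> nsq (\<sigma> t) > 0"
  then have z: "nsq (\<sigma> t) = 0" using nsq_nonneg[of "\<sigma> t"] by simp
  have "nsq (\<sigma> u) = 0" if "u \<in> I" for u
    using nsq_constant[OF \<sigma>(1)] t that z unfolding constant_on_def by metis
  then have "\<sigma> constant_on I" using VX.zero_velocity_constant[OF \<sigma>(1)] X_zero by blast
  then show False using \<sigma>(2) unfolding nontrivial_curve_def by blast
qed

lemma curvature_of_integral_curves:
  assumes \<sigma>: "integral_curve A X I \<sigma>" "nontrivial_curve I \<sigma>"
  shows "has_geodesic_curvature A h D J I \<sigma> (\<lambda>t. - (1/4) * inverse (sqrt (nsq (\<sigma> t))) * Fh (\<sigma> t))"
    "(\<lambda>t. - (1/4) * inverse (sqrt (nsq (\<sigma> t))) * Fh (\<sigma> t)) constant_on I"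
proof -
  obtain k where k: "\<And>t. t \<in> I \<Longrightarrow> nsq (\<sigma> t) = k"
    using nsq_constant[OF \<sigma>(1)] unfolding constant_on_def by blast
  obtain l where l: "\<And>t. t \<in> I \<Longrightarrow> Fh (\<sigma> t) = l"
    using Fh_constant[OF \<sigma>(1)] unfolding constant_on_def by blast
  show "(\<lambda>t. - (1/4) * inverse (sqrt (nsq (\<sigma> t))) * Fh (\<sigma> t)) constant_on I"
    unfolding constant_on_def using k l by auto
  \<comment> \<open>The definition of geodesic curvature wants the speed as an exponential, which is
    available because the constant k is positive on a non-trivial curve.\<close>
  define b where "b = ln (sqrt k)"
  have b: "exp b = sqrt k" if "t \<in> I" for t
    unfolding b_def using nsq_pos_X[OF \<sigma> that] k[OF that] by simp
  show "has_geodesic_curvature A h D J I \<sigma> (\<lambda>t. - (1/4) * inverse (sqrt (nsq (\<sigma> t))) * Fh (\<sigma> t))"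
    unfolding has_geodesic_curvature_def
  proof (intro conjI exI[of _ b] exI[of _ "\<lambda>t. - Fh (\<sigma> t) / 4"] ballI impI)
    show "twice_diff_curve A I \<sigma>" by (rule VX.twice_diff_integral_curve[OF \<sigma>(1)])
    fix t assume t: "t \<in> I"
    show "- (1/4) * inverse (sqrt (nsq (\<sigma> t))) * Fh (\<sigma> t) = exp (- b) * (- Fh (\<sigma> t) / 4)"
      unfolding exp_minus b[OF t] k[OF t] by simp
    fix c assume c: "c \<in> A" "\<sigma> t \<in> cdom c"
    show "sqrt (velocity c \<sigma> t \<bullet> (h c (\<sigma> t) *v velocity c \<sigma> t)) = exp b"
      unfolding VX.velocity_eq[OF \<sigma>(1) c(1) t c(2)] h_X(1)[OF c(1) c(1) c(2) c(2)] b[OF t] k[OF t, symmetric]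
        sq_norm_eq[OF c] by (simp add: inner_commute)
    show "acceleration D c \<sigma> t = (- Fh (\<sigma> t) / 4) *\<^sub>R (J c (\<sigma> t) *v velocity c \<sigma> t)"
      unfolding VX.velocity_eq[OF \<sigma>(1) c(1) t c(2)] by (rule acceleration_X[OF \<sigma>(1) c(1) t c(2)])
  qed
qed

lemma pd_at_maximum:
  assumes c: "c \<in> A" "p \<in> cdom c" and f: "chart_smooth c f" and max: "\<And>q. q \<in> cdom c \<Longrightarrow> f q \<le> f p"
  shows "pd c i f p = 0"
proof -
  note ch = is_chartD[OF chart[OF c(1)]]
  have "(\<lambda>w. \<Sum>i\<in>UNIV. w $ i * pd c i f p) = (\<lambda>v. 0)"
  proof (rule differential_zero_maxmin[OF _ ch(2) chart_has_derivative[OF f c(2)]])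
    show "coord c p \<in> coord c ` cdom c" using c(2) by blast
    show "(\<forall>y\<in>coord c ` cdom c. (f \<circ> cinv c) y \<le> (f \<circ> cinv c) (coord c p)) \<or>
      (\<forall>y\<in>coord c ` cdom c. (f \<circ> cinv c) (coord c p) \<le> (f \<circ> cinv c) y)"
      using max ch(3)[OF c(2)] ch(5) by auto
  qed
  from fun_cong[OF this, of "axis i 1"] show ?thesis using exhaust_2[of i] by (auto simp: sum_2 axis_def)
qed

lemma geodesic_through_maximum:
  assumes \<sigma>: "integral_curve A X I \<sigma>" and t0: "t0 \<in> I" "\<And>q. nsq q \<le> nsq (\<sigma> t0)"
  shows "geodesic A D I \<sigma>"
proof -
  have "acceleration D c \<sigma> t = 0" if c: "c \<in> A" "t \<in> I" "\<sigma> t \<in> cdom c" for c t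
  proof (cases "nsq (\<sigma> t0) = 0")
    \<comment> \<open>In this context \<gamma> may vanish identically; the curve then has zero
      velocity.\<close>
    case True
    then have "nsq (\<sigma> t) = 0" using nsq_constant[OF \<sigma>] t0(1) c(2) unfolding constant_on_def by metis
    then have "X c (\<sigma> t) = 0" using c(1,3) by (rule X_zero)
    then show ?thesis unfolding acceleration_X[OF \<sigma> c] by simp
  next
    case False
    obtain d where d: "d \<in> A" "\<sigma> t0 \<in> cdom d" using chart_at by blast
    have "pd d i (usq d) (\<sigma> t0) = 0" for i
      by (rule pd_at_maximum[OF d killing(10)[OF d]]) (use t0(2) d in \<open>simp add: sq_norm_eq[symmetric]\<close>)
    then have "Fc d (\<sigma> t0) * W d (\<sigma> t0) * X d (\<sigma> t0) $ 2 = 0" "Fc d (\<sigma> t0) * W d (\<sigma> t0) * X d (\<sigma> t0) $ 1 = 0"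
      using killing(2,3)[OF d] by simp_all
    moreover have "X d (\<sigma> t0) \<noteq> 0" using False unfolding sq_norm_eq[OF d] by auto
    ultimately have "Fc d (\<sigma> t0) = 0" using W(1)[OF d] unfolding vec_eq_iff forall_2 by auto
    then have "Fh (\<sigma> t0) = 0" unfolding faraday_scalar_eq[OF d] .
    then have "Fh (\<sigma> t) = 0" using Fh_constant[OF \<sigma>] t0(1) c(2) unfolding constant_on_def by metis
    then show ?thesis unfolding acceleration_X[OF \<sigma> c] by simp
  qed
  then show ?thesis unfolding geodesic_def using VX.twice_diff_integral_curve[OF \<sigma>] by blast
qed

text \<open>nabla |det h| = 4 \<gamma> |det h|, so a vanishing \<gamma> makes \<open>h\<close> a
  witness of exactness.\<close>

lemma exact_if_zero:
  assumes "\<And>p. nsq p = 0" and c: "c \<in> A" "p \<in> cdom c"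
  shows "cov_density nabla 2 (\<lambda>c p. \<bar>det (h c p)\<bar>) c p = 0"
proof -
  have "X c p = 0" by (rule X_zero[OF assms(1) c])
  then have g: "\<gamma> c p = 0" using h_X(1)[OF c(1) c(1) c(2) c(2)] by simp
  have "pd c i (\<lambda>q. \<bar>det (h c q)\<bar>) p = pd c i (\<lambda>q. det (h c q)) p" for i
    by (rule pd_cong[OF chart[OF c(1)] c(2)]) (rule abs_of_pos[OF h_pos(2)[OF c(1)]])
  then show ?thesis
    unfolding vec_eq_iff cov_density_def vec_lambda_beta sum_2 nabla_trace[OF c] g
    using h_pos(2)[OF c] by (simp add: pd_det[OF c])
qed

text \<open>A maximum point of |\<gamma>|^2 exists by compactness, and there the value is positive.
  So X does not vanish at that point, and the complete integral curve through it is not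
  constant.\<close>

lemma complete_geodesic:
  assumes "nsq p0 \<noteq> 0"
  shows "\<exists>\<sigma>. integral_curve A X UNIV \<sigma> \<and> nontrivial_curve UNIV \<sigma> \<and> geodesic A D UNIV \<sigma>"
proof -
  have "continuous_on UNIV nsq"
  proof (intro continuous_at_imp_continuous_on ballI)
    fix q
    obtain c where c: "c \<in> A" "q \<in> cdom c" using chart_at by blast
    have "continuous_on (cdom c) nsq"
      by (rule continuous_on_eq[OF continuous_on_chart[OF chart[OF c(1)] killing(10)[OF c]]]) (simp add: sq_norm_eq[OF c(1)])
    then show "isCont nsq q" using is_chartD(1)[OF chart[OF c(1)]] c(2) by (simp add: continuous_on_eq_continuous_at)
  qed
  then obtain q where q: "\<And>p. nsq p \<le> nsq q"
    using continuous_attains_sup[OF compact, of nsq] by blast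
  obtain \<sigma> where \<sigma>: "\<sigma> 0 = q" "integral_curve A X UNIV \<sigma>"
    using VX.complete_integral_curve[OF compact] by blast
  have "nontrivial_curve UNIV \<sigma>" unfolding nontrivial_curve_def
  proof
    assume "\<sigma> constant_on UNIV"
    then have const: "\<sigma> = (\<lambda>t. q)" using \<sigma>(1) unfolding constant_on_def by force
    obtain c where c: "c \<in> A" "q \<in> cdom c" using chart_at by blast
    have "((coord c \<circ> \<sigma>) has_vector_derivative X c q) (at 0)"
      using VX.integral_curveD(4)[OF \<sigma>(2) c(1), of 0] c(2) unfolding \<sigma>(1) by simp
    moreover have "((coord c \<circ> \<sigma>) has_vector_derivative 0) (at 0)" unfolding const o_def by simp
    ultimately have "X c q = 0" using vector_derivative_unique_at by blast
    then have "nsq q = 0" unfolding sq_norm_eq[OF c] by simp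
    then show False using q[of p0] nsq_nonneg[of p0] assms by simp
  qed
  moreover have "geodesic A D UNIV \<sigma>"
    by (rule geodesic_through_maximum[OF \<sigma>(2), of 0]) (simp_all add: \<sigma>(1) q)
  ultimately show ?thesis using \<sigma>(2) by blast
qed

text \<open>J X has the length of X, and |\<gamma>|^2 grows along it at the rate F / 2. The speed
  \<open>f\<close> therefore satisfies f' = (F / 4) f with the same coefficient as the acceleration
  (F / 4) J X, and arc length makes the curve a geodesic.\<close>

lemma projective_geodesic_JX:
  assumes \<sigma>: "integral_curve A JX I \<sigma>" "nontrivial_curve I \<sigma>"
  shows "projective_geodesic A D I \<sigma>"
proof -
  note ic = VJ.integral_curveD[OF \<sigma>(1)]
  have du: "((\<lambda>u. nsq (\<sigma> u)) has_real_derivative (Fh (\<sigma> t) / 2) * nsq (\<sigma> t)) (at t)"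
    and dF: "isCont (\<lambda>u. Fh (\<sigma> u)) t" if t: "t \<in> I" for t
  proof -
    obtain c where c: "c \<in> A" "\<sigma> t \<in> cdom c" using chart_at by blast
    have "((\<lambda>u. usq c (\<sigma> u)) has_real_derivative Fc c (\<sigma> t) / 2 * usq c (\<sigma> t)) (at t)"
      using VJ.integral_curve_fun_derivative[OF \<sigma>(1) c(1) t c(2) killing(10)[OF c]]
      unfolding sum_2 killing(7)[OF c] .
    then show "((\<lambda>u. nsq (\<sigma> u)) has_real_derivative (Fh (\<sigma> t) / 2) * nsq (\<sigma> t)) (at t)"
      unfolding sq_norm_eq[OF c] faraday_scalar_eq[OF c]
      by (rule along_curve[OF ic(2,3) t c]) (rule sq_norm_eq[OF c(1)])
    have "((\<lambda>u. Fh (\<sigma> u)) has_real_derivative (\<Sum>i\<in>UNIV. JX c (\<sigma> t) $ i * pd c i (Fc c) (\<sigma> t))) (at t)"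
      by (rule along_curve[OF ic(2,3) t c VJ.integral_curve_fun_derivative[OF \<sigma>(1) c(1) t c(2) smooth_Fc[OF c(1)]]])
        (rule faraday_scalar_eq[OF c(1)])
    then show "isCont (\<lambda>u. Fh (\<sigma> u)) t" by (rule DERIV_isCont)
  qed
  have cF: "continuous_on I (\<lambda>t. Fh (\<sigma> t) / k)" for k
    unfolding divide_inverse by (intro continuous_intros continuous_at_imp_continuous_on ballI dF)
  \<comment> \<open>Along J X the norm is not conserved; a zero spreads over the curve through the
    linear equation \<open>du\<close>.\<close>
  have pos: "nsq (\<sigma> t) > 0" if t: "t \<in> I" for t
  proof (rule ccontr)
    assume "\<not> nsq (\<sigma> t) > 0"
    then have z: "nsq (\<sigma> t) = 0" using nsq_nonneg[of "\<sigma> t"] by simp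
    have "nsq (\<sigma> u) = 0" if "u \<in> I" for u
      by (rule linear_ode_zero[OF ic(1) nsq_nonneg du cF t z that])
    then have "JX c (\<sigma> u) = 0" if "c \<in> A" "u \<in> I" "\<sigma> u \<in> cdom c" for c u
      using X_zero that by simp
    then have "\<sigma> constant_on I" using VJ.zero_velocity_constant[OF \<sigma>(1)] by blast
    then show False using \<sigma>(2) unfolding nontrivial_curve_def by blast
  qed
  define f where "f = (\<lambda>t. sqrt (nsq (\<sigma> t)))"
  have f_pos: "f t > 0" if "t \<in> I" for t unfolding f_def using pos[OF that] by simp
  have df: "(f has_real_derivative (Fh (\<sigma> t) / 4) * f t) (at t)" if t: "t \<in> I" for t
  proof -
    have "(f has_real_derivative inverse (sqrt (nsq (\<sigma> t))) / 2 * (Fh (\<sigma> t) / 2 * nsq (\<sigma> t))) (at t)"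
      unfolding f_def by (rule DERIV_chain2[OF DERIV_real_sqrt[OF pos[OF t]] du[OF t]])
    moreover have "inverse (sqrt x) / 2 * (k / 2 * x) = k / 4 * sqrt x" if "x > 0" for x k :: real
    proof -
      have "sqrt x * sqrt x = x" using that by simp
      then show ?thesis using that by (simp add: field_simps)
    qed
    ultimately show ?thesis unfolding f_def using pos[OF t] by metis
  qed
  obtain I' \<phi> where \<phi>: "open_interval I'" "Ck_on 2 I' \<phi>" "\<phi> ` I' = I"
    "\<And>u. u \<in> I' \<Longrightarrow> (\<phi> has_real_derivative inverse (f (\<phi> u))) (at u)"
    using unit_speed_reparametrization[OF ic(1) f_pos df cF] by blast
  have "geodesic A D I' (\<sigma> \<circ> \<phi>)"
    by (rule VJ.reparametrized_geodesic[OF \<sigma>(1) \<phi>(1,3,4) df f_pos acceleration_JX[OF \<sigma>(1)]])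
  moreover have "deriv \<phi> u \<noteq> 0" if "u \<in> I'" for u
  proof -
    have "\<phi> u \<in> I" using \<phi>(3) that by blast
    then show ?thesis using DERIV_imp_deriv[OF \<phi>(4)[OF that]] f_pos[of "\<phi> u"] by simp
  qed
  ultimately show ?thesis unfolding projective_geodesic_def using ic(1) \<phi>(1-3) by blast
qed

section \<open>Hamilton's equations of the magnetic flow\<close>

lemma smooth_h_inv:
  assumes c: "c \<in> A"
  shows "chart_smooth c (\<lambda>q. matrix_inv (h c q) $ i $ j)"
proof -
  note s = smooth_h[OF c] smooth_W[OF c]
  have w: "q \<in> cdom c \<Longrightarrow> W c q * W c q \<noteq> 0" for q using W(1)[OF c, of q] by simp
  have ww: "chart_smooth c (\<lambda>q. W c q * W c q)" by (intro chart_smooth_mult[OF chart[OF c]] s)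
  have d: "chart_smooth c (\<lambda>q. k q / (W c q * W c q))" if "chart_smooth c k" for k
    by (rule chart_smooth_divide[OF chart[OF c] that ww w])
  note cg = chart_smooth_cong[OF chart[OF c], THEN iffD2, rotated]
  have "chart_smooth c (\<lambda>q. matrix_inv (h c q) $ 1 $ 1)" by (rule cg[OF d[OF s(1)]]) (rule h_inv[OF c])
  moreover have "chart_smooth c (\<lambda>q. matrix_inv (h c q) $ 1 $ 2)"
    by (rule cg[OF d[OF chart_smooth_minus[OF chart[OF c] s(1)]]]) (rule h_inv[OF c])
  moreover have "chart_smooth c (\<lambda>q. matrix_inv (h c q) $ 2 $ 1)"
    by (rule cg[OF d[OF chart_smooth_minus[OF chart[OF c] s(1)]]]) (rule h_inv[OF c])
  moreover have "chart_smooth c (\<lambda>q. matrix_inv (h c q) $ 2 $ 2)" by (rule cg[OF d[OF s(1)]]) (rule h_inv[OF c])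
  ultimately show ?thesis using exhaust_2[of i] exhaust_2[of j] by auto
qed

lemma kinetic_energy_derivative:
  assumes c: "c \<in> A" "p \<in> cdom c"
  defines "G \<equiv> \<lambda>i j q. matrix_inv (h c q) $ i $ j"
  shows "frechet_derivative (kinetic_energy h c) (at (coord c p, s)) =
    (\<lambda>V. (\<Sum>i\<in>UNIV. \<Sum>j\<in>UNIV. s $ i * (G i j p * snd V $ j + (\<Sum>k\<in>UNIV. fst V $ k * pd c k (G i j) p) * s $ j)
       + snd V $ i * (G i j p * s $ j)) / 2)"
proof -
  have k: "kinetic_energy h c = (\<lambda>z. (\<Sum>i\<in>UNIV. \<Sum>j\<in>UNIV. snd z $ i * ((G i j \<circ> cinv c) (fst z) * snd z $ j)) / 2)"
    unfolding kinetic_energy_def G_def by (simp add: fun_eq_iff inner_vec_def matrix_vector_mult_def sum_2 algebra_simps)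
  have sG: "chart_smooth c (G i j)" for i j unfolding G_def by (rule smooth_h_inv[OF c(1)])
  have dG: "((\<lambda>z. (G i j \<circ> cinv c) (fst z)) has_derivative (\<lambda>V. \<Sum>k\<in>UNIV. fst V $ k * pd c k (G i j) p)) (at (coord c p, s))" for i j
  proof -
    have "((G i j \<circ> cinv c) has_derivative (\<lambda>w. \<Sum>k\<in>UNIV. w $ k * pd c k (G i j) p)) (at (fst (coord c p, s)))"
      using chart_has_derivative[OF sG c(2)] by simp
    from diff_chain_at[OF bounded_linear.has_derivative[OF bounded_linear_fst has_derivative_ident] this]
    show ?thesis by (simp add: o_def)
  qed
  have ds: "((\<lambda>z. snd z $ i) has_derivative (\<lambda>V. snd V $ i)) (at z)" for i and z :: "(real^2) \<times> (real^2)"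
    by (intro bounded_linear.has_derivative[OF bounded_linear_compose[OF bounded_linear_vec_nth bounded_linear_snd]] has_derivative_ident)
  have Gp: "(G i j \<circ> cinv c) (fst (coord c p, s)) = G i j p" for i j
    using is_chartD(3)[OF chart[OF c(1)] c(2)] by simp
  have "((\<lambda>z. snd z $ i * ((G i j \<circ> cinv c) (fst z) * snd z $ j)) has_derivative
     (\<lambda>V. s $ i * (G i j p * snd V $ j + (\<Sum>k\<in>UNIV. fst V $ k * pd c k (G i j) p) * s $ j)
       + snd V $ i * (G i j p * s $ j))) (at (coord c p, s))" for i j
    using has_derivative_mult[OF ds[of i "(coord c p, s)"] has_derivative_mult[OF dG[of i j] ds[of j]]] unfolding Gp snd_conv .
  note d = this
  have "(kinetic_energy h c has_derivative
    (\<lambda>V. (\<Sum>i\<in>UNIV. \<Sum>j\<in>UNIV. s $ i * (G i j p * snd V $ j + (\<Sum>k\<in>UNIV. fst V $ k * pd c k (G i j) p) * s $ j)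
       + snd V $ i * (G i j p * s $ j)) / 2)) (at (coord c p, s))"
    unfolding k divide_inverse by (intro has_derivative_mult_left has_derivative_sum d)
  from frechet_derivative_at[OF this] show ?thesis by simp
qed

text \<open>The lift to the cotangent bundle is the momentum \<gamma>, dual to the velocity X. The
  fibre part of Hamilton's equations is the definition of X. In the base part the derivatives of the
  inverse metric are traded for d|\<gamma>|^2 and the derivatives of \<gamma>; by the Killing
  equations the remaining force is that of d \<gamma> / 2.\<close>

lemma magnetic_geodesic_X:
  assumes \<sigma>: "integral_curve A X I \<sigma>"
  shows "magnetic_geodesic A h (\<lambda>c p. (1/2) *\<^sub>R ext_d \<gamma> c p) I \<sigma>"
  unfolding magnetic_geodesic_def magnetic_flow_curve_def
proof (intro exI[of _ "\<lambda>c t. \<gamma> c (\<sigma> t)"] conjI ballI impI)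
  note ic = VX.integral_curveD[OF \<sigma>]
  show "open_interval I" "continuous_on I \<sigma>" by (rule ic)+
  show "\<gamma> c (\<sigma> t) = transpose (jac c d (\<sigma> t)) *v \<gamma> d (\<sigma> t)" if "c \<in> A" "d \<in> A" "\<sigma> t \<in> cdom c \<inter> cdom d" for c d t
    using gamma_change that by blast
  fix c t assume c: "c \<in> A" and t: "t \<in> I" and p: "\<sigma> t \<in> cdom c"
  define p where "p = \<sigma> t"
  have pc: "p \<in> cdom c" using p unfolding p_def .
  define w :: "real^2" where "w = (\<chi> k. \<Sum>i\<in>UNIV. X c p $ i * pd c i (\<lambda>q. \<gamma> c q $ k) p)"
  have "((\<lambda>u. \<gamma> c (\<sigma> u)) has_vector_derivative w) (at t)"
  proof (rule has_vector_derivative_vec2)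
    show "((\<lambda>u. \<gamma> c (\<sigma> u) $ k) has_real_derivative w $ k) (at t)" for k
      unfolding w_def vec_lambda_beta p_def
      by (rule VX.integral_curve_fun_derivative[OF \<sigma> c t p smooth_gamma[OF c]])
  qed
  moreover have "((\<lambda>u. coord c (\<sigma> u)) has_vector_derivative X c p) (at t)"
    using ic(4)[OF c t p] unfolding p_def by (simp add: o_def)
  ultimately have Z: "((\<lambda>u. (coord c (\<sigma> u), \<gamma> c (\<sigma> u))) has_vector_derivative (X c p, w)) (at t)"
    unfolding has_vector_derivative_def using has_derivative_Pair by fastforce
  define G where "G = (\<lambda>i j q. matrix_inv (h c q) $ i $ j)"
  have sG: "chart_smooth c (G i j)" for i j unfolding G_def by (rule smooth_h_inv[OF c])
  have Gs: "G 2 1 q = G 1 2 q" if "q \<in> cdom c" for q unfolding G_def h_inv[OF c that] ..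
  have XG: "X c q $ k = G k 1 q * \<gamma> c q $ 1 + G k 2 q * \<gamma> c q $ 2" for q k
    unfolding sharp_def matrix_vector_mult_def G_def by (simp add: sum_2)
  note ch = chart[OF c]
  have dGs: "pd c k (G 2 1) p = pd c k (G 1 2) p" for k by (rule pd_cong[OF ch pc Gs])
  \<comment> \<open>The product rule for |\<gamma>|^2 = h^{ij} \<gamma>_i \<gamma>_j, which isolates
    the derivative of the inverse metric occurring in the kinetic energy.\<close>
  have du: "pd c k (usq c) p = pd c k (G 1 1) p * \<gamma> c p $ 1 * \<gamma> c p $ 1 + 2 * pd c k (G 1 2) p * \<gamma> c p $ 1 * \<gamma> c p $ 2
      + pd c k (G 2 2) p * \<gamma> c p $ 2 * \<gamma> c p $ 2
      + 2 * (X c p $ 1 * pd c k (\<lambda>q. \<gamma> c q $ 1) p + X c p $ 2 * pd c k (\<lambda>q. \<gamma> c q $ 2) p)" for k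
  proof -
    have "pd c k (usq c) p = pd c k (\<lambda>q. \<gamma> c q $ 1 * (G 1 1 q * \<gamma> c q $ 1 + G 1 2 q * \<gamma> c q $ 2)
        + \<gamma> c q $ 2 * (G 2 1 q * \<gamma> c q $ 1 + G 2 2 q * \<gamma> c q $ 2)) p"
      by (rule pd_cong[OF ch pc]) (simp add: inner_vec_def sum_2 XG)
    also have "\<dots> = \<gamma> c p $ 1 * (G 1 1 p * pd c k (\<lambda>q. \<gamma> c q $ 1) p + pd c k (G 1 1) p * \<gamma> c p $ 1
         + (G 1 2 p * pd c k (\<lambda>q. \<gamma> c q $ 2) p + pd c k (G 1 2) p * \<gamma> c p $ 2))
       + pd c k (\<lambda>q. \<gamma> c q $ 1) p * X c p $ 1
       + (\<gamma> c p $ 2 * (G 2 1 p * pd c k (\<lambda>q. \<gamma> c q $ 1) p + pd c k (G 2 1) p * \<gamma> c p $ 1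
         + (G 2 2 p * pd c k (\<lambda>q. \<gamma> c q $ 2) p + pd c k (G 2 2) p * \<gamma> c p $ 2))
       + pd c k (\<lambda>q. \<gamma> c q $ 2) p * X c p $ 2)"
      using pc by (simp add: pd_add pd_mult[OF ch] chart_smooth_add[OF ch] chart_smooth_mult[OF ch] sG smooth_gamma[OF c] XG)
    finally show ?thesis unfolding dGs Gs[OF pc] XG by (simp add: algebra_simps)
  qed
  have dg: "pd c 1 (\<lambda>q. \<gamma> c q $ 2) p = pd c 2 (\<lambda>q. \<gamma> c q $ 1) p - Fc c p * W c p / 2"
    using killing(1)[OF c pc] by simp
  have S: "magnetic_symplectic_form (\<lambda>c p. (1/2) *\<^sub>R ext_d \<gamma> c p) c (coord c p, \<gamma> c p) (X c p, w) V =
       - frechet_derivative (kinetic_energy h c) (at (coord c p, \<gamma> c p)) V" for V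
  proof -
    obtain v s where V: "V = (v, s)" by (cases V)
    have q: "pd c 1 (G 1 1) p * \<gamma> c p $ 1 * \<gamma> c p $ 1 + 2 * pd c 1 (G 1 2) p * \<gamma> c p $ 1 * \<gamma> c p $ 2
       + pd c 1 (G 2 2) p * \<gamma> c p $ 2 * \<gamma> c p $ 2 = - 2 * (X c p $ 1 * pd c 1 (\<lambda>q. \<gamma> c q $ 1) p + X c p $ 2 * pd c 2 (\<lambda>q. \<gamma> c q $ 1) p)
         + Fc c p * W c p * X c p $ 2 / 2"
      "pd c 2 (G 1 1) p * \<gamma> c p $ 1 * \<gamma> c p $ 1 + 2 * pd c 2 (G 1 2) p * \<gamma> c p $ 1 * \<gamma> c p $ 2
       + pd c 2 (G 2 2) p * \<gamma> c p $ 2 * \<gamma> c p $ 2 = - 2 * (X c p $ 1 * pd c 2 (\<lambda>q. \<gamma> c q $ 1) p + X c p $ 2 * pd c 2 (\<lambda>q. \<gamma> c q $ 2) p)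
         + Fc c p * W c p * X c p $ 1 / 2"
      using du[of 1] du[of 2] unfolding killing(2,3)[OF c pc] dg by (simp_all add: algebra_simps)
    \<comment> \<open>The Lorentz term has component - F W / 4 by \<open>dg\<close> and takes away
      half of the contribution of F W / 2 in the derivative of \<gamma> along the curve.\<close>
    have L: "magnetic_symplectic_form (\<lambda>c p. (1/2) *\<^sub>R ext_d \<gamma> c p) c (coord c p, \<gamma> c p) (X c p, w) V =
       v $ 1 * (X c p $ 1 * pd c 1 (\<lambda>q. \<gamma> c q $ 1) p + X c p $ 2 * pd c 2 (\<lambda>q. \<gamma> c q $ 1) p - Fc c p * W c p * X c p $ 2 / 4)
       + v $ 2 * (X c p $ 1 * pd c 2 (\<lambda>q. \<gamma> c q $ 1) p + X c p $ 2 * pd c 2 (\<lambda>q. \<gamma> c q $ 2) p - Fc c p * W c p * X c p $ 1 / 4)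
       - (s $ 1 * X c p $ 1 + s $ 2 * X c p $ 2)"
      unfolding magnetic_symplectic_form_def V fst_conv snd_conv is_chartD(3)[OF ch pc] w_def
      by (simp add: inner_vec_def matrix_vector_mult_def sum_2 ext_d_def dg field_simps)
    have "frechet_derivative (kinetic_energy h c) (at (coord c p, \<gamma> c p)) V =
      (v $ 1 * (pd c 1 (G 1 1) p * \<gamma> c p $ 1 * \<gamma> c p $ 1 + 2 * pd c 1 (G 1 2) p * \<gamma> c p $ 1 * \<gamma> c p $ 2
         + pd c 1 (G 2 2) p * \<gamma> c p $ 2 * \<gamma> c p $ 2)
      + v $ 2 * (pd c 2 (G 1 1) p * \<gamma> c p $ 1 * \<gamma> c p $ 1 + 2 * pd c 2 (G 1 2) p * \<gamma> c p $ 1 * \<gamma> c p $ 2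
         + pd c 2 (G 2 2) p * \<gamma> c p $ 2 * \<gamma> c p $ 2)) / 2 + (s $ 1 * X c p $ 1 + s $ 2 * X c p $ 2)"
    proof -
      have "frechet_derivative (kinetic_energy h c) (at (coord c p, \<gamma> c p)) V = (\<Sum>i\<in>UNIV. \<Sum>j\<in>UNIV.
          \<gamma> c p $ i * (G i j p * snd V $ j + (\<Sum>k\<in>UNIV. fst V $ k * pd c k (G i j) p) * \<gamma> c p $ j)
            + snd V $ i * (G i j p * \<gamma> c p $ j)) / 2"
        unfolding G_def kinetic_energy_derivative[OF c pc] ..
      then show ?thesis unfolding V fst_conv snd_conv sum_2 dGs Gs[OF pc] XG by (simp add: field_simps)
    qed
    then show ?thesis unfolding L q by (simp add: algebra_simps add_divide_distrib diff_divide_distrib)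
  qed
  show "\<exists>Z. ((\<lambda>u. (coord c (\<sigma> u), \<gamma> c (\<sigma> u))) has_vector_derivative Z) (at t) \<and>
     (\<forall>V. magnetic_symplectic_form (\<lambda>c p. (1/2) *\<^sub>R ext_d \<gamma> c p) c (coord c (\<sigma> t), \<gamma> c (\<sigma> t)) Z V =
       - frechet_derivative (kinetic_energy h c) (at (coord c (\<sigma> t), \<gamma> c (\<sigma> t))) V)"
    using Z S unfolding p_def by blast
qed

lemma exact_half_d_gamma: "exact_two_form A (\<lambda>c p. (1/2) *\<^sub>R ext_d \<gamma> c p)"
  unfolding exact_two_form_def
proof (intro exI[of _ "\<lambda>c p. (1/2) *\<^sub>R \<gamma> c p"] conjI ballI)
  have "smooth_comps A (\<lambda>c p. (1/2) *\<^sub>R \<gamma> c p)"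
  proof (rule smooth_comps_vec)
    fix c k assume c: "c \<in> A"
    show "chart_smooth c (\<lambda>q. ((1/2) *\<^sub>R \<gamma> c q) $ k)"
      using chart_smooth_cmult[OF chart[OF c] smooth_gamma[OF c], of "1/2"] by simp
  qed
  moreover have "(1/2) *\<^sub>R \<gamma> c p = transpose (jac c d p) *v ((1/2) *\<^sub>R \<gamma> d p)"
    if "c \<in> A" "d \<in> A" "p \<in> cdom c \<inter> cdom d" for c d p
    using gamma_change[OF that(1,2)] that(3) by (simp only: Int_iff matrix_vector_mult_scaleR)
  ultimately show "one_form A (\<lambda>c p. (1/2) *\<^sub>R \<gamma> c p)"
    unfolding one_form_def by blast
  fix c p assume c: "c \<in> A" "p \<in> cdom c"
  show "(1/2) *\<^sub>R ext_d \<gamma> c p = ext_d (\<lambda>c p. (1/2) *\<^sub>R \<gamma> c p) c p"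
    unfolding ext_d_def vec_eq_iff vector_scaleR_component vec_lambda_beta real_scaleR_def
      pd_cmult[OF chart[OF c(1)] smooth_gamma[OF c(1)] c(2)] by (simp add: algebra_simps)
qed

end

text \<open>The Gauduchon condition supplies co-closedness for some Levi-Civita connection, which
  has to be the given \<open>D\<close>. The difference of two, with its index lowered, is symmetric
  in one pair of indices and skew in another, hence zero; the linear equations in \<open>eqs\<close>
  and \<open>eqs2\<close> spell this out, with determinant det h.\<close>

lemma levi_civita_unique:
  assumes h: "pseudo_metric A h" and D: "levi_civita A h D" "levi_civita A h D'" and c: "c \<in> A" "p \<in> cdom c"
  shows "D c p = D' c p"
proof -
  define e f g where "e = h c p $ 1 $ 1" and "f = h c p $ 1 $ 2" and "g = h c p $ 2 $ 2"
  have "transpose (h c p) $ 1 $ 2 = h c p $ 1 $ 2" and d: "det (h c p) \<noteq> 0"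
    using h c unfolding pseudo_metric_def by auto
  then have f2: "h c p $ 2 $ 1 = f" unfolding f_def by (simp add: transpose_def)
  have det: "e * g - f * f \<noteq> 0" using d unfolding det_2 f2 e_def f_def g_def .
  define \<pi> where "\<pi> = (\<lambda>k i j. D c p $ k $ i $ j - D' c p $ k $ i $ j)"
  have sym: "\<pi> k 2 1 = \<pi> k 1 2" for k
    using D c unfolding \<pi>_def levi_civita_def torsion_free_def by simp
  have cov: "cov_two D 0 h c p $ i $ j $ k = cov_two D' 0 h c p $ i $ j $ k" for i j k
    using D c unfolding levi_civita_def by simp
  have m: "(\<pi> 1 i j * h c p $ 1 $ k + \<pi> 2 i j * h c p $ 2 $ k) + (\<pi> 1 i k * h c p $ j $ 1 + \<pi> 2 i k * h c p $ j $ 2) = 0" for i j k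
    using cov[of i j k] unfolding cov_two_def vec_lambda_beta sum_2 \<pi>_def by (simp add: algebra_simps)
  have eqs: "\<pi> 1 1 1 * e + \<pi> 2 1 1 * f = 0" "\<pi> 1 1 2 * e + \<pi> 2 1 2 * f = 0"
    "\<pi> 1 1 2 * f + \<pi> 2 1 2 * g = 0" "\<pi> 1 2 2 * f + \<pi> 2 2 2 * g = 0"
    using m[of 1 1 1] m[of 2 1 1] m[of 1 2 2] m[of 2 2 2] unfolding e_def f_def g_def sym f2[unfolded f_def] by simp_all
  have eqs2: "\<pi> 1 1 1 * f + \<pi> 2 1 1 * g = 0" "\<pi> 1 2 2 * e + \<pi> 2 2 2 * f = 0"
    using m[of 1 1 2] m[of 2 1 2] eqs unfolding e_def f_def g_def sym f2[unfolded f_def] by simp_all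
  have z: "a = 0 \<and> b = 0" if "a * e + b * f = 0" "a * f + b * g = 0" for a b
  proof -
    have "(e * g - f * f) * a = 0" "(e * g - f * f) * b = 0" using that by algebra+
    then show ?thesis using det by simp
  qed
  have "\<pi> k i j = 0" for k i j
    using z[OF eqs(1) eqs2(1)] z[OF eqs(2) eqs(3)] z[OF eqs2(2) eqs(4)] sym exhaust_2[of i] exhaust_2[of j] exhaust_2[of k]
    by metis
  then show ?thesis unfolding \<pi>_def vec_eq_iff by simp
qed

theorem theorem7p2:
  fixes A :: "'a::t2_space chart set"
    and P :: "('a, real^2^2^2) comps set"
    and C :: "('a, real^2^2) comps set"
    and nabla D :: "('a, real^2^2^2) comps"
    and h J :: "('a, real^2^2) comps"
    and \<gamma> :: "('a, real^2) comps"
    and Fh nsq :: "'a \<Rightarrow> real"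
  assumes surface: "oriented_surface A" "compact (UNIV :: 'a set)"
    and AH: "AH_structure A P C" "riemannian_signature A C"
    and nabla: "aligned A P C nabla"
    and einstein: "einstein_AH A C nabla"
    and nonexact: "\<not> exact_AH A C nabla"
    and gauduchon: "gauduchon A C nabla h"
    and D: "levi_civita A h D"
    and J: "complex_structure A h J"
    and gamma: "\<gamma> = faraday_primitive nabla h"
    and Fh: "Fh = faraday_scalar A nabla h J"
    and nsq: "nsq = sq_norm A h \<gamma>"
  shows
    "(exact_two_form A (\<lambda>c p. (1/2) *\<^sub>R ext_d \<gamma> c p) \<and>
      (\<forall>I \<sigma>. integral_curve A (sharp h \<gamma>) I \<sigma> \<longrightarrow>
         magnetic_geodesic A h (\<lambda>c p. (1/2) *\<^sub>R ext_d \<gamma> c p) I \<sigma>)) \<and>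
     (\<forall>I \<sigma>. integral_curve A (sharp h \<gamma>) I \<sigma> \<and> nontrivial_curve I \<sigma> \<longrightarrow>
         (\<lambda>t. nsq (\<sigma> t)) constant_on I \<and>
         has_geodesic_curvature A h D J I \<sigma> (\<lambda>t. - (1/4) * inverse (sqrt (nsq (\<sigma> t))) * Fh (\<sigma> t)) \<and>
         (\<lambda>t. - (1/4) * inverse (sqrt (nsq (\<sigma> t))) * Fh (\<sigma> t)) constant_on I) \<and>
     ((\<forall>I \<sigma>. integral_curve A (sharp h \<gamma>) I \<sigma> \<and> (\<exists>t\<in>I. \<forall>q. nsq q \<le> nsq (\<sigma> t)) \<longrightarrow>
         geodesic A D I \<sigma>) \<and>
      (\<exists>\<sigma>. integral_curve A (sharp h \<gamma>) UNIV \<sigma> \<and> nontrivial_curve UNIV \<sigma> \<and>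
         geodesic A D UNIV \<sigma>)) \<and>
     (\<forall>I \<sigma>. integral_curve A (\<lambda>c p. J c p *v sharp h \<gamma> c p) I \<sigma> \<and> nontrivial_curve I \<sigma> \<longrightarrow>
         projective_geodesic A D I \<sigma>)"
proof -
  have hC: "h \<in> C" using gauduchon unfolding gauduchon_def by blast
  have h: "pseudo_metric A h" "pos_def_on A h"
    using AH hC unfolding AH_structure_def conformal_structure_def riemannian_signature_def by auto
  have nab: "affine_connection A nabla" "torsion_free A nabla"
    using AH(1) nabla unfolding AH_structure_def projective_structure_def aligned_def by auto
  obtain D' where D': "levi_civita A h D'" "\<And>c p. c \<in> A \<Longrightarrow> p \<in> cdom c \<Longrightarrow>
      (\<Sum>i\<in>UNIV. \<Sum>j\<in>UNIV. matrix_inv (h c p) $ i $ j * cov_one D' \<gamma> c p $ i $ j) = 0"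
    using gauduchon unfolding gauduchon_def co_closed_def gamma by blast
  interpret compact_gauduchon_setting A nabla D h J \<gamma>
  proof (intro compact_gauduchon_setting.intro gauduchon_setting.intro compact_gauduchon_setting_axioms.intro)
    fix c p assume c: "c \<in> A" "p \<in> cdom c"
    show "cov_two nabla (-1) (unimod h) c p $ i $ j $ k = cov_two nabla (-1) (unimod h) c p $ j $ i $ k" for i j k
      using nabla hC c unfolding aligned_def by blast
    show "cov_density nabla 1 (weighted_scalar nabla h) c p $ i +
          2 * (\<Sum>k\<in>UNIV. \<Sum>l\<in>UNIV. matrix_inv (unimod h c p) $ k $ l *
                 cov_two nabla 0 (faraday_form nabla) c p $ l $ i $ k) = 0" for i
      using einstein hC c unfolding einstein_AH_def by blast
    have "cov_one D \<gamma> c p = cov_one D' \<gamma> c p"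
      unfolding cov_one_def levi_civita_unique[OF h(1) D D'(1) c] ..
    then show "(\<Sum>i\<in>UNIV. \<Sum>j\<in>UNIV. matrix_inv (h c p) $ i $ j * cov_one D \<gamma> c p $ i $ j) = 0"
      using D'(2)[OF c] by simp
  qed (rule surface nab D h J gamma)+
  \<comment> \<open>Non-exactness enters only here: if |\<gamma>| vanished everywhere,
    \<open>h\<close> would make the structure exact.\<close>
  obtain p0 where p0: "sq_norm A h \<gamma> p0 \<noteq> 0"
    using exact_if_zero nonexact hC unfolding exact_AH_def by blast
  show ?thesis
    unfolding Fh nsq
    using exact_half_d_gamma magnetic_geodesic_X nsq_constant curvature_of_integral_curves
      geodesic_through_maximum complete_geodesic[OF p0] projective_geodesic_JX by blast
qed

end
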